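(* Let $0\le k\le n$, $\mathcal U=\tilde{\mathbb U}_k$, let $\rho$ be a density operator and $O$ a traceless Hermitian operator on $\mathcal H$. Then, with $\gamma=3/4$, $$\bigl|V_*(O,\rho)-\gamma^{k}V_\triangle(O,\rho)\bigr|\le\frac6d\|O\|_2^2.$$
   Context: Let $n\ge1$, $d=2^n$, $\mathcal H=(\mathbb C^2)^{\otimes n}$ with computational basis $\{|\mathbf b\rangle\}$. For a unitary ensemble $\mathcal U$ with measurement channel $\mathcal M(X)=\mathbb E_{U}\sum_{\mathbf b}\langle\mathbf b|UXU^\dagger|\mathbf b\rangle U^\dagger|\mathbf b\rangle\langle\mathbf b|U$ (for a 2-design, $\mathcal M^{-1}(O)=(d+1)O-\operatorname{tr}(O)\mathbb 1$), define for a density operator $\rho$ and traceless Hermitian $O$: $V_*(O,\rho)=\mathbb E_{U}\bigl(\sum_{\mathbf b}\langle\mathbf b|U\rho U^\dagger|\mathbf b\rangle\langle\mathbf b|U\mathcal M^{-1}(O)U^\dagger|\mathbf b\rangle\bigr)^2-[\operatorname{tr}(O\rho)]^2$. Let $H$ be the Hadamard gate and $T=\mathrm{diag}(1,e^{i\pi/4})$. The ensemble $\tilde{\mathbb U}_k$ is the distribution of $(I^{\otimes(n-k)}\otimes(HT)^{\otimes k})\,C$ with $C$ uniform on the $n$-qubit Clifford group $\mathrm{Cl}_n$. Let $\overline{\mathcal P}_n=\{I,X,Y,Z\}^{\otimes n}$; for operators $A,B$ let $\Xi_{A,B}(P)=\operatorname{tr}(AP)\operatorname{tr}(BP)$ and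 $\tilde\Xi_{A,B}(P)=\operatorname{tr}(APBP)$, as vectors in $\mathbb R^{d^2}$ with Euclidean norm and inner product; $V_\triangle(O,\rho)=\frac{d+1}{d(d+2)}\bigl(\|\Xi_{\rho,O}\|_2^2+\tilde\Xi_{\rho,O}\cdot\Xi_{\rho,O}\bigr)$. $\|O\|_2$ is the Hilbert–Schmidt norm. *)

theory Defs
  imports Complex_Main "Jordan_Normal_Form.Matrix"
begin

definition mtrace :: "complex mat \<Rightarrow> complex" where
  "mtrace A = (\<Sum>i<dim_row A. A $$ (i,i))"

definition adj :: "complex mat \<Rightarrow> complex mat" where
  "adj A = mat (dim_col A) (dim_row A) (\<lambda>(i,j). cnj (A $$ (j,i)))"

definition hermitian_mat :: "nat \<Rightarrow> complex mat \<Rightarrow> bool" where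
  "hermitian_mat d A \<longleftrightarrow> A \<in> carrier_mat d d \<and> adj A = A"

definition unitary_mat :: "nat \<Rightarrow> complex mat \<Rightarrow> bool" where
  "unitary_mat d U \<longleftrightarrow> U \<in> carrier_mat d d \<and> adj U * U = 1\<^sub>m d \<and> U * adj U = 1\<^sub>m d"

definition density_op :: "nat \<Rightarrow> complex mat \<Rightarrow> bool" where
  "density_op d \<rho> \<longleftrightarrow> hermitian_mat d \<rho>
     \<and> (\<forall>v :: nat \<Rightarrow> complex. 0 \<le> Re (\<Sum>i<d. \<Sum>j<d. cnj (v i) * \<rho> $$ (i,j) * v j))
     \<and> mtrace \<rho> = 1"

definition hs_norm_sq :: "complex mat \<Rightarrow> real" where
  "hs_norm_sq A = (\<Sum>i<dim_row A. \<Sum>j<dim_col A. (cmod (A $$ (i,j)))\<^sup>2)"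

definition kron :: "complex mat \<Rightarrow> complex mat \<Rightarrow> complex mat" where
  "kron A B = mat (dim_row A * dim_row B) (dim_col A * dim_col B)
     (\<lambda>(i,j). A $$ (i div dim_row B, j div dim_col B) * B $$ (i mod dim_row B, j mod dim_col B))"

fun kron_list :: "complex mat list \<Rightarrow> complex mat" where
  "kron_list [] = 1\<^sub>m 1"
| "kron_list (A # As) = kron A (kron_list As)"

definition kpow :: "complex mat \<Rightarrow> nat \<Rightarrow> complex mat" where
  "kpow A m = kron_list (replicate m A)"

definition I2 :: "complex mat" where "I2 = 1\<^sub>m 2"
definition PX :: "complex mat" where
  "PX = mat 2 2 (\<lambda>(i,j). if i \<noteq> j then 1 else 0)"
definition PY :: "complex mat" where
  "PY = mat 2 2 (\<lambda>(i,j). if i = 0 \<and> j = 1 then - \<i> else if i = 1 \<and> j = 0 then \<i> else 0)"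
definition PZ :: "complex mat" where
  "PZ = mat 2 2 (\<lambda>(i,j). if i = j then (if i = 0 then 1 else -1) else 0)"

definition hadamard :: "complex mat" where
  "hadamard = mat 2 2 (\<lambda>(i,j). (if i = 1 \<and> j = 1 then -1 else 1) / complex_of_real (sqrt 2))"

definition phase_S :: "complex mat" where
  "phase_S = mat 2 2 (\<lambda>(i,j). if i = j then (if i = 0 then 1 else \<i>) else 0)"

definition gate_T :: "complex mat" where
  "gate_T = mat 2 2 (\<lambda>(i,j). if i = j then (if i = 0 then 1 else cis (pi / 4)) else 0)"

definition pauli1 :: "nat \<Rightarrow> complex mat" where
  "pauli1 a = (if a = 0 then I2 else if a = 1 then PX else if a = 2 then PY else PZ)"

definition pauli_set :: "nat \<Rightarrow> complex mat set" where
  "pauli_set n = (\<lambda>as. kron_list (map pauli1 as)) ` {as. length as = n \<and> set as \<subseteq> {0..<4}}"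

definition on_qubit :: "nat \<Rightarrow> nat \<Rightarrow> complex mat \<Rightarrow> complex mat" where
  "on_qubit n j G = kron (kpow I2 j) (kron G (kpow I2 (n - j - 1)))"

(* CNOT with control qubit c and target qubit t, as a permutation of the basis
   {0..<2^n}; qubit q of basis index s is the bit (s div 2^q) mod 2 *)
definition cnot_perm :: "nat \<Rightarrow> nat \<Rightarrow> nat \<Rightarrow> nat" where
  "cnot_perm c t s = (if odd (s div 2 ^ c)
      then (if odd (s div 2 ^ t) then s - 2 ^ t else s + 2 ^ t) else s)"

definition cnot :: "nat \<Rightarrow> nat \<Rightarrow> nat \<Rightarrow> complex mat" where
  "cnot n c t = mat (2 ^ n) (2 ^ n) (\<lambda>(r,s). if r = cnot_perm c t s then 1 else 0)"

definition clifford_gens :: "nat \<Rightarrow> complex mat set" where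
  "clifford_gens n = {on_qubit n j hadamard | j. j < n} \<union> {on_qubit n j phase_S | j. j < n}
     \<union> {cnot n c t | c t. c < n \<and> t < n \<and> c \<noteq> t}"

(* Cl_n: the group generated by H, S and CNOT gates (finite; global phases are
   powers of e^{i\<pi>/4}, which do not affect any quantity below) *)
inductive_set clifford_group :: "nat \<Rightarrow> complex mat set" for n where
  id: "1\<^sub>m (2 ^ n) \<in> clifford_group n"
| gen: "C \<in> clifford_group n \<Longrightarrow> G \<in> clifford_gens n \<Longrightarrow> G * C \<in> clifford_group n"

definition magic_layer :: "nat \<Rightarrow> nat \<Rightarrow> complex mat" where
  "magic_layer n k = kron (kpow I2 (n - k)) (kpow (hadamard * gate_T) k)"

definition expect_Uk :: "nat \<Rightarrow> nat \<Rightarrow> (complex mat \<Rightarrow> real) \<Rightarrow> real" where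
  "expect_Uk n k f = (\<Sum>C\<in>clifford_group n. f (magic_layer n k * C)) / real (card (clifford_group n))"

(* inverse measurement channel of a unitary 2-design (\<tilde>U_k is a 2-design) *)
definition Minv :: "nat \<Rightarrow> complex mat \<Rightarrow> complex mat" where
  "Minv n Ob = of_nat (2 ^ n + 1) \<cdot>\<^sub>m Ob - mtrace Ob \<cdot>\<^sub>m 1\<^sub>m (2 ^ n)"

definition V_star :: "nat \<Rightarrow> nat \<Rightarrow> complex mat \<Rightarrow> complex mat \<Rightarrow> real" where
  "V_star n k Ob \<rho> =
     expect_Uk n k (\<lambda>U. (\<Sum>b<2 ^ n. Re ((U * \<rho> * adj U) $$ (b,b))
                              * Re ((U * Minv n Ob * adj U) $$ (b,b)))\<^sup>2)
     - (Re (mtrace (Ob * \<rho>)))\<^sup>2"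

definition Xi :: "complex mat \<Rightarrow> complex mat \<Rightarrow> complex mat \<Rightarrow> real" where
  "Xi A B P = Re (mtrace (A * P) * mtrace (B * P))"

definition Xi_tilde :: "complex mat \<Rightarrow> complex mat \<Rightarrow> complex mat \<Rightarrow> real" where
  "Xi_tilde A B P = Re (mtrace (A * P * B * P))"

definition V_tri :: "nat \<Rightarrow> complex mat \<Rightarrow> complex mat \<Rightarrow> real" where
  "V_tri n Ob \<rho> = (let d = real (2 ^ n) in
     (d + 1) / (d * (d + 2)) *
       ((\<Sum>P\<in>pauli_set n. (Xi \<rho> Ob P)\<^sup>2) + (\<Sum>P\<in>pauli_set n. Xi_tilde \<rho> Ob P * Xi \<rho> Ob P)))"

end

theory Submission
  imports Defs "Jordan_Normal_Form.Determinant"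
begin

text \<open>With \<open>E\<^sub>b = M\<^sup>* |b><b| M\<close> for the magic layer \<open>M\<close> and \<open>D A B = d\<^sup>-\<^sup>1 \<Sum>\<^sub>b tr(E\<^sub>b A) tr(E\<^sub>b B)\<close>,
  the single-shot estimate is a bilinear form in the Pauli coefficients of \<open>\<rho>\<close> and \<open>O\<close> with
  matrix \<open>D\<close>. Its second moment over the Clifford group is a sum over quadruples of Paulis; the
  Pauli twirl and the parity rule \<open>D A B \<noteq> 0 \<Longrightarrow> \<chi>(A, B) = \<chi>(A, X\<^sup>n) \<chi>(B, X\<^sup>n)\<close> leave only the
  quadruples \<open>(A, B, C, ABC)\<close>. By Witt's theorem the Clifford group is transitive on independent
  Pauli tuples with prescribed commutation signs, so each class contributes the product of its
  averages. The class \<open>A = B\<close> yields \<open>\<gamma>\<^sup>k V\<^sub>\<triangle>\<close> up to lower-order terms, since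
  \<open>\<Sum>\<^sub>A (D A A)\<^sup>2 = d (3/4)\<^sup>k\<close>; the classes with \<open>A \<noteq> B\<close> are bounded by Parseval and Cauchy-Schwarz,
  since \<open>\<Sum>\<^sub>A\<^sub>B (D A B)\<^sup>2 = d\<close>.\<close>

lemma adj_carrier [simp]: "A \<in> carrier_mat m n \<Longrightarrow> adj A \<in> carrier_mat n m"
  by (auto simp: adj_def)

lemma adj_adj [simp]: "adj (adj A) = A"
  by (rule eq_matI) (auto simp: adj_def)

lemma adj_smult: "adj (c \<cdot>\<^sub>m A) = cnj c \<cdot>\<^sub>m adj A"
  by (rule eq_matI) (auto simp: adj_def)

lemma adj_add: "A \<in> carrier_mat m n \<Longrightarrow> B \<in> carrier_mat m n \<Longrightarrow> adj (A + B) = adj A + adj B"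
  by (rule eq_matI) (auto simp: adj_def)

lemma adj_one [simp]: "adj (1\<^sub>m n) = 1\<^sub>m n"
  by (rule eq_matI) (auto simp: adj_def)

lemma index_mult_mat_sum:
  assumes "A \<in> carrier_mat m n" "B \<in> carrier_mat n p" "i < m" "j < p"
  shows "(A * B) $$ (i, j) = (\<Sum>k<n. A $$ (i, k) * B $$ (k, j))"
  using assms by (auto simp: scalar_prod_def atLeast0LessThan)

lemma adj_mult:
  assumes "A \<in> carrier_mat m n" "B \<in> carrier_mat n p"
  shows "adj (A * B) = adj B * adj A"
proof (rule eq_matI)
  fix i j assume "i < dim_row (adj B * adj A)" "j < dim_col (adj B * adj A)"
  then have ij: "i < p" "j < m" using assms by (auto simp: adj_def)
  have "adj (A * B) $$ (i, j) = cnj ((A * B) $$ (j, i))"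
    using ij assms by (simp add: adj_def)
  also have "\<dots> = (\<Sum>k<n. adj B $$ (i, k) * adj A $$ (k, j))"
    using ij assms by (subst index_mult_mat_sum[OF assms ij(2,1)]) (simp add: adj_def mult.commute)
  also have "\<dots> = (adj B * adj A) $$ (i, j)"
    using assms ij by (subst index_mult_mat_sum[of _ p n _ m]) auto
  finally show "adj (A * B) $$ (i, j) = (adj B * adj A) $$ (i, j)" .
qed (use assms in \<open>auto simp: adj_def\<close>)

lemma mtrace_add: "A \<in> carrier_mat n n \<Longrightarrow> B \<in> carrier_mat n n \<Longrightarrow> mtrace (A + B) = mtrace A + mtrace B"
  by (simp add: mtrace_def sum.distrib)

lemma mtrace_diff: "A \<in> carrier_mat n n \<Longrightarrow> B \<in> carrier_mat n n \<Longrightarrow> mtrace (A - B) = mtrace A - mtrace B"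
  by (simp add: mtrace_def sum_subtractf)

lemma mtrace_smult: "A \<in> carrier_mat n n \<Longrightarrow> mtrace (c \<cdot>\<^sub>m A) = c * mtrace A"
  by (simp add: mtrace_def sum_distrib_left)

lemma mtrace_one [simp]: "mtrace (1\<^sub>m n) = of_nat n"
  by (simp add: mtrace_def)

lemma mtrace_adj: "A \<in> carrier_mat n n \<Longrightarrow> mtrace (adj A) = cnj (mtrace A)"
  by (simp add: mtrace_def adj_def)

lemma mtrace_mult:
  assumes "A \<in> carrier_mat m n" "B \<in> carrier_mat n m"
  shows "mtrace (A * B) = (\<Sum>i<m. \<Sum>j<n. A $$ (i, j) * B $$ (j, i))"
  using assms by (auto simp: mtrace_def index_mult_mat_sum[of _ m n _ m] simp del: index_mult_mat(1) intro!: sum.cong)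

lemma mtrace_comm:
  assumes "A \<in> carrier_mat m n" "B \<in> carrier_mat n m"
  shows "mtrace (A * B) = mtrace (B * A)"
  unfolding mtrace_mult[OF assms] mtrace_mult[OF assms(2,1)]
  by (subst sum.swap) (simp add: mult.commute)

definition tau :: "complex mat \<Rightarrow> complex mat \<Rightarrow> real" where
  "tau X Y = Re (mtrace (X * Y))"

text \<open>Fixing the dimension turns the carrier side conditions of matrix algebra into
  conditions the simplifier can discharge.\<close>

locale sqmat =
  fixes d :: nat
begin

lemma carrier_simps [simp]:
  "A \<in> carrier_mat d d \<Longrightarrow> B \<in> carrier_mat d d \<Longrightarrow> A * B \<in> carrier_mat d d"
  "A \<in> carrier_mat d d \<Longrightarrow> B \<in> carrier_mat d d \<Longrightarrow> A + B \<in> carrier_mat d d"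
  "A \<in> carrier_mat d d \<Longrightarrow> B \<in> carrier_mat d d \<Longrightarrow> A - B \<in> carrier_mat d d"
  "A \<in> carrier_mat d d \<Longrightarrow> c \<cdot>\<^sub>m A \<in> carrier_mat d d"
  "1\<^sub>m d \<in> carrier_mat d d"
  "A \<in> carrier_mat d d \<Longrightarrow> adj A \<in> carrier_mat d d"
  by auto

lemma assoc: "A \<in> carrier_mat d d \<Longrightarrow> B \<in> carrier_mat d d \<Longrightarrow> C \<in> carrier_mat d d \<Longrightarrow> A * B * C = A * (B * C)"
  by (rule assoc_mult_mat)

lemma smult_simps [simp]:
  "A \<in> carrier_mat d d \<Longrightarrow> B \<in> carrier_mat d d \<Longrightarrow> (c \<cdot>\<^sub>m A) * B = c \<cdot>\<^sub>m (A * B)"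
  "A \<in> carrier_mat d d \<Longrightarrow> B \<in> carrier_mat d d \<Longrightarrow> A * (c \<cdot>\<^sub>m B) = c \<cdot>\<^sub>m (A * B)"
  "c \<cdot>\<^sub>m (e \<cdot>\<^sub>m (A :: complex mat)) = (c * e) \<cdot>\<^sub>m A"
  "1 \<cdot>\<^sub>m (A :: complex mat) = A"
  "A \<in> carrier_mat d d \<Longrightarrow> 1\<^sub>m d * A = A"
  "A \<in> carrier_mat d d \<Longrightarrow> A * 1\<^sub>m d = A"
  by (auto simp: mult_smult_assoc_mat mult_smult_distrib)

lemma distrib_mat:
  fixes A B C :: "complex mat"
  assumes "A \<in> carrier_mat d d" "B \<in> carrier_mat d d" "C \<in> carrier_mat d d"
  shows "(A + B) * C = A * C + B * C" "A * (B + C) = A * B + A * C"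
    "(A - B) * C = A * C - B * C" "A * (B - C) = A * B - A * C"
  using assms by (simp_all add: add_mult_distrib_mat[of _ d d] mult_add_distrib_mat[of _ d d]
      minus_mult_distrib_mat[of _ d d] mult_minus_distrib_mat[of _ d d])

lemma adj_simps [simp]:
  "A \<in> carrier_mat d d \<Longrightarrow> B \<in> carrier_mat d d \<Longrightarrow> adj (A * B) = adj B * adj A"
  "A \<in> carrier_mat d d \<Longrightarrow> B \<in> carrier_mat d d \<Longrightarrow> adj (A + B) = adj A + adj B"
  "A \<in> carrier_mat d d \<Longrightarrow> adj (c \<cdot>\<^sub>m A) = cnj c \<cdot>\<^sub>m adj A"
  by (auto simp: adj_mult adj_add adj_smult)

lemma tr_simps [simp]:
  "A \<in> carrier_mat d d \<Longrightarrow> B \<in> carrier_mat d d \<Longrightarrow> mtrace (A + B) = mtrace A + mtrace B"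
  "A \<in> carrier_mat d d \<Longrightarrow> B \<in> carrier_mat d d \<Longrightarrow> mtrace (A - B) = mtrace A - mtrace B"
  "A \<in> carrier_mat d d \<Longrightarrow> mtrace (c \<cdot>\<^sub>m A) = c * mtrace A"
  by (auto simp: mtrace_add mtrace_diff mtrace_smult)

lemma tr_comm: "A \<in> carrier_mat d d \<Longrightarrow> B \<in> carrier_mat d d \<Longrightarrow> mtrace (A * B) = mtrace (B * A)"
  by (rule mtrace_comm)

lemma tau_comm: "A \<in> carrier_mat d d \<Longrightarrow> B \<in> carrier_mat d d \<Longrightarrow> tau A B = tau B A"
  by (simp add: tau_def tr_comm)

lemma tau_rot:
  assumes "X \<in> carrier_mat d d" "Y \<in> carrier_mat d d" "Z \<in> carrier_mat d d"
  shows "tau X (Y * Z) = tau (Z * X) Y"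
proof -
  have "mtrace (X * (Y * Z)) = mtrace ((X * Y) * Z)" using assms by (simp add: assoc)
  also have "\<dots> = mtrace (Z * (X * Y))" using assms by (subst tr_comm) auto
  also have "\<dots> = mtrace (Z * X * Y)" using assms by (simp add: assoc)
  finally show ?thesis by (simp add: tau_def)
qed

lemma tau_lin [simp]:
  "X \<in> carrier_mat d d \<Longrightarrow> Y \<in> carrier_mat d d \<Longrightarrow> Z \<in> carrier_mat d d \<Longrightarrow> tau X (Y + Z) = tau X Y + tau X Z"
  "X \<in> carrier_mat d d \<Longrightarrow> Y \<in> carrier_mat d d \<Longrightarrow> Z \<in> carrier_mat d d \<Longrightarrow> tau (X + Y) Z = tau X Z + tau Y Z"
  "X \<in> carrier_mat d d \<Longrightarrow> Y \<in> carrier_mat d d \<Longrightarrow> tau X (complex_of_real c \<cdot>\<^sub>m Y) = c * tau X Y"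
  "X \<in> carrier_mat d d \<Longrightarrow> Y \<in> carrier_mat d d \<Longrightarrow> tau (complex_of_real c \<cdot>\<^sub>m X) Y = c * tau X Y"
  "X \<in> carrier_mat d d \<Longrightarrow> Y \<in> carrier_mat d d \<Longrightarrow> tau X (- 1 \<cdot>\<^sub>m Y) = - tau X Y"
  "X \<in> carrier_mat d d \<Longrightarrow> Y \<in> carrier_mat d d \<Longrightarrow> tau (- 1 \<cdot>\<^sub>m X) Y = - tau X Y"
  by (auto simp: tau_def distrib_mat)

lemma tau_adj:
  assumes "X \<in> carrier_mat d d" "Y \<in> carrier_mat d d"
  shows "tau (adj X) (adj Y) = tau X Y"
proof -
  have "mtrace (adj X * adj Y) = cnj (mtrace (Y * X))"
    using assms mtrace_adj[of "Y * X" d] by simp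
  then show ?thesis using assms by (simp add: tau_def tr_comm)
qed

lemma herm_trace_real:
  assumes "X \<in> carrier_mat d d" "Y \<in> carrier_mat d d" "adj X = X" "adj Y = Y"
  shows "mtrace (X * Y) = complex_of_real (tau X Y)"
proof -
  have "cnj (mtrace (X * Y)) = mtrace (Y * X)"
    using assms mtrace_adj[of "X * Y" d] by simp
  then have "cnj (mtrace (X * Y)) = mtrace (X * Y)" using assms by (simp add: tr_comm)
  then show ?thesis unfolding tau_def by (simp add: complex_eq_iff)
qed

lemma smult_eq_iff:
  assumes "A \<in> carrier_mat d d" "B \<in> carrier_mat d d" "c \<noteq> 0"
  shows "c \<cdot>\<^sub>m A = c \<cdot>\<^sub>m B \<longleftrightarrow> A = (B :: complex mat)"
proof
  assume "c \<cdot>\<^sub>m A = c \<cdot>\<^sub>m B"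
  then have "inverse c \<cdot>\<^sub>m (c \<cdot>\<^sub>m A) = inverse c \<cdot>\<^sub>m (c \<cdot>\<^sub>m B)" by simp
  then show "A = B" using assms by simp
qed simp

lemma smult_inj:
  assumes "A \<in> carrier_mat d d" "A * A = 1\<^sub>m d" "0 < d" "c \<cdot>\<^sub>m A = e \<cdot>\<^sub>m (A :: complex mat)"
  shows "c = e"
proof -
  have "(c \<cdot>\<^sub>m A) * A = (e \<cdot>\<^sub>m A) * A" using assms(4) by simp
  then have "c \<cdot>\<^sub>m 1\<^sub>m d = (e \<cdot>\<^sub>m 1\<^sub>m d :: complex mat)" using assms(1,2) by simp
  then have "(c \<cdot>\<^sub>m 1\<^sub>m d) $$ (0, 0) = (e \<cdot>\<^sub>m 1\<^sub>m d :: complex mat) $$ (0, 0)" by simp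
  then show ?thesis using assms by simp
qed

end

lemma sum_product4:
  fixes f g :: "nat \<Rightarrow> nat \<Rightarrow> complex"
  shows "(\<Sum>i<d. \<Sum>j<d. f i j) * (\<Sum>k<d. \<Sum>l<d. g k l) = (\<Sum>i<d. \<Sum>j<d. \<Sum>k<d. \<Sum>l<d. f i j * g k l)"
  by (simp only: sum_distrib_right, simp only: sum_distrib_left)

section \<open>Signed Paulis and transvections\<close>

locale pauli_frame = sqmat +
  fixes PP :: "complex mat set"
  assumes dpos: "0 < d"
    and fin_PP: "finite PP"
    and PP_carrier: "P \<in> PP \<Longrightarrow> P \<in> carrier_mat d d"
    and one_PP: "1\<^sub>m d \<in> PP"
    and PP_adj: "P \<in> PP \<Longrightarrow> adj P = P"
    and PP_sq: "P \<in> PP \<Longrightarrow> P * P = 1\<^sub>m d"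
    and PP_prod: "P \<in> PP \<Longrightarrow> Q \<in> PP \<Longrightarrow> \<exists>R\<in>PP. \<exists>c\<in>{1, - 1, \<i>, - \<i>}. P * Q = c \<cdot>\<^sub>m R"
    and PP_trace: "P \<in> PP \<Longrightarrow> P \<noteq> 1\<^sub>m d \<Longrightarrow> mtrace P = 0"
    and complete: "i < d \<Longrightarrow> j < d \<Longrightarrow> k < d \<Longrightarrow> l < d \<Longrightarrow>
      (\<Sum>P\<in>PP. P $$ (i, j) * P $$ (k, l)) = (if i = l \<and> j = k then of_nat d else 0)"
begin

lemma complete_trace:
  assumes X: "X \<in> carrier_mat d d" and Y: "Y \<in> carrier_mat d d"
  shows "(\<Sum>P\<in>PP. mtrace (X * P) * mtrace (Y * P)) = of_nat d * mtrace (X * Y)"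
proof -
  have "(\<Sum>P\<in>PP. mtrace (X * P) * mtrace (Y * P)) =
    (\<Sum>P\<in>PP. \<Sum>i<d. \<Sum>j<d. \<Sum>k<d. \<Sum>l<d. X $$ (i, j) * Y $$ (k, l) * (P $$ (j, i) * P $$ (l, k)))"
    using PP_carrier by (intro sum.cong refl)
      (simp only: mtrace_mult[OF X] mtrace_mult[OF Y] sum_product4, simp add: mult_ac)
  also have "\<dots> = (\<Sum>i<d. \<Sum>j<d. \<Sum>k<d. \<Sum>l<d. X $$ (i, j) * Y $$ (k, l) * (\<Sum>P\<in>PP. P $$ (j, i) * P $$ (l, k)))"
    by (subst sum.swap, intro sum.cong refl, subst sum.swap, intro sum.cong refl,
        subst sum.swap, intro sum.cong refl, subst sum.swap, intro sum.cong refl) (simp add: sum_distrib_left)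
  also have "\<dots> = (\<Sum>i<d. \<Sum>j<d. \<Sum>k<d. \<Sum>l<d. if l = i then if k = j then of_nat d * (X $$ (i, j) * Y $$ (k, l)) else 0 else 0)"
    by (intro sum.cong refl) (auto simp: complete)
  also have "\<dots> = of_nat d * (\<Sum>i<d. \<Sum>j<d. X $$ (i, j) * Y $$ (j, i))"
    by (simp add: sum.delta sum_distrib_left)
  finally show ?thesis by (simp add: mtrace_mult[OF X Y])
qed

lemma twirl_trace:
  assumes X: "X \<in> carrier_mat d d" and Y: "Y \<in> carrier_mat d d"
  shows "(\<Sum>P\<in>PP. mtrace ((X * P) * (Y * P))) = of_nat d * mtrace X * mtrace Y"
proof -
  have "(\<Sum>P\<in>PP. mtrace ((X * P) * (Y * P))) =
    (\<Sum>P\<in>PP. \<Sum>i<d. \<Sum>k<d. \<Sum>j<d. \<Sum>l<d. X $$ (i, j) * Y $$ (k, l) * (P $$ (j, k) * P $$ (l, i)))"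
    using X Y PP_carrier by (intro sum.cong refl)
      (simp add: mtrace_mult[of _ d d] index_mult_mat_sum[of _ d d _ d] sum_product del: index_mult_mat(1), simp add: mult_ac)
  also have "\<dots> = (\<Sum>i<d. \<Sum>k<d. \<Sum>j<d. \<Sum>l<d. X $$ (i, j) * Y $$ (k, l) * (\<Sum>P\<in>PP. P $$ (j, k) * P $$ (l, i)))"
    by (subst sum.swap, intro sum.cong refl, subst sum.swap, intro sum.cong refl,
        subst sum.swap, intro sum.cong refl, subst sum.swap, intro sum.cong refl) (simp add: sum_distrib_left)
  also have "\<dots> = (\<Sum>i<d. \<Sum>k<d. \<Sum>j<d. \<Sum>l<d. if j = i then if l = k then of_nat d * (X $$ (i, j) * Y $$ (k, l)) else 0 else 0)"
    by (intro sum.cong refl) (auto simp: complete)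
  also have "\<dots> = (\<Sum>i<d. \<Sum>k<d. \<Sum>j<d. if j = i then of_nat d * (X $$ (i, j) * Y $$ (k, k)) else 0)"
    by (intro sum.cong refl) (simp add: sum.delta)
  also have "\<dots> = of_nat d * mtrace X * mtrace Y"
    using X Y by (simp add: mtrace_def sum_product sum_distrib_left sum.delta mult_ac)
  finally show ?thesis .
qed

text \<open>Each Pauli occurs with both signs, so that conjugation by a Clifford unitary permutes the set;
  sums of sign-invariant functions are therefore twice the sums over unsigned Paulis.\<close>

definition SS :: "complex mat set" where
  "SS = PP \<union> (\<lambda>P. - 1 \<cdot>\<^sub>m P) ` PP"

lemma fin_SS [simp]: "finite SS" by (simp add: SS_def fin_PP)

lemma SS_carrier [simp]: "A \<in> SS \<Longrightarrow> A \<in> carrier_mat d d"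
  by (auto simp: SS_def PP_carrier)

lemma SS_adj [simp]: "A \<in> SS \<Longrightarrow> adj A = A"
  by (auto simp: SS_def PP_carrier PP_adj)

lemma SS_sq [simp]: "A \<in> SS \<Longrightarrow> A * A = 1\<^sub>m d"
  by (auto simp: SS_def PP_carrier PP_sq)

lemma one_SS [simp]: "1\<^sub>m d \<in> SS" by (simp add: SS_def one_PP)

lemma PP_SS: "P \<in> PP \<Longrightarrow> P \<in> SS" by (simp add: SS_def)

lemma SS_neg [simp]: "A \<in> SS \<Longrightarrow> - 1 \<cdot>\<^sub>m A \<in> SS"
  by (auto simp: SS_def)

lemma SS_sqL [simp]: "A \<in> SS \<Longrightarrow> B \<in> carrier_mat d d \<Longrightarrow> A * (A * B) = B"
  by (simp add: assoc[symmetric])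

definition eqv :: "complex mat \<Rightarrow> complex mat \<Rightarrow> bool" where
  "eqv A B \<longleftrightarrow> A = B \<or> A = - 1 \<cdot>\<^sub>m B"

lemma eqv_refl [simp]: "eqv A A" by (simp add: eqv_def)

lemma eqv_sym: "eqv A B \<longleftrightarrow> eqv B A"
  by (auto simp: eqv_def)

lemma eqv_trans: "eqv A B \<Longrightarrow> eqv B C \<Longrightarrow> eqv A C"
  by (auto simp: eqv_def)

lemma eqv_neg [simp]: "eqv (- 1 \<cdot>\<^sub>m A) B \<longleftrightarrow> eqv A B" "eqv A (- 1 \<cdot>\<^sub>m B) \<longleftrightarrow> eqv A B"
  by (auto simp: eqv_def) (metis smult_simps(3,4) mult_minus1 verit_minus_simplify(4))+

lemma SS_inj: "A \<in> SS \<Longrightarrow> c \<cdot>\<^sub>m A = e \<cdot>\<^sub>m A \<Longrightarrow> c = e"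
  using smult_inj[of A c e] dpos by simp

lemma SS_trace: "A \<in> SS \<Longrightarrow> \<not> eqv A (1\<^sub>m d) \<Longrightarrow> mtrace A = 0"
proof -
  assume "A \<in> SS" "\<not> eqv A (1\<^sub>m d)"
  then obtain P where "P \<in> PP" "A = P \<or> A = - 1 \<cdot>\<^sub>m P" "P \<noteq> 1\<^sub>m d" by (auto simp: SS_def eqv_def)
  then show "mtrace A = 0" by (auto simp: PP_trace PP_carrier)
qed

lemma SS_prod:
  assumes "A \<in> SS" "B \<in> SS"
  obtains R c where "R \<in> SS" "c = 1 \<or> c = \<i>" "A * B = c \<cdot>\<^sub>m R"
proof -
  obtain P a where P: "P \<in> PP" "a \<in> {1, - 1 :: complex}" "A = a \<cdot>\<^sub>m P"
    using assms(1) by (auto simp: SS_def) (metis insertCI smult_simps(4))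
  obtain Q b where Q: "Q \<in> PP" "b \<in> {1, - 1 :: complex}" "B = b \<cdot>\<^sub>m Q"
    using assms(2) by (auto simp: SS_def) (metis insertCI smult_simps(4))
  obtain R c where R: "R \<in> PP" "c \<in> {1, - 1, \<i>, - \<i>}" "P * Q = c \<cdot>\<^sub>m R"
    using PP_prod[OF P(1) Q(1)] by blast
  have AB: "A * B = (a * b * c) \<cdot>\<^sub>m R"
    using P Q R by (simp add: PP_carrier mult_ac)
  have "a * b * c = 1 \<or> a * b * c = - 1 \<or> a * b * c = \<i> \<or> a * b * c = - \<i>"
    using P(2) Q(2) R(2) by auto
  then consider "a * b * c = 1" | "a * b * c = - 1" | "a * b * c = \<i>" | "a * b * c = \<i> * (- 1)" by auto
  then show ?thesis
  proof cases
    case 1 then show ?thesis using that[of R 1] AB R PP_SS by simp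
  next
    case 2 then show ?thesis using that[of "- 1 \<cdot>\<^sub>m R" 1] AB R PP_SS by simp
  next
    case 3 then show ?thesis using that[of R \<i>] AB R PP_SS by simp
  next
    case 4 then show ?thesis using that[of "- 1 \<cdot>\<^sub>m R" \<i>] AB R PP_SS by simp
  qed
qed

definition chi :: "complex mat \<Rightarrow> complex mat \<Rightarrow> real" where
  "chi A B = (if A * B = B * A then 1 else - 1)"

text \<open>The Hermitian representative of the product.\<close>

definition pj :: "complex mat \<Rightarrow> complex mat \<Rightarrow> complex mat" where
  "pj A B = (if A * B = B * A then A * B else \<i> \<cdot>\<^sub>m (A * B))"

lemma chi_cases: "chi A B = 1 \<or> chi A B = - 1" by (simp add: chi_def)

lemma chi_sq [simp]: "chi A B * chi A B = 1" "chi A B * (chi A B * x) = x" "(chi A B)\<^sup>2 = 1"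
  using chi_cases[of A B] by auto

lemma chi_sym: "chi A B = chi B A" by (auto simp: chi_def)

lemma chi_self [simp]: "chi A A = 1" by (simp add: chi_def)

lemma pj_SS_cases:
  assumes "A \<in> SS" "B \<in> SS"
  shows "pj A B \<in> SS \<and> (A * B = B * A \<or> A * B = - 1 \<cdot>\<^sub>m (B * A))"
proof -
  obtain R c where R: "R \<in> SS" "c = 1 \<or> c = \<i>" "A * B = c \<cdot>\<^sub>m R"
    using SS_prod[OF assms] .
  have BA: "B * A = cnj c \<cdot>\<^sub>m R"
  proof -
    have "B * A = adj (A * B)" using assms by simp
    also have "\<dots> = cnj c \<cdot>\<^sub>m R" using R by simp
    finally show ?thesis .
  qed
  show ?thesis
  proof (cases "c = 1")
    case True then show ?thesis using R BA by (simp add: pj_def)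
  next
    case False
    then have c: "c = \<i>" using R by simp
    have "A * B \<noteq> B * A" using SS_inj[OF R(1), of \<i> "- \<i>"] R(3) BA c by (auto simp: complex_eq_iff)
    moreover have "\<i> \<cdot>\<^sub>m (A * B) = - 1 \<cdot>\<^sub>m R" using R(3) c by simp
    ultimately show ?thesis using R BA c by (simp add: pj_def)
  qed
qed

lemma pj_SS [simp]: "A \<in> SS \<Longrightarrow> B \<in> SS \<Longrightarrow> pj A B \<in> SS"
  using pj_SS_cases by blast

lemma chi_comm:
  assumes "A \<in> SS" "B \<in> SS"
  shows "A * B = complex_of_real (chi A B) \<cdot>\<^sub>m (B * A)"
  using pj_SS_cases[OF assms] assms by (auto simp: chi_def)

lemma pj_phase:
  assumes "A \<in> SS" "B \<in> SS"
  obtains c where "c \<noteq> 0" "A * B = c \<cdot>\<^sub>m pj A B" "c = 1 \<or> c = - \<i>" "c = 1 \<longleftrightarrow> chi A B = 1"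
proof (cases "A * B = B * A")
  case True then show ?thesis using that[of 1] by (simp add: pj_def chi_def)
next
  case False
  have "(- \<i>) \<noteq> (1 :: complex)" by (simp add: complex_eq_iff)
  then show ?thesis using False that[of "- \<i>"] assms by (simp add: pj_def chi_def)
qed

lemma chi_unique:
  assumes "A \<in> SS" "B \<in> SS" "A * B = c \<cdot>\<^sub>m (B * A)"
  shows "complex_of_real (chi A B) = c"
proof -
  obtain e where e: "e \<noteq> 0" "B * A = e \<cdot>\<^sub>m pj B A" using pj_phase[OF assms(2,1)] by blast
  have "complex_of_real (chi A B) \<cdot>\<^sub>m (B * A) = c \<cdot>\<^sub>m (B * A)"
    using chi_comm[OF assms(1,2)] assms(3) by simp
  then have "(complex_of_real (chi A B) * e) \<cdot>\<^sub>m pj B A = (c * e) \<cdot>\<^sub>m pj B A" using e by simp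
  then have "complex_of_real (chi A B) * e = c * e"
    using SS_inj[of "pj B A"] pj_SS[OF assms(2,1)] by blast
  then show ?thesis using e(1) by simp
qed

lemma chi_conj:
  assumes "A \<in> SS" "B \<in> SS"
  shows "A * B * A = complex_of_real (chi A B) \<cdot>\<^sub>m B"
  using assms by (simp add: chi_comm[OF assms] assoc)

lemma chi_neg [simp]:
  assumes "A \<in> SS" "B \<in> SS"
  shows "chi (- 1 \<cdot>\<^sub>m A) B = chi A B" "chi A (- 1 \<cdot>\<^sub>m B) = chi A B"
  using assms chi_unique[of "- 1 \<cdot>\<^sub>m A" B "chi A B"] chi_unique[of A "- 1 \<cdot>\<^sub>m B" "chi A B"]
  by (simp_all add: chi_comm[OF assms])

lemma chi_eqv: "A \<in> SS \<Longrightarrow> B \<in> SS \<Longrightarrow> Z \<in> SS \<Longrightarrow> eqv A B \<Longrightarrow> chi Z A = chi Z B"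
  by (auto simp: eqv_def)

lemma chi_one [simp]: "A \<in> SS \<Longrightarrow> chi A (1\<^sub>m d) = 1" "A \<in> SS \<Longrightarrow> chi (1\<^sub>m d) A = 1"
  by (simp_all add: chi_def)

lemma chi_prod:
  assumes "A \<in> SS" "B \<in> SS" "Z \<in> SS" "R \<in> SS" "A * B = c \<cdot>\<^sub>m R" "c \<noteq> 0"
  shows "chi Z R = chi Z A * chi Z B"
proof -
  have *: "A * (B * Z) = c \<cdot>\<^sub>m (R * Z)" using assms by (simp add: assoc[symmetric])
  have "c \<cdot>\<^sub>m (Z * R) = Z * A * B" using assms by (simp add: assoc)
  also have "\<dots> = complex_of_real (chi Z A) \<cdot>\<^sub>m (A * (Z * B))"
    using assms by (simp add: chi_comm[of Z A] assoc)
  also have "\<dots> = complex_of_real (chi Z A * chi Z B) \<cdot>\<^sub>m (A * (B * Z))"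
    using assms by (simp add: chi_comm[of Z B] assoc)
  also have "\<dots> = c \<cdot>\<^sub>m (complex_of_real (chi Z A * chi Z B) \<cdot>\<^sub>m (R * Z))"
    using assms by (simp add: * mult_ac)
  finally have "Z * R = complex_of_real (chi Z A * chi Z B) \<cdot>\<^sub>m (R * Z)"
    using smult_eq_iff[of "Z * R" "complex_of_real (chi Z A * chi Z B) \<cdot>\<^sub>m (R * Z)" c] assms(3,4,6)
    by (metis SS_carrier carrier_simps(1,4))
  then have "complex_of_real (chi Z R) = complex_of_real (chi Z A * chi Z B)"
    using assms chi_unique by blast
  then show ?thesis by (simp only: of_real_eq_iff)
qed

lemma chi_pj:
  assumes "A \<in> SS" "B \<in> SS" "Z \<in> SS"
  shows "chi Z (pj A B) = chi Z A * chi Z B"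
  using pj_phase[OF assms(1,2)] chi_prod[OF assms(1,2,3) pj_SS[OF assms(1,2)]] by metis

lemma chi_pj': "A \<in> SS \<Longrightarrow> B \<in> SS \<Longrightarrow> Z \<in> SS \<Longrightarrow> chi (pj A B) Z = chi A Z * chi B Z"
  using chi_pj[of A B Z] by (simp add: chi_sym)

lemma disj_SS: "PP \<inter> (\<lambda>P. - 1 \<cdot>\<^sub>m P) ` PP = {}"
proof -
  have False if P: "P \<in> PP" and Q: "Q \<in> PP" and PQ: "P = - 1 \<cdot>\<^sub>m Q" for P Q
  proof -
    have r: "mtrace (P * R) = complex_of_real (tau P R)" if "R \<in> PP" for R
      using P that by (intro herm_trace_real) (auto simp: PP_carrier PP_adj)
    have PQ1: "P * Q = - 1 \<cdot>\<^sub>m 1\<^sub>m d" using PQ PP_sq[OF Q] Q by (simp add: PP_carrier)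
    have tq: "tau P Q = - real d" "tau P P = real d"
      using PQ1 PP_sq[OF P] by (auto simp: tau_def)
    have "P \<noteq> Q" using tq dpos by auto
    have "complex_of_real (\<Sum>R\<in>PP. tau P R * tau P R) = (\<Sum>R\<in>PP. mtrace (P * R) * mtrace (P * R))"
      by (simp add: r)
    also have "\<dots> = of_nat d * of_nat d"
      using P PP_sq[OF P] by (subst complete_trace) (auto simp: PP_carrier)
    also have "\<dots> = complex_of_real (real d * real d)" by simp
    finally have s: "(\<Sum>R\<in>PP. tau P R * tau P R) = real d * real d"
      by (simp only: of_real_eq_iff)
    have "(\<Sum>R\<in>{P, Q}. tau P R * tau P R) \<le> (\<Sum>R\<in>PP. tau P R * tau P R)"
      using P Q fin_PP by (intro sum_mono2) auto
    then show False using s tq \<open>P \<noteq> Q\<close> dpos by simp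
  qed
  then show ?thesis by auto
qed

lemma sum_SS:
  fixes F :: "complex mat \<Rightarrow> real"
  shows "(\<Sum>A\<in>SS. F A) = (\<Sum>P\<in>PP. F P + F (- 1 \<cdot>\<^sub>m P))"
proof -
  have "inj_on (\<lambda>P. - 1 \<cdot>\<^sub>m P :: complex mat) PP"
    by (rule inj_onI) (metis PP_carrier smult_eq_iff zero_neq_neg_one)
  then show ?thesis
    unfolding SS_def by (subst sum.union_disjoint) (auto simp: fin_PP disj_SS sum.reindex sum.distrib)
qed

lemma complete_tau:
  assumes X: "X \<in> carrier_mat d d" "adj X = X" and Y: "Y \<in> carrier_mat d d"
  shows "(\<Sum>A\<in>SS. tau X A * tau Y A) = 2 * d * tau X Y"
proof -
  have "(\<Sum>A\<in>SS. tau X A * tau Y A) = (\<Sum>P\<in>PP. 2 * (tau X P * tau Y P))"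
    unfolding sum_SS using X Y by (intro sum.cong refl) (simp add: PP_carrier)
  also have "\<dots> = 2 * Re (\<Sum>P\<in>PP. mtrace (X * P) * mtrace (Y * P))"
  proof -
    have "Re (mtrace (X * P) * mtrace (Y * P)) = tau X P * tau Y P" if "P \<in> PP" for P
    proof -
      have "mtrace (X * P) = complex_of_real (tau X P)"
        using X that by (intro herm_trace_real) (simp_all add: PP_carrier PP_adj)
      then have "Re (mtrace (X * P) * mtrace (Y * P)) = tau X P * Re (mtrace (Y * P))" by simp
      then show ?thesis by (simp only: tau_def[of Y P])
    qed
    then show ?thesis by (simp add: sum_distrib_left)
  qed
  also have "\<dots> = 2 * d * tau X Y"
    using X Y by (simp add: complete_trace tau_def)
  finally show ?thesis .
qed

lemma card_SS: "real (card SS) = 2 * d\<^sup>2"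
proof -
  have "of_nat (card PP * d) = (\<Sum>P\<in>PP. mtrace ((1\<^sub>m d * P) * (1\<^sub>m d * P)))"
    by (simp add: PP_carrier PP_sq)
  also have "\<dots> = of_nat (d * d * d)" by (subst twirl_trace) auto
  finally have "card PP * d = d * d * d" using of_nat_eq_iff by blast
  then have "card PP = d * d" using dpos by simp
  moreover have "real (card SS) = (\<Sum>A\<in>SS. 1)" by simp
  ultimately show ?thesis unfolding sum_SS by (simp add: power2_eq_square)
qed

lemma chi_sum:
  assumes A: "A \<in> SS"
  shows "(\<Sum>Z\<in>SS. chi Z A) = (if eqv A (1\<^sub>m d) then 2 * d\<^sup>2 else 0)"
proof -
  have e: "mtrace ((A * P) * (A * P)) = complex_of_real (chi P A) * of_nat d" if "P \<in> PP" for P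
  proof -
    have "(A * P) * (A * P) = A * (P * A * P)" using A PP_SS[OF that] by (simp add: assoc)
    also have "\<dots> = complex_of_real (chi P A) \<cdot>\<^sub>m 1\<^sub>m d"
      using A PP_SS[OF that] by (simp add: chi_conj)
    finally show ?thesis by simp
  qed
  have "(\<Sum>P\<in>PP. complex_of_real (chi P A) * of_nat d) = of_nat d * mtrace A * mtrace A"
    using A twirl_trace[of A A] by (simp add: e)
  then have "complex_of_real (\<Sum>P\<in>PP. chi P A) * of_nat d = mtrace A * mtrace A * of_nat d"
    by (simp add: sum_distrib_right)
  then have *: "complex_of_real (\<Sum>P\<in>PP. chi P A) = mtrace A * mtrace A"
    using dpos by simp
  have "(\<Sum>P\<in>PP. chi P A) = (if eqv A (1\<^sub>m d) then d\<^sup>2 else 0)"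
  proof (cases "eqv A (1\<^sub>m d)")
    case True
    then have "mtrace A * mtrace A = complex_of_real (d\<^sup>2)"
      by (auto simp: eqv_def power2_eq_square)
    then have "(\<Sum>P\<in>PP. chi P A) = (real d)\<^sup>2" using * by (metis of_real_eq_iff of_nat_power)
    then show ?thesis using True by simp
  next
    case False
    then have "complex_of_real (\<Sum>P\<in>PP. chi P A) = 0" using SS_trace[OF A False] * by simp
    then show ?thesis using False by (simp only: of_real_eq_0_iff if_False of_nat_0)
  qed
  then show ?thesis unfolding sum_SS
    using A by (simp add: sum.distrib PP_SS sum_distrib_left[symmetric])
qed

lemma eqv_pj:
  assumes "A \<in> SS" "B \<in> SS"
  shows "eqv (pj A B) (1\<^sub>m d) \<longleftrightarrow> eqv A B"
proof
  obtain c where c: "c \<noteq> 0" "A * B = c \<cdot>\<^sub>m pj A B" "c = 1 \<or> c = - \<i>" "c = 1 \<longleftrightarrow> chi A B = 1"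
    using pj_phase[OF assms] by blast
  assume e: "eqv (pj A B) (1\<^sub>m d)"
  then obtain a where a: "a = 1 \<or> a = - 1" "pj A B = a \<cdot>\<^sub>m 1\<^sub>m d"
    unfolding eqv_def by (metis smult_simps(4))
  have a2: "A * B = (a * c) \<cdot>\<^sub>m 1\<^sub>m d" using a(2) c(2) by (simp add: mult.commute)
  have "A = A * B * B" using assms by (simp add: assoc)
  also have "\<dots> = (a * c) \<cdot>\<^sub>m B" using a2 assms by simp
  finally have AB: "A = (a * c) \<cdot>\<^sub>m B" .
  then have "A * B = B * A" using assms by (metis SS_carrier smult_simps(1,2))
  then have "c = 1" using c by (simp add: chi_def)
  then show "eqv A B" using AB a by (auto simp: eqv_def)
next
  assume "eqv A B" then show "eqv (pj A B) (1\<^sub>m d)"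
    using assms by (auto simp: eqv_def pj_def)
qed

definition act :: "complex mat \<Rightarrow> complex mat \<Rightarrow> complex mat" where
  "act C A = C * A * adj C"

lemma act_mult: "C \<in> carrier_mat d d \<Longrightarrow> C' \<in> carrier_mat d d \<Longrightarrow> A \<in> carrier_mat d d \<Longrightarrow> act (C * C') A = act C (act C' A)"
  by (simp add: act_def assoc)

lemma act_transvection:
  assumes P: "P \<in> SS" and A: "A \<in> SS" and c: "c * cnj c * 2 = 1"
  shows "act (c \<cdot>\<^sub>m (1\<^sub>m d + \<i> \<cdot>\<^sub>m P)) A = (if chi P A = 1 then A else \<i> \<cdot>\<^sub>m (P * A))"
proof -
  have AP: "A * P = complex_of_real (chi P A) \<cdot>\<^sub>m (P * A)" using chi_comm[of A P] P A by (simp add: chi_sym)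
  have PAP: "P * (A * P) = complex_of_real (chi P A) \<cdot>\<^sub>m A" using P A by (simp add: AP)
  have "act (c \<cdot>\<^sub>m (1\<^sub>m d + \<i> \<cdot>\<^sub>m P)) A =
    (c * cnj c) \<cdot>\<^sub>m ((1\<^sub>m d + \<i> \<cdot>\<^sub>m P) * A * (1\<^sub>m d + (- \<i>) \<cdot>\<^sub>m P))"
    using P A by (simp add: act_def mult.commute)
  also have "(1\<^sub>m d + \<i> \<cdot>\<^sub>m P) * A * (1\<^sub>m d + (- \<i>) \<cdot>\<^sub>m P) = (A + \<i> \<cdot>\<^sub>m (P * A)) + ((- \<i>) \<cdot>\<^sub>m (A * P) + P * (A * P))"
    using P A by (simp add: distrib_mat assoc add_smult_distrib_left_mat[of _ d d])
  also have "\<dots> = 2 \<cdot>\<^sub>m (if chi P A = 1 then A else \<i> \<cdot>\<^sub>m (P * A))"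
  proof -
    have "(A + \<i> \<cdot>\<^sub>m R) + ((- \<i>) \<cdot>\<^sub>m (complex_of_real s \<cdot>\<^sub>m R) + complex_of_real s \<cdot>\<^sub>m A)
      = 2 \<cdot>\<^sub>m (if s = 1 then A else \<i> \<cdot>\<^sub>m R)"
      if "R \<in> carrier_mat d d" "A \<in> carrier_mat d d" "s = 1 \<or> s = - 1" for R A s
      using that by (intro eq_matI) auto
    note aux = this
    show ?thesis unfolding PAP unfolding AP
      by (rule aux) (use P A chi_cases[of P A] in simp_all)
  qed
  finally show ?thesis using c by simp
qed

end

locale clifford_frame = pauli_frame +
  fixes Cl :: "complex mat set"
  assumes fin_Cl: "finite Cl"
    and Cl_carrier [simp]: "C \<in> Cl \<Longrightarrow> C \<in> carrier_mat d d"
    and one_Cl: "1\<^sub>m d \<in> Cl"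
    and Cl_mult: "C \<in> Cl \<Longrightarrow> C' \<in> Cl \<Longrightarrow> C * C' \<in> Cl"
    and Cl_adj: "C \<in> Cl \<Longrightarrow> adj C \<in> Cl"
    and Cl_unitary [simp]: "C \<in> Cl \<Longrightarrow> adj C * C = 1\<^sub>m d"
    and Cl_SS: "C \<in> Cl \<Longrightarrow> A \<in> SS \<Longrightarrow> C * A * adj C \<in> SS"
    and Cl_transvection: "P \<in> SS \<Longrightarrow> \<exists>c. c * cnj c * 2 = 1 \<and> c \<cdot>\<^sub>m (1\<^sub>m d + \<i> \<cdot>\<^sub>m P) \<in> Cl"
begin

lemma Cl_unitary' [simp]: "C \<in> Cl \<Longrightarrow> C * adj C = 1\<^sub>m d"
  using Cl_unitary[OF Cl_adj] by simp

lemma Cl_cancel [simp]: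
  "C \<in> Cl \<Longrightarrow> A \<in> carrier_mat d d \<Longrightarrow> adj C * (C * A) = A"
  "C \<in> Cl \<Longrightarrow> A \<in> carrier_mat d d \<Longrightarrow> C * (adj C * A) = A"
  by (simp_all add: assoc[symmetric])

lemma act_SS [simp]: "C \<in> Cl \<Longrightarrow> A \<in> SS \<Longrightarrow> act C A \<in> SS"
  unfolding act_def by (rule Cl_SS)

lemma act_inv [simp]:
  "C \<in> Cl \<Longrightarrow> A \<in> carrier_mat d d \<Longrightarrow> act (adj C) (act C A) = A"
  "C \<in> Cl \<Longrightarrow> A \<in> carrier_mat d d \<Longrightarrow> act C (act (adj C) A) = A"
  by (simp_all add: act_def assoc)

lemma act_hom:
  assumes "C \<in> Cl" "A \<in> carrier_mat d d" "B \<in> carrier_mat d d"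
  shows "act C (A * B) = act C A * act C B"
  using assms by (simp add: act_def assoc)

lemma act_smult: "C \<in> Cl \<Longrightarrow> A \<in> carrier_mat d d \<Longrightarrow> act C (c \<cdot>\<^sub>m A) = c \<cdot>\<^sub>m act C A"
  by (simp add: act_def)

lemma act_one [simp]: "C \<in> Cl \<Longrightarrow> act C (1\<^sub>m d) = 1\<^sub>m d"
  by (simp add: act_def)

lemma act_inj:
  assumes "C \<in> Cl" "A \<in> carrier_mat d d" "B \<in> carrier_mat d d"
  shows "act C A = act C B \<longleftrightarrow> A = B"
  using assms by (metis act_inv(1))

lemma act_chi [simp]: "C \<in> Cl \<Longrightarrow> A \<in> SS \<Longrightarrow> B \<in> SS \<Longrightarrow> chi (act C A) (act C B) = chi A B"
  by (simp add: chi_def act_hom[symmetric] act_inj)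

lemma act_pj: "C \<in> Cl \<Longrightarrow> A \<in> SS \<Longrightarrow> B \<in> SS \<Longrightarrow> pj (act C A) (act C B) = act C (pj A B)"
  by (simp add: pj_def act_hom[symmetric] act_inj act_smult)

lemma act_eqv [simp]: "C \<in> Cl \<Longrightarrow> A \<in> SS \<Longrightarrow> B \<in> SS \<Longrightarrow> eqv (act C A) (act C B) \<longleftrightarrow> eqv A B"
  by (simp add: eqv_def act_smult[symmetric] act_inj)

lemma transvection_step:
  assumes A: "A \<in> SS" and B: "B \<in> SS" and "chi A B = - 1"
  shows "\<exists>C\<in>Cl. act C A = B \<and> (\<forall>W\<in>SS. chi A W = chi B W \<longrightarrow> act C W = W)"
proof -
  define P where "P = - 1 \<cdot>\<^sub>m pj B A"
  have P: "P \<in> SS" unfolding P_def using A B by simp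
  have chiP: "chi P W = chi A W * chi B W" if "W \<in> SS" for W
    unfolding P_def using A B that by (simp add: chi_pj')
  obtain c where c: "c * cnj c * 2 = 1" "c \<cdot>\<^sub>m (1\<^sub>m d + \<i> \<cdot>\<^sub>m P) \<in> Cl"
    using Cl_transvection[OF P] by blast
  have "B * A \<noteq> A * B" using assms(3) by (auto simp: chi_def)
  then have "\<i> \<cdot>\<^sub>m (P * A) = B" unfolding P_def pj_def using A B by (simp add: assoc)
  moreover have "chi P A = - 1" using chiP[OF A] assms by (simp add: chi_sym)
  ultimately have "act (c \<cdot>\<^sub>m (1\<^sub>m d + \<i> \<cdot>\<^sub>m P)) A = B"
    using act_transvection[OF P A c(1)] by simp
  moreover have "act (c \<cdot>\<^sub>m (1\<^sub>m d + \<i> \<cdot>\<^sub>m P)) W = W" if "W \<in> SS" "chi A W = chi B W" for W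
    using act_transvection[OF P that(1) c(1)] chiP[OF that(1)] that by simp
  ultimately show ?thesis using c(2) by blast
qed

lemma anticommuting_pair_sum:
  assumes A: "A \<in> SS" and B: "B \<in> SS" and W: "W \<in> SS"
    and AB: "chi A B = 1" and c: "chi A W = c" "chi B W = c"
    and ne: "\<not> eqv A W" "\<not> eqv B W"
  shows "(\<Sum>Z\<in>SS. (1 - chi Z A) * (1 - chi Z B) * (c * chi Z W)) \<ge> (if W = 1\<^sub>m d then 2 * d\<^sup>2 else 0)"
proof -
  let ?s = "\<lambda>X. \<Sum>Z\<in>SS. chi Z X"
  have "(\<Sum>Z\<in>SS. (1 - chi Z A) * (1 - chi Z B) * (c * chi Z W)) =
    (\<Sum>Z\<in>SS. c * chi Z W - c * chi Z (pj A W) - c * chi Z (pj B W) + c * chi Z (pj (pj A B) W))"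
    using A B W by (intro sum.cong refl) (simp add: chi_pj algebra_simps)
  also have "\<dots> = c * ?s W - c * ?s (pj A W) - c * ?s (pj B W) + c * ?s (pj (pj A B) W)"
    by (simp add: sum.distrib sum_subtractf sum_distrib_left)
  also have "?s (pj A W) = 0" using A W ne by (subst chi_sum) (simp_all add: eqv_pj)
  also have "?s (pj B W) = 0" using B W ne by (subst chi_sum) (simp_all add: eqv_pj)
  finally have e: "(\<Sum>Z\<in>SS. (1 - chi Z A) * (1 - chi Z B) * (c * chi Z W)) = c * ?s W + c * ?s (pj (pj A B) W)"
    by simp
  have "c * ?s (pj (pj A B) W) \<ge> 0"
  proof (cases "eqv (pj A B) W")
    case True
    then have "chi A W = chi A (pj A B)" using A B W chi_eqv[of "pj A B" W A] by simp
    then have "c = 1" using A B AB c by (simp add: chi_pj)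
    then show ?thesis using A B W by (simp add: chi_sum)
  next
    case False
    then show ?thesis using A B W by (simp add: chi_sum eqv_pj)
  qed
  moreover have "c * ?s W \<ge> (if W = 1\<^sub>m d then 2 * d\<^sup>2 else 0)"
  proof (cases "eqv W (1\<^sub>m d)")
    case True
    then have "c = 1" using A W c chi_eqv[OF W one_SS A True] by simp
    then show ?thesis using W True by (simp add: chi_sum)
  next
    case False
    then show ?thesis using W by (auto simp add: chi_sum)
  qed
  ultimately show ?thesis unfolding e by linarith
qed

text \<open>If \<open>A\<close> and \<open>B\<close> commute, two transvections lead from \<open>A\<close> to \<open>B\<close> through a \<open>Z\<close> that anticommutes with
  both and has the same signs against \<open>W\<close> and \<open>W'\<close>; a character sum shows that such \<open>Z\<close> exist.\<close>

lemma witt_step: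
  assumes A: "A \<in> SS" and B: "B \<in> SS" and W: "W \<in> SS" "W' \<in> SS"
    and c: "chi A W = chi B W" "chi A W' = chi B W'"
    and neA: "\<not> eqv A (1\<^sub>m d)" "\<not> eqv A W" "\<not> eqv A W'" "\<not> eqv A (pj W W')"
    and neB: "\<not> eqv B (1\<^sub>m d)" "\<not> eqv B W" "\<not> eqv B W'" "\<not> eqv B (pj W W')"
  shows "\<exists>C\<in>Cl. act C A = B \<and> act C W = W \<and> act C W' = W'"
proof (cases "chi A B = 1")
  case False
  then have "chi A B = - 1" using chi_cases by blast
  from transvection_step[OF A B this] show ?thesis using W c by blast
next
  case AB: True
  have "\<exists>Z\<in>SS. (1 - chi Z A) * (1 - chi Z B) * ((1 + chi A W * chi Z W) * (1 + chi A W' * chi Z W')) \<noteq> 0"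
  proof (rule ccontr)
    assume "\<not> ?thesis"
    then have "0 = (\<Sum>Z\<in>SS. (1 - chi Z A) * (1 - chi Z B) * ((1 + chi A W * chi Z W) * (1 + chi A W' * chi Z W')))"
      by (intro sum.neutral[symmetric]) blast
    also have "\<dots> = (\<Sum>Z\<in>SS. (1 - chi Z A) * (1 - chi Z B) * (chi A (1\<^sub>m d) * chi Z (1\<^sub>m d)))
      + (\<Sum>Z\<in>SS. (1 - chi Z A) * (1 - chi Z B) * (chi A W * chi Z W))
      + (\<Sum>Z\<in>SS. (1 - chi Z A) * (1 - chi Z B) * (chi A W' * chi Z W'))
      + (\<Sum>Z\<in>SS. (1 - chi Z A) * (1 - chi Z B) * (chi A (pj W W') * chi Z (pj W W')))"
      unfolding sum.distrib[symmetric] using A W by (intro sum.cong refl) (simp add: chi_pj algebra_simps)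
    also have "\<dots> \<ge> 2 * (real d)\<^sup>2 + 0 + 0 + 0"
    proof (intro add_mono)
      show "2 * (real d)\<^sup>2 \<le> (\<Sum>Z\<in>SS. (1 - chi Z A) * (1 - chi Z B) * (chi A (1\<^sub>m d) * chi Z (1\<^sub>m d)))"
        using anticommuting_pair_sum[OF A B one_SS AB refl] A B neA neB by simp
      show "0 \<le> (\<Sum>Z\<in>SS. (1 - chi Z A) * (1 - chi Z B) * (chi A W * chi Z W))"
        using anticommuting_pair_sum[OF A B W(1) AB refl c(1)[symmetric]] neA neB by (auto split: if_splits)
      show "0 \<le> (\<Sum>Z\<in>SS. (1 - chi Z A) * (1 - chi Z B) * (chi A W' * chi Z W'))"
        using anticommuting_pair_sum[OF A B W(2) AB refl c(2)[symmetric]] neA neB by (auto split: if_splits)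
      have "chi B (pj W W') = chi A (pj W W')" using A B W c by (simp add: chi_pj)
      then show "0 \<le> (\<Sum>Z\<in>SS. (1 - chi Z A) * (1 - chi Z B) * (chi A (pj W W') * chi Z (pj W W')))"
        using anticommuting_pair_sum[OF A B pj_SS[OF W] AB refl] neA neB by (auto split: if_splits)
    qed
    finally show False using dpos by simp
  qed
  then obtain Z where Z: "Z \<in> SS" and
    nz: "(1 - chi Z A) * (1 - chi Z B) * ((1 + chi A W * chi Z W) * (1 + chi A W' * chi Z W')) \<noteq> 0"
    by blast
  have ZA: "chi A Z = - 1" using nz chi_cases[of Z A] by (auto simp: chi_sym[of A])
  have ZB: "chi Z B = - 1" using nz chi_cases[of Z B] by auto
  have ZW: "chi A W = chi Z W" "chi A W' = chi Z W'"
    using nz chi_cases[of A W] chi_cases[of Z W] chi_cases[of A W'] chi_cases[of Z W'] by auto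
  obtain C where C: "C \<in> Cl" "act C A = Z" "act C W = W" "act C W' = W'"
    using transvection_step[OF A Z ZA] W ZW by blast
  obtain C' where C': "C' \<in> Cl" "act C' Z = B" "act C' W = W" "act C' W' = W'"
    using transvection_step[OF Z B ZB] W ZW c by metis
  show ?thesis using C C' Cl_mult[OF C'(1) C(1)] A W by (intro bexI[of _ "C' * C"]) (simp_all add: act_mult)
qed

definition indep2 :: "complex mat \<Rightarrow> complex mat \<Rightarrow> bool" where
  "indep2 A B \<longleftrightarrow> A \<in> SS \<and> B \<in> SS \<and> \<not> eqv A (1\<^sub>m d) \<and> \<not> eqv B (1\<^sub>m d) \<and> \<not> eqv B A"

definition indep3 :: "complex mat \<Rightarrow> complex mat \<Rightarrow> complex mat \<Rightarrow> bool" where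
  "indep3 A B C \<longleftrightarrow> indep2 A B \<and> C \<in> SS \<and> \<not> eqv C (1\<^sub>m d) \<and> \<not> eqv C A \<and> \<not> eqv C B \<and> \<not> eqv C (pj A B)"

lemma pj_one [simp]: "A \<in> SS \<Longrightarrow> pj A (1\<^sub>m d) = A"
  by (simp add: pj_def)

lemma witt1:
  assumes "A \<in> SS" "\<not> eqv A (1\<^sub>m d)" "B \<in> SS" "\<not> eqv B (1\<^sub>m d)"
  shows "\<exists>C\<in>Cl. act C A = B"
  using witt_step[of A B "1\<^sub>m d" "1\<^sub>m d"] assms by auto

lemma act_indep2: "X \<in> Cl \<Longrightarrow> indep2 A B \<Longrightarrow> indep2 (act X A) (act X B)"
  unfolding indep2_def using act_eqv[of X _ "1\<^sub>m d"] by simp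

lemma act_indep3: "X \<in> Cl \<Longrightarrow> indep3 A B C \<Longrightarrow> indep3 (act X A) (act X B) (act X C)"
  unfolding indep3_def using act_indep2[of X A B] act_eqv[of X _ "1\<^sub>m d"]
  by (simp add: act_pj indep2_def)

lemma witt2:
  assumes "indep2 A B" "indep2 A' B'" "chi A B = chi A' B'"
  shows "\<exists>C\<in>Cl. act C A = A' \<and> act C B = B'"
proof -
  have S: "A \<in> SS" "B \<in> SS" "A' \<in> SS" "B' \<in> SS" using assms by (auto simp: indep2_def)
  obtain C where C: "C \<in> Cl" "act C A = A'"
    using witt1[of A A'] assms by (auto simp: indep2_def)
  have i: "indep2 A' (act C B)" using act_indep2[OF C(1) assms(1)] C by simp
  have "chi A' (act C B) = chi A' B'" using C S assms(3) act_chi[of C A B] by simp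
  then obtain C' where C': "C' \<in> Cl" "act C' (act C B) = B'" "act C' A' = A'"
    using witt_step[of "act C B" B' A' "1\<^sub>m d"] i assms(2) S C by (auto simp: indep2_def chi_sym)
  show ?thesis using C C' S Cl_mult[OF C'(1) C(1)] by (intro bexI[of _ "C' * C"]) (simp_all add: act_mult)
qed

lemma witt3:
  assumes i: "indep3 A B D" "indep3 A' B' D'"
    and c: "chi A B = chi A' B'" "chi A D = chi A' D'" "chi B D = chi B' D'"
  shows "\<exists>C\<in>Cl. act C A = A' \<and> act C B = B' \<and> act C D = D'"
proof -
  have S: "A \<in> SS" "B \<in> SS" "A' \<in> SS" "B' \<in> SS" "D \<in> SS" "D' \<in> SS"
    using i by (auto simp: indep3_def indep2_def)
  obtain C where C: "C \<in> Cl" "act C A = A'" "act C B = B'"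
    using witt2[of A B A' B'] assms by (auto simp: indep3_def)
  have i': "indep3 A' B' (act C D)" using act_indep3[OF C(1) i(1)] C by simp
  have "chi A' (act C D) = chi A' D'" "chi B' (act C D) = chi B' D'"
    using C S c act_chi[of C A D] act_chi[of C B D] by simp_all
  then obtain C' where C': "C' \<in> Cl" "act C' (act C D) = D'" "act C' A' = A'" "act C' B' = B'"
    using witt_step[of "act C D" D' A' B'] i' i(2) S C by (auto simp: indep3_def indep2_def chi_sym)
  show ?thesis using C C' S Cl_mult[OF C'(1) C(1)] by (intro bexI[of _ "C' * C"]) (simp_all add: act_mult)
qed

definition avg :: "(complex mat \<Rightarrow> real) \<Rightarrow> real" where
  "avg f = (\<Sum>C\<in>Cl. f C) / real (card Cl)"

lemma card_Cl_pos: "0 < card Cl"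
  using fin_Cl one_Cl card_gt_0_iff by blast

lemma avg_right:
  assumes X: "X \<in> Cl"
  shows "avg (\<lambda>C. f (C * X)) = avg f"
proof -
  have "bij_betw (\<lambda>C. C * X) Cl Cl"
    by (rule bij_betw_byWitness[of _ "\<lambda>C. C * adj X"]) (use X in \<open>auto simp: assoc Cl_mult Cl_adj\<close>)
  then show ?thesis unfolding avg_def using sum.reindex_bij_betw[of "\<lambda>C. C * X" Cl Cl f] by simp
qed

lemma avg_adj: "avg (\<lambda>C. f (adj C)) = avg f"
proof -
  have "bij_betw adj Cl Cl" by (rule bij_betw_byWitness[of _ adj]) (auto simp: Cl_adj)
  then show ?thesis unfolding avg_def using sum.reindex_bij_betw[of adj Cl Cl f] by simp
qed

lemma avg_sum: "avg (\<lambda>C. \<Sum>t\<in>K. f t C) = (\<Sum>t\<in>K. avg (f t))"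
  unfolding avg_def by (subst sum.swap) (simp add: sum_divide_distrib)

lemma avg_cmult: "avg (\<lambda>C. c * f C) = c * avg f"
  unfolding avg_def by (simp add: sum_distrib_left[symmetric])

lemma avg_const [simp]: "avg (\<lambda>C. c) = c"
  unfolding avg_def using card_Cl_pos by simp

lemma avg_cong: "(\<And>C. C \<in> Cl \<Longrightarrow> f C = g C) \<Longrightarrow> avg f = avg g"
  unfolding avg_def by simp

text \<open>On an orbit the average of \<open>y\<close> over the group is the same at every point.\<close>

lemma class_average:
  fixes act' :: "complex mat \<Rightarrow> 'a \<Rightarrow> 'a" and w y :: "'a \<Rightarrow> real"
  assumes fin: "finite K"
    and closed: "\<And>C t. C \<in> Cl \<Longrightarrow> t \<in> K \<Longrightarrow> act' C t \<in> K"
    and mult: "\<And>C C' t. C \<in> Cl \<Longrightarrow> C' \<in> Cl \<Longrightarrow> t \<in> K \<Longrightarrow> act' (C * C') t = act' C (act' C' t)"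
    and inv: "\<And>C t. C \<in> Cl \<Longrightarrow> t \<in> K \<Longrightarrow> act' (adj C) (act' C t) = t"
    and trans: "\<And>t t'. t \<in> K \<Longrightarrow> t' \<in> K \<Longrightarrow> \<exists>C\<in>Cl. act' C t = t'"
  shows "(\<Sum>t\<in>K. w t * avg (\<lambda>C. y (act' C t))) * real (card K) = (\<Sum>t\<in>K. w t) * (\<Sum>t\<in>K. y t)"
proof (cases "K = {}")
  case False
  then obtain t0 where t0: "t0 \<in> K" by blast
  let ?p = "avg (\<lambda>C. y (act' C t0))"
  have const: "avg (\<lambda>C. y (act' C t)) = ?p" if "t \<in> K" for t
  proof -
    obtain X where X: "X \<in> Cl" "act' X t0 = t" using trans[OF t0 \<open>t \<in> K\<close>] by blast
    have "avg (\<lambda>C. y (act' C t)) = avg (\<lambda>C. y (act' (C * X) t0))"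
      using X t0 by (intro avg_cong) (simp add: mult)
    then show ?thesis using avg_right[OF X(1), of "\<lambda>C. y (act' C t0)"] by simp
  qed
  have "real (card K) * ?p = (\<Sum>t\<in>K. avg (\<lambda>C. y (act' C t)))" using const by simp
  also have "\<dots> = avg (\<lambda>C. \<Sum>t\<in>K. y (act' C t))" by (simp add: avg_sum)
  also have "\<dots> = avg (\<lambda>C. \<Sum>t\<in>K. y t)"
  proof (rule avg_cong)
    fix C assume C: "C \<in> Cl"
    have "inj_on (act' C) K" using inv[OF C] by (metis inj_onI)
    then have "bij_betw (act' C) K K"
      using endo_inj_surj[OF fin, of "act' C"] closed[OF C] by (auto simp: bij_betw_def)
    then show "(\<Sum>t\<in>K. y (act' C t)) = (\<Sum>t\<in>K. y t)" by (rule sum.reindex_bij_betw)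
  qed
  finally have "real (card K) * ?p = (\<Sum>t\<in>K. y t)" by simp
  moreover have "(\<Sum>t\<in>K. w t * avg (\<lambda>C. y (act' C t))) = (\<Sum>t\<in>K. w t) * ?p"
    using const by (simp add: sum_distrib_right)
  ultimately show ?thesis by (simp add: mult_ac)
qed simp

end

section \<open>The second moment of the estimator\<close>

definition diag_corr :: "nat \<Rightarrow> (nat \<Rightarrow> complex mat) \<Rightarrow> complex mat \<Rightarrow> complex mat \<Rightarrow> real" where
  "diag_corr d E X Y = (\<Sum>b<d. tau (E b) X * tau (E b) Y) / real d"

text \<open>Here \<open>rho\<close> is the traceless part of the state, \<open>E b\<close> the effects of the measurement behind the
  fixed layer, and \<open>W0\<close> the Pauli whose commutation signs govern the support of \<open>diag_corr\<close>.\<close>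

locale shadow_frame = clifford_frame +
  fixes rho Ob W0 :: "complex mat" and E :: "nat \<Rightarrow> complex mat"
  assumes rho [simp]: "rho \<in> carrier_mat d d" "adj rho = rho" and rho_tr: "mtrace rho = 0"
    and Ob [simp]: "Ob \<in> carrier_mat d d" "adj Ob = Ob" and Ob_tr: "mtrace Ob = 0"
    and W0: "W0 \<in> SS"
    and E_carrier: "b < d \<Longrightarrow> E b \<in> carrier_mat d d"
    and E_adj: "b < d \<Longrightarrow> adj (E b) = E b"
    and E_tr: "b < d \<Longrightarrow> mtrace (E b) = 1"
    and E_rank1: "b < d \<Longrightarrow> X \<in> carrier_mat d d \<Longrightarrow> Y \<in> carrier_mat d d \<Longrightarrow>
      mtrace ((E b * X) * (E b * Y)) = mtrace (E b * X) * mtrace (E b * Y)"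
    and E_sum: "X \<in> carrier_mat d d \<Longrightarrow> (\<Sum>b<d. mtrace (E b * X)) = mtrace X"
    and parity: "A \<in> SS \<Longrightarrow> B \<in> SS \<Longrightarrow> diag_corr d E A B \<noteq> 0 \<Longrightarrow> chi A B = chi A W0 * chi B W0"
begin

abbreviation D :: "complex mat \<Rightarrow> complex mat \<Rightarrow> real" where "D \<equiv> diag_corr d E"
abbreviation r :: "complex mat \<Rightarrow> real" where "r \<equiv> tau rho"
abbreviation q :: "complex mat \<Rightarrow> real" where "q \<equiv> tau Ob"

lemma D_sym: "D X Y = D Y X" by (simp add: diag_corr_def mult.commute)

lemma tau_antiherm:
  assumes "X \<in> carrier_mat d d" "adj X = X" "A \<in> carrier_mat d d" "adj A = - 1 \<cdot>\<^sub>m A"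
  shows "tau X A = 0"
  using tau_adj[of X A] assms by simp

lemma D_antiherm:
  assumes "A \<in> carrier_mat d d" "adj A = - 1 \<cdot>\<^sub>m A"
  shows "D X A = 0"
  unfolding diag_corr_def using assms by (simp add: tau_antiherm E_carrier E_adj)

lemma D_neg [simp]:
  assumes "X \<in> carrier_mat d d" "Y \<in> carrier_mat d d"
  shows "D (- 1 \<cdot>\<^sub>m X) Y = - D X Y" "D X (- 1 \<cdot>\<^sub>m Y) = - D X Y"
  using assms by (simp_all add: diag_corr_def E_carrier sum_negf)

lemma E_sum_tau: "X \<in> carrier_mat d d \<Longrightarrow> (\<Sum>b<d. tau (E b) X) = Re (mtrace X)"
  unfolding tau_def using E_sum[of X] by (metis Re_sum)

lemma D_one:
  assumes "A \<in> SS" "\<not> eqv A (1\<^sub>m d)"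
  shows "D (1\<^sub>m d) A = 0" "D A (1\<^sub>m d) = 0"
proof -
  have "D (1\<^sub>m d) A = (\<Sum>b<d. tau (E b) A) / d"
    unfolding diag_corr_def by (simp add: tau_def E_carrier E_tr)
  also have "\<dots> = 0" using assms by (simp add: E_sum_tau SS_trace)
  finally show "D (1\<^sub>m d) A = 0" .
  then show "D A (1\<^sub>m d) = 0" by (simp add: D_sym)
qed

lemma D_one_one: "D (1\<^sub>m d) (1\<^sub>m d) = 1"
  unfolding diag_corr_def using dpos by (simp add: tau_def E_carrier E_tr)

lemma rq_one: "eqv A (1\<^sub>m d) \<Longrightarrow> r A = 0" "eqv A (1\<^sub>m d) \<Longrightarrow> q A = 0"
  by (auto simp: eqv_def tau_def rho_tr Ob_tr)

text \<open>The expansion of the shadow estimator in Hermitian Paulis; every Pauli occurs with both signs,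
  whence the factor 4.\<close>

lemma estimator_expand:
  assumes X: "X \<in> carrier_mat d d" "adj X = X" and Y: "Y \<in> carrier_mat d d" "adj Y = Y"
  shows "4 * d * (\<Sum>b<d. tau (E b) X * tau (E b) Y) = (\<Sum>A\<in>SS. \<Sum>B\<in>SS. D A B * (tau X A * tau Y B))"
proof -
  have "(\<Sum>A\<in>SS. \<Sum>B\<in>SS. D A B * (tau X A * tau Y B)) =
    (\<Sum>b<d. (\<Sum>A\<in>SS. tau X A * tau (E b) A) * (\<Sum>B\<in>SS. tau Y B * tau (E b) B)) / d"
  proof -
    have "(\<Sum>A\<in>SS. \<Sum>B\<in>SS. D A B * (tau X A * tau Y B)) =
      (\<Sum>A\<in>SS. \<Sum>B\<in>SS. \<Sum>b<d. (tau X A * tau (E b) A) * (tau Y B * tau (E b) B) / d)"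
      unfolding diag_corr_def by (intro sum.cong refl) (simp add: sum_distrib_left sum_divide_distrib mult_ac)
    also have "\<dots> = (\<Sum>A\<in>SS. \<Sum>b<d. \<Sum>B\<in>SS. (tau X A * tau (E b) A) * (tau Y B * tau (E b) B) / d)"
      by (intro sum.cong refl sum.swap)
    also have "\<dots> = (\<Sum>b<d. \<Sum>A\<in>SS. \<Sum>B\<in>SS. (tau X A * tau (E b) A) * (tau Y B * tau (E b) B) / d)"
      by (rule sum.swap)
    finally show ?thesis by (simp only: sum_product sum_divide_distrib)
  qed
  also have "\<dots> = (\<Sum>b<d. 4 * d\<^sup>2 * (tau (E b) X * tau (E b) Y)) / d"
  proof -
    have "(\<Sum>A\<in>SS. tau Z A * tau (E b) A) = 2 * d * tau (E b) Z"
      if "b < d" "Z \<in> carrier_mat d d" "adj Z = Z" for Z b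
      using that complete_tau[of Z "E b"] tau_comm[of Z "E b"] by (simp add: E_carrier)
    then show ?thesis using X Y by (simp add: power2_eq_square mult_ac)
  qed
  also have "\<dots> = 4 * d * (\<Sum>b<d. tau (E b) X * tau (E b) Y)"
    using dpos by (simp add: sum_distrib_left[symmetric] power2_eq_square)
  finally show ?thesis by simp
qed

lemma tau_act:
  assumes "C \<in> Cl" "X \<in> carrier_mat d d" "A \<in> carrier_mat d d"
  shows "tau (C * X * adj C) A = tau X (act (adj C) A)"
proof -
  have "mtrace (C * X * adj C * A) = mtrace (C * (X * (adj C * A)))" using assms by (simp add: assoc)
  also have "\<dots> = mtrace (X * (adj C * A) * C)" using assms by (intro tr_comm) simp_all
  also have "X * (adj C * A) * C = X * act (adj C) A" using assms by (simp add: assoc act_def)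
  finally show ?thesis by (simp add: tau_def)
qed

lemma pauli_act:
  assumes Z: "Z \<in> SS"
  shows "\<exists>X\<in>Cl. \<forall>A\<in>SS. act X A = complex_of_real (chi Z A) \<cdot>\<^sub>m A"
proof -
  obtain c where c: "c * cnj c * 2 = 1" "c \<cdot>\<^sub>m (1\<^sub>m d + \<i> \<cdot>\<^sub>m Z) \<in> Cl"
    using Cl_transvection[OF Z] by blast
  let ?T = "c \<cdot>\<^sub>m (1\<^sub>m d + \<i> \<cdot>\<^sub>m Z)"
  have "act (?T * ?T) A = complex_of_real (chi Z A) \<cdot>\<^sub>m A" if A: "A \<in> SS" for A
  proof -
    have TA: "act ?T A = (if chi Z A = 1 then A else \<i> \<cdot>\<^sub>m (Z * A))"
      by (rule act_transvection[OF Z A c(1)])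
    have "act (?T * ?T) A = act ?T (act ?T A)" using c(2) A by (intro act_mult) auto
    also have "\<dots> = complex_of_real (chi Z A) \<cdot>\<^sub>m A"
    proof (cases "chi Z A = 1")
      case True then show ?thesis using TA by simp
    next
      case False
      then have n: "chi Z A = - 1" using chi_cases by blast
      then have e: "\<i> \<cdot>\<^sub>m (Z * A) = pj Z A" by (simp add: pj_def chi_def split: if_splits)
      have S: "pj Z A \<in> SS" using Z A by simp
      have "chi Z (pj Z A) = - 1" using Z A n by (simp add: chi_pj)
      then have "act ?T (pj Z A) = \<i> \<cdot>\<^sub>m (Z * pj Z A)"
        using act_transvection[OF Z S c(1)] by simp
      also have "\<dots> = - 1 \<cdot>\<^sub>m A" unfolding e[symmetric] using Z A by simp
      finally show ?thesis using TA n e by simp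
    qed
    finally show ?thesis .
  qed
  then show ?thesis using Cl_mult[OF c(2) c(2)] by blast
qed

definition Phi :: "complex mat \<Rightarrow> complex mat \<Rightarrow> complex mat \<Rightarrow> complex mat \<Rightarrow> real" where
  "Phi A B C F = avg (\<lambda>X. r (act X A) * q (act X B) * (r (act X C) * q (act X F)))"

text \<open>Averaging over conjugation by Paulis kills every quadruple whose product is not scalar.\<close>

lemma Phi_twirl:
  assumes S: "A \<in> SS" "B \<in> SS" "C \<in> SS" "F \<in> SS" and ne: "\<not> eqv F (pj (pj A B) C)"
  shows "Phi A B C F = 0"
proof -
  let ?R = "pj F (pj (pj A B) C)"
  have R: "?R \<in> SS" "\<not> eqv ?R (1\<^sub>m d)" using S ne by (simp_all add: eqv_pj)
  have "\<exists>Z\<in>SS. chi Z ?R = - 1"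
  proof (rule ccontr)
    assume "\<not> ?thesis"
    then have "\<forall>Z\<in>SS. chi Z ?R = 1" using chi_cases by blast
    then have "(\<Sum>Z\<in>SS. chi Z ?R) = real (card SS)" by simp
    then show False using R dpos by (simp add: chi_sum card_SS)
  qed
  then obtain Z where Z: "Z \<in> SS" "chi Z ?R = - 1" by blast
  then have s: "chi Z F * (chi Z A * chi Z B * chi Z C) = - 1" using S by (simp add: chi_pj)
  obtain X where X: "X \<in> Cl" "\<And>A. A \<in> SS \<Longrightarrow> act X A = complex_of_real (chi Z A) \<cdot>\<^sub>m A"
    using pauli_act[OF Z(1)] by blast
  let ?f = "\<lambda>C'. r (act C' A) * q (act C' B) * (r (act C' C) * q (act C' F))"
  have "avg ?f = avg (\<lambda>C'. ?f (C' * X))" using avg_right[OF X(1), of ?f] by simp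
  also have "\<dots> = avg (\<lambda>C'. (chi Z F * (chi Z A * chi Z B * chi Z C)) * ?f C')"
  proof (rule avg_cong)
    fix C' assume C': "C' \<in> Cl"
    have "act (C' * X) A = complex_of_real (chi Z A) \<cdot>\<^sub>m act C' A" if "A \<in> SS" for A
      using C' X that by (simp add: act_mult act_smult)
    then show "?f (C' * X) = (chi Z F * (chi Z A * chi Z B * chi Z C)) * ?f C'"
      using S C' by simp
  qed
  also have "\<dots> = - avg ?f" unfolding avg_cmult s by simp
  finally show ?thesis unfolding Phi_def by simp
qed

lemma triple_cases:
  assumes S: "A \<in> SS" "B \<in> SS" "C \<in> SS"
  shows "(chi A B * chi A C * chi B C = 1 \<and> A * B * C \<in> SS \<and> eqv (A * B * C) (pj (pj A B) C)) \<or>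
    (chi A B * chi A C * chi B C = - 1 \<and> A * B * C = (- \<i>) \<cdot>\<^sub>m pj (pj A B) C)"
proof -
  obtain c where c: "A * B = c \<cdot>\<^sub>m pj A B" "c = 1 \<or> c = - \<i>" "c = 1 \<longleftrightarrow> chi A B = 1"
    using pj_phase[OF S(1,2)] by blast
  obtain e where e: "pj A B * C = e \<cdot>\<^sub>m pj (pj A B) C" "e = 1 \<or> e = - \<i>" "e = 1 \<longleftrightarrow> chi (pj A B) C = 1"
    using pj_phase[OF pj_SS[OF S(1,2)] S(3)] by blast
  have m: "A * B * C = (c * e) \<cdot>\<^sub>m pj (pj A B) C" using c(1) e(1) S by simp
  have x: "chi A B * chi A C * chi B C = chi A B * chi (pj A B) C" using S by (simp add: chi_pj')
  have i: "- \<i> \<noteq> 1" by (simp add: complex_eq_iff)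
  have p: "pj (pj A B) C \<in> SS" using S by simp
  have nc: "c = - \<i> \<Longrightarrow> chi A B = - 1" using c(3) i chi_cases by metis
  have ne: "e = - \<i> \<Longrightarrow> chi (pj A B) C = - 1" using e(3) i chi_cases by metis
  from c(2) e(2) consider "c = 1" "e = 1" | "c = 1" "e = - \<i>" | "c = - \<i>" "e = 1" | "c = - \<i>" "e = - \<i>" by blast
  then show ?thesis
  proof cases
    case 1 then show ?thesis using m p x c(3) e(3) by simp
  next
    case 2 then show ?thesis using m p x c(3) ne by simp
  next
    case 3 then show ?thesis using m p x e(3) nc by simp
  next
    case 4 then show ?thesis using m p x nc ne by simp
  qed
qed

lemma triple_antiherm:
  assumes S: "A \<in> SS" "B \<in> SS" "C \<in> SS" and n: "A * B * C \<notin> SS"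
  shows "adj (A * B * C) = - 1 \<cdot>\<^sub>m (A * B * C)"
proof -
  have e: "A * B * C = (- \<i>) \<cdot>\<^sub>m pj (pj A B) C" using triple_cases[OF S] n by blast
  show ?thesis unfolding e using S by simp
qed

text \<open>The remaining candidate \<open>F = \<plusminus>\<i>ABC\<close> contradicts the parity rule.\<close>

lemma parity_kill:
  assumes S: "A \<in> SS" "B \<in> SS" "C \<in> SS" "F \<in> SS"
    and D: "D A B \<noteq> 0" "D C F \<noteq> 0" and n: "F \<noteq> A * B * C" "F \<noteq> - 1 \<cdot>\<^sub>m (A * B * C)"
  shows "Phi A B C F = 0"
proof (cases "eqv F (pj (pj A B) C)")
  case False then show ?thesis using Phi_twirl S by blast
next
  case True
  have "\<not> eqv F (A * B * C)" using n by (simp add: eqv_def)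
  then have "chi A B * chi A C * chi B C = - 1"
    using triple_cases[OF S(1-3)] True eqv_trans eqv_sym by blast
  moreover have "chi C F = chi C (pj (pj A B) C)" "chi W0 F = chi W0 (pj (pj A B) C)"
    using chi_eqv[OF S(4) pj_SS[OF pj_SS[OF S(1,2)] S(3)] _ True] S W0 by blast+
  then have "chi C F = chi A C * chi B C" "chi F W0 = chi A W0 * chi B W0 * chi C W0"
    using S W0 chi_sym[of C A] chi_sym[of C B] chi_sym[of F W0] chi_sym[of A W0] chi_sym[of B W0] chi_sym[of C W0]
    by (simp_all add: chi_pj)
  moreover have "chi A B = chi A W0 * chi B W0" "chi C F = chi C W0 * chi F W0"
    using parity S D by blast+
  ultimately show ?thesis
    using chi_cases[of A W0] chi_cases[of B W0] chi_cases[of C W0] by auto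
qed

lemma second_moment:
  fixes G :: "complex mat \<Rightarrow> complex mat \<Rightarrow> real"
  assumes supp: "\<And>A B. A \<in> SS \<Longrightarrow> B \<in> SS \<Longrightarrow> G A B \<noteq> 0 \<Longrightarrow> D A B \<noteq> 0"
    and neg: "\<And>A B. A \<in> SS \<Longrightarrow> B \<in> SS \<Longrightarrow> G A (- 1 \<cdot>\<^sub>m B) = - G A B"
    and anti: "\<And>A B. A \<in> SS \<Longrightarrow> B \<in> carrier_mat d d \<Longrightarrow> adj B = - 1 \<cdot>\<^sub>m B \<Longrightarrow> G A B = 0"
  shows "avg (\<lambda>X. (\<Sum>A\<in>SS. \<Sum>B\<in>SS. G A B * (r (act X A) * q (act X B)))\<^sup>2) =
    2 * (\<Sum>A\<in>SS. \<Sum>B\<in>SS. \<Sum>C\<in>SS. G A B * G C (A * B * C) * Phi A B C (A * B * C))"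
proof -
  have "avg (\<lambda>X. (\<Sum>A\<in>SS. \<Sum>B\<in>SS. G A B * (r (act X A) * q (act X B)))\<^sup>2) =
    avg (\<lambda>X. \<Sum>A\<in>SS. \<Sum>B\<in>SS. \<Sum>C\<in>SS. \<Sum>F\<in>SS. (G A B * G C F) * (r (act X A) * q (act X B) * (r (act X C) * q (act X F))))"
  proof (rule avg_cong)
    fix X
    let ?u = "\<lambda>A B. G A B * (r (act X A) * q (act X B))"
    have "(\<Sum>A\<in>SS. \<Sum>B\<in>SS. ?u A B)\<^sup>2 = (\<Sum>A\<in>SS. \<Sum>B\<in>SS. \<Sum>C\<in>SS. \<Sum>F\<in>SS. ?u A B * ?u C F)"
      unfolding power2_eq_square by (simp only: sum_distrib_right, simp only: sum_distrib_left)
    then show "(\<Sum>A\<in>SS. \<Sum>B\<in>SS. ?u A B)\<^sup>2 = (\<Sum>A\<in>SS. \<Sum>B\<in>SS. \<Sum>C\<in>SS. \<Sum>F\<in>SS.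
        (G A B * G C F) * (r (act X A) * q (act X B) * (r (act X C) * q (act X F))))"
      by (simp only: mult_ac)
  qed
  also have "\<dots> = (\<Sum>A\<in>SS. \<Sum>B\<in>SS. \<Sum>C\<in>SS. \<Sum>F\<in>SS. G A B * G C F * Phi A B C F)"
    unfolding avg_sum avg_cmult Phi_def ..
  also have "\<dots> = (\<Sum>A\<in>SS. \<Sum>B\<in>SS. \<Sum>C\<in>SS. 2 * (G A B * G C (A * B * C) * Phi A B C (A * B * C)))"
  proof (intro sum.cong refl)
    fix A B C assume S: "A \<in> SS" "B \<in> SS" "C \<in> SS"
    let ?R = "A * B * C"
    let ?h = "\<lambda>F. G A B * G C F * Phi A B C F"
    have kill: "?h F = 0" if "F \<in> SS" "F \<noteq> ?R" "F \<noteq> - 1 \<cdot>\<^sub>m ?R" for F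
      using parity_kill[OF S that(1) _ _ that(2,3)] supp[OF S(1,2)] supp[OF S(3) that(1)]
      by (cases "G A B = 0 \<or> G C F = 0") auto
    show "(\<Sum>F\<in>SS. ?h F) = 2 * ?h ?R"
    proof (cases "?R \<in> SS")
      case False
      then have "- 1 \<cdot>\<^sub>m ?R \<notin> SS" using SS_neg[of "- 1 \<cdot>\<^sub>m ?R"] by auto
      then have "(\<Sum>F\<in>SS. ?h F) = 0" using False kill by (intro sum.neutral) metis
      moreover have "G C ?R = 0" using anti S triple_antiherm[OF S False] by simp
      ultimately show ?thesis by simp
    next
      case R: True
      have ne: "?R \<noteq> - 1 \<cdot>\<^sub>m ?R" using SS_inj[OF R, of 1 "- 1"] by auto
      have "(\<Sum>F\<in>SS. ?h F) = (\<Sum>F\<in>{?R, - 1 \<cdot>\<^sub>m ?R}. ?h F)"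
        using R kill by (intro sum.mono_neutral_right) auto
      also have "\<dots> = ?h ?R + ?h (- 1 \<cdot>\<^sub>m ?R)" using ne by simp
      also have "Phi A B C (- 1 \<cdot>\<^sub>m ?R) = - Phi A B C ?R"
      proof -
        have "Phi A B C (- 1 \<cdot>\<^sub>m ?R) = avg (\<lambda>X. - 1 * (r (act X A) * q (act X B) * (r (act X C) * q (act X ?R))))"
          unfolding Phi_def using R by (intro avg_cong) (simp add: act_smult)
        then show ?thesis unfolding Phi_def avg_cmult by simp
      qed
      finally show ?thesis using neg S R by simp
    qed
  qed
  finally show ?thesis by (simp add: sum_distrib_left)
qed

end

context pauli_frame
begin

lemma neg_neq: "A \<in> SS \<Longrightarrow> - 1 \<cdot>\<^sub>m A \<noteq> A"
  using SS_inj[of A "- 1" 1] by auto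

lemma sum_remove_eqv:
  fixes F :: "complex mat \<Rightarrow> real"
  assumes Z: "Z \<in> SS" "P Z" "P (- 1 \<cdot>\<^sub>m Z)" and F: "F (- 1 \<cdot>\<^sub>m Z) = F Z"
  shows "(\<Sum>B | B \<in> SS \<and> P B. F B) = 2 * F Z + (\<Sum>B | B \<in> SS \<and> P B \<and> \<not> eqv B Z. F B)"
proof -
  have "{B. B \<in> SS \<and> P B} = {Z, - 1 \<cdot>\<^sub>m Z} \<union> {B. B \<in> SS \<and> P B \<and> \<not> eqv B Z}"
    using Z by (auto simp: eqv_def)
  then have "(\<Sum>B | B \<in> SS \<and> P B. F B) =
      (\<Sum>B\<in>{Z, - 1 \<cdot>\<^sub>m Z} \<union> {B. B \<in> SS \<and> P B \<and> \<not> eqv B Z}. F B)" by simp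
  also have "\<dots> = (\<Sum>B\<in>{Z, - 1 \<cdot>\<^sub>m Z}. F B) + (\<Sum>B | B \<in> SS \<and> P B \<and> \<not> eqv B Z. F B)"
    by (intro sum.union_disjoint) (auto simp: eqv_def)
  also have "(\<Sum>B\<in>{Z, - 1 \<cdot>\<^sub>m Z}. F B) = 2 * F Z" using neg_neq[OF Z(1)] F by (subst sum.insert) auto
  finally show ?thesis .
qed

end

context clifford_frame
begin

lemma pj_not_eqv:
  assumes "indep2 A B"
  shows "\<not> eqv (pj A B) (1\<^sub>m d)" "\<not> eqv (pj A B) A" "\<not> eqv (pj A B) B"
proof -
  have S: "A \<in> SS" "B \<in> SS" "\<not> eqv B A" "\<not> eqv A (1\<^sub>m d)" "\<not> eqv B (1\<^sub>m d)" using assms by (auto simp: indep2_def)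
  obtain c where c: "c \<noteq> 0" "A * B = c \<cdot>\<^sub>m pj A B" "c = 1 \<or> c = - \<i>" "c = 1 \<longleftrightarrow> chi A B = 1"
    using pj_phase[OF S(1,2)] by blast
  show "\<not> eqv (pj A B) (1\<^sub>m d)" using S eqv_pj eqv_sym by blast
  have chi_self_pj: "chi A B = 1" if "eqv (pj A B) A \<or> eqv (pj A B) B"
  proof -
    have "chi A (pj A B) = chi A B" "chi B (pj A B) = chi A B"
      using S chi_sym[of B A] by (simp_all add: chi_pj)
    moreover have "chi A (pj A B) = 1 \<or> chi B (pj A B) = 1 \<or> chi A B = 1"
      using that chi_eqv[OF pj_SS[OF S(1,2)] S(1) S(1)] chi_eqv[OF pj_SS[OF S(1,2)] S(2) S(2)] by auto
    ultimately show ?thesis by auto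
  qed
  show "\<not> eqv (pj A B) A"
  proof
    assume e: "eqv (pj A B) A"
    then have "A * B = pj A B" using c chi_self_pj by simp
    then have "B = A * pj A B" using S by (metis SS_sqL SS_carrier)
    then have "eqv B (1\<^sub>m d)" using e S by (auto simp: eqv_def)
    then show False using S by simp
  qed
  show "\<not> eqv (pj A B) B"
  proof
    assume e: "eqv (pj A B) B"
    then have "A * B = pj A B" using c chi_self_pj by simp
    then have "A = pj A B * B" using S by (metis SS_sq SS_carrier smult_simps(6) assoc)
    then have "eqv A (1\<^sub>m d)" using e S by (auto simp: eqv_def)
    then show False using S by simp
  qed
qed

lemma sum_indep3:
  fixes G :: "complex mat \<Rightarrow> real"
  assumes i: "indep2 A B" and G: "\<And>C. C \<in> SS \<Longrightarrow> G (- 1 \<cdot>\<^sub>m C) = G C"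
  shows "(\<Sum>C\<in>SS. G C) = 2 * (G (1\<^sub>m d) + G A + G B + G (pj A B)) + (\<Sum>C | indep3 A B C. G C)"
proof -
  have S: "A \<in> SS" "B \<in> SS" "pj A B \<in> SS" using i by (auto simp: indep2_def)
  note ne = pj_not_eqv[OF i]
  have i': "\<not> eqv A (1\<^sub>m d)" "\<not> eqv B (1\<^sub>m d)" "\<not> eqv B A" using i by (auto simp: indep2_def)
  have "(\<Sum>C\<in>SS. G C) = (\<Sum>C | C \<in> SS \<and> True. G C)" by simp
  also have "\<dots> = 2 * G (1\<^sub>m d) + (\<Sum>C | C \<in> SS \<and> (True \<and> \<not> eqv C (1\<^sub>m d)). G C)"
    using G[OF one_SS] by (subst sum_remove_eqv[of "1\<^sub>m d"]) auto
  also have "(\<Sum>C | C \<in> SS \<and> (True \<and> \<not> eqv C (1\<^sub>m d)). G C) = 2 * G A + (\<Sum>C | C \<in> SS \<and> ((True \<and> \<not> eqv C (1\<^sub>m d)) \<and> \<not> eqv C A). G C)"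
    using G[OF S(1)] i' S by (subst sum_remove_eqv[of A]) auto
  also have "(\<Sum>C | C \<in> SS \<and> ((True \<and> \<not> eqv C (1\<^sub>m d)) \<and> \<not> eqv C A). G C) = 2 * G B
     + (\<Sum>C | C \<in> SS \<and> (((True \<and> \<not> eqv C (1\<^sub>m d)) \<and> \<not> eqv C A) \<and> \<not> eqv C B). G C)"
    using G[OF S(2)] i' S by (subst sum_remove_eqv[of B]) auto
  also have "(\<Sum>C | C \<in> SS \<and> (((True \<and> \<not> eqv C (1\<^sub>m d)) \<and> \<not> eqv C A) \<and> \<not> eqv C B). G C) = 2 * G (pj A B)
     + (\<Sum>C | C \<in> SS \<and> ((((True \<and> \<not> eqv C (1\<^sub>m d)) \<and> \<not> eqv C A) \<and> \<not> eqv C B) \<and> \<not> eqv C (pj A B)). G C)"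
    using G[OF S(3)] ne S by (subst sum_remove_eqv[of "pj A B"]) auto
  also have "{C. C \<in> SS \<and> ((((True \<and> \<not> eqv C (1\<^sub>m d)) \<and> \<not> eqv C A) \<and> \<not> eqv C B) \<and> \<not> eqv C (pj A B))} = {C. indep3 A B C}"
    using i by (auto simp: indep3_def)
  finally show ?thesis by simp
qed

lemma sum_indep2:
  fixes G :: "complex mat \<Rightarrow> real"
  assumes A: "A \<in> SS" "\<not> eqv A (1\<^sub>m d)" and G: "\<And>C. C \<in> SS \<Longrightarrow> G (- 1 \<cdot>\<^sub>m C) = G C"
  shows "(\<Sum>C\<in>SS. G C) = 2 * (G (1\<^sub>m d) + G A) + (\<Sum>C | indep2 A C. G C)"
proof -
  have "(\<Sum>C\<in>SS. G C) = (\<Sum>C | C \<in> SS \<and> True. G C)" by simp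
  also have "\<dots> = 2 * G (1\<^sub>m d) + (\<Sum>C | C \<in> SS \<and> (True \<and> \<not> eqv C (1\<^sub>m d)). G C)"
    using G[OF one_SS] by (subst sum_remove_eqv[of "1\<^sub>m d"]) auto
  also have "(\<Sum>C | C \<in> SS \<and> (True \<and> \<not> eqv C (1\<^sub>m d)). G C) = 2 * G A + (\<Sum>C | C \<in> SS \<and> ((True \<and> \<not> eqv C (1\<^sub>m d)) \<and> \<not> eqv C A). G C)"
    using G[OF A(1)] A by (subst sum_remove_eqv[of A]) auto
  also have "{C. C \<in> SS \<and> ((True \<and> \<not> eqv C (1\<^sub>m d)) \<and> \<not> eqv C A)} = {C. indep2 A C}"
    using A by (auto simp: indep2_def)
  finally show ?thesis by simp
qed

definition nonid :: "complex mat set" where "nonid = {A \<in> SS. \<not> eqv A (1\<^sub>m d)}"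

definition pairs :: "real \<Rightarrow> (complex mat \<times> complex mat) set" where
  "pairs s = {(A, B). indep2 A B \<and> chi A B = s}"

definition triples :: "real \<Rightarrow> complex mat \<Rightarrow> complex mat \<Rightarrow> complex mat set" where
  "triples u A B = {C. indep3 A B C \<and> chi A C = u \<and> chi B C = chi A B * u}"

lemma fin_nonid [simp]: "finite nonid" by (simp add: nonid_def)

lemma fin_pairs [simp]: "finite (pairs s)"
  by (rule finite_subset[of _ "SS \<times> SS"]) (auto simp: pairs_def indep2_def)

lemma fin_triples [simp]: "finite (triples u A B)"
  by (rule finite_subset[of _ SS]) (auto simp: triples_def indep3_def)

lemma fin_indep [simp]: "finite {C. indep3 A B C}" "finite {C. indep2 A C}"
  by (rule finite_subset[of _ SS]; auto simp: indep3_def indep2_def)+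

lemma card_nonid: "real (card nonid) = 2 * (real d)\<^sup>2 - 2"
proof -
  have "2 * (real d)\<^sup>2 = (\<Sum>C | C \<in> SS \<and> True. 1)" using card_SS by simp
  also have "\<dots> = 2 * 1 + (\<Sum>C | C \<in> SS \<and> True \<and> \<not> eqv C (1\<^sub>m d). 1)"
    by (subst sum_remove_eqv[of "1\<^sub>m d"]) auto
  finally show ?thesis by (simp add: nonid_def)
qed

lemma sum_pairs:
  fixes F :: "complex mat \<Rightarrow> complex mat \<Rightarrow> real"
  shows "(\<Sum>(A, B)\<in>pairs s. F A B) = (\<Sum>A\<in>nonid. \<Sum>B | indep2 A B \<and> chi A B = s. F A B)"
proof -
  have "pairs s = Sigma nonid (\<lambda>A. {B. indep2 A B \<and> chi A B = s})"
    by (auto simp: pairs_def nonid_def indep2_def)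
  moreover have "finite {B. indep2 A B \<and> chi A B = s}" for A
    by (rule finite_subset[OF _ fin_indep(2)[of A]]) auto
  ultimately show ?thesis by (simp add: sum.Sigma)
qed

lemma sum_half:
  fixes F :: "complex mat \<Rightarrow> real"
  assumes "finite M" "s = 1 \<or> s = - 1" "\<And>B. B \<in> M \<Longrightarrow> c B = 1 \<or> c B = - 1"
  shows "(\<Sum>B | B \<in> M \<and> c B = s. F B) = ((\<Sum>B\<in>M. F B) + s * (\<Sum>B\<in>M. c B * F B)) / 2"
proof -
  have "(\<Sum>B | B \<in> M \<and> c B = s. F B) = (\<Sum>B\<in>M. if c B = s then F B else 0)"
    using assms(1) by (simp add: sum.inter_filter)
  also have "\<dots> = (\<Sum>B\<in>M. (F B + s * (c B * F B)) / 2)"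
  proof (intro sum.cong refl)
    fix B assume "B \<in> M"
    from assms(3)[OF this] assms(2) show "(if c B = s then F B else 0) = (F B + s * (c B * F B)) / 2" by auto
  qed
  finally show ?thesis by (simp add: sum_divide_distrib[symmetric] sum.distrib sum_distrib_left)
qed

lemma card_pairs:
  fixes s :: real
  assumes s: "s = 1 \<or> s = - 1"
  shows "real (card (pairs s)) = (2 * (real d)\<^sup>2 - 2) * ((real d)\<^sup>2 - 2 * (1 + s))"
proof -
  have "(\<Sum>B | indep2 A B \<and> chi A B = s. 1) = (real d)\<^sup>2 - 2 * (1 + s)" if A: "A \<in> nonid" for A
  proof -
    have A': "A \<in> SS" "\<not> eqv A (1\<^sub>m d)" using A by (auto simp: nonid_def)
    have "(\<Sum>B\<in>SS. 1) = 2 * (1 + 1) + (\<Sum>B | indep2 A B. 1 :: real)"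
      using sum_indep2[OF A', of "\<lambda>_. 1"] by simp
    moreover have "(\<Sum>B\<in>SS. chi A B) = 2 * (chi A (1\<^sub>m d) + chi A A) + (\<Sum>B | indep2 A B. chi A B)"
      using A' by (intro sum_indep2) auto
    moreover have "(\<Sum>B\<in>SS. chi A B) = 0" using A' chi_sum[of A] by (simp add: chi_sym[of A])
    ultimately have e: "(\<Sum>B | indep2 A B. 1 :: real) = 2 * (real d)\<^sup>2 - 4" "(\<Sum>B | indep2 A B. chi A B) = - 4"
      using A' card_SS by simp_all
    have "(\<Sum>B | indep2 A B \<and> chi A B = s. 1 :: real) = (\<Sum>B | B \<in> {B. indep2 A B} \<and> chi A B = s. 1)" by simp
    also have "\<dots> = ((\<Sum>B | indep2 A B. 1) + s * (\<Sum>B | indep2 A B. chi A B * 1)) / 2"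
      using s chi_cases by (intro sum_half) auto
    finally show ?thesis using e s by (auto simp: field_simps)
  qed
  then have "(\<Sum>(A, B)\<in>pairs s. 1) = (\<Sum>A\<in>nonid. (real d)\<^sup>2 - 2 * (1 + s))"
    unfolding sum_pairs by simp
  then show ?thesis using card_nonid by (simp add: case_prod_unfold)
qed

lemma card_triples:
  assumes i: "indep2 A B" and u: "u = 1 \<or> u = - 1"
  shows "real (card (triples u A B)) = (real d)\<^sup>2 / 2 - (if chi A B = 1 then 4 * (1 + u) else 2)"
proof -
  have S: "A \<in> SS" "B \<in> SS" using i by (auto simp: indep2_def)
  let ?s = "chi A B"
  let ?G = "\<lambda>C. (1 + u * chi A C) * (1 + ?s * u * chi B C) / 4"
  have ne: "\<not> eqv A (1\<^sub>m d)" "\<not> eqv B (1\<^sub>m d)" "\<not> eqv (pj A B) (1\<^sub>m d)"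
    using i pj_not_eqv[OF i] by (auto simp: indep2_def)
  have z: "(\<Sum>C\<in>SS. chi A C) = 0" "(\<Sum>C\<in>SS. chi B C) = 0" "(\<Sum>C\<in>SS. chi (pj A B) C) = 0"
    using S ne chi_sum[of A] chi_sum[of B] chi_sum[of "pj A B"] by (simp_all add: chi_sym[of A] chi_sym[of B] chi_sym[of "pj A B"])
  have "real (card (triples u A B)) = (\<Sum>C | indep3 A B C. if chi A C = u \<and> chi B C = ?s * u then 1 else 0)"
    using fin_indep(1)[of A B] by (simp add: triples_def sum.inter_filter[symmetric])
  also have "\<dots> = (\<Sum>C | indep3 A B C. ?G C)"
  proof (intro sum.cong refl)
    fix C
    show "(if chi A C = u \<and> chi B C = ?s * u then 1 else 0) = ?G C"
      using u chi_cases[of A C] chi_cases[of B C] chi_cases[of A B] by auto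
  qed
  also have "\<dots> = (\<Sum>C\<in>SS. ?G C) - 2 * (?G (1\<^sub>m d) + ?G A + ?G B + ?G (pj A B))"
    using sum_indep3[OF i, of ?G] S by simp
  also have "(\<Sum>C\<in>SS. ?G C) = (\<Sum>C\<in>SS. (1 + u * chi A C + ?s * u * chi B C + ?s * (u * u) * chi (pj A B) C) / 4)"
    using S by (intro sum.cong refl) (simp add: chi_pj' algebra_simps)
  also have "\<dots> = (real (card SS) + u * (\<Sum>C\<in>SS. chi A C) + ?s * u * (\<Sum>C\<in>SS. chi B C) + ?s * (u * u) * (\<Sum>C\<in>SS. chi (pj A B) C)) / 4"
    by (simp add: sum.distrib sum_divide_distrib[symmetric] sum_distrib_left)
  also have "\<dots> = d\<^sup>2 / 2" using z card_SS by simp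
  finally show ?thesis
    using S u chi_cases[of A B] chi_sym[of B A] by (auto simp: chi_pj)
qed

end

context shadow_frame
begin

definition est :: "complex mat \<Rightarrow> real" where
  "est C = (\<Sum>b<d. tau (E b) (C * rho * adj C) * tau (E b) (C * Ob * adj C))"

definition w :: "complex mat \<Rightarrow> complex mat \<Rightarrow> complex mat \<Rightarrow> real" where
  "w A B C = D A B * D C (A * B * C)"

definition y :: "complex mat \<Rightarrow> complex mat \<Rightarrow> complex mat \<Rightarrow> real" where
  "y A B C = r A * q B * (r C * q (A * B * C))"

definition Psi :: "complex mat \<Rightarrow> complex mat \<Rightarrow> complex mat \<Rightarrow> real" where
  "Psi A B C = Phi A B C (A * B * C)"

lemma est_second_moment:
  "8 * (real d)\<^sup>2 * avg (\<lambda>C. (est C)\<^sup>2) = (\<Sum>A\<in>SS. \<Sum>B\<in>SS. \<Sum>C\<in>SS. w A B C * Psi A B C)"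
proof -
  let ?F = "\<lambda>X. (\<Sum>A\<in>SS. \<Sum>B\<in>SS. D A B * (r (act X A) * q (act X B)))\<^sup>2"
  have "16 * (real d)\<^sup>2 * avg (\<lambda>C. (est C)\<^sup>2) = avg (\<lambda>C. 16 * (real d)\<^sup>2 * (est C)\<^sup>2)"
    by (simp add: avg_cmult)
  also have "\<dots> = avg (\<lambda>C. ?F (adj C))"
  proof (rule avg_cong)
    fix C assume C: "C \<in> Cl"
    have "4 * d * est C = (\<Sum>A\<in>SS. \<Sum>B\<in>SS. D A B * (tau (C * rho * adj C) A * tau (C * Ob * adj C) B))"
      unfolding est_def using C by (intro estimator_expand) (simp_all add: assoc)
    also have "\<dots> = (\<Sum>A\<in>SS. \<Sum>B\<in>SS. D A B * (r (act (adj C) A) * q (act (adj C) B)))"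
      using C by (intro sum.cong refl) (simp add: tau_act)
    finally have "?F (adj C) = (4 * d * est C)\<^sup>2" by simp
    then show "16 * (real d)\<^sup>2 * (est C)\<^sup>2 = ?F (adj C)" by (simp add: power2_eq_square)
  qed
  also have "\<dots> = avg ?F" by (rule avg_adj)
  also have "\<dots> = 2 * (\<Sum>A\<in>SS. \<Sum>B\<in>SS. \<Sum>C\<in>SS. D A B * D C (A * B * C) * Phi A B C (A * B * C))"
    by (rule second_moment) (simp_all add: D_antiherm)
  finally show ?thesis unfolding w_def Psi_def by simp
qed

lemma Psi_y:
  assumes "A \<in> SS" "B \<in> SS" "C \<in> SS"
  shows "Psi A B C = avg (\<lambda>X. y (act X A) (act X B) (act X C))"
  unfolding Psi_def Phi_def y_def using assms by (intro avg_cong) (simp add: act_hom)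

lemma w_neg:
  assumes "A \<in> SS" "B \<in> SS" "C \<in> SS"
  shows "w A (- 1 \<cdot>\<^sub>m B) C = w A B C" "w A B (- 1 \<cdot>\<^sub>m C) = w A B C"
  using assms by (simp_all add: w_def)

lemma y_neg:
  assumes "A \<in> SS" "B \<in> SS" "C \<in> SS"
  shows "y A (- 1 \<cdot>\<^sub>m B) C = y A B C" "y A B (- 1 \<cdot>\<^sub>m C) = y A B C"
  using assms by (simp_all add: y_def)

lemma Psi_neg:
  assumes "A \<in> SS" "B \<in> SS" "C \<in> SS"
  shows "Psi A (- 1 \<cdot>\<^sub>m B) C = Psi A B C" "Psi A B (- 1 \<cdot>\<^sub>m C) = Psi A B C"
  using assms by (simp_all add: Psi_y y_neg act_smult cong: avg_cong)

lemma Psi_zero: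
  assumes S: "A \<in> SS" "B \<in> SS" "C \<in> SS" and z: "\<And>X. X \<in> Cl \<Longrightarrow> y (act X A) (act X B) (act X C) = 0"
  shows "Psi A B C = 0"
proof -
  have "Psi A B C = avg (\<lambda>X. 0)" unfolding Psi_y[OF S] using z by (intro avg_cong) simp
  then show ?thesis by simp
qed

lemma act_eqv_one: "X \<in> Cl \<Longrightarrow> A \<in> SS \<Longrightarrow> eqv (act X A) (1\<^sub>m d) \<longleftrightarrow> eqv A (1\<^sub>m d)"
  using act_eqv[of X A "1\<^sub>m d"] by simp

lemma Psi_one:
  assumes "A \<in> SS" "B \<in> SS" "C \<in> SS" "eqv A (1\<^sub>m d) \<or> eqv B (1\<^sub>m d) \<or> eqv C (1\<^sub>m d)"
  shows "Psi A B C = 0"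
  using assms by (intro Psi_zero) (auto simp: y_def rq_one act_eqv_one)

lemma pj_closes:
  assumes "A \<in> SS" "B \<in> SS"
  shows "A * B * pj A B = (if chi A B = 1 then 1 else - \<i>) \<cdot>\<^sub>m 1\<^sub>m d"
proof (cases "chi A B = 1")
  case True
  then have c: "A * B = B * A" by (simp add: chi_def split: if_splits)
  have "A * B * pj A B = A * B * (B * A)" unfolding pj_def using c by simp
  then show ?thesis using assms True by (simp add: assoc)
next
  case False
  then have c: "A * B \<noteq> B * A" "chi A B = - 1" using chi_cases by (auto simp: chi_def)
  have ba: "A * B = - 1 \<cdot>\<^sub>m (B * A)" using chi_comm[OF assms] c by simp
  have "A * B * pj A B = \<i> \<cdot>\<^sub>m (A * B * (A * B))" unfolding pj_def using c assms by simp
  also have "A * B * (A * B) = A * B * (- 1 \<cdot>\<^sub>m (B * A))" using ba by simp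
  also have "\<dots> = - 1 \<cdot>\<^sub>m 1\<^sub>m d" using assms by (simp add: assoc)
  finally show ?thesis using False by simp
qed

lemma tau_scalar: "tau Ob (c \<cdot>\<^sub>m 1\<^sub>m d) = 0"
  by (simp add: tau_def Ob_tr)

lemma y_pj:
  assumes "A \<in> SS" "B \<in> SS"
  shows "y A B (pj A B) = 0"
  unfolding y_def pj_closes[OF assms] tau_scalar by simp

lemma Psi_pj:
  assumes "A \<in> SS" "B \<in> SS"
  shows "Psi A B (pj A B) = 0"
  using assms y_pj by (intro Psi_zero) (auto simp: act_pj[symmetric])

lemma y_one: "A \<in> SS \<Longrightarrow> B \<in> SS \<Longrightarrow> y A B (1\<^sub>m d) = 0"
  by (simp add: y_def rq_one)

lemma D_pj_close:
  assumes i: "indep2 A B"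
  shows "D (pj A B) (A * B * pj A B) = 0"
proof -
  have S: "A \<in> SS" "B \<in> SS" using i by (auto simp: indep2_def)
  show ?thesis
  proof (cases "chi A B = 1")
    case True
    then show ?thesis unfolding pj_closes[OF S] using S pj_not_eqv[OF i] by (simp add: D_one)
  next
    case False
    then show ?thesis unfolding pj_closes[OF S] by (simp add: D_antiherm)
  qed
qed

lemma antiherm_triple_vanishes:
  assumes S: "A \<in> SS" "B \<in> SS" "C \<in> SS" and "chi A B * chi A C * chi B C = - 1"
  shows "D X (A * B * C) = 0" "q (A * B * C) = 0"
proof -
  have e: "A * B * C = (- \<i>) \<cdot>\<^sub>m pj (pj A B) C" using triple_cases[OF S] assms(4) by auto
  have a: "adj (A * B * C) = - 1 \<cdot>\<^sub>m (A * B * C)" unfolding e using S by simp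
  show "D X (A * B * C) = 0" "q (A * B * C) = 0"
    using S a D_antiherm[of "A * B * C"] tau_antiherm[of Ob "A * B * C"] by simp_all
qed

lemma w_one:
  assumes i: "indep2 A B"
  shows "w A B (1\<^sub>m d) = 0"
proof -
  have S: "A \<in> SS" "B \<in> SS" using i by (auto simp: indep2_def)
  obtain c where c: "A * B = c \<cdot>\<^sub>m pj A B" "c = 1 \<or> c = - \<i>" using pj_phase[OF S] by blast
  have "D (1\<^sub>m d) (A * B) = 0"
    using c(2)
  proof
    assume "c = 1" then show ?thesis using c(1) S pj_not_eqv[OF i] by (simp add: D_one)
  next
    assume "c = - \<i>" then show ?thesis unfolding c(1) using S by (simp add: D_antiherm)
  qed
  then show ?thesis using S by (simp add: w_def)
qed

lemma sum_triples:
  fixes F :: "complex mat \<Rightarrow> real"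
  assumes i: "indep2 A B" and ev: "\<And>C. C \<in> SS \<Longrightarrow> F (- 1 \<cdot>\<^sub>m C) = F C"
    and z: "F (1\<^sub>m d) = 0" "F (pj A B) = 0"
    and bad: "\<And>C. C \<in> SS \<Longrightarrow> chi A B * chi A C * chi B C = - 1 \<Longrightarrow> F C = 0"
  shows "(\<Sum>C\<in>SS. F C) = 2 * F A + 2 * F B + (\<Sum>C\<in>triples 1 A B. F C) + (\<Sum>C\<in>triples (- 1) A B. F C)"
    and "(\<Sum>C\<in>SS. chi A C * F C) = 2 * F A + 2 * chi A B * F B + (\<Sum>C\<in>triples 1 A B. F C) - (\<Sum>C\<in>triples (- 1) A B. F C)"
proof -
  have S: "A \<in> SS" "B \<in> SS" using i by (auto simp: indep2_def)
  have main: "(\<Sum>C\<in>SS. G C) = 2 * G A + 2 * G B + (\<Sum>C\<in>triples 1 A B. G C) + (\<Sum>C\<in>triples (- 1) A B. G C)"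
    if ev: "\<And>C. C \<in> SS \<Longrightarrow> G (- 1 \<cdot>\<^sub>m C) = G C"
      and z: "G (1\<^sub>m d) = 0" "G (pj A B) = 0"
      and bad: "\<And>C. C \<in> SS \<Longrightarrow> chi A B * chi A C * chi B C = - 1 \<Longrightarrow> G C = 0" for G :: "complex mat \<Rightarrow> real"
  proof -
    have "(\<Sum>C\<in>SS. G C) = 2 * G A + 2 * G B + (\<Sum>C | indep3 A B C. G C)"
      using sum_indep3[OF i, of G] ev z by simp
    also have "(\<Sum>C | indep3 A B C. G C) = (\<Sum>C\<in>triples 1 A B \<union> triples (- 1) A B. G C)"
    proof (rule sum.mono_neutral_right)
      show "\<forall>C\<in>{C. indep3 A B C} - (triples 1 A B \<union> triples (- 1) A B). G C = 0"
      proof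
        fix C assume C: "C \<in> {C. indep3 A B C} - (triples 1 A B \<union> triples (- 1) A B)"
        then have "C \<in> SS" by (simp add: indep3_def)
        moreover have "chi A B * chi A C * chi B C = - 1"
          using C chi_cases[of A B] chi_cases[of A C] chi_cases[of B C] by (auto simp: triples_def)
        ultimately show "G C = 0" by (rule bad)
      qed
    qed (auto simp: triples_def)
    also have "\<dots> = (\<Sum>C\<in>triples 1 A B. G C) + (\<Sum>C\<in>triples (- 1) A B. G C)"
      by (intro sum.union_disjoint) (auto simp: triples_def)
    finally show ?thesis by simp
  qed
  show "(\<Sum>C\<in>SS. F C) = 2 * F A + 2 * F B + (\<Sum>C\<in>triples 1 A B. F C) + (\<Sum>C\<in>triples (- 1) A B. F C)"
    using assms by (intro main)
  have "(\<Sum>C\<in>SS. chi A C * F C) = 2 * (chi A A * F A) + 2 * (chi A B * F B)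
    + (\<Sum>C\<in>triples 1 A B. chi A C * F C) + (\<Sum>C\<in>triples (- 1) A B. chi A C * F C)"
    using ev z bad S by (intro main) auto
  moreover have "(\<Sum>C\<in>triples 1 A B. chi A C * F C) = (\<Sum>C\<in>triples 1 A B. F C)"
    by (intro sum.cong refl) (simp add: triples_def)
  moreover have "(\<Sum>C\<in>triples (- 1) A B. chi A C * F C) = - (\<Sum>C\<in>triples (- 1) A B. F C)"
    unfolding sum_negf[symmetric] by (intro sum.cong refl) (simp add: triples_def)
  ultimately show "(\<Sum>C\<in>SS. chi A C * F C) = 2 * F A + 2 * chi A B * F B + (\<Sum>C\<in>triples 1 A B. F C) - (\<Sum>C\<in>triples (- 1) A B. F C)"
    by simp
qed

lemma complete_contract:
  assumes "X \<in> carrier_mat d d" "adj X = X" "Z \<in> carrier_mat d d" "A \<in> SS" "B \<in> SS"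
  shows "(\<Sum>C\<in>SS. tau X C * tau Z (A * B * C)) = 2 * d * tau X (Z * (A * B))"
proof -
  have "(\<Sum>C\<in>SS. tau X C * tau Z (A * B * C)) = (\<Sum>C\<in>SS. tau X C * tau (Z * (A * B)) C)"
    using assms by (intro sum.cong refl) (simp add: tau_def assoc)
  also have "\<dots> = 2 * d * tau X (Z * (A * B))" using assms by (intro complete_tau) simp_all
  finally show ?thesis .
qed

lemma complete_contract_chi:
  assumes X: "X \<in> carrier_mat d d" "adj X = X" and Z: "Z \<in> carrier_mat d d" and S: "A \<in> SS" "B \<in> SS"
  shows "(\<Sum>C\<in>SS. chi A C * (tau X C * tau Z (A * B * C))) = 2 * d * chi A B * tau X (A * Z * B)"
proof -
  have e: "chi A C * tau Z (A * B * C) = tau (A * Z * (A * B * A)) C" if C: "C \<in> SS" for C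
  proof -
    have "chi A C * tau Z (A * B * C) = tau Z (A * B * (complex_of_real (chi A C) \<cdot>\<^sub>m C))"
      using S C Z by simp
    also have "\<dots> = tau Z (A * B * (A * C * A))" using S C by (simp add: chi_conj)
    also have "\<dots> = tau Z ((A * B * A * C) * A)" using S C by (simp add: assoc)
    also have "\<dots> = tau (A * Z) (A * B * A * C)" using S C Z by (intro tau_rot) simp_all
    also have "\<dots> = tau (A * Z * (A * B * A)) C" using S C Z by (simp add: tau_def assoc)
    finally show ?thesis .
  qed
  have "(\<Sum>C\<in>SS. chi A C * (tau X C * tau Z (A * B * C))) = (\<Sum>C\<in>SS. tau X C * tau (A * Z * (A * B * A)) C)"
    by (intro sum.cong refl) (simp add: e[symmetric])
  also have "\<dots> = 2 * d * tau X (A * Z * (A * B * A))" using X Z S by (intro complete_tau) simp_all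
  also have "\<dots> = 2 * d * (chi A B * tau X (A * Z * B))" using X Z S by (simp add: chi_conj)
  finally show ?thesis by simp
qed

lemma D_complete_contract:
  assumes S: "A \<in> SS" "B \<in> SS"
  shows "(\<Sum>C\<in>SS. D C (A * B * C)) = 2 * Re (mtrace (A * B))"
proof -
  have "(\<Sum>C\<in>SS. D C (A * B * C)) = (\<Sum>b<d. \<Sum>C\<in>SS. tau (E b) C * tau (E b) (A * B * C)) / d"
    unfolding diag_corr_def by (subst sum.swap) (simp add: sum_divide_distrib)
  also have "\<dots> = (\<Sum>b<d. 2 * d * tau (E b) (A * B)) / d"
  proof (intro arg_cong[where f = "\<lambda>x. x / real d"] sum.cong refl)
    fix b assume "b \<in> {..<d}"
    then have b: "b < d" by simp
    have "mtrace ((E b * 1\<^sub>m d) * (E b * (A * B))) = mtrace (E b * 1\<^sub>m d) * mtrace (E b * (A * B))"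
      using b S by (intro E_rank1) simp_all
    then have "tau (E b) (E b * (A * B)) = tau (E b) (A * B)"
      using b by (simp add: tau_def E_carrier E_tr)
    then show "(\<Sum>C\<in>SS. tau (E b) C * tau (E b) (A * B * C)) = 2 * d * tau (E b) (A * B)"
      using complete_contract[of "E b" "E b" A B] b S by (simp add: E_carrier E_adj)
  qed
  also have "\<dots> = 2 * (\<Sum>b<d. tau (E b) (A * B))" using dpos by (simp add: sum_distrib_left[symmetric])
  also have "\<dots> = 2 * Re (mtrace (A * B))" using S by (simp add: E_sum_tau)
  finally show ?thesis .
qed

lemma D_complete_contract_chi:
  assumes S: "A \<in> SS" "B \<in> SS"
  shows "(\<Sum>C\<in>SS. chi A C * D C (A * B * C)) = 2 * d * chi A B * D A B"
proof -
  have "(\<Sum>C\<in>SS. chi A C * D C (A * B * C)) =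
    (\<Sum>b<d. \<Sum>C\<in>SS. chi A C * (tau (E b) C * tau (E b) (A * B * C))) / d"
    unfolding diag_corr_def by (subst sum.swap) (simp add: sum_divide_distrib sum_distrib_left)
  also have "\<dots> = (\<Sum>b<d. 2 * d * chi A B * (tau (E b) A * tau (E b) B)) / d"
  proof (intro arg_cong[where f = "\<lambda>x. x / real d"] sum.cong refl)
    fix b assume "b \<in> {..<d}"
    then have b: "b < d" by simp
    have "mtrace (E b * (A * E b * B)) = mtrace ((E b * A) * (E b * B))"
      using b S by (simp add: E_carrier assoc)
    also have "\<dots> = complex_of_real (tau (E b) A) * complex_of_real (tau (E b) B)"
      using b S by (simp add: E_rank1 E_carrier E_adj herm_trace_real)
    finally have "tau (E b) (A * E b * B) = tau (E b) A * tau (E b) B" by (simp add: tau_def)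
    then show "(\<Sum>C\<in>SS. chi A C * (tau (E b) C * tau (E b) (A * B * C))) = 2 * d * chi A B * (tau (E b) A * tau (E b) B)"
      using complete_contract_chi[of "E b" "E b" A B] b S by (simp add: E_carrier E_adj)
  qed
  also have "\<dots> = 2 * d * chi A B * D A B"
    unfolding diag_corr_def by (simp add: sum_distrib_left[symmetric])
  finally show ?thesis .
qed

lemma class_average_triples:
  assumes fin: "finite K"
    and sub: "\<And>A B C. ((A, B), C) \<in> K \<Longrightarrow> A \<in> SS \<and> B \<in> SS \<and> C \<in> SS"
    and closed: "\<And>X A B C. X \<in> Cl \<Longrightarrow> ((A, B), C) \<in> K \<Longrightarrow> ((act X A, act X B), act X C) \<in> K"
    and trans: "\<And>A B C A' B' C'. ((A, B), C) \<in> K \<Longrightarrow> ((A', B'), C') \<in> K \<Longrightarrow>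
      \<exists>X\<in>Cl. act X A = A' \<and> act X B = B' \<and> act X C = C'"
  shows "(\<Sum>((A, B), C)\<in>K. w A B C * Psi A B C) * real (card K) =
    (\<Sum>((A, B), C)\<in>K. w A B C) * (\<Sum>((A, B), C)\<in>K. y A B C)"
proof -
  let ?act = "\<lambda>X ((A, B), C). ((act X A, act X B), act X C)"
  let ?w = "\<lambda>((A, B), C). w A B C" and ?y = "\<lambda>((A, B), C). y A B C"
  have "(\<Sum>t\<in>K. ?w t * avg (\<lambda>X. ?y (?act X t))) * real (card K) = (\<Sum>t\<in>K. ?w t) * (\<Sum>t\<in>K. ?y t)"
  proof (rule class_average[OF fin])
    fix X t assume X: "X \<in> Cl" and t: "t \<in> K"
    obtain A B C where e: "t = ((A, B), C)" by (metis prod.exhaust)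
    have S: "A \<in> SS" "B \<in> SS" "C \<in> SS" using sub t e by auto
    show "?act X t \<in> K" using closed X t e by simp
    show "?act (adj X) (?act X t) = t" using S X e by simp
  next
    fix X X' t assume X: "X \<in> Cl" "X' \<in> Cl" and t: "t \<in> K"
    obtain A B C where e: "t = ((A, B), C)" by (metis prod.exhaust)
    have S: "A \<in> SS" "B \<in> SS" "C \<in> SS" using sub t e by auto
    show "?act (X * X') t = ?act X (?act X' t)" using S X e by (simp add: act_mult)
  next
    fix t t' assume "t \<in> K" "t' \<in> K"
    then show "\<exists>X\<in>Cl. ?act X t = t'" using trans by (cases t, cases t') fastforce
  qed
  moreover have "(\<Sum>t\<in>K. ?w t * avg (\<lambda>X. ?y (?act X t))) = (\<Sum>((A, B), C)\<in>K. w A B C * Psi A B C)"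
  proof (rule sum.cong[OF refl])
    fix t assume t: "t \<in> K"
    obtain A B C where e: "t = ((A, B), C)" by (metis prod.exhaust)
    have S: "A \<in> SS" "B \<in> SS" "C \<in> SS" using sub t e by auto
    show "?w t * avg (\<lambda>X. ?y (?act X t)) = (case t of (p, C) \<Rightarrow> (case p of (A, B) \<Rightarrow> \<lambda>C. w A B C * Psi A B C) C)"
      unfolding e using S by (simp add: Psi_y)
  qed
  ultimately show ?thesis by simp
qed

text \<open>Sums over the pairs of independent Paulis with commutation sign \<open>s\<close>. \<open>Yt\<close> runs over the third
  Paulis in class \<open>u\<close>, \<open>Yb\<close> and \<open>Yh\<close> over all of them, without and with the sign \<open>chi A C\<close>: the
  contractions over all \<open>C\<close> are explicit, and the classes are recovered from them.\<close>

definition pair_weight :: "real \<Rightarrow> real" where "pair_weight s = (\<Sum>(A, B)\<in>pairs s. (D A B)\<^sup>2)"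
definition Pp :: "real \<Rightarrow> real" where "Pp s = (\<Sum>(A, B)\<in>pairs s. (r A * q B)\<^sup>2)"
definition Rr :: "real \<Rightarrow> real" where "Rr s = (\<Sum>(A, B)\<in>pairs s. (r A * q B) * (r B * q A))"
definition Vv :: "real \<Rightarrow> real" where "Vv s = (\<Sum>(A, B)\<in>pairs s. (tau rho (A * Ob * B))\<^sup>2)"
definition Yt :: "real \<Rightarrow> real \<Rightarrow> real" where "Yt s u = (\<Sum>(A, B)\<in>pairs s. \<Sum>C\<in>triples u A B. y A B C)"
definition Yb :: "real \<Rightarrow> real" where "Yb s = (\<Sum>(A, B)\<in>pairs s. \<Sum>C\<in>SS. y A B C)"
definition Yh :: "real \<Rightarrow> real" where "Yh s = (\<Sum>(A, B)\<in>pairs s. \<Sum>C\<in>SS. chi A C * y A B C)"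
definition pair_term :: "real \<Rightarrow> real" where "pair_term s = (\<Sum>(A, B)\<in>pairs s. \<Sum>C\<in>SS. w A B C * Psi A B C)"

lemma pairs_D: "(A, B) \<in> pairs s \<Longrightarrow> A \<in> SS \<and> B \<in> SS \<and> indep2 A B \<and> chi A B = s"
  by (auto simp: pairs_def indep2_def)

lemma repeated_triple:
  assumes "(A, B) \<in> pairs s"
  shows "w A B A = s * (D A B)\<^sup>2" "w A B B = (D A B)\<^sup>2"
    "y A B A = s * (r A * q B)\<^sup>2" "y A B B = (r A * q B) * (r B * q A)"
proof -
  have S: "A \<in> SS" "B \<in> SS" and c: "chi A B = s" using pairs_D[OF assms] by auto
  have e: "A * B * A = complex_of_real s \<cdot>\<^sub>m B" using S c by (simp add: chi_conj)
  have Ds: "D A (complex_of_real s \<cdot>\<^sub>m B) = s * D A B"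
    using S by (simp add: diag_corr_def E_carrier sum_distrib_left mult_ac)
  have f: "A * B * B = A" using S by (simp add: assoc)
  show "w A B A = s * (D A B)\<^sup>2" unfolding w_def e Ds by (simp add: power2_eq_square)
  show "w A B B = (D A B)\<^sup>2" unfolding w_def f by (simp add: power2_eq_square D_sym[of B])
  show "y A B A = s * (r A * q B)\<^sup>2" unfolding y_def e using S by (simp add: power2_eq_square)
  show "y A B B = (r A * q B) * (r B * q A)" unfolding y_def f by simp
qed

lemma class_pair:
  assumes h: "h = (\<lambda>A B. A) \<or> h = (\<lambda>A B. B)"
  shows "(\<Sum>(A, B)\<in>pairs s. w A B (h A B) * Psi A B (h A B)) * real (card (pairs s)) =
    (\<Sum>(A, B)\<in>pairs s. w A B (h A B)) * (\<Sum>(A, B)\<in>pairs s. y A B (h A B))"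
proof -
  let ?j = "\<lambda>(A, B). ((A, B), h A B)"
  have inj: "inj_on ?j (pairs s)" by (auto simp: inj_on_def)
  have "(\<Sum>((A, B), C)\<in>?j ` pairs s. w A B C * Psi A B C) * real (card (?j ` pairs s)) =
    (\<Sum>((A, B), C)\<in>?j ` pairs s. w A B C) * (\<Sum>((A, B), C)\<in>?j ` pairs s. y A B C)"
  proof (rule class_average_triples)
    show "finite (?j ` pairs s)" by simp
    show "A \<in> SS \<and> B \<in> SS \<and> C \<in> SS" if "((A, B), C) \<in> ?j ` pairs s" for A B C
      using that h pairs_D by auto
    show "((act X A, act X B), act X C) \<in> ?j ` pairs s" if X: "X \<in> Cl" and K: "((A, B), C) \<in> ?j ` pairs s" for X A B C
    proof -
      have AB: "(A, B) \<in> pairs s" and C: "C = h A B" using K by auto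
      have "(act X A, act X B) \<in> pairs s" using AB X pairs_D[OF AB] act_indep2 by (simp add: pairs_def)
      moreover have "act X C = h (act X A) (act X B)" using h C by auto
      ultimately show ?thesis by force
    qed
    show "\<exists>X\<in>Cl. act X A = A' \<and> act X B = B' \<and> act X C = C'"
      if K: "((A, B), C) \<in> ?j ` pairs s" and K': "((A', B'), C') \<in> ?j ` pairs s" for A B C A' B' C'
    proof -
      have "(A, B) \<in> pairs s" "C = h A B" "(A', B') \<in> pairs s" "C' = h A' B'" using K K' by auto
      moreover then obtain X where "X \<in> Cl" "act X A = A'" "act X B = B'"
        using witt2[of A B A' B'] by (auto simp: pairs_def)
      ultimately show ?thesis using h by auto
    qed
  qed
  then show ?thesis using inj by (simp add: sum.reindex card_image case_prod_unfold)
qed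

lemma class_triples:
  "(\<Sum>(A, B)\<in>pairs s. \<Sum>C\<in>triples u A B. w A B C * Psi A B C) * (\<Sum>(A, B)\<in>pairs s. real (card (triples u A B))) =
    (\<Sum>(A, B)\<in>pairs s. \<Sum>C\<in>triples u A B. w A B C) * Yt s u"
proof -
  let ?K = "Sigma (pairs s) (\<lambda>(A, B). triples u A B)"
  have "(\<Sum>((A, B), C)\<in>?K. w A B C * Psi A B C) * real (card ?K) =
    (\<Sum>((A, B), C)\<in>?K. w A B C) * (\<Sum>((A, B), C)\<in>?K. y A B C)"
  proof (rule class_average_triples)
    show "finite ?K" by auto
    show "A \<in> SS \<and> B \<in> SS \<and> C \<in> SS" if "((A, B), C) \<in> ?K" for A B C
      using that by (auto simp: triples_def indep3_def indep2_def)
    show "((act X A, act X B), act X C) \<in> ?K" if "X \<in> Cl" "((A, B), C) \<in> ?K" for X A B C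
    proof -
      have AB: "(A, B) \<in> pairs s" and C: "C \<in> triples u A B" using that by auto
      have S: "A \<in> SS" "B \<in> SS" "C \<in> SS" using AB C by (auto simp: triples_def indep3_def pairs_def indep2_def)
      show ?thesis using that S act_indep2[OF that(1)] act_indep3[OF that(1)] by (auto simp: pairs_def triples_def)
    qed
    show "\<exists>X\<in>Cl. act X A = A' \<and> act X B = B' \<and> act X C = C'"
      if "((A, B), C) \<in> ?K" "((A', B'), C') \<in> ?K" for A B C A' B' C'
      using that by (intro witt3) (auto simp: pairs_def triples_def)
  qed
  moreover have s: "(\<Sum>((A, B), C)\<in>?K. f A B C) = (\<Sum>(A, B)\<in>pairs s. \<Sum>C\<in>triples u A B. f A B C)"
    for f :: "complex mat \<Rightarrow> complex mat \<Rightarrow> complex mat \<Rightarrow> real"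
  proof -
    have "(\<Sum>p\<in>pairs s. \<Sum>C\<in>(case p of (A, B) \<Rightarrow> triples u A B). (case p of (A, B) \<Rightarrow> f A B C)) =
      (\<Sum>(p, C)\<in>?K. (case p of (A, B) \<Rightarrow> f A B C))"
      by (rule sum.Sigma) auto
    then show ?thesis by (simp add: case_prod_unfold)
  qed
  moreover have "real (card ?K) = (\<Sum>(A, B)\<in>pairs s. real (card (triples u A B)))"
    using s[of "\<lambda>_ _ _. 1"] by (simp add: case_prod_unfold)
  ultimately show ?thesis unfolding Yt_def by simp
qed

lemma pairs_trace: "(A, B) \<in> pairs s \<Longrightarrow> mtrace (A * B) = 0"
proof -
  assume p: "(A, B) \<in> pairs s"
  then have S: "A \<in> SS" "B \<in> SS" "indep2 A B" using pairs_D by auto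
  obtain c where "A * B = c \<cdot>\<^sub>m pj A B" using pj_phase[OF S(1,2)] by blast
  then show ?thesis using S pj_not_eqv[OF S(3)] by (simp add: SS_trace)
qed

lemma triples_w:
  assumes p: "(A, B) \<in> pairs s" and u: "u = 1 \<or> u = - 1"
  shows "(\<Sum>C\<in>triples u A B. w A B C) = (u * s * (real d - 2) - (s + 1)) * (D A B)\<^sup>2"
proof -
  have S: "A \<in> SS" "B \<in> SS" "indep2 A B" and c: "chi A B = s" using pairs_D[OF p] by auto
  have z: "w A B (1\<^sub>m d) = 0" "w A B (pj A B) = 0" using w_one[OF S(3)] D_pj_close[OF S(3)] by (simp_all add: w_def[of A B "pj A B"])
  have b: "w A B C = 0" if "C \<in> SS" "chi A B * chi A C * chi B C = - 1" for C
    using antiherm_triple_vanishes(1)[OF S(1,2) that] by (simp add: w_def)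
  note st = sum_triples[OF S(3) w_neg(2)[OF S(1,2)] z b]
  have 1: "(\<Sum>C\<in>SS. w A B C) = 0"
    using D_complete_contract[OF S(1,2)] pairs_trace[OF p] by (simp add: w_def sum_distrib_left[symmetric])
  have "(\<Sum>C\<in>SS. chi A C * w A B C) = D A B * (\<Sum>C\<in>SS. chi A C * D C (A * B * C))"
    by (simp add: w_def sum_distrib_left mult_ac)
  then have 2: "(\<Sum>C\<in>SS. chi A C * w A B C) = 2 * d * s * (D A B)\<^sup>2"
    unfolding D_complete_contract_chi[OF S(1,2)] using c by (simp add: power2_eq_square)
  have lin: "comm_sign1 = (s * (e - 2) - (s + 1)) * z \<and> inv_sqrt2 = (- s * (e - 2) - (s + 1)) * z"
    if "2 * (s * z) + 2 * z + comm_sign1 + inv_sqrt2 = 0" "2 * (s * z) + 2 * s * z + comm_sign1 - inv_sqrt2 = 2 * e * s * z" for comm_sign1 inv_sqrt2 e z :: real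
  proof -
    have x: "(s * (e - 2) - (s + 1)) * z = e * s * z - 3 * (s * z) - z"
      "(- s * (e - 2) - (s + 1)) * z = - (e * s * z) + s * z - z" by (simp_all add: algebra_simps)
    have "2 * s * z = 2 * (s * z)" "2 * e * s * z = 2 * (e * s * z)" by simp_all
    then show ?thesis unfolding x using that by linarith
  qed
  have "2 * (s * (D A B)\<^sup>2) + 2 * (D A B)\<^sup>2 + (\<Sum>C\<in>triples 1 A B. w A B C) + (\<Sum>C\<in>triples (- 1) A B. w A B C) = 0"
    using st(1) unfolding 1 repeated_triple[OF p] by linarith
  moreover have "2 * (s * (D A B)\<^sup>2) + 2 * s * (D A B)\<^sup>2 + (\<Sum>C\<in>triples 1 A B. w A B C) - (\<Sum>C\<in>triples (- 1) A B. w A B C) = 2 * real d * s * (D A B)\<^sup>2"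
    using st(2) unfolding 2 repeated_triple[OF p] c by linarith
  ultimately have "(\<Sum>C\<in>triples 1 A B. w A B C) = (s * (real d - 2) - (s + 1)) * (D A B)\<^sup>2 \<and>
    (\<Sum>C\<in>triples (- 1) A B. w A B C) = (- s * (real d - 2) - (s + 1)) * (D A B)\<^sup>2"
    by (rule lin)
  then show ?thesis using u by auto
qed

lemma Yt_sums:
  "Yb s = 2 * s * Pp s + 2 * Rr s + Yt s 1 + Yt s (- 1)"
  "Yh s = 2 * s * Pp s + 2 * s * Rr s + Yt s 1 - Yt s (- 1)"
proof -
  have "(\<Sum>C\<in>SS. y A B C) = 2 * s * (r A * q B)\<^sup>2 + 2 * ((r A * q B) * (r B * q A)) + (\<Sum>C\<in>triples 1 A B. y A B C) + (\<Sum>C\<in>triples (- 1) A B. y A B C) \<and>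
    (\<Sum>C\<in>SS. chi A C * y A B C) = 2 * s * (r A * q B)\<^sup>2 + 2 * s * ((r A * q B) * (r B * q A)) + (\<Sum>C\<in>triples 1 A B. y A B C) - (\<Sum>C\<in>triples (- 1) A B. y A B C)"
    if p: "(A, B) \<in> pairs s" for A B
  proof -
    have S: "A \<in> SS" "B \<in> SS" "indep2 A B" and c: "chi A B = s" using pairs_D[OF p] by auto
    have b: "y A B C = 0" if "C \<in> SS" "chi A B * chi A C * chi B C = - 1" for C
      using antiherm_triple_vanishes(2)[OF S(1,2) that] by (simp add: y_def)
    note st = sum_triples[OF S(3) y_neg(2)[OF S(1,2)] y_one[OF S(1,2)] y_pj[OF S(1,2)] b]
    show ?thesis using st repeated_triple[OF p] c by simp
  qed
  note e = this
  have "Yb s = (\<Sum>(A, B)\<in>pairs s. 2 * s * (r A * q B)\<^sup>2 + 2 * ((r A * q B) * (r B * q A)) + (\<Sum>C\<in>triples 1 A B. y A B C) + (\<Sum>C\<in>triples (- 1) A B. y A B C))"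
    unfolding Yb_def by (intro sum.cong refl) (use e in auto)
  then show "Yb s = 2 * s * Pp s + 2 * Rr s + Yt s 1 + Yt s (- 1)"
    unfolding Pp_def Rr_def Yt_def by (simp only: sum.distrib sum_distrib_left case_prod_unfold)
  have "Yh s = (\<Sum>(A, B)\<in>pairs s. 2 * s * (r A * q B)\<^sup>2 + 2 * s * ((r A * q B) * (r B * q A)) + (\<Sum>C\<in>triples 1 A B. y A B C) - (\<Sum>C\<in>triples (- 1) A B. y A B C))"
    unfolding Yh_def by (intro sum.cong refl) (use e in auto)
  then show "Yh s = 2 * s * Pp s + 2 * s * Rr s + Yt s 1 - Yt s (- 1)"
    unfolding Pp_def Rr_def Yt_def by (simp only: sum.distrib sum_subtractf sum_distrib_left case_prod_unfold)
qed

lemma class_triples_scaled: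
  assumes s: "s = 1 \<or> s = - 1" and u: "u = 1 \<or> u = - 1"
    and c: "c * ((real d)\<^sup>2 / 2 - (if s = 1 then 4 * (1 + u) else 2)) = u * s * (real d - 2) - (s + 1)"
  shows "(\<Sum>(A, B)\<in>pairs s. \<Sum>C\<in>triples u A B. w A B C * Psi A B C) * real (card (pairs s)) = pair_weight s * (c * Yt s u)"
proof -
  let ?n = "(real d)\<^sup>2 / 2 - (if s = 1 then 4 * (1 + u) else 2)"
  let ?T = "\<Sum>(A, B)\<in>pairs s. \<Sum>C\<in>triples u A B. w A B C * Psi A B C"
  have card: "real (card (triples u A B)) = ?n" if "(A, B) \<in> pairs s" for A B
    using card_triples[OF _ u] pairs_D[OF that] by auto
  have W: "(\<Sum>(A, B)\<in>pairs s. \<Sum>C\<in>triples u A B. w A B C) = (u * s * (real d - 2) - (s + 1)) * pair_weight s"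
    unfolding pair_weight_def sum_distrib_left by (intro sum.cong refl) (use triples_w[OF _ u] in auto)
  have "(\<Sum>(A, B)\<in>pairs s. real (card (triples u A B))) = real (card (pairs s)) * ?n"
  proof -
    have "(\<Sum>(A, B)\<in>pairs s. real (card (triples u A B))) = (\<Sum>p\<in>pairs s. ?n)"
      by (intro sum.cong refl) (use card in auto)
    then show ?thesis by simp
  qed
  then have "?T * (real (card (pairs s)) * ?n) = (\<Sum>(A, B)\<in>pairs s. \<Sum>C\<in>triples u A B. w A B C) * Yt s u"
    using class_triples[where s = s and u = u] by (simp only:)
  also have "\<dots> = (c * ?n) * pair_weight s * Yt s u" by (simp only: W c)
  finally have main: "?T * (real (card (pairs s)) * ?n) = (c * ?n) * pair_weight s * Yt s u" .
  show ?thesis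
  proof (cases "?n = 0")
    case False
    have "(?T * real (card (pairs s))) * ?n = (pair_weight s * (c * Yt s u)) * ?n" using main by (simp only: mult_ac)
    then show ?thesis using False mult_right_cancel by blast
  next
    case True
    then have "triples u A B = {}" if "(A, B) \<in> pairs s" for A B using card[OF that] by simp
    then have "?T = 0" "Yt s u = 0" unfolding Yt_def by (auto intro!: sum.neutral)
    then show ?thesis by simp
  qed
qed

lemma pair_term_card:
  assumes s: "s = 1 \<or> s = - 1"
    and c: "c * ((real d)\<^sup>2 / 2 - (if s = 1 then 8 else 2)) = s * (real d - 2) - (s + 1)"
    and c': "c' * ((real d)\<^sup>2 / 2 - (if s = 1 then 0 else 2)) = - s * (real d - 2) - (s + 1)"
  shows "pair_term s * real (card (pairs s)) = pair_weight s * (2 * Pp s + 2 * Rr s + c * Yt s 1 + c' * Yt s (- 1))"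
proof -
  have "(\<Sum>C\<in>SS. w A B C * Psi A B C) = 2 * (w A B A * Psi A B A) + 2 * (w A B B * Psi A B B)
    + (\<Sum>C\<in>triples 1 A B. w A B C * Psi A B C) + (\<Sum>C\<in>triples (- 1) A B. w A B C * Psi A B C)"
    if p: "(A, B) \<in> pairs s" for A B
  proof -
    have S: "A \<in> SS" "B \<in> SS" "indep2 A B" using pairs_D[OF p] by auto
    have b: "w A B C * Psi A B C = 0" if "C \<in> SS" "chi A B * chi A C * chi B C = - 1" for C
      using antiherm_triple_vanishes(1)[OF S(1,2) that] by (simp add: w_def)
    show ?thesis using S b
      by (intro sum_triples(1)) (simp_all add: w_neg Psi_neg w_one Psi_pj)
  qed
  then have "pair_term s = (\<Sum>(A, B)\<in>pairs s. 2 * (w A B A * Psi A B A) + 2 * (w A B B * Psi A B B)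
    + (\<Sum>C\<in>triples 1 A B. w A B C * Psi A B C) + (\<Sum>C\<in>triples (- 1) A B. w A B C * Psi A B C))"
    unfolding pair_term_def by (intro sum.cong refl) auto
  also have "\<dots> = 2 * (\<Sum>(A, B)\<in>pairs s. w A B A * Psi A B A) + 2 * (\<Sum>(A, B)\<in>pairs s. w A B B * Psi A B B)
    + (\<Sum>(A, B)\<in>pairs s. \<Sum>C\<in>triples 1 A B. w A B C * Psi A B C) + (\<Sum>(A, B)\<in>pairs s. \<Sum>C\<in>triples (- 1) A B. w A B C * Psi A B C)"
    by (simp only: sum.distrib sum_distrib_left case_prod_unfold)
  finally have T: "pair_term s = \<dots>" .
  have a: "(\<Sum>(A, B)\<in>pairs s. w A B A) = s * pair_weight s" "(\<Sum>(A, B)\<in>pairs s. y A B A) = s * Pp s"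
    "(\<Sum>(A, B)\<in>pairs s. w A B B) = pair_weight s" "(\<Sum>(A, B)\<in>pairs s. y A B B) = Rr s"
    unfolding pair_weight_def Pp_def Rr_def sum_distrib_left by (intro sum.cong refl; use repeated_triple in auto)+
  have ss: "s * s = 1" using s by auto
  have 1: "(\<Sum>(A, B)\<in>pairs s. w A B A * Psi A B A) * real (card (pairs s)) = pair_weight s * Pp s"
    using class_pair[of "\<lambda>A B. A" s] a ss by simp
  have 2: "(\<Sum>(A, B)\<in>pairs s. w A B B * Psi A B B) * real (card (pairs s)) = pair_weight s * Rr s"
    using class_pair[of "\<lambda>A B. B" s] a by simp
  have 3: "(\<Sum>(A, B)\<in>pairs s. \<Sum>C\<in>triples 1 A B. w A B C * Psi A B C) * real (card (pairs s)) = pair_weight s * (c * Yt s 1)"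
    using s c by (intro class_triples_scaled) auto
  have 4: "(\<Sum>(A, B)\<in>pairs s. \<Sum>C\<in>triples (- 1) A B. w A B C * Psi A B C) * real (card (pairs s)) = pair_weight s * (c' * Yt s (- 1))"
    using s c' by (intro class_triples_scaled) auto
  have lin: "(2 * x1 + 2 * x2 + x3 + x4) * n = m * (2 * p + 2 * p' + y1 + y2)"
    if "x1 * n = m * p" "x2 * n = m * p'" "x3 * n = m * y1" "x4 * n = m * y2" for x1 x2 x3 x4 n m p p' y1 y2 :: real
  proof -
    have "(2 * x1 + 2 * x2 + x3 + x4) * n = 2 * (x1 * n) + 2 * (x2 * n) + x3 * n + x4 * n"
      by (simp add: algebra_simps)
    then show ?thesis unfolding that by (simp add: algebra_simps)
  qed
  show ?thesis unfolding T by (rule lin[OF 1 2 3 4])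
qed

lemma pair_term_even:
  "pair_term 1 * real (card (pairs 1)) = pair_weight 1 * (2 * (Pp 1 + Rr 1) * (d + 2) / (d + 4)
     + Yh 1 * (2 * d + 4) / (d * (d + 4)) - 4 / (d * (d + 4)) * Yb 1)"
proof -
  have d: "real d > 0" using dpos by simp
  have "pair_term 1 * real (card (pairs 1)) = pair_weight 1 * (2 * Pp 1 + 2 * Rr 1 + 2 / (real d + 4) * Yt 1 1 + (- 2 / real d) * Yt 1 (- 1))"
    using d by (intro pair_term_card) (auto simp: field_simps power2_eq_square)
  moreover have "Yt 1 1 = (Yb 1 + Yh 1) / 2 - 2 * (Pp 1 + Rr 1)"
    using Yt_sums[of 1] by (simp add: field_simps)
  moreover have "Yt 1 (- 1) = (Yb 1 - Yh 1) / 2"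
    using Yt_sums[of 1] by (simp add: field_simps)
  moreover have "2 * P + 2 * R + 2 / (real d + 4) * ((yb + yh) / 2 - 2 * (P + R)) + (- 2 / real d) * ((yb - yh) / 2) =
    2 * (P + R) * (d + 2) / (d + 4) + yh * (2 * d + 4) / (d * (d + 4)) - 4 / (d * (d + 4)) * yb" for P R yb yh :: real
  proof -
    have e: "2 / (real d + 4) * ((yb + yh) / 2 - 2 * (P + R)) + (- 2 / real d) * ((yb - yh) / 2) =
      (yb + yh) / (d + 4) - 4 * (P + R) / (d + 4) - (yb - yh) / d"
    proof -
      have e12: "2 / (real d + 4) * ((yb + yh) / 2 - z) = (yb + yh) / (d + 4) - 2 * z / (d + 4)"
        "(- 2 / real d) * ((yb - yh) / 2) = - ((yb - yh) / d)" for z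
        using d by (simp_all add: divide_simps) (simp_all add: algebra_simps)?
      show ?thesis unfolding e12 by simp
    qed
    have f: "x / (d + 4) - z / d = (d * x - (d + 4) * z) / (d * (d + 4))" for x z :: real
      using d by (simp add: divide_simps)
    have g: "2 * (P + R) - 4 * (P + R) / (d + 4) = 2 * (P + R) * (d + 2) / (d + 4)"
      using d by (simp add: divide_simps) (simp add: algebra_simps)
    have h: "(d * (yb + yh) - (d + 4) * (yb - yh)) / (d * (d + 4)) = yh * (2 * d + 4) / (d * (d + 4)) - 4 / (d * (d + 4)) * yb"
      by (simp add: diff_divide_distrib[symmetric] algebra_simps)
    have k: "(yb + yh) / (d + 4) - (yb - yh) / d = yh * (2 * d + 4) / (d * (d + 4)) - 4 / (d * (d + 4)) * yb"
      unfolding f by (rule h)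
    have f0: "2 * P + 2 * R + a + b = 2 * (P + R) + (a + b)" for a b :: real by simp
    have m: "v + (a - b - c) = (v - b) + (a - c)" "A + u - v = A + (u - v)" for a b c v u A :: real by simp_all
    show ?thesis unfolding f0 e m k g ..
  qed
  ultimately show ?thesis by (simp only:)
qed

lemma pair_term_odd:
  "pair_term (- 1) * real (card (pairs (- 1))) = pair_weight (- 1) * (2 * (Pp (- 1) + Rr (- 1)) * d / (d + 2) - 2 * Yh (- 1) / (d + 2))"
proof -
  have d: "real d > 0" using dpos by simp
  have "pair_term (- 1) * real (card (pairs (- 1))) = pair_weight (- 1) * (2 * Pp (- 1) + 2 * Rr (- 1)
      + (- 2 / (real d + 2)) * Yt (- 1) 1 + 2 / (real d + 2) * Yt (- 1) (- 1))"
    using d by (intro pair_term_card) (auto simp: field_simps power2_eq_square)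
  moreover have "Yt (- 1) 1 = Yt (- 1) (- 1) + Yh (- 1) + 2 * (Pp (- 1) + Rr (- 1))"
    using Yt_sums[of "- 1"] by simp
  moreover have "2 * P + 2 * R + (- 2 / (real d + 2)) * (x + yh + 2 * (P + R)) + 2 / (real d + 2) * x =
    2 * (P + R) * d / (d + 2) - 2 * yh / (d + 2)" for P R x yh :: real
  proof -
    have e: "(- 2 / (real d + 2)) * (x + yh + 2 * (P + R)) + 2 / (real d + 2) * x = - (4 * (P + R) / (d + 2)) - 2 * yh / (d + 2)"
      using d by (simp add: divide_simps) (simp add: algebra_simps)?
    have g: "2 * (P + R) - 4 * (P + R) / (d + 2) = 2 * (P + R) * d / (d + 2)"
      using d by (simp add: divide_simps) (simp add: algebra_simps)
    have f: "2 * P + 2 * R + a + b = 2 * (P + R) + (a + b)" for a b :: real by simp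
    show ?thesis unfolding f e g[symmetric] by simp
  qed
  ultimately show ?thesis by (simp only:)
qed

abbreviation rr :: real where "rr \<equiv> tau rho rho"
abbreviation oo :: real where "oo \<equiv> tau Ob Ob"
abbreviation xi :: "complex mat \<Rightarrow> real" where "xi A \<equiv> r A * q A"
abbreviation eta :: "complex mat \<Rightarrow> real" where "eta A \<equiv> tau rho (A * Ob * A)"

lemma sum_r2: "(\<Sum>A\<in>SS. (r A)\<^sup>2) = 2 * d * rr"
  using complete_tau[of rho rho] by (simp add: power2_eq_square)

lemma sum_q2: "(\<Sum>A\<in>SS. (q A)\<^sup>2) = 2 * d * oo"
  using complete_tau[of Ob Ob] by (simp add: power2_eq_square)

lemma oo_nonneg: "0 \<le> oo"
proof -
  have "0 \<le> (\<Sum>A\<in>SS. (q A)\<^sup>2)" by (simp add: sum_nonneg)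
  then show ?thesis unfolding sum_q2 using dpos by (simp add: zero_le_mult_iff)
qed

lemma sum_cauchy:
  fixes f g :: "'b \<Rightarrow> real"
  shows "(\<Sum>x\<in>M. f x * g x)\<^sup>2 \<le> (\<Sum>x\<in>M. (f x)\<^sup>2) * (\<Sum>x\<in>M. (g x)\<^sup>2)"
proof -
  have "(\<Sum>x\<in>M. f x * g x)\<^sup>2 = (\<Sum>x\<in>M. \<Sum>z\<in>M. (f x * g x) * (f z * g z))"
    by (simp add: power2_eq_square sum_product)
  also have "\<dots> \<le> (\<Sum>x\<in>M. \<Sum>z\<in>M. ((f x)\<^sup>2 * (g z)\<^sup>2 + (f z)\<^sup>2 * (g x)\<^sup>2) / 2)"
  proof (intro sum_mono)
    fix x z
    have "2 * (f x * g z) * (f z * g x) \<le> (f x * g z)\<^sup>2 + (f z * g x)\<^sup>2" by (rule sum_squares_bound)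
    then show "(f x * g x) * (f z * g z) \<le> ((f x)\<^sup>2 * (g z)\<^sup>2 + (f z)\<^sup>2 * (g x)\<^sup>2) / 2"
      by (simp add: power_mult_distrib mult_ac)
  qed
  also have "\<dots> = ((\<Sum>x\<in>M. \<Sum>z\<in>M. (f x)\<^sup>2 * (g z)\<^sup>2) + (\<Sum>x\<in>M. \<Sum>z\<in>M. (f z)\<^sup>2 * (g x)\<^sup>2)) / 2"
    by (simp add: sum.distrib sum_divide_distrib[symmetric])
  also have "(\<Sum>x\<in>M. \<Sum>z\<in>M. (f z)\<^sup>2 * (g x)\<^sup>2) = (\<Sum>x\<in>M. \<Sum>z\<in>M. (f x)\<^sup>2 * (g z)\<^sup>2)"
    by (rule sum.swap)
  finally show ?thesis by (simp add: sum_product)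
qed

lemma tau_cauchy: "(tau rho Ob)\<^sup>2 \<le> rr * oo"
proof -
  have "(2 * d * tau rho Ob)\<^sup>2 = (\<Sum>A\<in>SS. r A * q A)\<^sup>2"
    using complete_tau[of rho Ob] by simp
  also have "\<dots> \<le> (\<Sum>A\<in>SS. (r A)\<^sup>2) * (\<Sum>A\<in>SS. (q A)\<^sup>2)" by (rule sum_cauchy)
  also have "\<dots> = (2 * d)\<^sup>2 * (rr * oo)" unfolding sum_r2 sum_q2 by (simp add: power2_eq_square)
  finally have "(2 * real d)\<^sup>2 * (tau rho Ob)\<^sup>2 \<le> (2 * real d)\<^sup>2 * (rr * oo)" by (simp add: power_mult_distrib)
  then show ?thesis using dpos by simp
qed

lemma sum_rq: "(\<Sum>A\<in>SS. \<Sum>B\<in>SS. (r A * q B)\<^sup>2) = 4 * (real d)\<^sup>2 * (rr * oo)"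
proof -
  have "(\<Sum>A\<in>SS. \<Sum>B\<in>SS. (r A * q B)\<^sup>2) = (\<Sum>A\<in>SS. (r A)\<^sup>2) * (\<Sum>B\<in>SS. (q B)\<^sup>2)"
    by (simp add: sum_product power_mult_distrib)
  then show ?thesis unfolding sum_r2 sum_q2 by (simp add: power2_eq_square)
qed

lemma parseval_le:
  assumes Z: "Z \<in> carrier_mat d d"
  shows "(\<Sum>B\<in>SS. (tau Z B)\<^sup>2) \<le> 2 * d * Re (mtrace (Z * adj Z))"
proof -
  have n: "mtrace (Z * P) * mtrace (adj Z * P) = complex_of_real ((cmod (mtrace (Z * P)))\<^sup>2)" if P: "P \<in> PP" for P
  proof -
    have "mtrace (adj Z * P) = mtrace (P * adj Z)" using Z P by (simp add: tr_comm PP_carrier)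
    also have "\<dots> = cnj (mtrace (Z * P))"
      using mtrace_adj[of "Z * P" d] Z P by (simp add: PP_carrier PP_adj)
    finally show ?thesis using complex_norm_square[of "mtrace (Z * P)"] by simp
  qed
  have "(\<Sum>B\<in>SS. (tau Z B)\<^sup>2) = 2 * (\<Sum>P\<in>PP. (tau Z P)\<^sup>2)"
    unfolding sum_SS sum_distrib_left using Z by (intro sum.cong refl) (simp add: PP_carrier)
  also have "\<dots> \<le> 2 * (\<Sum>P\<in>PP. (cmod (mtrace (Z * P)))\<^sup>2)"
    by (intro mult_left_mono sum_mono) (simp_all add: tau_def cmod_power2)
  also have "(\<Sum>P\<in>PP. (cmod (mtrace (Z * P)))\<^sup>2) = Re (\<Sum>P\<in>PP. mtrace (Z * P) * mtrace (adj Z * P))"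
    by (simp add: n)
  also have "\<dots> = d * Re (mtrace (Z * adj Z))" using Z by (simp add: complete_trace)
  finally show ?thesis by simp
qed

lemma sum_V: "(\<Sum>A\<in>SS. \<Sum>B\<in>SS. (tau rho (A * Ob * B))\<^sup>2) \<le> 4 * (real d)\<^sup>2 * (rr * oo)"
proof -
  have z: "Re (mtrace ((rho * A * Ob) * adj (rho * A * Ob))) = Re (mtrace ((rho * rho * A) * (Ob * Ob * A)))"
    if A: "A \<in> SS" for A
  proof -
    have "mtrace ((rho * A * Ob) * adj (rho * A * Ob)) = mtrace ((rho * A * (Ob * Ob) * A) * rho)"
      using A by (simp add: assoc)
    also have "\<dots> = mtrace (rho * (rho * A * (Ob * Ob) * A))" using A by (intro tr_comm) simp_all
    also have "rho * (rho * A * (Ob * Ob) * A) = (rho * rho * A) * (Ob * Ob * A)" using A by (simp add: assoc)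
    finally show ?thesis by simp
  qed
  have e: "(\<Sum>B\<in>SS. (tau rho (A * Ob * B))\<^sup>2) = (\<Sum>B\<in>SS. (tau (rho * A * Ob) B)\<^sup>2)" if "A \<in> SS" for A
    using that by (intro sum.cong refl) (simp add: tau_def assoc)
  have "(\<Sum>A\<in>SS. \<Sum>B\<in>SS. (tau rho (A * Ob * B))\<^sup>2) \<le> (\<Sum>A\<in>SS. 2 * d * Re (mtrace ((rho * rho * A) * (Ob * Ob * A))))"
  proof (intro sum_mono)
    fix A assume A: "A \<in> SS"
    have "(\<Sum>B\<in>SS. (tau (rho * A * Ob) B)\<^sup>2) \<le> 2 * d * Re (mtrace ((rho * A * Ob) * adj (rho * A * Ob)))"
      using A by (intro parseval_le) simp
    then show "(\<Sum>B\<in>SS. (tau rho (A * Ob * B))\<^sup>2) \<le> 2 * d * Re (mtrace ((rho * rho * A) * (Ob * Ob * A)))"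
      unfolding e[OF A] z[OF A] .
  qed
  also have "\<dots> = 2 * d * (2 * (\<Sum>P\<in>PP. Re (mtrace ((rho * rho * P) * (Ob * Ob * P)))))"
    unfolding sum_SS sum_distrib_left by (intro sum.cong refl) (simp add: PP_carrier)
  also have "(\<Sum>P\<in>PP. Re (mtrace ((rho * rho * P) * (Ob * Ob * P)))) = Re (of_nat d * mtrace (rho * rho) * mtrace (Ob * Ob))"
    using twirl_trace[of "rho * rho" "Ob * Ob"] by (simp flip: Re_sum)
  also have "\<dots> = d * (rr * oo)" by (simp add: herm_trace_real)
  finally show ?thesis by (simp add: power2_eq_square)
qed

lemma sum_pairs_le:
  assumes nn: "\<And>A B. 0 \<le> (F A B :: real)"
  shows "(\<Sum>(A, B)\<in>pairs 1. F A B) + (\<Sum>(A, B)\<in>pairs (- 1). F A B) \<le> (\<Sum>A\<in>SS. \<Sum>B\<in>SS. F A B)"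
proof -
  have "(\<Sum>(A, B)\<in>pairs 1. F A B) + (\<Sum>(A, B)\<in>pairs (- 1). F A B) = (\<Sum>(A, B)\<in>pairs 1 \<union> pairs (- 1). F A B)"
    by (intro sum.union_disjoint[symmetric] fin_pairs) (auto simp: pairs_def)
  also have "\<dots> \<le> (\<Sum>(A, B)\<in>SS \<times> SS. F A B)"
    using nn by (intro sum_mono2) (auto simp: pairs_def indep2_def)
  finally show ?thesis by (simp add: sum.cartesian_product)
qed

lemma PV_le: "3 * Pp 1 + Vv 1 + (3 * Pp (- 1) + Vv (- 1)) \<le> 16 * (real d)\<^sup>2 * (rr * oo)"
proof -
  have "Pp 1 + Pp (- 1) \<le> 4 * (real d)\<^sup>2 * (rr * oo)"
    unfolding Pp_def using sum_pairs_le[of "\<lambda>A B. (r A * q B)\<^sup>2"] sum_rq by simp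
  moreover have "Vv 1 + Vv (- 1) \<le> 4 * (real d)\<^sup>2 * (rr * oo)"
    unfolding Vv_def using sum_pairs_le[of "\<lambda>A B. (tau rho (A * Ob * B))\<^sup>2"] sum_V by simp
  ultimately show ?thesis by linarith
qed

lemma PV_nonneg: "0 \<le> Pp s" "0 \<le> Vv s" "0 \<le> pair_weight s"
  unfolding Pp_def Vv_def pair_weight_def by (auto intro!: sum_nonneg)

lemma Rr_le: "Rr s \<le> Pp s"
proof -
  have sw: "(\<Sum>(A, B)\<in>pairs s. (r B * q A)\<^sup>2) = Pp s"
  proof -
    have "bij_betw prod.swap (pairs s) (pairs s)"
      by (rule bij_betw_byWitness[of _ prod.swap]) (auto simp: pairs_def indep2_def chi_sym eqv_sym)
    then show ?thesis unfolding Pp_def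
      using sum.reindex_bij_betw[of prod.swap "pairs s" "pairs s" "\<lambda>(A, B). (r A * q B)\<^sup>2"]
      by (simp add: case_prod_unfold)
  qed
  have "Rr s \<le> (\<Sum>(A, B)\<in>pairs s. ((r A * q B)\<^sup>2 + (r B * q A)\<^sup>2) / 2)"
    unfolding Rr_def
  proof (intro sum_mono)
    fix p assume "p \<in> pairs s"
    have "u * v \<le> (u\<^sup>2 + v\<^sup>2) / 2" for u v :: real using sum_squares_bound[of u v] by simp
    then show "(case p of (A, B) \<Rightarrow> (r A * q B) * (r B * q A)) \<le> (case p of (A, B) \<Rightarrow> ((r A * q B)\<^sup>2 + (r B * q A)\<^sup>2) / 2)"
      by (simp only: case_prod_unfold)
  qed
  also have "\<dots> = (Pp s + (\<Sum>(A, B)\<in>pairs s. (r B * q A)\<^sup>2)) / 2"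
    unfolding Pp_def by (simp add: case_prod_unfold sum.distrib sum_divide_distrib[symmetric])
  finally show ?thesis unfolding sw by simp
qed

lemma Yh_le:
  assumes s: "s = 1 \<or> s = - 1"
  shows "\<bar>Yh s\<bar> \<le> d * (Pp s + Vv s)"
proof -
  have e: "(\<Sum>C\<in>SS. chi A C * y A B C) = 2 * d * (s * ((r A * q B) * tau rho (A * Ob * B)))"
    if p: "(A, B) \<in> pairs s" for A B
  proof -
    have S: "A \<in> SS" "B \<in> SS" "chi A B = s" using pairs_D[OF p] by auto
    have "(\<Sum>C\<in>SS. chi A C * y A B C) = r A * q B * (\<Sum>C\<in>SS. chi A C * (r C * q (A * B * C)))"
      by (simp add: y_def sum_distrib_left mult_ac)
    then show ?thesis using complete_contract_chi[of rho Ob A B] S by simp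
  qed
  have "\<bar>Yh s\<bar> \<le> (\<Sum>p\<in>pairs s. \<bar>case p of (A, B) \<Rightarrow> \<Sum>C\<in>SS. chi A C * y A B C\<bar>)"
    unfolding Yh_def by (rule sum_abs)
  also have "\<dots> \<le> (\<Sum>(A, B)\<in>pairs s. d * ((r A * q B)\<^sup>2 + (tau rho (A * Ob * B))\<^sup>2))"
  proof (intro sum_mono)
    fix p assume p: "p \<in> pairs s"
    obtain A B where AB: "p = (A, B)" by (cases p)
    have am: "2 * \<bar>u * v\<bar> \<le> u\<^sup>2 + v\<^sup>2" for u v :: real
      using sum_squares_bound[of "\<bar>u\<bar>" "\<bar>v\<bar>"] by (simp add: abs_mult)
    have "\<bar>2 * real d * (s * (u * v))\<bar> = real d * (2 * \<bar>u * v\<bar>)" for u v :: real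
      using s by (auto simp: abs_mult)
    then have "\<bar>2 * real d * (s * (u * v))\<bar> \<le> real d * (u\<^sup>2 + v\<^sup>2)" for u v :: real
      using mult_left_mono[OF am, of "real d" u v] by simp
    then show "\<bar>case p of (A, B) \<Rightarrow> \<Sum>C\<in>SS. chi A C * y A B C\<bar> \<le>
      (case p of (A, B) \<Rightarrow> d * ((r A * q B)\<^sup>2 + (tau rho (A * Ob * B))\<^sup>2))"
      using e[of A B] p unfolding AB by simp
  qed
  also have "\<dots> = d * (Pp s + Vv s)"
    unfolding Pp_def Vv_def by (simp add: case_prod_unfold sum.distrib sum_distrib_left[symmetric])
  finally show ?thesis .
qed

lemma Yb_nonneg: "0 \<le> Yb 1"
proof -
  let ?z = "\<lambda>S. \<Sum>A\<in>SS. r A * q (S * A)"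
  have inner: "(\<Sum>B | indep2 A B \<and> chi A B = 1. \<Sum>C\<in>SS. y A B C) = (\<Sum>S\<in>nonid. r A * q (S * A) * ?z S)"
    if A: "A \<in> nonid" for A
  proof -
    have A': "A \<in> SS" "\<not> eqv A (1\<^sub>m d)" using A by (auto simp: nonid_def)
    let ?M = "{S \<in> nonid. chi A S = 1 \<and> \<not> eqv S A}"
    have comm: "S * A = A * S" if "chi A S = 1" for S using that by (simp add: chi_def split: if_splits)
    have prodS: "A * S \<in> SS \<and> chi A (A * S) = 1 \<and> (eqv (A * S) (1\<^sub>m d) \<longleftrightarrow> eqv A S) \<and> (eqv (A * S) A \<longleftrightarrow> eqv S (1\<^sub>m d))"
      if "S \<in> SS" "chi A S = 1" for S
    proof -
      have p: "A * S = pj A S" using comm[OF that(2)] by (simp add: pj_def)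
      have "eqv (A * S) A \<longleftrightarrow> eqv S (1\<^sub>m d)"
      proof
        assume "eqv (A * S) A"
        then obtain c where c: "c = 1 \<or> c = - 1" "A * S = c \<cdot>\<^sub>m A" unfolding eqv_def by (metis smult_simps(4))
        have "S = A * (A * S)" using A' that(1) by simp
        also have "\<dots> = c \<cdot>\<^sub>m 1\<^sub>m d" using A' by (simp add: c(2))
        finally show "eqv S (1\<^sub>m d)" using c(1) by (auto simp: eqv_def)
      next
        assume "eqv S (1\<^sub>m d)" then show "eqv (A * S) A" using A' by (auto simp: eqv_def)
      qed
      then show ?thesis unfolding p using A' that by (simp add: chi_pj eqv_pj)
    qed
    have "(\<Sum>B | indep2 A B \<and> chi A B = 1. \<Sum>C\<in>SS. y A B C) = (\<Sum>S\<in>?M. \<Sum>C\<in>SS. y A (A * S) C)"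
    proof (rule sum.reindex_bij_witness[of _ "\<lambda>S. A * S" "\<lambda>B. A * B"])
      fix B assume B: "B \<in> {B. indep2 A B \<and> chi A B = 1}"
      then have B': "B \<in> SS" "chi A B = 1" "\<not> eqv B (1\<^sub>m d)" "\<not> eqv B A" by (auto simp: indep2_def)
      show "A * (A * B) = B" using A' B' by simp
      show "A * B \<in> ?M" using prodS[OF B'(1,2)] B' eqv_sym by (auto simp: nonid_def)
      show "(\<Sum>C\<in>SS. y A (A * (A * B)) C) = (\<Sum>C\<in>SS. y A B C)" using A' B' by simp
    next
      fix S assume S: "S \<in> ?M"
      then have S': "S \<in> SS" "chi A S = 1" "\<not> eqv S (1\<^sub>m d)" "\<not> eqv S A" by (auto simp: nonid_def)
      show "A * (A * S) = S" using A' S' by simp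
      show "A * S \<in> {B. indep2 A B \<and> chi A B = 1}" using prodS[OF S'(1,2)] S' A' eqv_sym by (auto simp: indep2_def)
    qed
    also have "\<dots> = (\<Sum>S\<in>?M. r A * q (S * A) * ?z S)"
    proof (intro sum.cong refl)
      fix S assume S: "S \<in> ?M"
      then have S': "S \<in> SS" "chi A S = 1" by (auto simp: nonid_def)
      have "y A (A * S) C = r A * q (S * A) * (r C * q (S * C))" if "C \<in> SS" for C
        unfolding y_def comm[OF S'(2)] using A' S' by simp
      then show "(\<Sum>C\<in>SS. y A (A * S) C) = r A * q (S * A) * ?z S" by (simp add: sum_distrib_left)
    qed
    also have "\<dots> = (\<Sum>S\<in>nonid. r A * q (S * A) * ?z S)"
    proof (rule sum.mono_neutral_left)
      show "\<forall>S\<in>nonid - ?M. r A * q (S * A) * ?z S = 0"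
      proof
        fix S assume S: "S \<in> nonid - ?M"
        then have S': "S \<in> SS" by (simp add: nonid_def)
        have "q (S * A) = 0"
        proof (cases "eqv S A")
          case True
          then have "S * A = 1\<^sub>m d \<or> S * A = - 1 \<cdot>\<^sub>m 1\<^sub>m d" using A' by (auto simp: eqv_def)
          then show ?thesis using rq_one(2)[of "S * A"] by (auto simp: eqv_def)
        next
          case False
          then have n: "chi A S = - 1" using S chi_cases by auto
          have "adj (S * A) = - 1 \<cdot>\<^sub>m (S * A)" using chi_comm[OF A'(1) S'] n A' S' by simp
          then show ?thesis using A' S' tau_antiherm[of Ob "S * A"] by simp
        qed
        then show "r A * q (S * A) * ?z S = 0" by simp
      qed
    qed auto
    finally show ?thesis .
  qed
  have "Yb 1 = (\<Sum>A\<in>nonid. \<Sum>S\<in>nonid. r A * q (S * A) * ?z S)"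
    unfolding Yb_def sum_pairs by (intro sum.cong refl inner)
  also have "\<dots> = (\<Sum>S\<in>nonid. (\<Sum>A\<in>nonid. r A * q (S * A)) * ?z S)"
    by (subst sum.swap) (simp add: sum_distrib_right)
  also have "\<dots> = (\<Sum>S\<in>nonid. (?z S)\<^sup>2)"
  proof (intro sum.cong refl)
    fix S
    have "(\<Sum>A\<in>nonid. r A * q (S * A)) = ?z S"
      by (rule sum.mono_neutral_left) (auto simp: nonid_def rq_one)
    then show "(\<Sum>A\<in>nonid. r A * q (S * A)) * ?z S = (?z S)\<^sup>2" by (simp add: power2_eq_square)
  qed
  finally show ?thesis by (simp add: sum_nonneg)
qed

lemma pair_term_even_le: "pair_term 1 * real (card (pairs 1)) \<le> pair_weight 1 * (2 * (d + 2) / (d + 4) * (3 * Pp 1 + Vv 1))"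
proof -
  have d: "real d > 0" using dpos by simp
  have k: "Yh 1 * (2 * real d + 4) / (d * (d + 4)) \<le> (d * (Pp 1 + Vv 1)) * (2 * real d + 4) / (d * (d + 4))"
    using Yh_le[of 1] d by (intro divide_right_mono mult_right_mono) auto
  also have "\<dots> = 2 * (d + 2) / (d + 4) * (Pp 1 + Vv 1)" using d by (simp add: divide_simps)
  finally have 1: "Yh 1 * (2 * real d + 4) / (d * (d + 4)) \<le> 2 * (d + 2) / (d + 4) * (Pp 1 + Vv 1)" .
  have 2: "2 * (Pp 1 + Rr 1) * (d + 2) / (d + 4) \<le> 2 * (real d + 2) / (d + 4) * (2 * Pp 1)"
  proof -
    have "2 * (Pp 1 + Rr 1) * (d + 2) / (d + 4) = 2 * (real d + 2) / (d + 4) * (Pp 1 + Rr 1)" by (simp add: algebra_simps)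
    also have "\<dots> \<le> 2 * (real d + 2) / (d + 4) * (2 * Pp 1)" using Rr_le[of 1] d by (intro mult_left_mono) auto
    finally show ?thesis .
  qed
  have 3: "0 \<le> 4 / (real d * (d + 4)) * Yb 1" using Yb_nonneg d by simp
  have 4: "2 * (real d + 2) / (d + 4) * (2 * Pp 1) + 2 * (d + 2) / (d + 4) * (Pp 1 + Vv 1) = 2 * (d + 2) / (d + 4) * (3 * Pp 1 + Vv 1)"
    unfolding of_nat_add of_nat_numeral of_nat_mult distrib_left[symmetric] add.commute[of 2 "real d"] by (simp add: field_simps)
  have "2 * (Pp 1 + Rr 1) * (d + 2) / (d + 4) + Yh 1 * (2 * d + 4) / (d * (d + 4)) - 4 / (d * (d + 4)) * Yb 1
    \<le> 2 * (d + 2) / (d + 4) * (3 * Pp 1 + Vv 1)"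
    using 1 2 3 4 by simp
  then show ?thesis unfolding pair_term_even using PV_nonneg(3)[of 1] by (rule mult_left_mono)
qed

lemma pair_term_odd_le: "pair_term (- 1) * real (card (pairs (- 1))) \<le> pair_weight (- 1) * (2 * d / (d + 2) * (3 * Pp (- 1) + Vv (- 1)))"
proof -
  have d: "real d > 0" using dpos by simp
  have "- (2 * Yh (- 1)) \<le> 2 * (d * (Pp (- 1) + Vv (- 1)))" using Yh_le[of "- 1"] by simp
  then have "- (2 * Yh (- 1)) / (real d + 2) \<le> 2 * (d * (Pp (- 1) + Vv (- 1))) / (real d + 2)"
    using d by (intro divide_right_mono) auto
  then have 1: "- (2 * Yh (- 1) / (real d + 2)) \<le> 2 * d / (d + 2) * (Pp (- 1) + Vv (- 1))" by (simp add: mult_ac add.commute)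
  have 2: "2 * (Pp (- 1) + Rr (- 1)) * d / (d + 2) \<le> 2 * real d / (d + 2) * (2 * Pp (- 1))"
  proof -
    have "2 * (Pp (- 1) + Rr (- 1)) * d / (d + 2) = 2 * real d / (d + 2) * (Pp (- 1) + Rr (- 1))" by simp
    also have "\<dots> \<le> 2 * real d / (d + 2) * (2 * Pp (- 1))" using Rr_le[of "- 1"] d by (intro mult_left_mono) auto
    finally show ?thesis .
  qed
  have 4: "2 * real d / (d + 2) * (2 * Pp (- 1)) + 2 * d / (d + 2) * (Pp (- 1) + Vv (- 1)) = 2 * d / (d + 2) * (3 * Pp (- 1) + Vv (- 1))"
    unfolding of_nat_add of_nat_numeral of_nat_mult distrib_left[symmetric] add.commute[of 2 "real d"] by (simp add: field_simps)
  have "2 * (Pp (- 1) + Rr (- 1)) * d / (d + 2) - 2 * Yh (- 1) / (d + 2) \<le> 2 * d / (d + 2) * (3 * Pp (- 1) + Vv (- 1))"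
    using 1 2 4 by (simp add: add.commute)
  then show ?thesis unfolding pair_term_odd using PV_nonneg(3)[of "- 1"] by (rule mult_left_mono)
qed

text \<open>The part of the second moment with \<open>A = \<plusminus>B\<close>.\<close>

definition diag_term :: real where
  "diag_term = 2 * (\<Sum>A\<in>nonid. \<Sum>C\<in>SS. w A A C * Psi A A C)"

lemma sum_indep2_split:
  fixes F :: "complex mat \<Rightarrow> real"
  shows "(\<Sum>B | indep2 A B. F B) = (\<Sum>B | indep2 A B \<and> chi A B = 1. F B) + (\<Sum>B | indep2 A B \<and> chi A B = - 1. F B)"
proof -
  have f: "finite {B. indep2 A B \<and> chi A B = s}" for s
    by (rule finite_subset[OF _ fin_indep(2)[of A]]) auto
  have "{B. indep2 A B} = {B. indep2 A B \<and> chi A B = 1} \<union> {B. indep2 A B \<and> chi A B = - 1}"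
    using chi_cases by auto
  then have "(\<Sum>B | indep2 A B. F B) = sum F ({B. indep2 A B \<and> chi A B = 1} \<union> {B. indep2 A B \<and> chi A B = - 1})"
    by (rule arg_cong)
  also have "\<dots> = (\<Sum>B | indep2 A B \<and> chi A B = 1. F B) + (\<Sum>B | indep2 A B \<and> chi A B = - 1. F B)"
    by (rule sum.union_disjoint[OF f f]) auto
  finally show ?thesis .
qed

lemma split_total:
  "(\<Sum>A\<in>SS. \<Sum>B\<in>SS. \<Sum>C\<in>SS. w A B C * Psi A B C) = diag_term + (pair_term 1 + pair_term (- 1))"
proof -
  let ?F = "\<lambda>A B. \<Sum>C\<in>SS. w A B C * Psi A B C"
  have one: "?F A B = 0" if "A \<in> SS" "B \<in> SS" "eqv A (1\<^sub>m d) \<or> eqv B (1\<^sub>m d)" for A B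
    using that by (intro sum.neutral) (auto simp: Psi_one)
  have "(\<Sum>A\<in>SS. \<Sum>B\<in>SS. ?F A B) = (\<Sum>A\<in>nonid. \<Sum>B\<in>SS. ?F A B)"
  proof (rule sum.mono_neutral_right)
    show "\<forall>A\<in>SS - nonid. (\<Sum>B\<in>SS. ?F A B) = 0"
    proof
      fix A assume "A \<in> SS - nonid"
      then have A: "A \<in> SS" "eqv A (1\<^sub>m d)" by (auto simp: nonid_def)
      show "(\<Sum>B\<in>SS. ?F A B) = 0" using A by (intro sum.neutral ballI one) simp_all
    qed
  qed (auto simp: nonid_def)
  also have "\<dots> = (\<Sum>A\<in>nonid. 2 * ?F A A + (\<Sum>B | indep2 A B \<and> chi A B = 1. ?F A B) + (\<Sum>B | indep2 A B \<and> chi A B = - 1. ?F A B))"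
  proof (intro sum.cong refl)
    fix A assume "A \<in> nonid"
    then have A: "A \<in> SS" "\<not> eqv A (1\<^sub>m d)" by (auto simp: nonid_def)
    have "(\<Sum>B\<in>SS. ?F A B) = 2 * (?F A (1\<^sub>m d) + ?F A A) + (\<Sum>B | indep2 A B. ?F A B)"
      using A by (intro sum_indep2) (auto simp: w_neg Psi_neg intro!: sum.cong)
    moreover have "?F A (1\<^sub>m d) = 0" using A by (intro one) auto
    moreover have "(\<Sum>B | indep2 A B. ?F A B) = (\<Sum>B | indep2 A B \<and> chi A B = 1. ?F A B) + (\<Sum>B | indep2 A B \<and> chi A B = - 1. ?F A B)"
      by (rule sum_indep2_split)
    ultimately show "(\<Sum>B\<in>SS. ?F A B) = 2 * ?F A A + (\<Sum>B | indep2 A B \<and> chi A B = 1. ?F A B) + (\<Sum>B | indep2 A B \<and> chi A B = - 1. ?F A B)"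
      by simp
  qed
  also have "\<dots> = diag_term + (pair_term 1 + pair_term (- 1))"
    unfolding diag_term_def pair_term_def sum_pairs by (simp add: sum.distrib sum_distrib_left)
  finally show ?thesis .
qed

lemma eqv_triple:
  assumes S: "A \<in> SS" "B \<in> SS" "C \<in> SS" and n: "\<not> eqv B A"
  shows "\<not> eqv (A * B * C) C"
proof
  assume "eqv (A * B * C) C"
  then obtain c where c: "c = 1 \<or> c = - 1" "A * B * C = c \<cdot>\<^sub>m C" unfolding eqv_def by (metis smult_simps(4))
  have "A * (A * B * C * C) = B" using S by (simp add: assoc)
  also have "A * (A * B * C * C) = c \<cdot>\<^sub>m A" unfolding c(2) using S by simp
  finally show False using c(1) n by (auto simp: eqv_def)
qed

lemma pair_term_nonneg: "0 \<le> pair_term 1 + pair_term (- 1)"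
proof -
  let ?G = "\<lambda>A B. if eqv B A then 0 else D A B"
  have "avg (\<lambda>X. (\<Sum>A\<in>SS. \<Sum>B\<in>SS. ?G A B * (r (act X A) * q (act X B)))\<^sup>2) =
    2 * (\<Sum>A\<in>SS. \<Sum>B\<in>SS. \<Sum>C\<in>SS. ?G A B * ?G C (A * B * C) * Phi A B C (A * B * C))"
    by (rule second_moment) (auto simp: D_antiherm split: if_splits)
  moreover have "0 \<le> avg (\<lambda>X. (\<Sum>A\<in>SS. \<Sum>B\<in>SS. ?G A B * (r (act X A) * q (act X B)))\<^sup>2)"
    unfolding avg_def by (intro divide_nonneg_nonneg sum_nonneg) auto
  moreover have "(\<Sum>A\<in>SS. \<Sum>B\<in>SS. \<Sum>C\<in>SS. ?G A B * ?G C (A * B * C) * Phi A B C (A * B * C)) = pair_term 1 + pair_term (- 1)"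
  proof -
    let ?F = "\<lambda>A B. \<Sum>C\<in>SS. w A B C * Psi A B C"
    let ?H = "\<lambda>A B. \<Sum>C\<in>SS. ?G A B * ?G C (A * B * C) * Phi A B C (A * B * C)"
    have H: "?H A B = (if eqv B A then 0 else ?F A B)" if "A \<in> SS" "B \<in> SS" for A B
    proof (cases "eqv B A")
      case False
      then show ?thesis using that eqv_triple[OF that _ False] by (auto simp: w_def Psi_def intro!: sum.cong)
    qed simp
    have one: "?F A B = 0" if "A \<in> SS" "B \<in> SS" "eqv A (1\<^sub>m d) \<or> eqv B (1\<^sub>m d)" for A B
      using that by (intro sum.neutral) (auto simp: Psi_one)
    have "(\<Sum>A\<in>SS. \<Sum>B\<in>SS. ?H A B) = (\<Sum>A\<in>SS. \<Sum>B\<in>SS. if eqv B A then 0 else ?F A B)"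
      by (intro sum.cong refl H)
    also have "\<dots> = (\<Sum>(A, B)\<in>SS \<times> SS. if eqv B A then 0 else ?F A B)" by (simp add: sum.cartesian_product)
    also have "\<dots> = (\<Sum>(A, B)\<in>pairs 1 \<union> pairs (- 1). ?F A B)"
    proof (rule sum.mono_neutral_cong_right)
      show "pairs 1 \<union> pairs (- 1) \<subseteq> SS \<times> SS" by (auto simp: pairs_def indep2_def)
      show "\<forall>p\<in>SS \<times> SS - (pairs 1 \<union> pairs (- 1)). (case p of (A, B) \<Rightarrow> if eqv B A then 0 else ?F A B) = 0"
      proof
        fix p assume p: "p \<in> SS \<times> SS - (pairs 1 \<union> pairs (- 1))"
        obtain A B where AB: "p = (A, B)" by (cases p)
        have S: "A \<in> SS" "B \<in> SS" using p AB by auto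
        have "eqv B A \<or> eqv A (1\<^sub>m d) \<or> eqv B (1\<^sub>m d)"
          using p chi_cases[of A B] unfolding AB by (auto simp: pairs_def indep2_def)
        then show "(case p of (A, B) \<Rightarrow> if eqv B A then 0 else ?F A B) = 0"
          unfolding AB using one[OF S] by auto
      qed
    qed (auto simp: pairs_def indep2_def)
    also have "\<dots> = pair_term 1 + pair_term (- 1)"
      unfolding pair_term_def by (intro sum.union_disjoint fin_pairs) (auto simp: pairs_def)
    finally show ?thesis .
  qed
  ultimately show ?thesis by simp
qed

definition diag_weight :: real where "diag_weight = (\<Sum>A\<in>nonid. (D A A)\<^sup>2)"
definition XX :: real where "XX = (\<Sum>A\<in>SS. (xi A)\<^sup>2)"
definition BB :: real where "BB = (\<Sum>A\<in>SS. xi A * eta A)"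

lemma XX_nonid: "(\<Sum>A\<in>nonid. (xi A)\<^sup>2) = XX"
  unfolding XX_def by (rule sum.mono_neutral_left) (auto simp: nonid_def rq_one)

lemma BB_nonid: "(\<Sum>A\<in>nonid. xi A * eta A) = BB"
  unfolding BB_def by (rule sum.mono_neutral_left) (auto simp: nonid_def rq_one)

lemma xi_nonid: "(\<Sum>A\<in>nonid. xi A) = 2 * d * tau rho Ob"
proof -
  have "(\<Sum>A\<in>nonid. xi A) = (\<Sum>A\<in>SS. xi A)" by (rule sum.mono_neutral_left) (auto simp: nonid_def rq_one)
  then show ?thesis using complete_tau[of rho Ob] by simp
qed

lemma sum_D_diag: "(\<Sum>C\<in>SS. D C C) = 2 * d"
  using D_complete_contract[of "1\<^sub>m d" "1\<^sub>m d"] by simp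

lemma sum_chi_D: "A \<in> SS \<Longrightarrow> (\<Sum>C\<in>SS. chi A C * D C C) = 2 * d * D A A"
  using D_complete_contract_chi[of A A] by simp

lemma sum_chi_xi: "A \<in> SS \<Longrightarrow> (\<Sum>C\<in>SS. chi A C * xi C) = 2 * d * eta A"
  using complete_contract_chi[of rho Ob A A] by simp

lemma sigma_nonid: "(\<Sum>A\<in>nonid. D A A) = 2 * real d - 2"
proof -
  have "(\<Sum>C\<in>SS. D C C) = (\<Sum>C | C \<in> SS \<and> True. D C C)" by simp
  also have "\<dots> = 2 * D (1\<^sub>m d) (1\<^sub>m d) + (\<Sum>C | C \<in> SS \<and> True \<and> \<not> eqv C (1\<^sub>m d). D C C)"
    by (rule sum_remove_eqv) auto
  finally show ?thesis using sum_D_diag by (simp add: nonid_def D_one_one)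
qed

lemma sum_pairs_half:
  fixes f :: "complex mat \<Rightarrow> real"
  assumes u: "u = 1 \<or> u = - 1" and ev: "\<And>C. C \<in> SS \<Longrightarrow> f (- 1 \<cdot>\<^sub>m C) = f C"
  shows "(\<Sum>(A, C)\<in>pairs u. f A * f C) =
    (\<Sum>A\<in>nonid. f A * ((\<Sum>C\<in>SS. f C) + u * (\<Sum>C\<in>SS. chi A C * f C) - 2 * (1 + u) * (f (1\<^sub>m d) + f A)) / 2)"
proof -
  have "(\<Sum>C | indep2 A C \<and> chi A C = u. f A * f C) =
     f A * ((\<Sum>C\<in>SS. f C) + u * (\<Sum>C\<in>SS. chi A C * f C) - 2 * (1 + u) * (f (1\<^sub>m d) + f A)) / 2"
    if "A \<in> nonid" for A
  proof -
    have A: "A \<in> SS" "\<not> eqv A (1\<^sub>m d)" using that by (auto simp: nonid_def)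
    have 1: "(\<Sum>C\<in>SS. f C) = 2 * (f (1\<^sub>m d) + f A) + (\<Sum>C | indep2 A C. f C)"
      using A ev by (intro sum_indep2) auto
    have "(\<Sum>C\<in>SS. chi A C * f C) = 2 * (chi A (1\<^sub>m d) * f (1\<^sub>m d) + chi A A * f A) + (\<Sum>C | indep2 A C. chi A C * f C)"
      using A ev by (intro sum_indep2) auto
    then have 2: "(\<Sum>C\<in>SS. chi A C * f C) = 2 * (f (1\<^sub>m d) + f A) + (\<Sum>C | indep2 A C. chi A C * f C)"
      using A by simp
    have "(\<Sum>C | indep2 A C \<and> chi A C = u. f A * f C) = f A * (\<Sum>C | C \<in> {C. indep2 A C} \<and> chi A C = u. f C)"
      by (simp add: sum_distrib_left)
    also have "(\<Sum>C | C \<in> {C. indep2 A C} \<and> chi A C = u. f C) = ((\<Sum>C | indep2 A C. f C) + u * (\<Sum>C | indep2 A C. chi A C * f C)) / 2"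
      using u chi_cases by (intro sum_half) auto
    finally show ?thesis unfolding 1 2 by (simp add: algebra_simps)
  qed
  then show ?thesis unfolding sum_pairs by (intro sum.cong refl)
qed

lemma W_pairs:
  "(\<Sum>(A, C)\<in>pairs 1. D A A * D C C) = (real d - 2) * (2 * real d - 2 + diag_weight)"
  "(\<Sum>(A, C)\<in>pairs (- 1). D A A * D C C) = real d * (2 * real d - 2 - diag_weight)"
proof -
  have "(\<Sum>(A, C)\<in>pairs 1. D A A * D C C) = (\<Sum>A\<in>nonid. (real d - 2) * (D A A + (D A A)\<^sup>2))"
    by (subst sum_pairs_half) (auto simp: sum_D_diag sum_chi_D D_one_one nonid_def field_simps power2_eq_square intro!: sum.cong)
  also have "\<dots> = (real d - 2) * (2 * real d - 2 + diag_weight)"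
    unfolding diag_weight_def sigma_nonid[symmetric] by (simp only: sum_distrib_left[symmetric] sum.distrib)
  finally show "(\<Sum>(A, C)\<in>pairs 1. D A A * D C C) = (real d - 2) * (2 * real d - 2 + diag_weight)" .
  have "(\<Sum>(A, C)\<in>pairs (- 1). D A A * D C C) = (\<Sum>A\<in>nonid. real d * (D A A - (D A A)\<^sup>2))"
    by (subst sum_pairs_half) (auto simp: sum_D_diag sum_chi_D D_one_one nonid_def field_simps power2_eq_square intro!: sum.cong)
  also have "\<dots> = real d * (2 * real d - 2 - diag_weight)"
    unfolding diag_weight_def sigma_nonid[symmetric] by (simp only: sum_distrib_left[symmetric] sum_subtractf)
  finally show "(\<Sum>(A, C)\<in>pairs (- 1). D A A * D C C) = real d * (2 * real d - 2 - diag_weight)" .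
qed

lemma Y_pairs:
  "(\<Sum>(A, C)\<in>pairs 1. xi A * xi C) = 2 * (real d)\<^sup>2 * (tau rho Ob)\<^sup>2 + d * BB - 2 * XX"
  "(\<Sum>(A, C)\<in>pairs (- 1). xi A * xi C) = 2 * (real d)\<^sup>2 * (tau rho Ob)\<^sup>2 - d * BB"
proof -
  have s: "(\<Sum>C\<in>SS. xi C) = 2 * d * tau rho Ob" using complete_tau[of rho Ob] by simp
  have z: "xi (1\<^sub>m d) = 0" by (simp add: rq_one)
  have "(\<Sum>(A, C)\<in>pairs 1. xi A * xi C) = (\<Sum>A\<in>nonid. xi A * ((\<Sum>C\<in>SS. xi C) + (1) * (\<Sum>C\<in>SS. chi A C * xi C)
      - 2 * (1 + (1)) * (xi (1\<^sub>m d) + xi A)) / 2)"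
    by (rule sum_pairs_half) auto
  also have "\<dots> = (\<Sum>A\<in>nonid. d * tau rho Ob * xi A + d * (xi A * eta A) - 2 * (xi A)\<^sup>2)"
  proof (intro sum.cong refl)
    fix A assume "A \<in> nonid"
    then have A: "A \<in> SS" by (simp add: nonid_def)
    show "xi A * ((\<Sum>C\<in>SS. xi C) + (1) * (\<Sum>C\<in>SS. chi A C * xi C) - 2 * (1 + (1)) * (xi (1\<^sub>m d) + xi A)) / 2 = d * tau rho Ob * xi A + d * (xi A * eta A) - 2 * (xi A)\<^sup>2"
      unfolding s z sum_chi_xi[OF A] by (simp add: field_simps power2_eq_square)
  qed
  also have "\<dots> = d * tau rho Ob * (2 * d * tau rho Ob) + d * BB - 2 * XX"
    unfolding xi_nonid[symmetric] BB_nonid[symmetric] XX_nonid[symmetric] by (simp only: sum.distrib sum_subtractf sum_distrib_left)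
  finally show "(\<Sum>(A, C)\<in>pairs 1. xi A * xi C) = 2 * (real d)\<^sup>2 * (tau rho Ob)\<^sup>2 + d * BB - 2 * XX"
    by (simp add: power2_eq_square mult_ac)
  have "(\<Sum>(A, C)\<in>pairs (- 1). xi A * xi C) = (\<Sum>A\<in>nonid. xi A * ((\<Sum>C\<in>SS. xi C) + (- 1) * (\<Sum>C\<in>SS. chi A C * xi C)
      - 2 * (1 + (- 1)) * (xi (1\<^sub>m d) + xi A)) / 2)"
    by (rule sum_pairs_half) auto
  also have "\<dots> = (\<Sum>A\<in>nonid. d * tau rho Ob * xi A - d * (xi A * eta A))"
  proof (intro sum.cong refl)
    fix A assume "A \<in> nonid"
    then have A: "A \<in> SS" by (simp add: nonid_def)
    show "xi A * ((\<Sum>C\<in>SS. xi C) + (- 1) * (\<Sum>C\<in>SS. chi A C * xi C) - 2 * (1 + (- 1)) * (xi (1\<^sub>m d) + xi A)) / 2 = d * tau rho Ob * xi A - d * (xi A * eta A)"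
      unfolding s z sum_chi_xi[OF A] by (simp add: field_simps power2_eq_square)
  qed
  also have "\<dots> = d * tau rho Ob * (2 * d * tau rho Ob) - d * BB"
    unfolding xi_nonid[symmetric] BB_nonid[symmetric] by (simp only: sum_subtractf sum_distrib_left)
  finally show "(\<Sum>(A, C)\<in>pairs (- 1). xi A * xi C) = 2 * (real d)\<^sup>2 * (tau rho Ob)\<^sup>2 - d * BB"
    by (simp add: power2_eq_square mult_ac)
qed

lemma diag_w: "A \<in> SS \<Longrightarrow> C \<in> SS \<Longrightarrow> w A A C = D A A * D C C" "A \<in> SS \<Longrightarrow> C \<in> SS \<Longrightarrow> y A A C = xi A * xi C"
  by (simp_all add: w_def y_def)

lemma class_diag: "(\<Sum>A\<in>nonid. w A A A * Psi A A A) * (2 * (real d)\<^sup>2 - 2) = diag_weight * XX"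
proof -
  let ?j = "\<lambda>A. ((A, A), A)"
  have inj: "inj_on ?j nonid" by (auto simp: inj_on_def)
  have "(\<Sum>((A, B), C)\<in>?j ` nonid. w A B C * Psi A B C) * real (card (?j ` nonid)) =
    (\<Sum>((A, B), C)\<in>?j ` nonid. w A B C) * (\<Sum>((A, B), C)\<in>?j ` nonid. y A B C)"
  proof (rule class_average_triples)
    show "finite (?j ` nonid)" by simp
    show "A \<in> SS \<and> B \<in> SS \<and> C \<in> SS" if "((A, B), C) \<in> ?j ` nonid" for A B C
      using that by (auto simp: nonid_def)
    show "((act X A, act X B), act X C) \<in> ?j ` nonid" if "X \<in> Cl" "((A, B), C) \<in> ?j ` nonid" for X A B C
      using that by (auto simp: nonid_def act_eqv_one)
    show "\<exists>X\<in>Cl. act X A = A' \<and> act X B = B' \<and> act X C = C'"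
      if "((A, B), C) \<in> ?j ` nonid" "((A', B'), C') \<in> ?j ` nonid" for A B C A' B' C'
      using that witt1[of A A'] by (auto simp: nonid_def)
  qed
  then have "(\<Sum>A\<in>nonid. w A A A * Psi A A A) * real (card nonid) = (\<Sum>A\<in>nonid. w A A A) * (\<Sum>A\<in>nonid. y A A A)"
    using inj by (simp add: sum.reindex card_image)
  also have "(\<Sum>A\<in>nonid. w A A A) = diag_weight" unfolding diag_weight_def
    by (intro sum.cong refl) (simp add: nonid_def diag_w power2_eq_square)
  also have "(\<Sum>A\<in>nonid. y A A A) = XX" unfolding XX_nonid[symmetric]
    by (intro sum.cong refl) (simp add: nonid_def diag_w power2_eq_square)
  finally show ?thesis unfolding card_nonid .
qed

lemma class_diag_pairs:
  "(\<Sum>(A, C)\<in>pairs u. w A A C * Psi A A C) * real (card (pairs u)) =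
    (\<Sum>(A, C)\<in>pairs u. D A A * D C C) * (\<Sum>(A, C)\<in>pairs u. xi A * xi C)"
proof -
  let ?j = "\<lambda>(A, C). ((A, A), C)"
  have inj: "inj_on ?j (pairs u)" by (auto simp: inj_on_def)
  have "(\<Sum>((A, B), C)\<in>?j ` pairs u. w A B C * Psi A B C) * real (card (?j ` pairs u)) =
    (\<Sum>((A, B), C)\<in>?j ` pairs u. w A B C) * (\<Sum>((A, B), C)\<in>?j ` pairs u. y A B C)"
  proof (rule class_average_triples)
    show "finite (?j ` pairs u)" by simp
    show "A \<in> SS \<and> B \<in> SS \<and> C \<in> SS" if "((A, B), C) \<in> ?j ` pairs u" for A B C
      using that pairs_D by auto
    show "((act X A, act X B), act X C) \<in> ?j ` pairs u" if X: "X \<in> Cl" and K: "((A, B), C) \<in> ?j ` pairs u" for X A B C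
    proof -
      have AB: "(A, C) \<in> pairs u" and C: "B = A" using K by auto
      have "(act X A, act X C) \<in> pairs u" using AB X pairs_D[OF AB] act_indep2 by (simp add: pairs_def)
      then show ?thesis using C by force
    qed
    show "\<exists>X\<in>Cl. act X A = A' \<and> act X B = B' \<and> act X C = C'"
      if K: "((A, B), C) \<in> ?j ` pairs u" and K': "((A', B'), C') \<in> ?j ` pairs u" for A B C A' B' C'
      using K K' witt2[of A C A' C'] by (auto simp: pairs_def)
  qed
  then have "(\<Sum>(A, C)\<in>pairs u. w A A C * Psi A A C) * real (card (pairs u)) =
    (\<Sum>(A, C)\<in>pairs u. w A A C) * (\<Sum>(A, C)\<in>pairs u. y A A C)"
    using inj by (simp add: sum.reindex card_image case_prod_unfold)
  also have "(\<Sum>(A, C)\<in>pairs u. w A A C) = (\<Sum>(A, C)\<in>pairs u. D A A * D C C)"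
    by (intro sum.cong refl) (auto dest: pairs_D simp: diag_w)
  also have "(\<Sum>(A, C)\<in>pairs u. y A A C) = (\<Sum>(A, C)\<in>pairs u. xi A * xi C)"
    by (intro sum.cong refl) (auto dest: pairs_D simp: diag_w)
  finally show ?thesis .
qed

lemma diag_term_formula:
  "diag_term * (2 * (real d)\<^sup>2 - 2) = 4 * (diag_weight * XX)
    + 2 * ((2 * real d - 2 + diag_weight) / (real d + 2) * (2 * (real d)\<^sup>2 * (tau rho Ob)\<^sup>2 + d * BB - 2 * XX))
    + 2 * ((2 * real d - 2 - diag_weight) / real d * (2 * (real d)\<^sup>2 * (tau rho Ob)\<^sup>2 - d * BB))"
proof -
  have d: "real d > 0" using dpos by simp
  let ?t = "tau rho Ob"
  let ?T = "\<lambda>u. \<Sum>(A, C)\<in>pairs u. w A A C * Psi A A C"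
  have "diag_term = 2 * (\<Sum>A\<in>nonid. 2 * (w A A A * Psi A A A) + (\<Sum>C | indep2 A C \<and> chi A C = 1. w A A C * Psi A A C)
     + (\<Sum>C | indep2 A C \<and> chi A C = - 1. w A A C * Psi A A C))"
    unfolding diag_term_def
  proof (intro arg_cong[where f = "\<lambda>x. 2 * x"] sum.cong refl)
    fix A assume "A \<in> nonid"
    then have A: "A \<in> SS" "\<not> eqv A (1\<^sub>m d)" by (auto simp: nonid_def)
    let ?F = "\<lambda>C. w A A C * Psi A A C"
    have "(\<Sum>C\<in>SS. ?F C) = 2 * (?F (1\<^sub>m d) + ?F A) + (\<Sum>C | indep2 A C. ?F C)"
      using A by (intro sum_indep2) (auto simp: w_neg Psi_neg)
    moreover have "?F (1\<^sub>m d) = 0" using A by (simp add: Psi_one)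
    moreover have "(\<Sum>C | indep2 A C. ?F C) = (\<Sum>C | indep2 A C \<and> chi A C = 1. ?F C) + (\<Sum>C | indep2 A C \<and> chi A C = - 1. ?F C)"
      by (rule sum_indep2_split)
    ultimately show "(\<Sum>C\<in>SS. ?F C) = 2 * ?F A + (\<Sum>C | indep2 A C \<and> chi A C = 1. ?F C) + (\<Sum>C | indep2 A C \<and> chi A C = - 1. ?F C)"
      by simp
  qed
  then have diag_term: "diag_term = 4 * (\<Sum>A\<in>nonid. w A A A * Psi A A A) + 2 * ?T 1 + 2 * ?T (- 1)"
    unfolding sum_pairs by (simp add: sum.distrib sum_distrib_left)
  have p: "?T 1 * (2 * (real d)\<^sup>2 - 2) = (2 * real d - 2 + diag_weight) / (real d + 2) * (2 * (real d)\<^sup>2 * ?t\<^sup>2 + d * BB - 2 * XX)"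
  proof (cases "d = 2")
    case True
    then have "card (pairs 1) = 0" using card_pairs[of 1] by simp
    then have e: "pairs 1 = {}" by simp
    have "2 * (real d)\<^sup>2 * ?t\<^sup>2 + d * BB - 2 * XX = 0" using Y_pairs(1) unfolding e by simp
    then show ?thesis unfolding e by simp
  next
    case False
    then have n: "real d - 2 \<noteq> 0" by simp
    have "(x * z * (real d + 2)) * (real d - 2) = x * (z * ((real d)\<^sup>2 - 2 * (1 + 1)))" for x z
      by (simp add: power2_eq_square algebra_simps)
    then have "(?T 1 * (2 * (real d)\<^sup>2 - 2) * (real d + 2)) * (real d - 2) = ?T 1 * real (card (pairs 1))"
      using card_pairs[of 1] by (simp only: simp_thms)
    also have "\<dots> = ((2 * real d - 2 + diag_weight) * (2 * (real d)\<^sup>2 * ?t\<^sup>2 + d * BB - 2 * XX)) * (real d - 2)"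
      unfolding class_diag_pairs W_pairs Y_pairs by (simp only: mult_ac)
    finally have "?T 1 * (2 * (real d)\<^sup>2 - 2) * (real d + 2) = (2 * real d - 2 + diag_weight) * (2 * (real d)\<^sup>2 * ?t\<^sup>2 + d * BB - 2 * XX)"
      using n mult_right_cancel by blast
    then show ?thesis using d eq_divide_eq[of _ _ "real d + 2"] by simp
  qed
  have m: "?T (- 1) * (2 * (real d)\<^sup>2 - 2) = (2 * real d - 2 - diag_weight) / real d * (2 * (real d)\<^sup>2 * ?t\<^sup>2 - d * BB)"
  proof -
    have "(x * z * real d) * real d = x * (z * ((real d)\<^sup>2 - 2 * (1 + - 1)))" for x z
      by (simp add: power2_eq_square)
    then have "(?T (- 1) * (2 * (real d)\<^sup>2 - 2) * real d) * real d = ?T (- 1) * real (card (pairs (- 1)))"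
      using card_pairs[of "- 1"] by (simp only: simp_thms)
    also have "\<dots> = ((2 * real d - 2 - diag_weight) * (2 * (real d)\<^sup>2 * ?t\<^sup>2 - d * BB)) * real d"
      unfolding class_diag_pairs W_pairs Y_pairs by (simp only: mult_ac)
    finally have "?T (- 1) * (2 * (real d)\<^sup>2 - 2) * real d = (2 * real d - 2 - diag_weight) * (2 * (real d)\<^sup>2 * ?t\<^sup>2 - d * BB)"
      using d mult_right_cancel[of "real d"] by force
    then show ?thesis using d eq_divide_eq[of _ _ "real d"] by simp
  qed
  have "(4 * a + 2 * b + 2 * c) * n = 4 * (a * n) + 2 * (b * n) + 2 * (c * n)" for a b c n :: real
    by (simp add: algebra_simps)
  then show ?thesis unfolding diag_term by (simp only: class_diag p m)
qed

lemma eta_sq: "(\<Sum>A\<in>SS. (eta A)\<^sup>2) = XX"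
proof -
  have "(\<Sum>A\<in>SS. (2 * d * eta A)\<^sup>2) = (\<Sum>A\<in>SS. \<Sum>C\<in>SS. \<Sum>C'\<in>SS. xi C * xi C' * chi A (pj C C'))"
  proof (intro sum.cong refl)
    fix A assume A: "A \<in> SS"
    have "(2 * d * eta A)\<^sup>2 = (\<Sum>C\<in>SS. \<Sum>C'\<in>SS. (chi A C * xi C) * (chi A C' * xi C'))"
      unfolding sum_chi_xi[OF A, symmetric] power2_eq_square by (rule sum_product)
    also have "\<dots> = (\<Sum>C\<in>SS. \<Sum>C'\<in>SS. xi C * xi C' * chi A (pj C C'))"
      using A by (intro sum.cong refl) (simp add: chi_pj)
    finally show "(2 * d * eta A)\<^sup>2 = (\<Sum>C\<in>SS. \<Sum>C'\<in>SS. xi C * xi C' * chi A (pj C C'))" .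
  qed
  also have "\<dots> = (\<Sum>C\<in>SS. \<Sum>C'\<in>SS. xi C * xi C' * (\<Sum>A\<in>SS. chi A (pj C C')))"
  proof -
    have "(\<Sum>A\<in>SS. \<Sum>C\<in>SS. \<Sum>C'\<in>SS. xi C * xi C' * chi A (pj C C')) = (\<Sum>C\<in>SS. \<Sum>A\<in>SS. \<Sum>C'\<in>SS. xi C * xi C' * chi A (pj C C'))"
      by (rule sum.swap)
    also have "\<dots> = (\<Sum>C\<in>SS. \<Sum>C'\<in>SS. \<Sum>A\<in>SS. xi C * xi C' * chi A (pj C C'))"
      by (intro sum.cong[OF refl] sum.swap)
    finally show ?thesis by (simp only: sum_distrib_left)
  qed
  also have "\<dots> = (\<Sum>C\<in>SS. 4 * (real d)\<^sup>2 * (xi C)\<^sup>2)"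
  proof (intro sum.cong refl)
    fix C assume C: "C \<in> SS"
    have "(\<Sum>C'\<in>SS. xi C * xi C' * (\<Sum>A\<in>SS. chi A (pj C C'))) = (\<Sum>C' | C' \<in> SS \<and> True. xi C * xi C' * (if eqv C' C then 2 * (real d)\<^sup>2 else 0))"
    proof (intro sum.cong)
      fix C' assume C': "C' \<in> {C'. C' \<in> SS \<and> True}"
      then have "(\<Sum>A\<in>SS. chi A (pj C C')) = (if eqv C' C then 2 * (real d)\<^sup>2 else 0)"
        using C chi_sum[OF pj_SS[OF C, of C']] eqv_pj[OF C, of C'] eqv_sym[of C C'] by simp
      then show "xi C * xi C' * (\<Sum>A\<in>SS. chi A (pj C C')) = xi C * xi C' * (if eqv C' C then 2 * (real d)\<^sup>2 else 0)" by simp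
    qed simp
    also have "\<dots> = 2 * (xi C * xi C * (2 * (real d)\<^sup>2)) + (\<Sum>C' | C' \<in> SS \<and> True \<and> \<not> eqv C' C. xi C * xi C' * (if eqv C' C then 2 * (real d)\<^sup>2 else 0))"
      using C by (subst sum_remove_eqv[of C]) auto
    also have "\<dots> = 4 * (real d)\<^sup>2 * (xi C)\<^sup>2" by (simp add: power2_eq_square)
    finally show "(\<Sum>C'\<in>SS. xi C * xi C' * (\<Sum>A\<in>SS. chi A (pj C C'))) = 4 * (real d)\<^sup>2 * (xi C)\<^sup>2" .
  qed
  also have "\<dots> = 4 * (real d)\<^sup>2 * XX" unfolding XX_def by (simp add: sum_distrib_left)
  finally have "4 * (real d)\<^sup>2 * (\<Sum>A\<in>SS. (eta A)\<^sup>2) = 4 * (real d)\<^sup>2 * XX"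
    by (simp add: power_mult_distrib sum_distrib_left)
  then show ?thesis using dpos by simp
qed

lemma BB_bound: "\<bar>BB\<bar> \<le> XX"
proof -
  have "0 \<le> (\<Sum>A\<in>SS. (xi A + c * eta A)\<^sup>2)" for c by (simp add: sum_nonneg)
  moreover have "(\<Sum>A\<in>SS. (xi A + c * eta A)\<^sup>2) = XX + 2 * c * BB + c\<^sup>2 * XX" for c
  proof -
    have "(\<Sum>A\<in>SS. (xi A + c * eta A)\<^sup>2) = (\<Sum>A\<in>SS. (xi A)\<^sup>2 + 2 * c * (xi A * eta A) + c\<^sup>2 * (eta A)\<^sup>2)"
      by (intro sum.cong refl) (simp add: power2_eq_square algebra_simps)
    also have "\<dots> = XX + 2 * c * BB + c\<^sup>2 * (\<Sum>A\<in>SS. (eta A)\<^sup>2)"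
      unfolding XX_def BB_def by (simp only: sum.distrib sum_distrib_left)
    finally show ?thesis unfolding eta_sq .
  qed
  ultimately have "0 \<le> XX + 2 * c * BB + c\<^sup>2 * XX" for c by simp
  from this[of 1] this[of "- 1"] show ?thesis by simp
qed

end

lemma le_of_mult_le:
  fixes x c k K :: real
  assumes "x * c \<le> k" "0 < c" "k \<le> K * c"
  shows "x \<le> K"
  using assms by (meson mult_le_cancel_right_pos order_trans)

context shadow_frame
begin

lemma pair_term_le:
  assumes d: "4 \<le> d" and pair_weight: "pair_weight 1 \<le> 2 * d" "pair_weight (- 1) \<le> 2 * d"
  shows "pair_term 1 + pair_term (- 1) \<le> 32 * (real d)^3 / (((real d)\<^sup>2 - 1) * (real d - 2) * (real d + 4)) * (rr * oo)"
proof -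
  define x where "x = real d"
  have x: "4 \<le> x" using d unfolding x_def by simp
  define k where "k = 2 * x / ((x\<^sup>2 - 1) * (x - 2) * (x + 4))"
  have x2: "x\<^sup>2 \<ge> 16" using power_mono[OF x, of 2] by simp
  have k0: "0 \<le> k" unfolding k_def using x x2 by simp
  define S1 where "S1 = 3 * Pp 1 + Vv 1"
  define S2 where "S2 = 3 * Pp (- 1) + Vv (- 1)"
  have S: "0 \<le> S1" "0 \<le> S2" unfolding S1_def S2_def using PV_nonneg by simp_all
  have 1: "pair_term 1 \<le> k * S1"
  proof (rule le_of_mult_le)
    show "pair_term 1 * ((2 * x\<^sup>2 - 2) * (x\<^sup>2 - 4)) \<le> 2 * x * (2 * (x + 2) / (x + 4) * S1)"
    proof -
      have "pair_term 1 * ((2 * x\<^sup>2 - 2) * (x\<^sup>2 - 4)) \<le> pair_weight 1 * (2 * (x + 2) / (x + 4) * S1)"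
        using pair_term_even_le card_pairs[of 1] unfolding x_def S1_def by (simp add: add.commute)
      also have "\<dots> \<le> 2 * x * (2 * (x + 2) / (x + 4) * S1)"
        using pair_weight(1) S x unfolding x_def by (intro mult_right_mono) simp_all
      finally show ?thesis .
    qed
    show "0 < (2 * x\<^sup>2 - 2) * (x\<^sup>2 - 4)" using x2 by simp
    have "k * ((2 * x\<^sup>2 - 2) * (x\<^sup>2 - 4)) = 2 * x * (2 * (x + 2) / (x + 4))"
    proof -
      have e: "x\<^sup>2 - 4 = (x - 2) * (x + 2)" by (simp add: power2_eq_square algebra_simps)
      have n: "x\<^sup>2 - 1 \<noteq> 0" "x - 2 \<noteq> 0" "x + 4 \<noteq> 0" using x x2 by simp_all
      have "2 * x / (a * b * c) * ((2 * a) * (b * f)) = 2 * x * (2 * f / c)" if "a \<noteq> 0" "b \<noteq> 0" "c \<noteq> 0" for a b c f :: real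
        using that by (simp add: field_simps)
      from this[OF n, of "x + 2"] show ?thesis unfolding k_def e by (simp add: algebra_simps)
    qed
    then show "2 * x * (2 * (x + 2) / (x + 4) * S1) \<le> k * S1 * ((2 * x\<^sup>2 - 2) * (x\<^sup>2 - 4))"
      by (simp add: mult_ac)
  qed
  have 2: "pair_term (- 1) \<le> k * S2"
  proof (rule le_of_mult_le)
    show "pair_term (- 1) * ((2 * x\<^sup>2 - 2) * x\<^sup>2) \<le> 2 * x * (2 * x / (x + 2) * S2)"
    proof -
      have "pair_term (- 1) * ((2 * x\<^sup>2 - 2) * x\<^sup>2) \<le> pair_weight (- 1) * (2 * x / (x + 2) * S2)"
        using pair_term_odd_le card_pairs[of "- 1"] unfolding x_def S2_def by (simp add: add.commute)
      also have "\<dots> \<le> 2 * x * (2 * x / (x + 2) * S2)"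
        using pair_weight(2) S x unfolding x_def by (intro mult_right_mono) simp_all
      finally show ?thesis .
    qed
    show "0 < (2 * x\<^sup>2 - 2) * x\<^sup>2" using x2 by (intro mult_pos_pos) linarith+
    have kk: "2 * x * (2 * x / (x + 2)) \<le> k * ((2 * x\<^sup>2 - 2) * x\<^sup>2)"
    proof -
      have n: "x\<^sup>2 - 1 \<noteq> 0" "x - 2 \<noteq> 0" "x + 4 \<noteq> 0" using x x2 by simp_all
      have "2 * x / (a * b * c) * ((2 * a) * x\<^sup>2) = 4 * x\<^sup>2 * (x / (b * c))" if "a \<noteq> 0" "b \<noteq> 0" "c \<noteq> 0" for a b c :: real
        using that by (simp add: field_simps power2_eq_square)
      from this[OF n] have e: "k * ((2 * x\<^sup>2 - 2) * x\<^sup>2) = 4 * x\<^sup>2 * (x / ((x - 2) * (x + 4)))"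
        unfolding k_def by (simp add: algebra_simps)
      have "1 / (x + 2) \<le> x / ((x - 2) * (x + 4))"
      proof -
        have "x / (x * (x + 2)) \<le> x / ((x - 2) * (x + 4))"
          using x by (intro divide_left_mono mult_pos_pos) (simp_all add: algebra_simps)
        then show ?thesis using x by simp
      qed
      then have "4 * x\<^sup>2 * (1 / (x + 2)) \<le> 4 * x\<^sup>2 * (x / ((x - 2) * (x + 4)))"
        by (intro mult_left_mono) simp_all
      then show ?thesis unfolding e by (simp add: power2_eq_square)
    qed
    have "2 * x * (2 * x / (x + 2)) * S2 \<le> k * ((2 * x\<^sup>2 - 2) * x\<^sup>2) * S2"
      by (rule mult_right_mono[OF kk S(2)])
    then show "2 * x * (2 * x / (x + 2) * S2) \<le> k * S2 * ((2 * x\<^sup>2 - 2) * x\<^sup>2)"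
      by (simp add: mult_ac)
  qed
  have "pair_term 1 + pair_term (- 1) \<le> k * (S1 + S2)" using 1 2 by (simp add: distrib_left)
  also have "\<dots> \<le> k * (16 * x\<^sup>2 * (rr * oo))"
    using PV_le k0 unfolding S1_def S2_def x_def by (intro mult_left_mono) simp_all
  also have "\<dots> = 32 * x^3 / ((x\<^sup>2 - 1) * (x - 2) * (x + 4)) * (rr * oo)"
    unfolding k_def by (simp add: power2_eq_square power3_eq_cube)
  finally show ?thesis unfolding x_def .
qed

lemma pair_term_le_2:
  assumes d: "d = 2" and pair_weight: "pair_weight (- 1) \<le> 4"
  shows "pair_term 1 + pair_term (- 1) \<le> 32 / 3 * (rr * oo)"
proof -
  have "card (pairs 1) = 0" using card_pairs[of 1] d by simp
  then have 1: "pair_term 1 = 0" "Pp 1 = 0" "Vv 1 = 0" unfolding pair_term_def Pp_def Vv_def by simp_all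
  have "pair_term (- 1) * 24 \<le> pair_weight (- 1) * (3 * Pp (- 1) + Vv (- 1))"
    using pair_term_odd_le card_pairs[of "- 1"] d by simp
  also have "\<dots> \<le> 4 * (3 * Pp (- 1) + Vv (- 1))" using pair_weight PV_nonneg by (intro mult_right_mono) simp_all
  also have "\<dots> \<le> 4 * (64 * (rr * oo))" using PV_le 1 d by simp
  finally show ?thesis using 1 by (simp add: mult_ac)
qed

lemma diag_term_closed:
  fixes g :: real
  assumes g: "diag_weight = 2 * (d * g - 1)" and d: "2 \<le> d"
  shows "(real d + 1)\<^sup>2 / (8 * (real d)\<^sup>2) * diag_term =
    ((real d + 1) * g - 2) / (real d - 1) * ((real d + 1) / (real d * (real d + 2)) * ((XX + BB) / 2))
    + (real d + 1) * (real d - g) / ((real d - 1) * (real d + 2)) * (tau rho Ob)\<^sup>2"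
proof -
  define x where "x = real d"
  have x: "2 \<le> x" using d unfolding x_def by simp
  let ?t = "(tau rho Ob)\<^sup>2"
  have T: "diag_term * (2 * x\<^sup>2 - 2) = 4 * (2 * (x * g - 1) * XX)
    + 2 * ((2 * x - 2 + 2 * (x * g - 1)) / (x + 2) * (2 * x\<^sup>2 * ?t + x * BB - 2 * XX))
    + 2 * ((2 * x - 2 - 2 * (x * g - 1)) / x * (2 * x\<^sup>2 * ?t - x * BB))"
    using diag_term_formula unfolding g x_def by simp
  have n: "x \<noteq> 0" "x + 2 \<noteq> 0" "x - 1 \<noteq> 0" "x + 1 \<noteq> 0" using x by simp_all
  have T': "diag_term * (2 * x\<^sup>2 - 2) * (x + 2) = 4 * (2 * (x * g - 1) * XX) * (x + 2)
    + 2 * ((2 * x - 2 + 2 * (x * g - 1)) * (2 * x\<^sup>2 * ?t + x * BB - 2 * XX))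
    + 2 * ((2 * x - 2 - 2 * (x * g - 1)) * (2 * x * ?t - BB)) * (x + 2)"
  proof -
    have "c / x * (2 * x\<^sup>2 * ?t - x * BB) = c * (2 * x * ?t - BB)" for c
      using n by (simp add: field_simps power2_eq_square)
    then show ?thesis unfolding T using n by (simp add: distrib_right)
  qed
  have "diag_term * (2 * x\<^sup>2 - 2) * (x + 2) = 8 * x * (((x + 1) * g - 2) * ((XX + BB) ) ) + 16 * x\<^sup>2 * (x - g) * ?t"
    unfolding T' by (simp add: algebra_simps power2_eq_square power3_eq_cube)
  from this have diag_term: "diag_term = (8 * x * (((x + 1) * g - 2) * (XX + BB)) + 16 * x\<^sup>2 * (x - g) * ?t) / ((2 * x\<^sup>2 - 2) * (x + 2))"
  proof -
    have "x\<^sup>2 \<ge> 4" using power_mono[OF x, of 2] by simp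
    then have nz: "(2 * x\<^sup>2 - 2) * (x + 2) \<noteq> 0" using x by simp
    assume "diag_term * (2 * x\<^sup>2 - 2) * (x + 2) = 8 * x * (((x + 1) * g - 2) * ((XX + BB) ) ) + 16 * x\<^sup>2 * (x - g) * ?t"
    then show ?thesis by (simp only: nonzero_eq_divide_eq[OF nz] mult.assoc)
  qed
  have e: "2 * x\<^sup>2 - 2 = 2 * ((x - 1) * (x + 1))" by (simp add: power2_eq_square algebra_simps)
  have "(x + 1)\<^sup>2 / (8 * x\<^sup>2) * diag_term = ((x + 1) * g - 2) / (x - 1) * ((x + 1) / (x * (x + 2)) * ((XX + BB) / 2))
    + (x + 1) * (x - g) / ((x - 1) * (x + 2)) * ?t"
  proof -
    have "(x + 1)\<^sup>2 / (8 * x\<^sup>2) * ((8 * x * (G * V) + 16 * x\<^sup>2 * H * ?t) / (2 * ((x - 1) * (x + 1)) * (x + 2)))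
      = G / (x - 1) * ((x + 1) / (x * (x + 2)) * (V / 2)) + (x + 1) * H / ((x - 1) * (x + 2)) * ?t" for G V H
    proof -
      have "(a)\<^sup>2 / (8 * x\<^sup>2) * ((8 * x * (G * V) + 16 * x\<^sup>2 * H * ?t) / (2 * (b * a) * c))
        = G / b * (a / (x * c) * (V / 2)) + a * H / (b * c) * ?t" if "a \<noteq> 0" "b \<noteq> 0" "c \<noteq> 0" for a b c :: real
        using that n(1) by (simp add: field_simps power2_eq_square)
      from this[OF n(4,3,2)] show ?thesis .
    qed
    then show ?thesis unfolding diag_term e .
  qed
  then show ?thesis unfolding x_def .
qed

lemma XX_le:
  assumes "\<And>A. A \<in> SS \<Longrightarrow> \<not> eqv A (1\<^sub>m d) \<Longrightarrow> \<bar>r A\<bar> \<le> 1"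
  shows "XX \<le> 2 * d * oo"
proof -
  have "XX \<le> (\<Sum>A\<in>SS. (q A)\<^sup>2)"
    unfolding XX_def
  proof (intro sum_mono)
    fix A assume A: "A \<in> SS"
    show "(xi A)\<^sup>2 \<le> (q A)\<^sup>2"
    proof (cases "eqv A (1\<^sub>m d)")
      case True then show ?thesis by (simp add: rq_one)
    next
      case False
      then have "(r A)\<^sup>2 \<le> 1" using assms[OF A] by (simp add: abs_square_le_1)
      then show ?thesis using mult_right_mono[of "(r A)\<^sup>2" 1 "(q A)\<^sup>2"] by (simp add: power_mult_distrib)
    qed
  qed
  then show ?thesis unfolding sum_q2 .
qed

end

lemma variance_arith:
  fixes x g V t T v :: real
  assumes x: "x = 2 \<or> 4 \<le> x" and g: "0 \<le> g" "g \<le> 1"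
    and V: "0 \<le> V" "V \<le> 2 * (x + 1) / (x + 2) * v" and t: "0 \<le> t" "t \<le> v" and v: "0 \<le> v"
    and T: "0 \<le> T" "x = 2 \<Longrightarrow> T \<le> 3 / 2 * v" "4 \<le> x \<Longrightarrow> T \<le> 4 * (x + 1) / ((x - 2) * (x + 4)) * v"
  shows "\<bar>((x + 1) * g - 2) / (x - 1) * V + (x + 1) * (x - g) / ((x - 1) * (x + 2)) * t + T - t - g * V\<bar> \<le> 6 / x * v"
proof -
  have x2: "2 \<le> x" using x by auto
  define K where "K = (x - 1) * (x + 2)"
  have K: "0 < K" unfolding K_def using x2 by simp
  have n: "x - 1 \<noteq> 0" "x + 2 \<noteq> 0" using x2 by simp_all
  have e: "((x + 1) * g - 2) / (x - 1) * V + (x + 1) * (x - g) / ((x - 1) * (x + 2)) * t + T - t - g * V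
    = T - 2 * (1 - g) / (x - 1) * V - ((x + 1) * g - 2) / K * t"
  proof -
    have 1: "((x + 1) * g - 2) / (x - 1) * V - g * V = - (2 * (1 - g) / (x - 1) * V)"
      using n by (simp add: field_simps)
    have 2: "(x + 1) * (x - g) / ((x - 1) * (x + 2)) * t - t = - (((x + 1) * g - 2) / K * t)"
    proof -
      have "(x + 1) * (x - g) = K - ((x + 1) * g - 2)" unfolding K_def by (simp add: algebra_simps)
      then have "(x + 1) * (x - g) / K = 1 - ((x + 1) * g - 2) / K" using K by (simp add: diff_divide_distrib)
      then show ?thesis unfolding K_def[symmetric] by (simp only: left_diff_distrib mult_1)
    qed
    show ?thesis using 1 2 by linarith
  qed
  have V0: "0 \<le> 2 * (1 - g) / (x - 1) * V" using V g x2 by simp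
  have V1: "2 * (1 - g) / (x - 1) * V \<le> 4 * (1 - g) * (x + 1) / K * v"
  proof -
    have "2 * (1 - g) / (x - 1) * V \<le> 2 * (1 - g) / (x - 1) * (2 * (x + 1) / (x + 2) * v)"
      using V g x2 by (intro mult_left_mono) simp_all
    also have "\<dots> = 4 * (1 - g) * (x + 1) / K * v" unfolding K_def by simp (simp add: algebra_simps)
    finally show ?thesis .
  qed
  have tK: "0 \<le> t / K" "t / K \<le> v / K" using t K by (simp_all add: divide_right_mono)
  have vK: "0 \<le> v / K" using v K by simp
  have up: "T - 2 * (1 - g) / (x - 1) * V - ((x + 1) * g - 2) / K * t \<le> 6 / x * v"
  proof -
    have "0 \<le> (x + 1) * g * (t / K)" using tK g x2 by (intro mult_nonneg_nonneg) simp_all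
    moreover have "((x + 1) * g - 2) / K * t = (x + 1) * g * (t / K) - 2 * (t / K)"
      by (simp add: diff_divide_distrib left_diff_distrib)
    moreover have "- c \<le> 2 * b" if "0 \<le> a" "c = a - 2 * b" for a b c :: real using that by linarith
    ultimately have "- (((x + 1) * g - 2) / K * t) \<le> 2 * (t / K)" by blast
    also have "\<dots> \<le> 2 * (v / K)" using tK by simp
    finally have a: "- (((x + 1) * g - 2) / K * t) \<le> 2 / K * v" by simp
    have "T + 2 / K * v \<le> 6 / x * v"
    proof (cases "x = 2")
      case True
      then show ?thesis using T(2) v unfolding K_def by simp
    next
      case False
      then have x4: "4 \<le> x" using x by simp
      have "4 * (x + 1) / ((x - 2) * (x + 4)) + 2 / K \<le> 6 / x"
      proof -
        have q: "x * x \<ge> 4 * x" using x4 by (simp add: mult_right_mono)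
        have e1: "4 * (x + 1) * x = 4 * (x * x) + 4 * x" "16 / 3 * ((x - 2) * (x + 4)) = 16 / 3 * (x * x) + 32 / 3 * x - 128 / 3"
          "K = x * x + x - 2" unfolding K_def by (simp_all add: algebra_simps)
        have frac: "a / b \<le> c / e" if "0 < b" "0 < e" "a * e \<le> c * b" for a b c e :: real
          using that by (simp add: field_simps)
        have "4 * (x + 1) / ((x - 2) * (x + 4)) \<le> (16 / 3) / x"
        proof (rule frac)
          show "4 * (x + 1) * x \<le> 16 / 3 * ((x - 2) * (x + 4))" unfolding e1 using x4 q by linarith
        qed (use x4 in simp_all)
        moreover have "2 / K \<le> (2 / 3) / x"
        proof (rule frac)
          show "2 * x \<le> 2 / 3 * K"
          proof -
            have "2 * x \<le> 2 / 3 * (z + x - 2)" if "4 * x \<le> z" for z using that x4 by (simp add: field_simps)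
            from this[OF q] show ?thesis unfolding e1 .
          qed
        qed (use x4 K in simp_all)
        ultimately show ?thesis by (simp add: add_divide_distrib[symmetric])
      qed
      then have "(4 * (x + 1) / ((x - 2) * (x + 4)) + 2 / K) * v \<le> 6 / x * v" using v by (rule mult_right_mono)
      then show ?thesis using T(3)[OF x4] by (simp add: distrib_right)
    qed
    then show ?thesis using a V0 by linarith
  qed
  have lo: "- (6 / x * v) \<le> T - 2 * (1 - g) / (x - 1) * V - ((x + 1) * g - 2) / K * t"
  proof -
    have b: "((x + 1) * g - 2) / K * t \<le> max 0 ((x + 1) * g - 2) * (v / K)"
    proof -
      have "((x + 1) * g - 2) / K * t = ((x + 1) * g - 2) * (t / K)" by simp
      also have "\<dots> \<le> max 0 ((x + 1) * g - 2) * (t / K)" using tK by (intro mult_right_mono) simp_all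
      also have "\<dots> \<le> max 0 ((x + 1) * g - 2) * (v / K)" using tK by (intro mult_left_mono) simp_all
      finally show ?thesis .
    qed
    have xg: "0 \<le> x * g" "x * g \<le> x" using x2 g by (simp_all add: mult_left_le)
    have "4 * (1 - g) * (x + 1) + max 0 ((x + 1) * g - 2) \<le> 4 * (x + 1)"
      using xg g x2 by (auto simp: max_def algebra_simps)
    also have "\<dots> \<le> 6 / x * K"
    proof -
      have "x * x \<ge> 2 * x" using x2 by (simp add: mult_right_mono)
      then have "4 * (x * x) + 4 * x \<le> 6 * (x * x) + 6 * x - 12" using x2 by linarith
      moreover have "4 * (x + 1) * x = 4 * (x * x) + 4 * x" "6 * K = 6 * (x * x) + 6 * x - 12"
        unfolding K_def by (simp_all add: algebra_simps)
      ultimately have "4 * (x + 1) * x \<le> 6 * K" by simp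
      then show ?thesis using x2 by (simp add: field_simps)
    qed
    finally have "(4 * (1 - g) * (x + 1) + max 0 ((x + 1) * g - 2)) * (v / K) \<le> 6 / x * K * (v / K)"
      using vK by (rule mult_right_mono)
    then have "4 * (1 - g) * (x + 1) / K * v + max 0 ((x + 1) * g - 2) * (v / K) \<le> 6 / x * v"
      using K by (simp add: distrib_right add_divide_distrib)
    then show ?thesis using b V1 T(1) by linarith
  qed
  show ?thesis unfolding e using up lo by (simp add: abs_le_iff)
qed

context shadow_frame
begin

theorem variance_bound:
  fixes g :: real
  assumes d: "d = 2 \<or> 4 \<le> d" and pair_weight: "pair_weight 1 \<le> 2 * d" "pair_weight (- 1) \<le> 2 * d"
    and diag_weight: "diag_weight = 2 * (d * g - 1)" and g: "0 \<le> g" "g \<le> 1"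
    and rb: "\<And>A. A \<in> SS \<Longrightarrow> \<not> eqv A (1\<^sub>m d) \<Longrightarrow> \<bar>r A\<bar> \<le> 1" and rr: "rr \<le> 1 - 1 / d"
  shows "\<bar>(real d + 1)\<^sup>2 * avg (\<lambda>C. (est C)\<^sup>2) - (tau rho Ob)\<^sup>2
    - g * ((real d + 1) / (real d * (real d + 2)) * ((XX + BB) / 2))\<bar> \<le> 6 / d * oo"
proof -
  define x where "x = real d"
  define V where "V = (x + 1) / (x * (x + 2)) * ((XX + BB) / 2)"
  define T where "T = (x + 1)\<^sup>2 / (8 * x\<^sup>2) * (pair_term 1 + pair_term (- 1))"
  have x: "x = 2 \<or> 4 \<le> x" using d unfolding x_def by auto
  have x2: "2 \<le> x" using x by auto
  have tot: "(x + 1)\<^sup>2 * avg (\<lambda>C. (est C)\<^sup>2) = (x + 1)\<^sup>2 / (8 * x\<^sup>2) * diag_term + T"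
  proof -
    have "avg (\<lambda>C. (est C)\<^sup>2) = (diag_term + (pair_term 1 + pair_term (- 1))) / (8 * x\<^sup>2)"
      using est_second_moment split_total x2 unfolding x_def by (simp add: field_simps)
    then show ?thesis unfolding T_def by (simp add: distrib_left add_divide_distrib)
  qed
  have rr1: "rr * oo \<le> (x - 1) / x * oo"
    using rr x2 oo_nonneg unfolding x_def by (intro mult_right_mono) (simp_all add: diff_divide_distrib)
  have V: "0 \<le> V" "V \<le> 2 * (x + 1) / (x + 2) * oo"
  proof -
    have b: "0 \<le> (XX + BB) / 2" "(XX + BB) / 2 \<le> 2 * x * oo"
      using BB_bound XX_le[OF rb] unfolding x_def by auto
    show "0 \<le> V" unfolding V_def using b x2 by (intro mult_nonneg_nonneg) simp_all
    have "V \<le> (x + 1) / (x * (x + 2)) * (2 * x * oo)"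
      unfolding V_def using b x2 by (intro mult_left_mono) simp_all
    also have "\<dots> = 2 * (x + 1) / (x + 2) * oo"
    proof -
      have "b / (x * a) * (2 * x * z) = 2 * b / a * z" if "a \<noteq> 0" for a b z :: real
        using that x2 by (simp add: field_simps)
      then show ?thesis using x2 by simp
    qed
    finally show "V \<le> 2 * (x + 1) / (x + 2) * oo" .
  qed
  have t: "(tau rho Ob)\<^sup>2 \<le> oo"
  proof -
    have "rr * oo \<le> 1 * oo" using rr oo_nonneg dpos by (intro mult_right_mono) (auto intro: order_trans)
    then show ?thesis using tau_cauchy by simp
  qed
  have T0: "0 \<le> T" unfolding T_def using pair_term_nonneg by simp
  have T2: "T \<le> 3 / 2 * oo" if "x = 2"
  proof -
    have d2: "d = 2" using that unfolding x_def by simp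
    have "pair_weight (- 1) \<le> 4" using pair_weight(2) that unfolding x_def by linarith
    then have *: "pair_term 1 + pair_term (- 1) \<le> 32 / 3 * (rr * oo)" by (rule pair_term_le_2[OF d2])
    have "T = 9 / 32 * (pair_term 1 + pair_term (- 1))" unfolding T_def that by simp
    moreover have "rr * oo \<le> 1 / 2 * oo" using rr1 unfolding that by simp
    moreover have "T' \<le> 3 / 2 * o'" if "T' = 9 / 32 * a" "z \<le> 1 / 2 * o'" "a \<le> 32 / 3 * z" for T' o' a z :: real
      using that by linarith
    ultimately show ?thesis using * by blast
  qed
  have T4: "T \<le> 4 * (x + 1) / ((x - 2) * (x + 4)) * oo" if x4: "4 \<le> x"
  proof -
    have d4: "4 \<le> d" using x4 unfolding x_def by simp
    have n: "x + 1 \<noteq> 0" "x - 1 \<noteq> 0" "x - 2 \<noteq> 0" "x + 4 \<noteq> 0" "x \<noteq> 0" using x4 by simp_all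
    have "T \<le> (x + 1)\<^sup>2 / (8 * x\<^sup>2) * (32 * x^3 / ((x\<^sup>2 - 1) * (x - 2) * (x + 4)) * (rr * oo))"
      unfolding T_def using pair_term_le[OF d4 pair_weight] unfolding x_def by (intro mult_left_mono) simp_all
    also have "x\<^sup>2 - 1 = (x - 1) * (x + 1)" by (simp add: power2_eq_square algebra_simps)
    also have "(x + 1)\<^sup>2 / (8 * x\<^sup>2) * (32 * x^3 / ((x - 1) * (x + 1) * (x - 2) * (x + 4)) * (rr * oo))
      = 4 * x * (x + 1) / ((x - 1) * (x - 2) * (x + 4)) * (rr * oo)"
    proof -
      have "a\<^sup>2 / (8 * x\<^sup>2) * (32 * x^3 / (b * a * c * f) * z) = 4 * x * a / (b * c * f) * z"
        if "a \<noteq> 0" "b \<noteq> 0" "c \<noteq> 0" "f \<noteq> 0" for a b c f z :: real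
        using that n(5) by (simp add: field_simps power2_eq_square power3_eq_cube)
      from this[OF n(1-4)] show ?thesis .
    qed
    also have "\<dots> \<le> 4 * x * (x + 1) / ((x - 1) * (x - 2) * (x + 4)) * ((x - 1) / x * oo)"
      using rr1 x4 by (intro mult_left_mono) simp_all
    also have "\<dots> = 4 * (x + 1) / ((x - 2) * (x + 4)) * oo"
    proof -
      have "4 * x * a / (b * c * f) * (b / x * z) = 4 * a / (c * f) * z"
        if "b \<noteq> 0" "c \<noteq> 0" "f \<noteq> 0" for a b c f z :: real
        using that n(5) by (simp add: field_simps)
      from this[OF n(2-4)] show ?thesis .
    qed
    finally show ?thesis .
  qed
  have diag_term: "(x + 1)\<^sup>2 / (8 * x\<^sup>2) * diag_term = ((x + 1) * g - 2) / (x - 1) * V + (x + 1) * (x - g) / ((x - 1) * (x + 2)) * (tau rho Ob)\<^sup>2"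
    using diag_term_closed[OF diag_weight] d unfolding x_def V_def by auto
  have "\<bar>((x + 1) * g - 2) / (x - 1) * V + (x + 1) * (x - g) / ((x - 1) * (x + 2)) * (tau rho Ob)\<^sup>2 + T - (tau rho Ob)\<^sup>2 - g * V\<bar> \<le> 6 / x * oo"
    by (rule variance_arith[OF x g V _ t oo_nonneg T0 T2 T4]) simp
  then show ?thesis using tot diag_term unfolding x_def V_def by simp
qed

end

section \<open>Pauli strings\<close>

lemma kron_carrier [simp]:
  "A \<in> carrier_mat m n \<Longrightarrow> B \<in> carrier_mat p q \<Longrightarrow> kron A B \<in> carrier_mat (m * p) (n * q)"
  by (auto simp: kron_def)

lemma kron_dim [simp]: "dim_row (kron A B) = dim_row A * dim_row B" "dim_col (kron A B) = dim_col A * dim_col B"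
  by (simp_all add: kron_def)

lemma kron_index:
  "i < dim_row A * dim_row B \<Longrightarrow> j < dim_col A * dim_col B \<Longrightarrow>
    kron A B $$ (i, j) = A $$ (i div dim_row B, j div dim_col B) * B $$ (i mod dim_row B, j mod dim_col B)"
  by (simp add: kron_def)

lemma div_mod_less:
  assumes "i < m * (n :: nat)"
  shows "i div n < m" "i mod n < n" "0 < n"
proof -
  show n: "0 < n" using assms by (cases n) auto
  show "i div n < m" using assms by (simp add: less_mult_imp_div_less)
  show "i mod n < n" using n by simp
qed

lemma sum_div_mod:
  fixes f :: "nat \<Rightarrow> nat \<Rightarrow> 'b :: comm_monoid_add"
  shows "(\<Sum>i<m * n. f (i div n) (i mod n)) = (\<Sum>a<m. \<Sum>b<n. f a b)"
proof -
  have "(\<Sum>i<m * n. f (i div n) (i mod n)) = (\<Sum>(a, b)\<in>{..<m} \<times> {..<n}. f a b)"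
  proof (rule sum.reindex_bij_witness[of _ "\<lambda>(a, b). a * n + b" "\<lambda>i. (i div n, i mod n)"])
    fix p assume "p \<in> {..<m} \<times> {..<n}"
    then obtain a b where p: "p = (a, b)" "a < m" "b < n" by auto
    have "a * n + b < (a + 1) * n" using p by simp
    also have "\<dots> \<le> m * n" using p by (intro mult_right_mono) auto
    finally show "(case p of (a, b) \<Rightarrow> a * n + b) \<in> {..<m * n}" using p by simp
  qed (auto simp: div_mod_less)
  then show ?thesis by (simp add: sum.cartesian_product)
qed

lemma kron_mult:
  assumes A: "A \<in> carrier_mat m n" and C: "C \<in> carrier_mat n p"
    and B: "B \<in> carrier_mat m' n'" and D: "D \<in> carrier_mat n' p'"
  shows "kron A B * kron C D = kron (A * C) (B * D)"
proof (rule eq_matI)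
  fix i j assume "i < dim_row (kron (A * C) (B * D))" "j < dim_col (kron (A * C) (B * D))"
  then have ij: "i < m * m'" "j < p * p'" using assms by auto
  have "(kron A B * kron C D) $$ (i, j) = (\<Sum>k<n * n'. kron A B $$ (i, k) * kron C D $$ (k, j))"
    using ij assms by (intro index_mult_mat_sum) auto
  also have "\<dots> = (\<Sum>k<n * n'. (A $$ (i div m', k div n') * C $$ (k div n', j div p')) *
      (B $$ (i mod m', k mod n') * D $$ (k mod n', j mod p')))"
    using ij assms by (intro sum.cong refl) (simp add: kron_index)
  also have "\<dots> = (\<Sum>a<n. \<Sum>b<n'. (A $$ (i div m', a) * C $$ (a, j div p')) * (B $$ (i mod m', b) * D $$ (b, j mod p')))"
    by (rule sum_div_mod[where f = "\<lambda>a b. (A $$ (i div m', a) * C $$ (a, j div p')) * (B $$ (i mod m', b) * D $$ (b, j mod p'))"])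
  also have "\<dots> = (A * C) $$ (i div m', j div p') * (B * D) $$ (i mod m', j mod p')"
    using ij div_mod_less[OF ij(1)] div_mod_less[OF ij(2)]
    by (simp add: index_mult_mat_sum[OF A C] index_mult_mat_sum[OF B D] sum_product)
  also have "\<dots> = kron (A * C) (B * D) $$ (i, j)" using ij assms by (simp add: kron_index)
  finally show "(kron A B * kron C D) $$ (i, j) = kron (A * C) (B * D) $$ (i, j)" .
qed (use assms in auto)

lemma kron_adj: "adj (kron A B) = kron (adj A) (adj B)"
  by (rule eq_matI) (auto simp: adj_def kron_def div_mod_less)

lemma kron_one: "kron (1\<^sub>m m) (1\<^sub>m n) = 1\<^sub>m (m * n)"
proof (rule eq_matI)
  fix i j assume "i < dim_row (1\<^sub>m (m * n))" "j < dim_col (1\<^sub>m (m * n))"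
  then have ij: "i < m * n" "j < m * n" by auto
  have "i = j \<longleftrightarrow> i div n = j div n \<and> i mod n = j mod n" by (metis div_mult_mod_eq)
  then show "kron (1\<^sub>m m) (1\<^sub>m n) $$ (i, j) = 1\<^sub>m (m * n) $$ (i, j)"
    using ij div_mod_less[OF ij(1)] div_mod_less[OF ij(2)] by (auto simp: kron_index)
qed auto

lemma kron_smult:
  "kron (c \<cdot>\<^sub>m A) B = c \<cdot>\<^sub>m kron A B" "kron A (c \<cdot>\<^sub>m B) = c \<cdot>\<^sub>m kron A B"
  by (rule eq_matI; auto simp: kron_def div_mod_less)+

lemma kron_add:
  assumes "A \<in> carrier_mat m n" "A' \<in> carrier_mat m n"
  shows "kron (A + A') B = kron A B + kron A' B" "kron B (A + A') = kron B A + kron B A'"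
  using assms by (intro eq_matI; auto simp: kron_def div_mod_less algebra_simps)+

lemma kron_trace:
  assumes "A \<in> carrier_mat m m" "B \<in> carrier_mat n n"
  shows "mtrace (kron A B) = mtrace A * mtrace B"
proof -
  have "mtrace (kron A B) = (\<Sum>i<m * n. A $$ (i div n, i div n) * B $$ (i mod n, i mod n))"
    using assms unfolding mtrace_def by (intro sum.cong) (auto simp: kron_index)
  also have "\<dots> = (\<Sum>a<m. \<Sum>b<n. A $$ (a, a) * B $$ (b, b))"
    by (rule sum_div_mod[where f = "\<lambda>a b. A $$ (a, a) * B $$ (b, b)"])
  also have "\<dots> = mtrace A * mtrace B" using assms by (simp add: mtrace_def sum_product)
  finally show ?thesis .
qed

abbreviation kl :: "complex mat list \<Rightarrow> complex mat" where "kl \<equiv> kron_list"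

lemma kron_list_carrier [simp]:
  "set Ps \<subseteq> carrier_mat 2 2 \<Longrightarrow> kl Ps \<in> carrier_mat (2 ^ length Ps) (2 ^ length Ps)"
  by (induction Ps) auto

lemma kron_list_mult:
  assumes "length Ps = length Qs" "set Ps \<subseteq> carrier_mat 2 2" "set Qs \<subseteq> carrier_mat 2 2"
  shows "kl Ps * kl Qs = kl (map2 (*) Ps Qs)"
  using assms
proof (induction Ps Qs rule: list_induct2)
  case (Cons P Ps Q Qs)
  then show ?case using kron_mult[of P 2 2 Q 2 "kl Ps" "2 ^ length Ps" "2 ^ length Ps" "kl Qs" "2 ^ length Qs"]
    kron_list_carrier[of Ps] by simp
qed simp

lemma kron_list_adj: "adj (kl Ps) = kl (map adj Ps)"
  by (induction Ps) (simp_all add: kron_adj)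

lemma smult_smult_mat: "c \<cdot>\<^sub>m (e \<cdot>\<^sub>m (A :: complex mat)) = (c * e) \<cdot>\<^sub>m A"
  by (rule eq_matI) auto

lemma one_smult_mat: "1 \<cdot>\<^sub>m (A :: complex mat) = A"
  by (rule eq_matI) auto

lemma kron_list_smult_map2:
  assumes "length cs = length Ps"
  shows "kl (map2 (\<lambda>c P. c \<cdot>\<^sub>m P) cs Ps) = prod_list cs \<cdot>\<^sub>m kl Ps"
  using assms by (induction cs Ps rule: list_induct2) (simp_all add: kron_smult smult_smult_mat one_smult_mat mult.commute)

lemma kron_list_append: "kron (kl Ps) (kl Qs) = kl (Ps @ Qs)"
  if "set Ps \<subseteq> carrier_mat 2 2" "set Qs \<subseteq> carrier_mat 2 2" for Ps Qs
  using that
proof (induction Ps)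
  case Nil
  then have Q: "kl Qs \<in> carrier_mat (2 ^ length Qs) (2 ^ length Qs)" by simp
  show ?case using Q by (intro eq_matI) (auto simp: kron_index)
next
  case (Cons P Ps)
  have P: "P \<in> carrier_mat 2 2" using Cons by simp
  have assoc: "kron (kron P A) B = kron P (kron A B)"
    if A: "A \<in> carrier_mat a a" and B: "B \<in> carrier_mat b b" for A B a b
  proof (rule eq_matI)
    fix i j assume "i < dim_row (kron P (kron A B))" "j < dim_col (kron P (kron A B))"
    then have ij: "i < 2 * (a * b)" "j < 2 * (a * b)" using P A B by auto
    have ij': "i < 2 * a * b" "j < 2 * a * b" using ij by (simp_all add: mult.assoc)
    note l = div_mod_less[OF ij(1)] div_mod_less[OF ij(2)] div_mod_less[OF ij'(1)] div_mod_less[OF ij'(2)]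
    have "0 < b" using ij by (cases b) auto
    then have e: "x div b div a = x div (a * b)" "x div b mod a = x mod (a * b) div b" "x mod (a * b) mod b = x mod b" for x
      by (simp_all add: div_mult2_eq[symmetric] mult.commute[of a b] mod_mult2_eq)
    show "kron (kron P A) B $$ (i, j) = kron P (kron A B) $$ (i, j)"
      using P A B ij ij' l by (simp add: kron_index e mult_ac)
  qed (use P A B in auto)
  show ?case using Cons assoc[of "kl Ps" "2 ^ length Ps" "kl Qs" "2 ^ length Qs"]
    kron_list_carrier[of Ps] by simp
qed

lemma kpow_map: "kpow A m = kl (replicate m A)"
  by (simp add: kpow_def)

lemma pauli1_carrier [simp]: "pauli1 a \<in> carrier_mat 2 2"
  by (simp add: pauli1_def I2_def PX_def PY_def PZ_def)

lemma pauli1_dim [simp]: "dim_row (pauli1 a) = 2" "dim_col (pauli1 a) = 2"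
  by (simp_all add: pauli1_def I2_def PX_def PY_def PZ_def)

lemma adj_index: "A \<in> carrier_mat m n \<Longrightarrow> i < n \<Longrightarrow> j < m \<Longrightarrow> adj A $$ (i, j) = cnj (A $$ (j, i))"
  by (auto simp: adj_def)

lemma lt2: "(i :: nat) < 2 \<longleftrightarrow> i = 0 \<or> i = 1" by auto

lemma mult2_index:
  fixes A B :: "complex mat"
  assumes "A \<in> carrier_mat 2 2" "B \<in> carrier_mat 2 2" "i < 2" "j < 2"
  shows "(A * B) $$ (i, j) = A $$ (i, 0) * B $$ (0, j) + A $$ (i, 1) * B $$ (1, j)"
proof -
  have "(\<Sum>k<2. f k) = f 0 + f 1" for f :: "nat \<Rightarrow> complex" by (simp add: numeral_2_eq_2)
  note sum2 = this
  show ?thesis unfolding index_mult_mat_sum[OF assms] sum2 ..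
qed

lemma pauli1_index:
  "i < 2 \<Longrightarrow> j < 2 \<Longrightarrow> pauli1 a $$ (i, j) =
    (if a = 0 then (if i = j then 1 else 0)
     else if a = 1 then (if i \<noteq> j then 1 else 0)
     else if a = 2 then (if i = 0 \<and> j = 1 then - \<i> else if i = 1 \<and> j = 0 then \<i> else 0)
     else (if i = j then (if i = 0 then 1 else - 1) else 0))"
  by (simp add: pauli1_def I2_def PX_def PY_def PZ_def)

lemma eq_mat2I:
  assumes "A \<in> carrier_mat 2 2" "B \<in> carrier_mat 2 2"
    "A $$ (0, 0) = B $$ (0, 0)" "A $$ (0, 1) = B $$ (0, 1)" "A $$ (1, 0) = B $$ (1, 0)" "A $$ (1, 1) = B $$ (1, 1)"
  shows "A = B"
  using assms by (intro eq_matI) (auto simp: lt2)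

text \<open>The label of a product of single-qubit Paulis, and its phase.\<close>

definition pauli_xor :: "nat \<Rightarrow> nat \<Rightarrow> nat" where
  "pauli_xor a b = (if a = 0 then b else if b = 0 then a else if a = b then 0 else 6 - a - b)"

definition pauli_phase :: "nat \<Rightarrow> nat \<Rightarrow> complex" where
  "pauli_phase a b = (if a = 0 \<or> b = 0 \<or> a = b then 1 else if (a, b) \<in> {(1, 2), (2, 3), (3, 1)} then \<i> else - \<i>)"

lemma lt4: "(a :: nat) < 4 \<longleftrightarrow> a = 0 \<or> a = 1 \<or> a = 2 \<or> a = 3" by auto

lemma pauli_xor_less: "a < 4 \<Longrightarrow> b < 4 \<Longrightarrow> pauli_xor a b < 4"
  by (auto simp: pauli_xor_def lt4)

lemma pauli1_mult:
  assumes "a < 4" "b < 4"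
  shows "pauli1 a * pauli1 b = pauli_phase a b \<cdot>\<^sub>m pauli1 (pauli_xor a b)"
  using assms
  unfolding lt4
  by (elim disjE; simp only:; intro eq_mat2I)
     (simp_all add: pauli_xor_def pauli_phase_def mult2_index pauli1_index mult_carrier_mat[of _ 2 2] del: index_mult_mat(1))

lemma pauli1_adj: "adj (pauli1 a) = pauli1 a"
  by (intro eq_mat2I) (simp_all add: adj_index[of _ 2 2] pauli1_index)

lemma pauli1_sq: "pauli1 a * pauli1 a = 1\<^sub>m 2"
  by (intro eq_mat2I) (auto simp: mult2_index pauli1_index mult_carrier_mat[of _ 2 2] simp del: index_mult_mat(1))

lemma pauli1_trace: "mtrace (pauli1 a) = (if a = 0 then 2 else 0)"
proof -
  have "mtrace (pauli1 a) = pauli1 a $$ (0, 0) + pauli1 a $$ (1, 1)"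
    using pauli1_carrier[of a] by (simp add: mtrace_def numeral_2_eq_2)
  then show ?thesis by (simp add: pauli1_index)
qed

lemma pauli1_complete:
  assumes "i < 2" "j < 2" "k < 2" "l < 2"
  shows "(\<Sum>a<4. pauli1 a $$ (i, j) * pauli1 a $$ (k, l)) = (if i = l \<and> j = k then 2 else 0)"
  using assms by (auto simp: lt2 numeral_eq_Suc pauli1_index)

definition labels :: "nat \<Rightarrow> nat list set" where
  "labels n = {as. length as = n \<and> set as \<subseteq> {0..<4}}"

abbreviation pl :: "nat list \<Rightarrow> complex mat" where "pl as \<equiv> kl (map pauli1 as)"

lemma fin_labels [simp]: "finite (labels n)"
  using finite_lists_length_eq[of "{0..<4 :: nat}" n] by (simp add: labels_def conj_commute)

lemma pauli_set_labels: "pauli_set n = pl ` labels n"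
  by (simp add: pauli_set_def labels_def)

lemma pl_carrier [simp]: "as \<in> labels n \<Longrightarrow> pl as \<in> carrier_mat (2 ^ n) (2 ^ n)"
  using kron_list_carrier[of "map pauli1 as"] by (simp add: labels_def image_subset_iff)

lemma labels_Suc: "labels (Suc n) = (\<lambda>(a, as). a # as) ` ({..<4} \<times> labels n)"
proof (intro equalityI subsetI)
  fix xs assume "xs \<in> labels (Suc n)"
  then show "xs \<in> (\<lambda>(a, as). a # as) ` ({..<4} \<times> labels n)"
    by (cases xs) (auto simp: labels_def image_iff)
qed (auto simp: labels_def)

lemma labels_0: "labels 0 = {[]}" by (auto simp: labels_def)

lemma sum_labels_Suc: "(\<Sum>as\<in>labels (Suc n). f as) = (\<Sum>a<4. \<Sum>as\<in>labels n. f (a # as))"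
  unfolding labels_Suc by (subst sum.reindex) (auto simp: inj_on_def sum.cartesian_product case_prod_unfold)

lemma pl_adj: "adj (pl as) = pl as"
  by (simp add: kron_list_adj pauli1_adj comp_def)

lemma pl_mult:
  assumes "as \<in> labels n" "bs \<in> labels n"
  shows "pl as * pl bs = prod_list (map2 pauli_phase as bs) \<cdot>\<^sub>m pl (map2 pauli_xor as bs)"
proof -
  have l: "length as = length bs" "set as \<subseteq> {0..<4}" "set bs \<subseteq> {0..<4}" using assms by (auto simp: labels_def)
  have "pl as * pl bs = kl (map2 (*) (map pauli1 as) (map pauli1 bs))"
    using l by (intro kron_list_mult) auto
  also have "map2 (*) (map pauli1 as) (map pauli1 bs) = map2 (\<lambda>c P. c \<cdot>\<^sub>m P) (map2 pauli_phase as bs) (map pauli1 (map2 pauli_xor as bs))"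
    using l by (induction as bs rule: list_induct2) (auto simp: pauli1_mult)
  also have "kl \<dots> = prod_list (map2 pauli_phase as bs) \<cdot>\<^sub>m pl (map2 pauli_xor as bs)"
    using l by (intro kron_list_smult_map2) simp
  finally show ?thesis .
qed

lemma map2_pauli_xor_labels: "as \<in> labels n \<Longrightarrow> bs \<in> labels n \<Longrightarrow> map2 pauli_xor as bs \<in> labels n"
proof -
  assume l: "as \<in> labels n" "bs \<in> labels n"
  have "pauli_xor a b < 4" if "(a, b) \<in> set (zip as bs)" for a b
    using l set_zip_leftD[OF that] set_zip_rightD[OF that] by (intro pauli_xor_less) (auto simp: labels_def)
  then show "map2 pauli_xor as bs \<in> labels n" using l by (auto simp: labels_def)
qed

lemma prod_pauli_phase: "prod_list (map2 pauli_phase as bs) \<in> {1, - 1, \<i>, - \<i>}"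
proof (induction as arbitrary: bs)
  case (Cons a as)
  show ?case
  proof (cases bs)
    case (Cons b bs')
    have "pauli_phase a b \<in> {1, \<i>, - \<i>}" by (simp add: pauli_phase_def)
    then show ?thesis using Cons.IH[of bs'] Cons by auto
  qed simp
qed simp

lemma pl_sq: "as \<in> labels n \<Longrightarrow> pl as * pl as = 1\<^sub>m (2 ^ n)"
proof (induction n arbitrary: as)
  case (Suc n)
  then obtain a bs where e: "as = a # bs" "bs \<in> labels n" by (auto simp: labels_Suc)
  have "pl as * pl as = kron (pauli1 a * pauli1 a) (pl bs * pl bs)"
    using e kron_mult[of "pauli1 a" 2 2 "pauli1 a" 2 "pl bs" "2 ^ n" "2 ^ n" "pl bs" "2 ^ n"] by simp
  then show ?case using Suc.IH[OF e(2)] by (simp add: pauli1_sq kron_one)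
qed (simp add: labels_0)

lemma pl_trace: "as \<in> labels n \<Longrightarrow> mtrace (pl as) = (if as = replicate n 0 then 2 ^ n else 0)"
proof (induction n arbitrary: as)
  case 0 then show ?case by (simp add: labels_0)
next
  case (Suc n)
  then obtain a bs where e: "as = a # bs" "bs \<in> labels n" by (auto simp: labels_Suc)
  have "mtrace (pl as) = mtrace (pauli1 a) * mtrace (pl bs)"
    using e kron_trace[OF pauli1_carrier pl_carrier[OF e(2)]] by simp
  then show ?case using Suc.IH[OF e(2)] e by (auto simp: pauli1_trace)
qed

lemma pl_zero: "pl (replicate n 0) = 1\<^sub>m (2 ^ n)"
  by (induction n) (simp_all add: pauli1_def I2_def kron_one)

lemma zero_labels: "replicate n 0 \<in> labels n"
  by (auto simp: labels_def)

lemma pauli_xor_zero: "as \<in> labels n \<Longrightarrow> bs \<in> labels n \<Longrightarrow> map2 pauli_xor as bs = replicate n 0 \<Longrightarrow> as = bs"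
proof (induction n arbitrary: as bs)
  case (Suc n)
  then obtain a as' b bs' where e: "as = a # as'" "as' \<in> labels n" "bs = b # bs'" "bs' \<in> labels n" "a < 4" "b < 4"
    by (auto simp: labels_Suc)
  have "pauli_xor a b = 0 \<Longrightarrow> a = b" using e by (auto simp: pauli_xor_def lt4 split: if_splits)
  then show ?case using Suc e by auto
qed (simp add: labels_0)

lemma pl_inj: "inj_on pl (labels n)"
proof (rule inj_onI)
  fix as bs assume l: "as \<in> labels n" "bs \<in> labels n" and e: "pl as = pl bs"
  have "mtrace (pl as * pl bs) = 2 ^ n" unfolding e pl_sq[OF l(2)] by simp
  then have "prod_list (map2 pauli_phase as bs) * mtrace (pl (map2 pauli_xor as bs)) = 2 ^ n"
    unfolding pl_mult[OF l] mtrace_smult[OF pl_carrier[OF map2_pauli_xor_labels[OF l]]] .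
  then have "map2 pauli_xor as bs = replicate n 0"
    using pl_trace[OF map2_pauli_xor_labels[OF l]] by (auto split: if_splits)
  then show "as = bs" using pauli_xor_zero l by blast
qed

lemma sum_pauli_set: "(\<Sum>P\<in>pauli_set n. f P) = (\<Sum>as\<in>labels n. f (pl as))"
  unfolding pauli_set_labels by (simp add: sum.reindex[OF pl_inj])

lemma pl_complete:
  assumes "i < 2 ^ n" "j < 2 ^ n" "k < 2 ^ n" "l < 2 ^ n"
  shows "(\<Sum>as\<in>labels n. pl as $$ (i, j) * pl as $$ (k, l)) = (if i = l \<and> j = k then 2 ^ n else 0)"
  using assms
proof (induction n arbitrary: i j k l)
  case 0 then show ?case by (simp add: labels_0)
next
  case (Suc n)
  let ?m = "2 ^ n :: nat"
  have b: "i < 2 * ?m" "j < 2 * ?m" "k < 2 * ?m" "l < 2 * ?m" using Suc.prems by simp_all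
  note lt = div_mod_less[OF b(1)] div_mod_less[OF b(2)] div_mod_less[OF b(3)] div_mod_less[OF b(4)]
  have "(\<Sum>as\<in>labels (Suc n). pl as $$ (i, j) * pl as $$ (k, l)) =
    (\<Sum>a<4. \<Sum>as\<in>labels n. (pauli1 a $$ (i div ?m, j div ?m) * pauli1 a $$ (k div ?m, l div ?m)) *
      (pl as $$ (i mod ?m, j mod ?m) * pl as $$ (k mod ?m, l mod ?m)))"
    unfolding sum_labels_Suc
  proof (intro sum.cong refl)
    fix a as assume as: "as \<in> labels n"
    have d: "dim_row (pl as) = ?m" "dim_col (pl as) = ?m" "dim_row (pauli1 a) = 2" "dim_col (pauli1 a) = 2"
      using pl_carrier[OF as] pauli1_carrier[of a] by auto
    show "pl (a # as) $$ (i, j) * pl (a # as) $$ (k, l) = (pauli1 a $$ (i div ?m, j div ?m) * pauli1 a $$ (k div ?m, l div ?m)) *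
      (pl as $$ (i mod ?m, j mod ?m) * pl as $$ (k mod ?m, l mod ?m))"
      using b d by (simp add: kron_index mult_ac)
  qed
  also have "\<dots> = (\<Sum>a<4. pauli1 a $$ (i div ?m, j div ?m) * pauli1 a $$ (k div ?m, l div ?m)) *
     (\<Sum>as\<in>labels n. pl as $$ (i mod ?m, j mod ?m) * pl as $$ (k mod ?m, l mod ?m))"
    by (simp add: sum_product)
  also have "\<dots> = (if i div ?m = l div ?m \<and> j div ?m = k div ?m then 2 else 0) *
     (if i mod ?m = l mod ?m \<and> j mod ?m = k mod ?m then 2 ^ n else 0)"
    using lt by (simp add: pauli1_complete Suc.IH)
  also have "\<dots> = (if i = l \<and> j = k then 2 ^ Suc n else 0)"
  proof -
    have "x = z \<longleftrightarrow> x div ?m = z div ?m \<and> x mod ?m = z mod ?m" for x z by (metis div_mult_mod_eq)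
    from this[of i l] this[of j k] show ?thesis by auto
  qed
  finally show ?case .
qed

interpretation pf: pauli_frame "2 ^ n" "pauli_set n" for n
proof
  show "0 < (2 :: nat) ^ n" by simp
  show "finite (pauli_set n)" by (simp add: pauli_set_labels)
  show "P \<in> carrier_mat (2 ^ n) (2 ^ n)" if "P \<in> pauli_set n" for P using that by (auto simp: pauli_set_labels)
  show "1\<^sub>m (2 ^ n) \<in> pauli_set n" using pl_zero[of n] zero_labels[of n] by (force simp: pauli_set_labels)
  show "adj P = P" if "P \<in> pauli_set n" for P using that by (auto simp: pauli_set_labels pl_adj)
  show "P * P = 1\<^sub>m (2 ^ n)" if "P \<in> pauli_set n" for P using that by (auto simp: pauli_set_labels pl_sq)
  show "\<exists>R\<in>pauli_set n. \<exists>c\<in>{1, - 1, \<i>, - \<i>}. P * Q = c \<cdot>\<^sub>m R" if "P \<in> pauli_set n" "Q \<in> pauli_set n" for P Q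
    using that pl_mult map2_pauli_xor_labels prod_pauli_phase unfolding pauli_set_labels by blast
  show "mtrace P = 0" if "P \<in> pauli_set n" "P \<noteq> 1\<^sub>m (2 ^ n)" for P
    using that pl_trace pl_zero by (auto simp: pauli_set_labels)
  show "(\<Sum>P\<in>pauli_set n. P $$ (i, j) * P $$ (k, l)) = (if i = l \<and> j = k then of_nat (2 ^ n) else 0)"
    if "i < 2 ^ n" "j < 2 ^ n" "k < 2 ^ n" "l < 2 ^ n" for i j k l
    using pl_complete[OF that] by (simp add: sum_pauli_set)
qed

context pauli_frame
begin

lemma mat_eq_by_trace:
  assumes X: "X \<in> carrier_mat d d" and Y: "Y \<in> carrier_mat d d"
    and e: "\<And>E. E \<in> carrier_mat d d \<Longrightarrow> mtrace (E * X) = mtrace (E * Y)"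
  shows "X = Y"
proof (rule eq_matI)
  fix i j assume "i < dim_row Y" "j < dim_col Y"
  then have ij: "i < d" "j < d" using Y by auto
  let ?E = "mat d d (\<lambda>(a, b). if a = j \<and> b = i then 1 else 0) :: complex mat"
  have "mtrace (?E * Z) = Z $$ (i, j)" if Z: "Z \<in> carrier_mat d d" for Z
  proof -
    have layer_corr_prod: "(if Q then 1 else 0) * x = (if Q then x else 0)" for Q and x :: complex by simp
    have "mtrace (?E * Z) = (\<Sum>a<d. \<Sum>b<d. (if a = j \<and> b = i then 1 else 0) * Z $$ (b, a))"
      using Z by (subst mtrace_mult[of _ d d]) auto
    also have "\<dots> = (\<Sum>a<d. if a = j then (\<Sum>b<d. if b = i then Z $$ (b, a) else 0) else 0)"
      unfolding layer_corr_prod by (intro sum.cong refl) simp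
    also have "\<dots> = Z $$ (i, j)" using ij by simp
    finally show ?thesis .
  qed
  then show "X $$ (i, j) = Y $$ (i, j)" using e[of ?E] X Y by simp
qed (use X Y in auto)

text \<open>Schur's lemma for the irreducible action of the Pauli group.\<close>

lemma commutes_paulis_scalar:
  assumes X: "X \<in> carrier_mat d d" and c: "\<And>P. P \<in> PP \<Longrightarrow> P * X = X * P"
  shows "X = (mtrace X / of_nat d) \<cdot>\<^sub>m 1\<^sub>m d"
proof (rule mat_eq_by_trace[OF X])
  fix E :: "complex mat" assume E: "E \<in> carrier_mat d d"
  have card: "of_nat (card PP) = (of_nat d * of_nat d :: complex)"
  proof -
    have "(\<Sum>P\<in>PP. mtrace ((1\<^sub>m d * P) * (1\<^sub>m d * P))) = of_nat d * of_nat d * of_nat d"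
      by (subst twirl_trace) auto
    then have "of_nat (card PP) * of_nat d = (of_nat d * of_nat d * of_nat d :: complex)"
      by (simp add: PP_carrier PP_sq)
    then show ?thesis using dpos by simp
  qed
  have "(E * P) * (X * P) = E * X" if "P \<in> PP" for P
  proof -
    have "(E * P) * (X * P) = E * (P * X) * P" using E X that by (simp add: assoc PP_carrier)
    also have "\<dots> = E * X" unfolding c[OF that] using E X that by (simp add: assoc PP_carrier PP_sq)
    finally show ?thesis .
  qed
  then have "of_nat (card PP) * mtrace (E * X) = of_nat d * mtrace E * mtrace X"
    using twirl_trace[OF E X] by simp
  then have "of_nat d * mtrace (E * X) = mtrace E * mtrace X" unfolding card using dpos by simp
  then show "mtrace (E * X) = mtrace (E * ((mtrace X / of_nat d) \<cdot>\<^sub>m 1\<^sub>m d))"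
    using E dpos by (simp add: field_simps)
qed simp

lemma adj_transvection:
  "P \<in> SS \<Longrightarrow> adj (c \<cdot>\<^sub>m (1\<^sub>m d + \<i> \<cdot>\<^sub>m P)) = cnj c \<cdot>\<^sub>m (1\<^sub>m d + \<i> \<cdot>\<^sub>m (- 1 \<cdot>\<^sub>m P))"
  by simp

lemma act_transvection_SS:
  assumes P: "P \<in> SS" and A: "A \<in> SS" and c: "c * cnj c * 2 = 1"
  shows "act (c \<cdot>\<^sub>m (1\<^sub>m d + \<i> \<cdot>\<^sub>m P)) A \<in> SS"
proof (cases "chi P A = 1")
  case True then show ?thesis using act_transvection[OF P A c] A by simp
next
  case False
  then have "\<i> \<cdot>\<^sub>m (P * A) = pj P A" by (simp add: pj_def chi_def split: if_splits)
  then show ?thesis using act_transvection[OF P A c] P A False by simp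
qed

lemma act_smultL: "U \<in> carrier_mat d d \<Longrightarrow> A \<in> carrier_mat d d \<Longrightarrow> act (z \<cdot>\<^sub>m U) A = (z * cnj z) \<cdot>\<^sub>m act U A"
  by (simp add: act_def mult_ac)

text \<open>A unitary is determined up to a scalar by its action on the Paulis, and the determinant leaves
  finitely many scalars.\<close>

lemma finite_unitaries:
  assumes car: "\<And>C. C \<in> G \<Longrightarrow> C \<in> carrier_mat d d"
    and unit: "\<And>C. C \<in> G \<Longrightarrow> adj C * C = 1\<^sub>m d" "\<And>C. C \<in> G \<Longrightarrow> C * adj C = 1\<^sub>m d"
    and SS: "\<And>C A. C \<in> G \<Longrightarrow> A \<in> SS \<Longrightarrow> act C A \<in> SS"
    and det: "\<And>C. C \<in> G \<Longrightarrow> det C ^ m = 1" and m: "0 < m"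
  shows "finite G"
proof (rule ccontr)
  assume inf: "infinite G"
  let ?f = "\<lambda>C. restrict (act C) SS"
  have "?f ` G \<subseteq> SS \<rightarrow>\<^sub>E SS" using SS by auto
  then have "finite (?f ` G)" using finite_PiE[OF fin_SS, of "\<lambda>_. SS"] finite_subset fin_SS by blast
  then obtain C0 where C0: "C0 \<in> G" "infinite {C \<in> G. ?f C = ?f C0}"
    using pigeonhole_infinite[OF inf] by blast
  let ?L = "{z :: complex. z ^ (d * m) = 1}"
  have fL: "finite ?L" using finite_nth_roots[of "d * m" 1] dpos m by simp
  have "{C \<in> G. ?f C = ?f C0} \<subseteq> (\<lambda>z. z \<cdot>\<^sub>m C0) ` ?L"
  proof
    fix C assume "C \<in> {C \<in> G. ?f C = ?f C0}"
    then have C: "C \<in> G" "\<And>A. A \<in> SS \<Longrightarrow> act C A = act C0 A" by (auto simp: restrict_def fun_eq_iff) metis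
    let ?X = "adj C0 * C"
    have c: "C0 \<in> carrier_mat d d" "C \<in> carrier_mat d d" using car C C0 by auto
    have cancel: "adj C0 * (C0 * Y) = Y" "C0 * (adj C0 * Y) = Y" "adj C * (C * Y) = Y" if "Y \<in> carrier_mat d d" for Y
      using that c unit[OF C0(1)] unit[OF C(1)] by (simp_all add: assoc[symmetric])
    have "P * ?X = ?X * P" if P: "P \<in> PP" for P
    proof -
      have Pc: "P \<in> carrier_mat d d" using P PP_carrier by blast
      have "C * P * adj C = C0 * P * adj C0" using C(2)[OF PP_SS[OF P]] by (simp add: act_def)
      then have "adj C0 * (C * P * adj C) * C = adj C0 * (C0 * P * adj C0) * C" by simp
      then show ?thesis using c Pc by (simp add: assoc cancel unit[OF C(1)])
    qed
    then obtain z where z: "?X = z \<cdot>\<^sub>m 1\<^sub>m d" using commutes_paulis_scalar[of ?X] c by auto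
    have "C = C0 * ?X" using c by (simp add: cancel)
    then have Cz: "C = z \<cdot>\<^sub>m C0" unfolding z using c by simp
    have "det C = z ^ d * det C0" unfolding Cz using c by (simp add: det_smult)
    then have "det C ^ m = z ^ (d * m) * det C0 ^ m" by (simp add: power_mult_distrib power_mult)
    then have "z ^ (d * m) = 1" using det[OF C(1)] det[OF C0(1)] by simp
    then show "C \<in> (\<lambda>z. z \<cdot>\<^sub>m C0) ` ?L" using Cz by blast
  qed
  then show False using C0(2) fL finite_surj by blast
qed

end

section \<open>The Clifford group\<close>

lemma kpow_I2: "kpow I2 k = 1\<^sub>m (2 ^ k)"
  unfolding kpow_def I2_def by (induction k) (simp_all add: kron_one)

lemma on_qubit_index:
  assumes j: "j < n" and G: "G \<in> carrier_mat 2 2" and rs: "r < 2 ^ n" "s < 2 ^ n"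
  shows "on_qubit n j G $$ (r, s) =
    (if r div (2 * 2 ^ (n - j - 1)) = s div (2 * 2 ^ (n - j - 1)) \<and> r mod 2 ^ (n - j - 1) = s mod 2 ^ (n - j - 1)
     then G $$ (r div 2 ^ (n - j - 1) mod 2, s div 2 ^ (n - j - 1) mod 2) else 0)"
proof -
  let ?m = "2 ^ (n - j - 1) :: nat"
  have m: "2 ^ j * (2 * ?m) = (2 :: nat) ^ n"
  proof -
    have "2 ^ j * (2 * ?m) = (2 :: nat) ^ (j + (1 + (n - j - 1)))" by (simp add: power_add)
    then show ?thesis using j by simp
  qed
  have K: "kron G (1\<^sub>m ?m) \<in> carrier_mat (2 * ?m) (2 * ?m)" using G by simp
  have rs': "r < 2 ^ j * (2 * ?m)" "s < 2 ^ j * (2 * ?m)" using rs m by simp_all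
  note l = div_mod_less[OF rs'(1)] div_mod_less[OF rs'(2)]
  have aux: "x mod (2 * k) div k = x div k mod 2 \<and> x mod (2 * k) mod k = x mod k" if "0 < k" for x k :: nat
    using mod_mult2_eq[of x k 2] that by (simp add: mult.commute[of 2 k])
  have p0: "0 < ?m" by simp
  have a: "x mod (2 * ?m) div ?m = x div ?m mod 2" "x mod (2 * ?m) mod ?m = x mod ?m" for x
    using aux[OF p0, of x] by blast+
  have "on_qubit n j G $$ (r, s) = 1\<^sub>m (2 ^ j) $$ (r div (2 * ?m), s div (2 * ?m)) *
    kron G (1\<^sub>m ?m) $$ (r mod (2 * ?m), s mod (2 * ?m))"
    unfolding on_qubit_def kpow_I2 using rs' K G by (subst kron_index) auto
  also have "kron G (1\<^sub>m ?m) $$ (r mod (2 * ?m), s mod (2 * ?m)) =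
    G $$ (r mod (2 * ?m) div ?m, s mod (2 * ?m) div ?m) * 1\<^sub>m ?m $$ (r mod (2 * ?m) mod ?m, s mod (2 * ?m) mod ?m)"
    using G l by (subst kron_index) auto
  finally show ?thesis unfolding a using l by auto
qed

lemma on_qubit_list: "on_qubit n j G = kl (replicate j I2 @ G # replicate (n - j - 1) I2)"
  if "G \<in> carrier_mat 2 2" for G
proof -
  have I: "I2 \<in> carrier_mat 2 2" by (simp add: I2_def)
  have "kron G (kpow I2 (n - j - 1)) = kl (G # replicate (n - j - 1) I2)" by (simp add: kpow_def)
  then show ?thesis unfolding on_qubit_def kpow_map
    using kron_list_append[of "replicate j I2" "G # replicate (n - j - 1) I2"] I that
    by (auto simp: kpow_def set_replicate_conv_if split: if_splits)
qed

definition single :: "nat \<Rightarrow> nat \<Rightarrow> nat \<Rightarrow> nat list" where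
  "single n j a = (replicate n 0)[j := a]"

lemma single_labels: "a < 4 \<Longrightarrow> single n j a \<in> labels n"
  unfolding single_def labels_def using set_update_subset_insert[of "replicate n 0" j a] by fastforce

lemma on_qubit_pauli: "j < n \<Longrightarrow> on_qubit n j (pauli1 a) = pl (single n j a)"
proof -
  assume j: "j < n"
  have "single n j a = replicate j 0 @ a # replicate (n - j - 1) 0"
    unfolding single_def using j
    by (simp add: upd_conv_take_nth_drop Suc_diff_Suc min_def)
  moreover have "pauli1 0 = I2" by (simp add: pauli1_def)
  ultimately show ?thesis by (simp add: on_qubit_list)
qed

lemma on_qubit_carrier [simp]: "j < n \<Longrightarrow> G \<in> carrier_mat 2 2 \<Longrightarrow> on_qubit n j G \<in> carrier_mat (2 ^ n) (2 ^ n)"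
proof -
  assume j: "j < n" and G: "G \<in> carrier_mat 2 2"
  have "set (replicate j I2 @ G # replicate (n - j - 1) I2) \<subseteq> carrier_mat 2 2"
    using G by (auto simp: I2_def set_replicate_conv_if split: if_splits)
  from kron_list_carrier[OF this] show ?thesis using j G by (simp add: on_qubit_list)
qed

lemma on_qubit_smult: "on_qubit n j (c \<cdot>\<^sub>m G) = c \<cdot>\<^sub>m on_qubit n j G"
  unfolding on_qubit_def by (simp add: kron_smult)

lemma on_qubit_add:
  assumes "G \<in> carrier_mat 2 2" "H \<in> carrier_mat 2 2"
  shows "on_qubit n j (G + H) = on_qubit n j G + on_qubit n j H"
proof -
  have "1\<^sub>m p \<in> carrier_mat p p" for p by simp
  then show ?thesis unfolding on_qubit_def kpow_I2
    using assms by (simp add: kron_add[OF assms] kron_add(2)[of _ "2 * 2 ^ (n - j - 1)" "2 * 2 ^ (n - j - 1)"])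
qed

context pauli_frame
begin

definition normalizes :: "complex mat \<Rightarrow> bool" where
  "normalizes U \<longleftrightarrow> U \<in> carrier_mat d d \<and> adj U * U = 1\<^sub>m d \<and> U * adj U = 1\<^sub>m d \<and> (\<forall>A\<in>SS. act U A \<in> SS)"

lemma normalizes_mult: "normalizes U \<Longrightarrow> normalizes V \<Longrightarrow> normalizes (U * V)"
proof -
  assume U: "normalizes U" and V: "normalizes V"
  then have c: "U \<in> carrier_mat d d" "V \<in> carrier_mat d d" by (auto simp: normalizes_def)
  have u: "adj U * U = 1\<^sub>m d" "U * adj U = 1\<^sub>m d" "adj V * V = 1\<^sub>m d" "V * adj V = 1\<^sub>m d"
    using U V by (auto simp: normalizes_def)
  have cancel: "adj U * (U * Y) = Y" "V * (adj V * Y) = Y" if "Y \<in> carrier_mat d d" for Y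
    using that c u by (simp_all add: assoc[symmetric])
  have "adj (U * V) * (U * V) = 1\<^sub>m d" "(U * V) * adj (U * V) = 1\<^sub>m d"
    using c u by (simp_all add: assoc cancel)
  moreover have "act (U * V) A \<in> SS" if "A \<in> SS" for A
    using U V c that by (simp add: act_mult normalizes_def)
  ultimately show ?thesis using c by (simp add: normalizes_def)
qed

lemma normalizes_smult: "normalizes U \<Longrightarrow> z * cnj z = 1 \<Longrightarrow> normalizes (z \<cdot>\<^sub>m U)"
  by (auto simp: normalizes_def act_smultL mult.commute)

definition inv_sqrt2 :: complex where "inv_sqrt2 = complex_of_real (1 / sqrt 2)"

lemma inv_sqrt2: "inv_sqrt2 * inv_sqrt2 = 1 / 2" "cnj inv_sqrt2 = inv_sqrt2" "inv_sqrt2 * (inv_sqrt2 * x) = x / 2"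
proof -
  have "inv_sqrt2 * inv_sqrt2 = complex_of_real (1 / sqrt 2 * (1 / sqrt 2))" unfolding inv_sqrt2_def by (simp only: of_real_mult)
  also have "1 / sqrt 2 * (1 / sqrt 2) = (1 / 2 :: real)" by simp
  finally show e: "inv_sqrt2 * inv_sqrt2 = 1 / 2" by simp
  show "cnj inv_sqrt2 = inv_sqrt2" by (simp add: inv_sqrt2_def)
  have "inv_sqrt2 * (inv_sqrt2 * x) = (inv_sqrt2 * inv_sqrt2) * x" by simp
  then show "inv_sqrt2 * (inv_sqrt2 * x) = x / 2" unfolding e by simp
qed

definition transv :: "complex mat \<Rightarrow> complex mat" where
  "transv P = inv_sqrt2 \<cdot>\<^sub>m (1\<^sub>m d + \<i> \<cdot>\<^sub>m P)"

lemma transv_carrier [simp]: "P \<in> carrier_mat d d \<Longrightarrow> transv P \<in> carrier_mat d d"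
  by (simp add: transv_def)

lemma transv_normalizes: "P \<in> SS \<Longrightarrow> normalizes (transv P)"
proof -
  assume P: "P \<in> SS"
  have "act (transv P) A \<in> SS" if "A \<in> SS" for A
    unfolding transv_def by (rule act_transvection_SS[OF P that]) (simp add: inv_sqrt2)
  moreover have a: "adj (transv P) = inv_sqrt2 \<cdot>\<^sub>m (1\<^sub>m d + (- \<i>) \<cdot>\<^sub>m P)" using P by (simp add: transv_def inv_sqrt2)
  have x: "(1\<^sub>m d + (- \<i>) \<cdot>\<^sub>m P) * (1\<^sub>m d + \<i> \<cdot>\<^sub>m P) = 2 \<cdot>\<^sub>m 1\<^sub>m d"
    "(1\<^sub>m d + \<i> \<cdot>\<^sub>m P) * (1\<^sub>m d + (- \<i>) \<cdot>\<^sub>m P) = 2 \<cdot>\<^sub>m 1\<^sub>m d"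
  proof -
    have "(1\<^sub>m d + (- c) \<cdot>\<^sub>m P) * (1\<^sub>m d + c \<cdot>\<^sub>m P) = 2 \<cdot>\<^sub>m 1\<^sub>m d" if "c * c = - 1" for c
    proof -
      have "(1\<^sub>m d + (- c) \<cdot>\<^sub>m P) * (1\<^sub>m d + c \<cdot>\<^sub>m P) = (1\<^sub>m d + c \<cdot>\<^sub>m P) + ((- c) \<cdot>\<^sub>m P + 1 \<cdot>\<^sub>m 1\<^sub>m d)"
        using that SS_carrier[OF P] SS_sq[OF P] by (simp add: distrib_mat add_smult_distrib_left_mat[of _ d d]) (intro eq_matI; auto)
      also have "\<dots> = 2 \<cdot>\<^sub>m 1\<^sub>m d"
        using SS_carrier[OF P] by (intro eq_matI) auto
      finally show ?thesis .
    qed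
    from this[of \<i>] this[of "- \<i>"] show "(1\<^sub>m d + (- \<i>) \<cdot>\<^sub>m P) * (1\<^sub>m d + \<i> \<cdot>\<^sub>m P) = 2 \<cdot>\<^sub>m 1\<^sub>m d"
      "(1\<^sub>m d + \<i> \<cdot>\<^sub>m P) * (1\<^sub>m d + (- \<i>) \<cdot>\<^sub>m P) = 2 \<cdot>\<^sub>m 1\<^sub>m d" by simp_all
  qed
  have "adj (transv P) * transv P = 1\<^sub>m d" "transv P * adj (transv P) = 1\<^sub>m d"
    unfolding a unfolding transv_def using P x by (simp_all add: inv_sqrt2)
  ultimately show ?thesis using P by (simp add: normalizes_def)
qed

text \<open>Up to a phase the Hadamard, phase and CNOT gates are products of the transvections
  \<open>(1 + iP) / sqrt 2\<close>.\<close>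

lemma hadamard_transv:
  assumes S: "X \<in> SS" "Z \<in> SS" and n: "chi Z X = - 1"
  shows "inv_sqrt2 \<cdot>\<^sub>m (X + Z) = (- \<i>) \<cdot>\<^sub>m (transv Z * (transv X * transv Z))"
proof -
  define R where "R = X * Z"
  have R: "R \<in> carrier_mat d d" unfolding R_def using S by simp
  have ZX: "Z * X = - 1 \<cdot>\<^sub>m R" unfolding R_def using chi_comm[OF S(2,1)] n by simp
  have XZ: "X * Z = R" by (simp add: R_def)
  have ZR: "Z * R = - 1 \<cdot>\<^sub>m X" unfolding R_def using S ZX
    by (simp add: assoc[symmetric, of Z X Z]) (simp add: R_def assoc)
  have c: "X \<in> carrier_mat d d" "Z \<in> carrier_mat d d" using S by auto
  have 1: "(1\<^sub>m d + \<i> \<cdot>\<^sub>m X) * (1\<^sub>m d + \<i> \<cdot>\<^sub>m Z) = (1\<^sub>m d + \<i> \<cdot>\<^sub>m Z) + (\<i> \<cdot>\<^sub>m X + (- 1) \<cdot>\<^sub>m R)"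
    using c R XZ by (simp add: distrib_mat add_smult_distrib_left_mat[of _ d d]) (intro eq_matI; auto)
  have 2: "(1\<^sub>m d + \<i> \<cdot>\<^sub>m Z) * ((1\<^sub>m d + \<i> \<cdot>\<^sub>m Z) + (\<i> \<cdot>\<^sub>m X + (- 1) \<cdot>\<^sub>m R)) =
    ((1\<^sub>m d + \<i> \<cdot>\<^sub>m Z) + (\<i> \<cdot>\<^sub>m X + (- 1) \<cdot>\<^sub>m R)) + ((\<i> \<cdot>\<^sub>m Z + (- 1) \<cdot>\<^sub>m 1\<^sub>m d) + (1 \<cdot>\<^sub>m R + \<i> \<cdot>\<^sub>m X))"
    using c R SS_sq[OF S(2)] by (simp add: distrib_mat ZX ZR add_smult_distrib_left_mat[of _ d d], (intro eq_matI; auto)?)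
  have 3: "((1\<^sub>m d + \<i> \<cdot>\<^sub>m Z) + (\<i> \<cdot>\<^sub>m X + (- 1) \<cdot>\<^sub>m R)) + ((\<i> \<cdot>\<^sub>m Z + (- 1) \<cdot>\<^sub>m 1\<^sub>m d) + (1 \<cdot>\<^sub>m R + \<i> \<cdot>\<^sub>m X)) = (2 * \<i>) \<cdot>\<^sub>m (X + Z)"
    using c R by (intro eq_matI) (auto simp: algebra_simps)
  have "transv Z * (transv X * transv Z) = (inv_sqrt2 * (inv_sqrt2 * inv_sqrt2)) \<cdot>\<^sub>m ((1\<^sub>m d + \<i> \<cdot>\<^sub>m Z) * ((1\<^sub>m d + \<i> \<cdot>\<^sub>m X) * (1\<^sub>m d + \<i> \<cdot>\<^sub>m Z)))"
    unfolding transv_def using c by (simp add: mult_ac)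
  also have "\<dots> = (inv_sqrt2 * (inv_sqrt2 * inv_sqrt2) * (2 * \<i>)) \<cdot>\<^sub>m (X + Z)" unfolding 1 2 3 using c by simp
  finally show ?thesis using c by (simp add: inv_sqrt2 mult_ac)
qed

lemma cnot_transv:
  assumes S: "X \<in> SS" "Z \<in> SS" and n: "X * Z = Z * X"
  shows "(1 / 2) \<cdot>\<^sub>m (1\<^sub>m d + Z + X - X * Z) = ((1 + \<i>) * inv_sqrt2) \<cdot>\<^sub>m (transv (- 1 \<cdot>\<^sub>m Z) * (transv (- 1 \<cdot>\<^sub>m X) * transv (X * Z)))"
    and "((1 / 2) \<cdot>\<^sub>m (1\<^sub>m d + Z + X - X * Z)) * ((1 / 2) \<cdot>\<^sub>m (1\<^sub>m d + Z + X - X * Z)) = 1\<^sub>m d"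
    and "(1\<^sub>m d + \<i> \<cdot>\<^sub>m X) * ((1\<^sub>m d + \<i> \<cdot>\<^sub>m Z) * ((1 / 2) \<cdot>\<^sub>m (1\<^sub>m d + Z + X - X * Z))) = (1 + \<i>) \<cdot>\<^sub>m (1\<^sub>m d + \<i> \<cdot>\<^sub>m (X * Z))"
proof -
  define R where "R = X * Z"
  have R: "R \<in> carrier_mat d d" unfolding R_def using S by simp
  have c: "X \<in> carrier_mat d d" "Z \<in> carrier_mat d d" using S by auto
  have p: "X * Z = R" "Z * X = R" "X * R = Z" "Z * R = X" "R * X = Z" "R * Z = X" "R * R = 1\<^sub>m d" "X * X = 1\<^sub>m d" "Z * Z = 1\<^sub>m d"
  proof -
    show "X * Z = R" "Z * X = R" using n by (simp_all add: R_def)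
    show "X * R = Z" unfolding R_def using S by simp
    show "Z * R = X" unfolding R_def n using S by simp
    show "R * X = Z" unfolding R_def n using S by (simp add: assoc)
    show "R * Z = X" unfolding R_def using S by (simp add: assoc)
    show "R * R = 1\<^sub>m d" unfolding R_def using S n by (simp add: assoc) (metis SS_carrier SS_sq SS_sqL)
  qed (use S in auto)
  note ex = distrib_mat p add_smult_distrib_left_mat[of _ d d] smult_smult_mat
  let ?C = "1\<^sub>m d + Z + X - R"
  have a: "(1\<^sub>m d + \<i> \<cdot>\<^sub>m (- 1 \<cdot>\<^sub>m X)) * (1\<^sub>m d + \<i> \<cdot>\<^sub>m R) = (1\<^sub>m d + \<i> \<cdot>\<^sub>m R) + ((- \<i>) \<cdot>\<^sub>m X + 1 \<cdot>\<^sub>m Z)"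
    using c R by (simp add: ex, (intro eq_matI; auto simp: algebra_simps)?)
  have b: "(1\<^sub>m d + \<i> \<cdot>\<^sub>m (- 1 \<cdot>\<^sub>m Z)) * ((1\<^sub>m d + \<i> \<cdot>\<^sub>m R) + ((- \<i>) \<cdot>\<^sub>m X + 1 \<cdot>\<^sub>m Z)) = (1 - \<i>) \<cdot>\<^sub>m ?C"
  proof -
    have "(1\<^sub>m d + \<i> \<cdot>\<^sub>m (- 1 \<cdot>\<^sub>m Z)) * ((1\<^sub>m d + \<i> \<cdot>\<^sub>m R) + ((- \<i>) \<cdot>\<^sub>m X + 1 \<cdot>\<^sub>m Z)) =
      ((1\<^sub>m d + \<i> \<cdot>\<^sub>m R) + ((- \<i>) \<cdot>\<^sub>m X + 1 \<cdot>\<^sub>m Z)) + (((- \<i>) \<cdot>\<^sub>m Z + 1 \<cdot>\<^sub>m X) + ((- 1) \<cdot>\<^sub>m R + (- \<i>) \<cdot>\<^sub>m 1\<^sub>m d))"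
      using c R by (simp add: ex, (intro eq_matI; auto simp: algebra_simps)?)
    also have "\<dots> = (1 - \<i>) \<cdot>\<^sub>m ?C" using c R by (intro eq_matI) (auto simp: algebra_simps)
    finally show ?thesis .
  qed
  have "transv (- 1 \<cdot>\<^sub>m Z) * (transv (- 1 \<cdot>\<^sub>m X) * transv R) = (inv_sqrt2 * (inv_sqrt2 * inv_sqrt2)) \<cdot>\<^sub>m
    ((1\<^sub>m d + \<i> \<cdot>\<^sub>m (- 1 \<cdot>\<^sub>m Z)) * ((1\<^sub>m d + \<i> \<cdot>\<^sub>m (- 1 \<cdot>\<^sub>m X)) * (1\<^sub>m d + \<i> \<cdot>\<^sub>m R)))"
    unfolding transv_def using c R by (simp add: mult_ac)
  also have "\<dots> = (inv_sqrt2 * (inv_sqrt2 * inv_sqrt2) * (1 - \<i>)) \<cdot>\<^sub>m ?C" unfolding a b by simp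
  finally have t: "transv (- 1 \<cdot>\<^sub>m Z) * (transv (- 1 \<cdot>\<^sub>m X) * transv R) = (inv_sqrt2 * (inv_sqrt2 * inv_sqrt2) * (1 - \<i>)) \<cdot>\<^sub>m ?C" .
  have "(1 + \<i>) * inv_sqrt2 * (inv_sqrt2 * (inv_sqrt2 * inv_sqrt2) * (1 - \<i>)) = ((1 + \<i>) * (1 - \<i>)) * ((inv_sqrt2 * inv_sqrt2) * (inv_sqrt2 * inv_sqrt2))"
    by (simp only: mult_ac)
  also have "\<dots> = 1 / 2" unfolding inv_sqrt2 by (simp add: algebra_simps)
  finally show "(1 / 2) \<cdot>\<^sub>m (1\<^sub>m d + Z + X - X * Z) = ((1 + \<i>) * inv_sqrt2) \<cdot>\<^sub>m (transv (- 1 \<cdot>\<^sub>m Z) * (transv (- 1 \<cdot>\<^sub>m X) * transv (X * Z)))"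
    unfolding p(1) t by (simp only: smult_smult_mat)
  have sq: "?C * ?C = 4 \<cdot>\<^sub>m 1\<^sub>m d"
  proof -
    have "?C * ?C = (1\<^sub>m d + Z + X - R) + (Z + 1\<^sub>m d + R - X) + (X + R + 1\<^sub>m d - Z) - (R + X + Z - 1\<^sub>m d)"
      using c R by (simp add: ex, (intro eq_matI; auto simp: algebra_simps)?)
    also have "\<dots> = 4 \<cdot>\<^sub>m 1\<^sub>m d" using c R by (intro eq_matI) auto
    finally show ?thesis .
  qed
  have Cc: "?C \<in> carrier_mat d d" using c R by simp
  have "((1 / 2) \<cdot>\<^sub>m ?C) * ((1 / 2) \<cdot>\<^sub>m ?C) = (1 / 2 * (1 / 2)) \<cdot>\<^sub>m (?C * ?C)"
    using Cc by (simp only: smult_simps carrier_simps)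
  also have "\<dots> = 1\<^sub>m d" unfolding sq by simp
  finally show "((1 / 2) \<cdot>\<^sub>m (1\<^sub>m d + Z + X - X * Z)) * ((1 / 2) \<cdot>\<^sub>m (1\<^sub>m d + Z + X - X * Z)) = 1\<^sub>m d"
    unfolding p(1) .
  have e1: "(1\<^sub>m d + \<i> \<cdot>\<^sub>m Z) * ?C = (1\<^sub>m d + Z + X - R) + ((\<i> \<cdot>\<^sub>m Z + \<i> \<cdot>\<^sub>m 1\<^sub>m d + \<i> \<cdot>\<^sub>m R) - \<i> \<cdot>\<^sub>m X)"
    using c R by (simp add: ex, (intro eq_matI; auto simp: algebra_simps)?)
  have e2: "(1\<^sub>m d + Z + X - R) + ((\<i> \<cdot>\<^sub>m Z + \<i> \<cdot>\<^sub>m 1\<^sub>m d + \<i> \<cdot>\<^sub>m R) - \<i> \<cdot>\<^sub>m X) =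
      (1 + \<i>) \<cdot>\<^sub>m 1\<^sub>m d + (1 + \<i>) \<cdot>\<^sub>m Z + (1 - \<i>) \<cdot>\<^sub>m X + (- (1 - \<i>)) \<cdot>\<^sub>m R"
    using c R by (intro eq_matI) (auto simp: algebra_simps)
  have e3: "(1\<^sub>m d + \<i> \<cdot>\<^sub>m X) * ((1 + \<i>) \<cdot>\<^sub>m 1\<^sub>m d + (1 + \<i>) \<cdot>\<^sub>m Z + (1 - \<i>) \<cdot>\<^sub>m X + (- (1 - \<i>)) \<cdot>\<^sub>m R) =
      ((1 + \<i>) \<cdot>\<^sub>m 1\<^sub>m d + (1 + \<i>) \<cdot>\<^sub>m Z + (1 - \<i>) \<cdot>\<^sub>m X + (- (1 - \<i>)) \<cdot>\<^sub>m R) +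
      ((\<i> * (1 + \<i>)) \<cdot>\<^sub>m X + (\<i> * (1 + \<i>)) \<cdot>\<^sub>m R + (\<i> * (1 - \<i>)) \<cdot>\<^sub>m 1\<^sub>m d + (\<i> * (- (1 - \<i>))) \<cdot>\<^sub>m Z)"
    using c R by (simp add: ex, (intro eq_matI; auto simp: algebra_simps)?)
  also have "\<dots> = (2 * (1 + \<i>)) \<cdot>\<^sub>m (1\<^sub>m d + \<i> \<cdot>\<^sub>m R)"
    using c R by (intro eq_matI) (auto simp: algebra_simps)
  finally have e4: "(1\<^sub>m d + \<i> \<cdot>\<^sub>m X) * ((1\<^sub>m d + \<i> \<cdot>\<^sub>m Z) * ?C) = (2 * (1 + \<i>)) \<cdot>\<^sub>m (1\<^sub>m d + \<i> \<cdot>\<^sub>m R)"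
    unfolding e1 e2 .
  have "(1\<^sub>m d + \<i> \<cdot>\<^sub>m X) * ((1\<^sub>m d + \<i> \<cdot>\<^sub>m Z) * ((1 / 2) \<cdot>\<^sub>m ?C)) = (1 / 2) \<cdot>\<^sub>m ((1\<^sub>m d + \<i> \<cdot>\<^sub>m X) * ((1\<^sub>m d + \<i> \<cdot>\<^sub>m Z) * ?C))"
    using c Cc by (simp only: smult_simps carrier_simps)
  also have "\<dots> = (1 + \<i>) \<cdot>\<^sub>m (1\<^sub>m d + \<i> \<cdot>\<^sub>m R)"
  proof -
    have h: "(1 / 2) * (2 * (1 + \<i>)) = 1 + \<i>" by (simp only: mult.assoc[symmetric]) simp
    show ?thesis unfolding e4 smult_smult_mat h ..
  qed
  finally show "(1\<^sub>m d + \<i> \<cdot>\<^sub>m X) * ((1\<^sub>m d + \<i> \<cdot>\<^sub>m Z) * ((1 / 2) \<cdot>\<^sub>m (1\<^sub>m d + Z + X - X * Z))) = (1 + \<i>) \<cdot>\<^sub>m (1\<^sub>m d + \<i> \<cdot>\<^sub>m (X * Z))"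
    unfolding p(1) .
qed

end

definition comm_sign1 :: "nat \<Rightarrow> nat \<Rightarrow> real" where
  "comm_sign1 a b = (if a \<noteq> 0 \<and> b \<noteq> 0 \<and> a \<noteq> b then - 1 else 1)"

definition comm_sign :: "nat list \<Rightarrow> nat list \<Rightarrow> real" where
  "comm_sign as bs = prod_list (map2 comm_sign1 as bs)"

lemma pauli_xor_sym: "pauli_xor a b = pauli_xor b a" by (auto simp: pauli_xor_def)

lemma pauli_phase_comm_sign1: "a < 4 \<Longrightarrow> b < 4 \<Longrightarrow> pauli_phase a b = complex_of_real (comm_sign1 a b) * pauli_phase b a"
  by (auto simp: pauli_phase_def comm_sign1_def lt4)

lemma pl_commute:
  assumes "as \<in> labels n" "bs \<in> labels n"
  shows "pl as * pl bs = complex_of_real (comm_sign as bs) \<cdot>\<^sub>m (pl bs * pl as)"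
proof -
  have l: "length as = length bs" "set as \<subseteq> {0..<4}" "set bs \<subseteq> {0..<4}" using assms by (auto simp: labels_def)
  have p: "prod_list (map2 pauli_phase as bs) = complex_of_real (comm_sign as bs) * prod_list (map2 pauli_phase bs as)"
    using l unfolding comm_sign_def
  proof (induction as bs rule: list_induct2)
    case (Cons a as b bs)
    then have "pauli_phase a b = complex_of_real (comm_sign1 a b) * pauli_phase b a" by (intro pauli_phase_comm_sign1) auto
    then show ?case using Cons by simp
  qed simp
  have x: "map2 pauli_xor as bs = map2 pauli_xor bs as"
    using l(1) by (induction as bs rule: list_induct2) (simp_all add: pauli_xor_sym)
  show ?thesis unfolding pl_mult[OF assms] pl_mult[OF assms(2,1)] p x by (simp add: smult_smult_mat)
qed

lemma pl_SS: "as \<in> labels n \<Longrightarrow> pl as \<in> pf.SS n"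
  by (intro pf.PP_SS) (simp add: pauli_set_labels)

lemma chi_pl:
  assumes "as \<in> labels n" "bs \<in> labels n"
  shows "pf.chi (pl as) (pl bs) = comm_sign as bs"
proof -
  have "complex_of_real (pf.chi (pl as) (pl bs)) = complex_of_real (comm_sign as bs)"
    by (rule pf.chi_unique[OF pl_SS[OF assms(1)] pl_SS[OF assms(2)] pl_commute[OF assms]])
  then show ?thesis by (simp only: of_real_eq_iff)
qed

lemma comm_sign_nth:
  assumes "length as = n" "length bs = n"
  shows "comm_sign as bs = (\<Prod>i<n. comm_sign1 (as ! i) (bs ! i))"
  using assms by (simp add: comm_sign_def prod.list_conv_set_nth atLeast0LessThan)

lemma single_nth: "i < n \<Longrightarrow> j < n \<Longrightarrow> single n j a ! i = (if i = j then a else 0)"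
  by (simp add: single_def)

lemma single_length [simp]: "length (single n j a) = n" by (simp add: single_def)

lemma comm_sign1_zero [simp]: "comm_sign1 0 b = 1" "comm_sign1 a 0 = 1" "comm_sign1 a a = 1" by (simp_all add: comm_sign1_def)

lemma comm_sign_single:
  assumes "length as = n" "j < n"
  shows "comm_sign as (single n j b) = comm_sign1 (as ! j) b"
proof -
  have "comm_sign as (single n j b) = (\<Prod>i<n. if i = j then comm_sign1 (as ! j) b else 1)"
    unfolding comm_sign_nth[OF assms(1) single_length] using assms(2) by (intro prod.cong refl) (auto simp: single_nth)
  then show ?thesis using assms by simp
qed

abbreviation Zq :: "nat \<Rightarrow> nat \<Rightarrow> complex mat" where "Zq n j \<equiv> on_qubit n j PZ"
abbreviation Xq :: "nat \<Rightarrow> nat \<Rightarrow> complex mat" where "Xq n j \<equiv> on_qubit n j PX"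

lemma P_carrier [simp]: "PX \<in> carrier_mat 2 2" "PY \<in> carrier_mat 2 2" "PZ \<in> carrier_mat 2 2" "I2 \<in> carrier_mat 2 2"
  by (simp_all add: PX_def PY_def PZ_def I2_def)

lemma Zq_pl: "j < n \<Longrightarrow> Zq n j = pl (single n j 3)"
  using on_qubit_pauli[of j n 3] by (simp add: pauli1_def)

lemma Xq_pl: "j < n \<Longrightarrow> Xq n j = pl (single n j 1)"
  using on_qubit_pauli[of j n 1] by (simp add: pauli1_def)

lemma ZXq_SS [simp]: "j < n \<Longrightarrow> Zq n j \<in> pf.SS n" "j < n \<Longrightarrow> Xq n j \<in> pf.SS n"
  by (simp_all add: Zq_pl Xq_pl pl_SS single_labels)

lemma chi_ZX: "j < n \<Longrightarrow> l < n \<Longrightarrow> pf.chi (Zq n j) (Xq n l) = (if j = l then - 1 else 1)"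
  using chi_pl[of "single n j 3" n "single n l 1"]
  by (simp add: Zq_pl Xq_pl single_labels comm_sign_single single_nth comm_sign1_def)

lemma on_qubit_one: "j < n \<Longrightarrow> on_qubit n j (1\<^sub>m 2) = 1\<^sub>m (2 ^ n)"
proof -
  assume j: "j < n"
  have "single n j 0 = replicate n 0" using j by (intro nth_equalityI) (auto simp: single_def nth_list_update)
  then have "on_qubit n j (pauli1 0) = 1\<^sub>m (2 ^ n)" using on_qubit_pauli[OF j, of 0] pl_zero[of n] by (simp only:)
  moreover have "pauli1 0 = 1\<^sub>m 2" by (simp add: pauli1_def I2_def)
  ultimately show "on_qubit n j (1\<^sub>m 2) = 1\<^sub>m (2 ^ n)" by (simp only:)
qed

lemma hadamard_q:
  assumes j: "j < n"
  shows "on_qubit n j hadamard = pf.inv_sqrt2 \<cdot>\<^sub>m (Xq n j + Zq n j)"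
proof -
  have h: "hadamard = pf.inv_sqrt2 \<cdot>\<^sub>m (PX + PZ)"
    by (rule eq_mat2I) (simp_all add: hadamard_def PX_def PZ_def pf.inv_sqrt2_def)
  show ?thesis unfolding h on_qubit_smult on_qubit_add[OF P_carrier(1,3)] ..
qed

lemma phase_q:
  assumes j: "j < n"
  shows "on_qubit n j phase_S = ((1 + \<i>) * pf.inv_sqrt2) \<cdot>\<^sub>m pf.transv n (- 1 \<cdot>\<^sub>m Zq n j)"
    and "on_qubit n j phase_S = ((1 + \<i>) / 2) \<cdot>\<^sub>m (1\<^sub>m (2 ^ n) + \<i> \<cdot>\<^sub>m (- 1 \<cdot>\<^sub>m Zq n j))"
proof -
  have h: "phase_S = ((1 + \<i>) / 2) \<cdot>\<^sub>m (1\<^sub>m 2 + \<i> \<cdot>\<^sub>m (- 1 \<cdot>\<^sub>m PZ))"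
    by (rule eq_mat2I) (simp_all add: phase_S_def PZ_def field_simps)
  have "on_qubit n j phase_S = ((1 + \<i>) / 2) \<cdot>\<^sub>m (on_qubit n j (1\<^sub>m 2) + \<i> \<cdot>\<^sub>m (- 1 \<cdot>\<^sub>m Zq n j))"
  proof -
    have c: "1\<^sub>m 2 \<in> carrier_mat 2 2" "\<i> \<cdot>\<^sub>m (- 1 \<cdot>\<^sub>m PZ) \<in> carrier_mat 2 2" using P_carrier(3) by simp_all
    show ?thesis unfolding h on_qubit_smult on_qubit_add[OF c] ..
  qed
  then show e: "on_qubit n j phase_S = ((1 + \<i>) / 2) \<cdot>\<^sub>m (1\<^sub>m (2 ^ n) + \<i> \<cdot>\<^sub>m (- 1 \<cdot>\<^sub>m Zq n j))"
    by (simp add: on_qubit_one[OF j])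
  have f: "(1 + \<i>) * pf.inv_sqrt2 * pf.inv_sqrt2 = (1 + \<i>) / 2" using pf.inv_sqrt2(1) by (simp add: mult.assoc)
  show "on_qubit n j phase_S = ((1 + \<i>) * pf.inv_sqrt2) \<cdot>\<^sub>m pf.transv n (- 1 \<cdot>\<^sub>m Zq n j)"
    unfolding e pf.transv_def smult_smult_mat f ..
qed

lemma Zq_index:
  assumes j: "j < n" and rs: "r < 2 ^ n" "s < 2 ^ n"
  shows "Zq n j $$ (r, s) = (if r = s then (if odd (s div 2 ^ (n - j - 1)) then - 1 else 1) else 0)"
proof -
  let ?m = "2 ^ (n - j - 1) :: nat"
  have eq: "r = s \<longleftrightarrow> r div (2 * ?m) = s div (2 * ?m) \<and> r mod ?m = s mod ?m \<and> r div ?m mod 2 = s div ?m mod 2"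
  proof
    assume a: "r div (2 * ?m) = s div (2 * ?m) \<and> r mod ?m = s mod ?m \<and> r div ?m mod 2 = s div ?m mod 2"
    have "x div ?m = 2 * (x div (2 * ?m)) + x div ?m mod 2" for x
      by (metis div_mult2_eq mult.commute mult_div_mod_eq)
    then have "r div ?m = s div ?m" using a by metis
    then show "r = s" using a by (metis div_mult_mod_eq)
  qed simp
  have Z: "PZ $$ (a mod 2, b mod 2) = (if a mod 2 = b mod 2 then (if odd b then - 1 else 1) else 0)" for a b :: nat
    by (auto simp: PZ_def odd_iff_mod_2_eq_one even_iff_mod_2_eq_zero)
  show ?thesis unfolding on_qubit_index[OF j P_carrier(3) rs] Z using eq by auto
qed

definition flip :: "nat \<Rightarrow> nat \<Rightarrow> nat" where
  "flip t s = (if odd (s div 2 ^ t) then s - 2 ^ t else s + 2 ^ t)"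

lemma Xq_index:
  assumes j: "j < n" and rs: "r < 2 ^ n" "s < 2 ^ n"
  shows "Xq n j $$ (r, s) = (if r = flip (n - j - 1) s then 1 else 0)"
proof -
  let ?m = "2 ^ (n - j - 1) :: nat"
  have m0: "0 < ?m" by simp
  have eq: "r = flip (n - j - 1) s \<longleftrightarrow> r div (2 * ?m) = s div (2 * ?m) \<and> r mod ?m = s mod ?m \<and> r div ?m mod 2 \<noteq> s div ?m mod 2"
    (is "_ \<longleftrightarrow> ?R")
  proof -
    have d2: "x div (2 * ?m) = x div ?m div 2" for x by (simp add: div_mult2_eq[symmetric] mult.commute)
    have fd: "flip (n - j - 1) s div ?m = (if odd (s div ?m) then s div ?m - 1 else s div ?m + 1)"
      "flip (n - j - 1) s mod ?m = s mod ?m"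
    proof -
      have ge: "odd (s div ?m) \<Longrightarrow> ?m \<le> s" using m0 by (metis div_less even_zero not_le)
      show "flip (n - j - 1) s div ?m = (if odd (s div ?m) then s div ?m - 1 else s div ?m + 1)"
        unfolding flip_def using ge m0 le_div_geq[of ?m s] by (cases "odd (s div ?m)") auto
      show "flip (n - j - 1) s mod ?m = s mod ?m"
        unfolding flip_def using ge m0 le_mod_geq[of ?m s] by (cases "odd (s div ?m)") auto
    qed
    have par: "p div 2 = u div 2 \<and> p mod 2 \<noteq> u mod 2 \<longleftrightarrow> p = (if odd u then u - 1 else u + 1)" for p u :: nat
    proof (cases "odd u")
      case True
      then obtain k where k: "u = 2 * k + 1" by (elim oddE)
      have "p div 2 = k \<and> p mod 2 \<noteq> 1 \<longleftrightarrow> p = 2 * k" by arith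
      then show ?thesis using k by simp
    next
      case False
      then obtain k where k: "u = 2 * k" by (auto elim: evenE)
      have "p div 2 = k \<and> p mod 2 \<noteq> 0 \<longleftrightarrow> p = 2 * k + 1" by arith
      then show ?thesis using k by simp
    qed
    have "r = f \<longleftrightarrow> r div ?m = f div ?m \<and> r mod ?m = f mod ?m" for f by (metis div_mult_mod_eq)
    then have "r = flip (n - j - 1) s \<longleftrightarrow> r div ?m = (if odd (s div ?m) then s div ?m - 1 else s div ?m + 1) \<and> r mod ?m = s mod ?m"
      using fd by simp
    then show ?thesis unfolding d2 using par[of "r div ?m" "s div ?m"] by blast
  qed
  have X: "PX $$ (a mod 2, b mod 2) = (if a mod 2 \<noteq> b mod 2 then 1 else 0)" for a b :: nat
    by (auto simp: PX_def)
  show ?thesis unfolding on_qubit_index[OF j P_carrier(1) rs] X using eq by auto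
qed

text \<open>\<open>cnot\<close> counts qubits from the least significant bit of the basis index, \<open>on_qubit\<close> from the most
  significant one; hence the reversal of indices.\<close>

lemma cnot_q:
  assumes ct: "c < n" "t < n" "c \<noteq> t"
  shows "cnot n c t = (1 / 2) \<cdot>\<^sub>m (1\<^sub>m (2 ^ n) + Zq n (n - c - 1) + Xq n (n - t - 1) - Xq n (n - t - 1) * Zq n (n - c - 1))"
    (is "_ = ?R")
proof (rule eq_matI)
  let ?Z = "Zq n (n - c - 1)" and ?X = "Xq n (n - t - 1)"
  have lt: "n - c - 1 < n" "n - t - 1 < n" using ct by auto
  have inv_ix: "n - (n - c - 1) - 1 = c" "n - (n - t - 1) - 1 = t"
    "n - Suc (n - Suc c) = c" "n - Suc (n - Suc t) = t" using ct by auto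
  have car: "?Z \<in> carrier_mat (2 ^ n) (2 ^ n)" "?X \<in> carrier_mat (2 ^ n) (2 ^ n)" using lt by simp_all
  fix r s assume "r < dim_row ?R" and "s < dim_col ?R"
  then have rs: "r < 2 ^ n" "s < 2 ^ n" using car by auto
  let ?z = "\<lambda>s. if odd (s div 2 ^ c) then - 1 else 1 :: complex"
  have "(?X * ?Z) $$ (r, s) = (\<Sum>k<2 ^ n. ?X $$ (r, k) * ?Z $$ (k, s))"
    using index_mult_mat_sum[OF car(2,1) rs] .
  also have "\<dots> = (\<Sum>k<2 ^ n. if k = s then ?X $$ (r, s) * ?z s else 0)"
    using rs lt by (intro sum.cong refl) (auto simp: Zq_index inv_ix)
  also have "\<dots> = ?X $$ (r, s) * ?z s" using rs by simp
  finally have XZ: "(?X * ?Z) $$ (r, s) = ?X $$ (r, s) * ?z s" .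
  have "?R $$ (r, s) = 1 / 2 * ((if r = s then 1 else 0) + ?Z $$ (r, s) + ?X $$ (r, s) - ?X $$ (r, s) * ?z s)"
    using rs car XZ by (simp del: index_mult_mat(1))
  also have "\<dots> = cnot n c t $$ (r, s)"
    using rs lt by (auto simp: Zq_index Xq_index inv_ix cnot_def cnot_perm_def flip_def)
  finally show "cnot n c t $$ (r, s) = ?R $$ (r, s)" by simp
next
  have d: "dim_row (Xq n (n - t - 1)) = 2 ^ n" "dim_col (Zq n (n - c - 1)) = 2 ^ n"
    using on_qubit_carrier[of "n - t - 1" n PX] on_qubit_carrier[of "n - c - 1" n PZ] ct
    unfolding carrier_mat_def PX_def PZ_def by simp_all
  show "dim_row (cnot n c t) = dim_row ?R" "dim_col (cnot n c t) = dim_col ?R" using d by (simp_all add: cnot_def)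
qed

lemma gens_props:
  assumes G: "G \<in> clifford_gens n"
  shows "pf.normalizes n G" "(G * G) * (G * G) = 1\<^sub>m (2 ^ n)"
proof -
  note [simp] = pf.smult_simps(1,2,5,6)[where n = n] pf.carrier_simps[where n = n] pf.SS_sq[where n = n]
  have i1: "(1 + \<i>) * pf.inv_sqrt2 * cnj ((1 + \<i>) * pf.inv_sqrt2) = 1"
  proof -
    have "(1 + \<i>) * pf.inv_sqrt2 * cnj ((1 + \<i>) * pf.inv_sqrt2) = ((1 + \<i>) * (1 - \<i>)) * (pf.inv_sqrt2 * pf.inv_sqrt2)"
      by (simp add: pf.inv_sqrt2(2) mult_ac)
    then show ?thesis unfolding pf.inv_sqrt2(1) by (simp add: algebra_simps)
  qed
  have sq: "pf.normalizes n G \<and> (G * G) * (G * G) = 1\<^sub>m (2 ^ n)" if "pf.normalizes n G" "G * G = 1\<^sub>m (2 ^ n)" for G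
    using that by simp
  consider j where "j < n" "G = on_qubit n j hadamard" | j where "j < n" "G = on_qubit n j phase_S"
    | c t where "c < n" "t < n" "c \<noteq> t" "G = cnot n c t"
    using G by (auto simp: clifford_gens_def)
  then have "pf.normalizes n G \<and> (G * G) * (G * G) = 1\<^sub>m (2 ^ n)"
  proof cases
    case 1
    let ?X = "Xq n j" and ?Z = "Zq n j"
    have S: "?X \<in> pf.SS n" "?Z \<in> pf.SS n" using 1 by simp_all
    have n: "pf.chi ?Z ?X = - 1" using 1 by (simp add: chi_ZX)
    have e: "G = (- \<i>) \<cdot>\<^sub>m (pf.transv n ?Z * (pf.transv n ?X * pf.transv n ?Z))"
      using 1 pf.hadamard_transv[OF S n] by (simp add: hadamard_q)
    have g: "pf.normalizes n G" unfolding e using S by (intro pf.normalizes_smult pf.normalizes_mult pf.transv_normalizes) simp_all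
    have c: "?X \<in> carrier_mat (2 ^ n) (2 ^ n)" "?Z \<in> carrier_mat (2 ^ n) (2 ^ n)" using 1 by simp_all
    define R where "R = ?X * ?Z"
    have R: "R \<in> carrier_mat (2 ^ n) (2 ^ n)" unfolding R_def using c by simp
    have p: "?Z * ?X = - 1 \<cdot>\<^sub>m R" "?X * ?Z = R" "?X * ?X = 1\<^sub>m (2 ^ n)" "?Z * ?Z = 1\<^sub>m (2 ^ n)"
      unfolding R_def using pf.chi_comm[OF S(2,1)] n S by simp_all
    have "G * G = (pf.inv_sqrt2 * pf.inv_sqrt2) \<cdot>\<^sub>m ((?X + ?Z) * (?X + ?Z))" using 1 c by (simp add: hadamard_q)
    also have "(?X + ?Z) * (?X + ?Z) = 2 \<cdot>\<^sub>m 1\<^sub>m (2 ^ n)"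
      using c R by (simp add: pf.distrib_mat[where n = n] p) (intro eq_matI; auto)
    finally have "G * G = 1\<^sub>m (2 ^ n)" by (simp add: pf.inv_sqrt2)
    then show ?thesis using g sq by blast
  next
    case 2
    let ?Z = "Zq n j"
    have S: "?Z \<in> pf.SS n" using 2 by simp
    have c: "?Z \<in> carrier_mat (2 ^ n) (2 ^ n)" using 2 by simp
    have g: "pf.normalizes n G" unfolding 2(2) phase_q(1)[OF 2(1)] using S i1 by (intro pf.normalizes_smult pf.transv_normalizes) simp_all
    have "G * G = ((1 + \<i>) / 2 * ((1 + \<i>) / 2)) \<cdot>\<^sub>m ((1\<^sub>m (2 ^ n) + (- \<i>) \<cdot>\<^sub>m ?Z) * (1\<^sub>m (2 ^ n) + (- \<i>) \<cdot>\<^sub>m ?Z))"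
      unfolding 2(2) phase_q(2)[OF 2(1)] using c by simp
    also have "(1\<^sub>m (2 ^ n) + (- \<i>) \<cdot>\<^sub>m ?Z) * (1\<^sub>m (2 ^ n) + (- \<i>) \<cdot>\<^sub>m ?Z) = (- 2 * \<i>) \<cdot>\<^sub>m ?Z"
    proof -
      have "(1\<^sub>m (2 ^ n) + (- \<i>) \<cdot>\<^sub>m ?Z) * (1\<^sub>m (2 ^ n) + (- \<i>) \<cdot>\<^sub>m ?Z) =
        (1\<^sub>m (2 ^ n) + (- \<i>) \<cdot>\<^sub>m ?Z) + ((- \<i>) \<cdot>\<^sub>m ?Z + (- 1) \<cdot>\<^sub>m 1\<^sub>m (2 ^ n))"
        using c pf.SS_sq[OF S]
        by (simp add: pf.distrib_mat[where n = n] add_smult_distrib_left_mat[of _ "2 ^ n" "2 ^ n"], (intro eq_matI; auto)?)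
      also have "\<dots> = (- 2 * \<i>) \<cdot>\<^sub>m ?Z" using c by (intro eq_matI) auto
      finally show ?thesis .
    qed
    also have "((1 + \<i>) / 2 * ((1 + \<i>) / 2)) \<cdot>\<^sub>m ((- 2 * \<i>) \<cdot>\<^sub>m ?Z) = ?Z"
    proof -
      have "(1 + \<i>) / 2 * ((1 + \<i>) / 2) * (- 2 * \<i>) = 1" by (simp add: field_simps)
      then show ?thesis unfolding smult_smult_mat by (simp only: one_smult_mat)
    qed
    finally show ?thesis using g pf.SS_sq[OF S] by simp
  next
    case 3
    let ?Z = "Zq n (n - c - 1)" and ?X = "Xq n (n - t - 1)"
    have lt: "n - c - 1 < n" "n - t - 1 < n" using 3 by auto
    have S: "?X \<in> pf.SS n" "?Z \<in> pf.SS n" using lt by simp_all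
    have "n - c - 1 \<noteq> n - t - 1" using 3 by auto
    then have "pf.chi ?X ?Z = 1" using lt chi_ZX[of "n - c - 1" n "n - t - 1"] pf.chi_sym by simp
    then have cm: "?X * ?Z = ?Z * ?X" by (simp add: pf.chi_def split: if_splits)
    then have XZ: "?X * ?Z \<in> pf.SS n" using pf.pj_SS[OF S] by (simp add: pf.pj_def)
    have e: "G = (1 / 2) \<cdot>\<^sub>m (1\<^sub>m (2 ^ n) + ?Z + ?X - ?X * ?Z)" unfolding 3(4) by (rule cnot_q[OF 3(1-3)])
    have "pf.normalizes n G" unfolding e pf.cnot_transv(1)[OF S cm] using S XZ i1
      by (intro pf.normalizes_smult pf.normalizes_mult pf.transv_normalizes) simp_all
    moreover have "G * G = 1\<^sub>m (2 ^ n)" unfolding e by (rule pf.cnot_transv(2)[OF S cm])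
    ultimately show ?thesis by (rule sq)
  qed
  then show "pf.normalizes n G" "(G * G) * (G * G) = 1\<^sub>m (2 ^ n)" by blast+
qed

lemma gens_carrier: "G \<in> clifford_gens n \<Longrightarrow> G \<in> carrier_mat (2 ^ n) (2 ^ n)"
  using gens_props(1) by (simp add: pf.normalizes_def)

lemma clifford_normalizes: "C \<in> clifford_group n \<Longrightarrow> pf.normalizes n C"
proof (induction rule: clifford_group.induct)
  case id
  have "pf.normalizes n (1\<^sub>m (2 ^ n))" by (simp add: pf.normalizes_def pf.act_def)
  then show ?case .
next
  case (gen C G) then show ?case using pf.normalizes_mult gens_props(1) by blast
qed

lemma clifford_carrier: "C \<in> clifford_group n \<Longrightarrow> C \<in> carrier_mat (2 ^ n) (2 ^ n)"
  using clifford_normalizes by (simp add: pf.normalizes_def)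

lemma clifford_mult:
  assumes "C \<in> clifford_group n" "C' \<in> clifford_group n"
  shows "C * C' \<in> clifford_group n"
  using assms(1)
proof (induction rule: clifford_group.induct)
  case id then show ?case using assms(2) clifford_carrier by simp
next
  case (gen C G)
  have "G * C * C' = G * (C * C')"
    using gens_carrier[OF gen(2)] clifford_carrier[OF gen(1)] clifford_carrier[OF assms(2)] by (rule pf.assoc)
  then show ?case using gen clifford_group.gen by metis
qed

lemma gens_clifford: "G \<in> clifford_gens n \<Longrightarrow> G \<in> clifford_group n"
  using clifford_group.gen[OF clifford_group.id, of G n] gens_carrier[of G n] by simp

lemma gens_adj: "G \<in> clifford_gens n \<Longrightarrow> adj G \<in> clifford_group n"
proof -
  assume G: "G \<in> clifford_gens n"
  have c: "G \<in> carrier_mat (2 ^ n) (2 ^ n)" by (rule gens_carrier[OF G])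
  have "adj G = adj G * ((G * G) * (G * G))" using gens_props(2)[OF G] c by simp
  also have "\<dots> = (adj G * G) * (G * (G * G))" using c by (simp add: pf.assoc[of _ n])
  also have "\<dots> = G * (G * G)" using gens_props(1)[OF G] c by (simp add: pf.normalizes_def)
  finally show ?thesis using clifford_mult gens_clifford[OF G] by metis
qed

lemma clifford_adj: "C \<in> clifford_group n \<Longrightarrow> adj C \<in> clifford_group n"
proof (induction rule: clifford_group.induct)
  case id then show ?case by (simp add: clifford_group.id)
next
  case (gen C G)
  have "adj (G * C) = adj C * adj G"
    using gens_carrier[OF gen(2)] clifford_carrier[OF gen(1)] by (rule pf.adj_simps)
  then show ?case using clifford_mult[OF gen(3) gens_adj[OF gen(2)]] by simp
qed

lemma clifford_det: "C \<in> clifford_group n \<Longrightarrow> det C ^ 4 = 1"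
proof (induction rule: clifford_group.induct)
  case id then show ?case by simp
next
  case (gen C G)
  have c: "G \<in> carrier_mat (2 ^ n) (2 ^ n)" "C \<in> carrier_mat (2 ^ n) (2 ^ n)"
    using gens_carrier[OF gen(2)] clifford_carrier[OF gen(1)] by auto
  have "det ((G * G) * (G * G)) = det G ^ 4"
    using c by (simp add: det_mult[of _ "2 ^ n"] power4_eq_xxxx mult.assoc)
  then have "det G ^ 4 = 1" unfolding gens_props(2)[OF gen(2)] by simp
  then show ?case using gen(3) c by (simp add: det_mult[of _ "2 ^ n"] power_mult_distrib)
qed

lemma clifford_finite: "finite (clifford_group n)"
  by (rule pf.finite_unitaries[of _ n 4])
     (use clifford_normalizes clifford_det in \<open>auto simp: pf.normalizes_def\<close>)

definition has_transv :: "nat \<Rightarrow> complex mat \<Rightarrow> bool" where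
  "has_transv n P \<longleftrightarrow> (\<exists>c. c * cnj c * 2 = 1 \<and> c \<cdot>\<^sub>m (1\<^sub>m (2 ^ n) + \<i> \<cdot>\<^sub>m P) \<in> clifford_group n)"

lemma has_transv_neg:
  assumes P: "P \<in> pf.SS n" and h: "has_transv n P"
  shows "has_transv n (- 1 \<cdot>\<^sub>m P)"
proof -
  obtain c where c: "c * cnj c * 2 = 1" "c \<cdot>\<^sub>m (1\<^sub>m (2 ^ n) + \<i> \<cdot>\<^sub>m P) \<in> clifford_group n"
    using h by (auto simp: has_transv_def)
  have "cnj c \<cdot>\<^sub>m (1\<^sub>m (2 ^ n) + \<i> \<cdot>\<^sub>m (- 1 \<cdot>\<^sub>m P)) \<in> clifford_group n"
    using clifford_adj[OF c(2)] unfolding pf.adj_transvection[OF P] .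
  then show ?thesis unfolding has_transv_def using c(1) by (intro exI[of _ "cnj c"]) (simp add: mult.commute)
qed

lemma has_transv_act:
  assumes C: "C \<in> clifford_group n" and P: "P \<in> pf.SS n" and h: "has_transv n P"
  shows "has_transv n (pf.act C P)"
proof -
  note [simp] = pf.smult_simps(1,2,5,6)[where n = n] pf.carrier_simps[where n = n]
  obtain c where c: "c * cnj c * 2 = 1" "c \<cdot>\<^sub>m (1\<^sub>m (2 ^ n) + \<i> \<cdot>\<^sub>m P) \<in> clifford_group n"
    using h by (auto simp: has_transv_def)
  have Cc: "C \<in> carrier_mat (2 ^ n) (2 ^ n)" "C * adj C = 1\<^sub>m (2 ^ n)" using clifford_normalizes[OF C] by (auto simp: pf.normalizes_def)
  have Pc: "P \<in> carrier_mat (2 ^ n) (2 ^ n)" using P by simp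
  have "C * (c \<cdot>\<^sub>m (1\<^sub>m (2 ^ n) + \<i> \<cdot>\<^sub>m P)) * adj C = c \<cdot>\<^sub>m (1\<^sub>m (2 ^ n) + \<i> \<cdot>\<^sub>m pf.act C P)"
    using Cc Pc by (simp add: pf.distrib_mat[where n = n] pf.act_def)
  moreover have "C * (c \<cdot>\<^sub>m (1\<^sub>m (2 ^ n) + \<i> \<cdot>\<^sub>m P)) * adj C \<in> clifford_group n"
    using C c(2) by (intro clifford_mult clifford_adj)
  ultimately show ?thesis unfolding has_transv_def using c(1) by auto
qed

lemma has_transv_pj:
  assumes P: "P \<in> pf.SS n" and Q: "Q \<in> pf.SS n" and "pf.chi P Q = - 1" "has_transv n P" "has_transv n Q"
  shows "has_transv n (pf.pj P Q)"
proof -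
  obtain c where c: "c * cnj c * 2 = 1" "c \<cdot>\<^sub>m (1\<^sub>m (2 ^ n) + \<i> \<cdot>\<^sub>m P) \<in> clifford_group n"
    using assms(4) by (auto simp: has_transv_def)
  have "P * Q \<noteq> Q * P" using assms(3) by (auto simp: pf.chi_def)
  then have "pf.pj P Q = pf.act (c \<cdot>\<^sub>m (1\<^sub>m (2 ^ n) + \<i> \<cdot>\<^sub>m P)) Q"
    unfolding pf.act_transvection[OF P Q c(1)] using assms(3) by (simp add: pf.pj_def)
  then show ?thesis using has_transv_act[OF c(2) Q assms(5)] by simp
qed

lemma has_transv_xor:
  assumes l: "as \<in> labels n" "bs \<in> labels n" and s: "comm_sign as bs = - 1"
    and h: "has_transv n (pl as)" "has_transv n (pl bs)"
  shows "has_transv n (pl (map2 pauli_xor as bs))"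
proof -
  let ?x = "pl (map2 pauli_xor as bs)"
  have x: "?x \<in> pf.SS n" using map2_pauli_xor_labels[OF l] by (rule pl_SS)
  have S: "pl as \<in> pf.SS n" "pl bs \<in> pf.SS n" using l by (simp_all add: pl_SS)
  have j: "has_transv n (pf.pj (pl as) (pl bs))" using has_transv_pj[OF S _ h] chi_pl[OF l] s by simp
  have "pl as * pl bs \<noteq> pl bs * pl as" using chi_pl[OF l] s by (auto simp: pf.chi_def)
  then have "pf.pj (pl as) (pl bs) = (\<i> * prod_list (map2 pauli_phase as bs)) \<cdot>\<^sub>m ?x"
    unfolding pf.pj_def pl_mult[OF l, symmetric] smult_smult_mat[symmetric] by simp
  then obtain z where z: "pf.pj (pl as) (pl bs) = z \<cdot>\<^sub>m ?x" by blast
  have "(z * z) \<cdot>\<^sub>m 1\<^sub>m (2 ^ n) = pf.pj (pl as) (pl bs) * pf.pj (pl as) (pl bs)"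
    unfolding z using pf.SS_sq[OF x] pf.smult_simps(1,2)[where n = n] pf.carrier_simps(4)[where n = n] pf.SS_carrier[OF x] by (simp add: smult_smult_mat)
  also have "\<dots> = 1 \<cdot>\<^sub>m 1\<^sub>m (2 ^ n)" using pf.SS_sq[OF pf.pj_SS[OF S]] by (simp add: one_smult_mat)
  finally have "z * z = 1" by (rule pf.SS_inj[OF pf.one_SS])
  then have "z = 1 \<or> z = - 1" using square_eq_1_iff by blast
  then have "?x = pf.pj (pl as) (pl bs) \<or> ?x = - 1 \<cdot>\<^sub>m pf.pj (pl as) (pl bs)"
    unfolding z by (auto simp: one_smult_mat smult_smult_mat)
  then show ?thesis using j has_transv_neg[OF pf.pj_SS[OF S] j] by metis
qed

lemma has_transv_Z: "j < n \<Longrightarrow> has_transv n (Zq n j)"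
proof -
  assume j: "j < n"
  have g: "on_qubit n j phase_S \<in> clifford_group n" using j by (intro gens_clifford) (auto simp: clifford_gens_def)
  have "(1 + \<i>) / 2 * cnj ((1 + \<i>) / 2) * 2 = 1" by (simp add: field_simps)
  then have "has_transv n (- 1 \<cdot>\<^sub>m Zq n j)" unfolding has_transv_def using g phase_q(2)[OF j] by metis
  from has_transv_neg[OF _ this] show ?thesis using j by (simp add: smult_smult_mat one_smult_mat)
qed

lemma has_transv_X: "j < n \<Longrightarrow> has_transv n (Xq n j)"
proof -
  assume j: "j < n"
  note [simp] = pf.smult_simps(1,2,5,6)[where n = n] pf.carrier_simps[where n = n] pf.adj_simps[where n = n]
  let ?X = "Xq n j" and ?Z = "Zq n j"
  have g: "on_qubit n j hadamard \<in> clifford_group n" using j by (intro gens_clifford) (auto simp: clifford_gens_def)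
  have S: "?X \<in> pf.SS n" "?Z \<in> pf.SS n" using j by simp_all
  have c: "?X \<in> carrier_mat (2 ^ n) (2 ^ n)" "?Z \<in> carrier_mat (2 ^ n) (2 ^ n)" using j by simp_all
  define R where "R = ?X * ?Z"
  have R: "R \<in> carrier_mat (2 ^ n) (2 ^ n)" unfolding R_def using c by simp
  have p: "?X * ?Z = R" "?Z * ?Z = 1\<^sub>m (2 ^ n)" "R * ?X = - 1 \<cdot>\<^sub>m ?Z" "R * ?Z = ?X"
  proof -
    have ZX: "?Z * ?X = - 1 \<cdot>\<^sub>m (?X * ?Z)" using pf.chi_comm[OF S(2,1)] chi_ZX[OF j j] by simp
    show "?X * ?Z = R" "?Z * ?Z = 1\<^sub>m (2 ^ n)" unfolding R_def using S by simp_all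
    show "R * ?X = - 1 \<cdot>\<^sub>m ?Z" unfolding R_def using S c by (simp add: pf.assoc[where n = n] ZX)
    show "R * ?Z = ?X" unfolding R_def using S c by (simp add: pf.assoc[where n = n])
  qed
  have "pf.act (on_qubit n j hadamard) ?Z = (pf.inv_sqrt2 * pf.inv_sqrt2) \<cdot>\<^sub>m ((?X + ?Z) * ?Z * (?X + ?Z))"
    unfolding hadamard_q[OF j] pf.act_def using c S by (simp add: pf.inv_sqrt2(2) smult_smult_mat)
  also have "(?X + ?Z) * ?Z * (?X + ?Z) = 2 \<cdot>\<^sub>m ?X"
    using c R by (simp add: pf.distrib_mat[where n = n] p) (intro eq_matI; auto)
  finally have "pf.act (on_qubit n j hadamard) ?Z = ?X" by (simp add: pf.inv_sqrt2 smult_smult_mat one_smult_mat)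
  then show ?thesis using has_transv_act[OF g S(2) has_transv_Z[OF j]] by simp
qed

definition two_qubit :: "nat \<Rightarrow> nat \<Rightarrow> nat \<Rightarrow> nat \<Rightarrow> nat \<Rightarrow> nat list" where
  "two_qubit n j a l b = (single n j a)[l := b]"

lemma two_qubit_length [simp]: "length (two_qubit n j a l b) = n" by (simp add: two_qubit_def)

lemma two_qubit_nth: "i < n \<Longrightarrow> j < n \<Longrightarrow> l < n \<Longrightarrow> two_qubit n j a l b ! i = (if i = l then b else if i = j then a else 0)"
  by (simp add: two_qubit_def nth_list_update single_nth)

lemma labelsI: "length as = n \<Longrightarrow> (\<And>i. i < n \<Longrightarrow> as ! i < 4) \<Longrightarrow> as \<in> labels n"
  by (auto simp: labels_def set_conv_nth)

lemma labels_nth: "as \<in> labels n \<Longrightarrow> i < n \<Longrightarrow> as ! i < 4"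
  by (auto simp: labels_def set_conv_nth)

lemma labels_length: "as \<in> labels n \<Longrightarrow> length as = n"
  by (simp add: labels_def)

lemma two_qubit_labels: "j < n \<Longrightarrow> l < n \<Longrightarrow> a < 4 \<Longrightarrow> b < 4 \<Longrightarrow> two_qubit n j a l b \<in> labels n"
  by (rule labelsI) (auto simp: two_qubit_nth)

lemma pauli_xor_simps [simp]: "pauli_xor 0 b = b" "pauli_xor a 0 = a" "pauli_xor a a = 0"
  by (auto simp: pauli_xor_def)

lemma has_transv_CZ:
  assumes "j < n" "l < n" "j \<noteq> l"
  shows "has_transv n (pl (two_qubit n j 1 l 3))"
proof -
  note [simp] = pf.smult_simps(1,2,5,6)[where n = n] pf.carrier_simps[where n = n]
  let ?c = "n - l - 1" and ?t = "n - j - 1"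
  have ct: "?c < n" "?t < n" "?c \<noteq> ?t" using assms by auto
  have ix: "n - ?c - 1 = l" "n - ?t - 1 = j" using assms by auto
  let ?X = "Xq n j" and ?Z = "Zq n l"
  have S: "?X \<in> pf.SS n" "?Z \<in> pf.SS n" using assms by simp_all
  have c: "?X \<in> carrier_mat (2 ^ n) (2 ^ n)" "?Z \<in> carrier_mat (2 ^ n) (2 ^ n)" using assms by simp_all
  have cm: "?X * ?Z = ?Z * ?X" using chi_ZX[of l n j] assms by (auto simp: pf.chi_def split: if_splits)
  have g: "cnot n ?c ?t \<in> clifford_group n" 
    by (rule gens_clifford, unfold clifford_gens_def, rule UnI2, intro CollectI exI conjI, rule refl) (fact ct)+
  obtain a where a: "a * cnj a * 2 = 1" "a \<cdot>\<^sub>m (1\<^sub>m (2 ^ n) + \<i> \<cdot>\<^sub>m ?X) \<in> clifford_group n"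
    using has_transv_X[OF assms(1)] by (auto simp: has_transv_def)
  obtain b where b: "b * cnj b * 2 = 1" "b \<cdot>\<^sub>m (1\<^sub>m (2 ^ n) + \<i> \<cdot>\<^sub>m ?Z) \<in> clifford_group n"
    using has_transv_Z[OF assms(2)] by (auto simp: has_transv_def)
  have K: "cnot n ?c ?t = (1 / 2) \<cdot>\<^sub>m (1\<^sub>m (2 ^ n) + ?Z + ?X - ?X * ?Z)"
    using cnot_q[OF ct] unfolding ix .
  have kc: "cnot n ?c ?t \<in> carrier_mat (2 ^ n) (2 ^ n)" by (rule clifford_carrier[OF g])
  have "(a \<cdot>\<^sub>m (1\<^sub>m (2 ^ n) + \<i> \<cdot>\<^sub>m ?X)) * ((b \<cdot>\<^sub>m (1\<^sub>m (2 ^ n) + \<i> \<cdot>\<^sub>m ?Z)) * cnot n ?c ?t) =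
    (a * b) \<cdot>\<^sub>m ((1\<^sub>m (2 ^ n) + \<i> \<cdot>\<^sub>m ?X) * ((1\<^sub>m (2 ^ n) + \<i> \<cdot>\<^sub>m ?Z) * cnot n ?c ?t))"
    using c kc by (simp add: smult_smult_mat mult.commute)
  also have "\<dots> = (a * b * (1 + \<i>)) \<cdot>\<^sub>m (1\<^sub>m (2 ^ n) + \<i> \<cdot>\<^sub>m (?X * ?Z))"
    unfolding K pf.cnot_transv(3)[OF S cm] by (simp add: smult_smult_mat)
  finally have "(a * b * (1 + \<i>)) \<cdot>\<^sub>m (1\<^sub>m (2 ^ n) + \<i> \<cdot>\<^sub>m (?X * ?Z)) \<in> clifford_group n"
    using clifford_mult[OF a(2) clifford_mult[OF b(2) g]] by simp
  moreover have "(a * b * (1 + \<i>)) * cnj (a * b * (1 + \<i>)) * 2 = 1"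
  proof -
    have "(a * b * (1 + \<i>)) * cnj (a * b * (1 + \<i>)) * 2 = (a * cnj a * 2) * (b * cnj b * 2) * ((1 + \<i>) * (1 - \<i>) / 2)"
      by (simp add: mult_ac)
    then show ?thesis unfolding a(1) b(1) by (simp add: algebra_simps)
  qed
  ultimately have "has_transv n (?X * ?Z)" unfolding has_transv_def by blast
  moreover have "?X * ?Z = pl (two_qubit n j 1 l 3)"
  proof -
    have sl: "single n j 1 \<in> labels n" "single n l 3 \<in> labels n" by (simp_all add: single_labels)
    have "map2 pauli_xor (single n j 1) (single n l 3) = two_qubit n j 1 l 3"
      using assms by (intro nth_equalityI) (auto simp: single_nth two_qubit_nth)
    moreover have "prod_list (map2 pauli_phase (single n j 1) (single n l 3)) = 1"
    proof -
      have "prod_list (map2 pauli_phase (single n j 1) (single n l 3)) = (\<Prod>i<n. pauli_phase (single n j 1 ! i) (single n l 3 ! i))"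
        by (simp add: prod.list_conv_set_nth atLeast0LessThan)
      also have "\<dots> = 1" using assms by (intro prod.neutral) (auto simp: single_nth pauli_phase_def)
      finally show ?thesis .
    qed
    ultimately show ?thesis unfolding Xq_pl[OF assms(1)] Zq_pl[OF assms(2)] pl_mult[OF sl] by (simp add: one_smult_mat)
  qed
  ultimately show ?thesis by simp
qed

lemma has_transv_single:
  assumes "j < n" "a < 4" "a \<noteq> 0"
  shows "has_transv n (pl (single n j a))"
proof -
  have 3: "has_transv n (pl (single n j 3))" using has_transv_Z[OF assms(1)] by (simp add: Zq_pl assms)
  have 1: "has_transv n (pl (single n j 1))" using has_transv_X[OF assms(1)] Xq_pl[OF assms(1)] by (simp only:)
  have l: "single n j 3 \<in> labels n" "single n j 1 \<in> labels n" by (simp_all add: single_labels)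
  have "map2 pauli_xor (single n j 3) (single n j 1) = single n j 2"
    using assms by (intro nth_equalityI) (auto simp: single_nth pauli_xor_def)
  moreover have "comm_sign (single n j 3) (single n j 1) = - 1"
    using comm_sign_single[OF single_length assms(1)] assms by (simp add: single_nth comm_sign1_def)
  ultimately have "has_transv n (pl (single n j 2))" using has_transv_xor[OF l _ 3 1] by simp
  then show ?thesis using 1 3 assms by (auto simp: lt4)
qed

lemma pauli_xor_self: "a < 4 \<Longrightarrow> b < 4 \<Longrightarrow> pauli_xor a (pauli_xor a b) = b" "a < 4 \<Longrightarrow> b < 4 \<Longrightarrow> pauli_xor (pauli_xor a b) b = a"
  by (auto simp: pauli_xor_def lt4)

lemma comm_sign1_pauli_xor: "a < 4 \<Longrightarrow> b < 4 \<Longrightarrow> a \<noteq> 0 \<Longrightarrow> b \<noteq> 0 \<Longrightarrow> a \<noteq> b \<Longrightarrow> comm_sign1 a (pauli_xor a b) = - 1 \<and> comm_sign1 (pauli_xor a b) b = - 1 \<and> pauli_xor a b \<noteq> 0"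
  by (auto simp: pauli_xor_def lt4 comm_sign1_def)

lemma has_transv_two_qubit:
  assumes jl: "j < n" "l < n" "j \<noteq> l" and ab: "a < 4" "a \<noteq> 0" "b < 4" "b \<noteq> 0"
  shows "has_transv n (pl (two_qubit n j a l b))"
proof -
  have 1: "has_transv n (pl (two_qubit n j a l 3))"
  proof (cases "a = 1")
    case True then show ?thesis using has_transv_CZ[OF jl] by (simp only:)
  next
    case False
    let ?x = "pauli_xor 1 a"
    have x: "?x < 4" "?x \<noteq> 0" "comm_sign1 1 ?x = - 1" using ab False comm_sign1_pauli_xor[of 1 a] pauli_xor_less[of 1 a] by auto
    have l: "two_qubit n j 1 l 3 \<in> labels n" "single n j ?x \<in> labels n" using jl x by (auto intro!: two_qubit_labels single_labels)
    have e: "map2 pauli_xor (two_qubit n j 1 l 3) (single n j ?x) = two_qubit n j a l 3"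
      using jl pauli_xor_self(1)[of 1 a] ab by (intro nth_equalityI) (auto simp: two_qubit_nth single_nth)
    have s: "comm_sign (two_qubit n j 1 l 3) (single n j ?x) = - 1"
      using comm_sign_single[OF two_qubit_length jl(1)] jl x(3) by (simp add: two_qubit_nth)
    show ?thesis using has_transv_xor[OF l s has_transv_CZ[OF jl] has_transv_single[OF jl(1) x(1,2)]] unfolding e .
  qed
  show ?thesis
  proof (cases "b = 3")
    case True then show ?thesis using 1 by simp
  next
    case False
    let ?x = "pauli_xor 3 b"
    have x: "?x < 4" "?x \<noteq> 0" "comm_sign1 3 ?x = - 1" using ab False comm_sign1_pauli_xor[of 3 b] pauli_xor_less[of 3 b] by auto
    have l: "two_qubit n j a l 3 \<in> labels n" "single n l ?x \<in> labels n" using jl x ab by (auto intro!: two_qubit_labels single_labels)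
    have e: "map2 pauli_xor (two_qubit n j a l 3) (single n l ?x) = two_qubit n j a l b"
      using jl pauli_xor_self(1)[of 3 b] ab by (intro nth_equalityI) (auto simp: two_qubit_nth single_nth)
    have s: "comm_sign (two_qubit n j a l 3) (single n l ?x) = - 1"
      using comm_sign_single[OF two_qubit_length jl(2)] jl x(3) by (simp add: two_qubit_nth)
    show ?thesis using has_transv_xor[OF l s 1 has_transv_single[OF jl(2) x(1,2)]] unfolding e .
  qed
qed

lemma has_transv_one: "has_transv n (1\<^sub>m (2 ^ n))"
proof -
  have "1 / (1 + \<i>) * cnj (1 / (1 + \<i>)) * 2 = 1"
  proof -
    have "1 / (1 + \<i>) * cnj (1 / (1 + \<i>)) * 2 = 2 / ((1 + \<i>) * (1 - \<i>))" by simp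
    also have "(1 + \<i>) * (1 - \<i>) = 2" by (simp add: algebra_simps)
    finally show ?thesis by simp
  qed
  moreover have "(1 / (1 + \<i>)) \<cdot>\<^sub>m (1\<^sub>m (2 ^ n) + \<i> \<cdot>\<^sub>m 1\<^sub>m (2 ^ n)) = 1\<^sub>m (2 ^ n)"
  proof -
    have "1 + \<i> \<noteq> 0" by (simp add: complex_eq_iff)
    then show ?thesis by (intro eq_matI) (auto simp: field_simps)
  qed
  ultimately show ?thesis unfolding has_transv_def using clifford_group.id by metis
qed

text \<open>Induction on the weight: multiplying by a suitable anticommuting Pauli of weight two
  removes one qubit from the support.\<close>

lemma has_transv_labels: "as \<in> labels n \<Longrightarrow> has_transv n (pl as)"
proof (induction "card {i. i < n \<and> as ! i \<noteq> 0}" arbitrary: as rule: less_induct)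
  case less
  let ?s = "{i. i < n \<and> as ! i \<noteq> 0}"
  note len = labels_length[OF less.prems]
  consider "?s = {}" | j where "?s = {j}" | j l where "j \<in> ?s" "l \<in> ?s" "j \<noteq> l" by blast
  then show ?case
  proof cases
    case 1
    then have "as = replicate n 0" using len by (intro nth_equalityI) auto
    then show ?thesis using has_transv_one pl_zero by simp
  next
    case (2 j)
    then have j: "j < n" "as ! j \<noteq> 0" by auto
    have z: "as ! i = 0" if "i < n" "i \<noteq> j" for i using that 2 by blast
    have "as = single n j (as ! j)"
    proof (rule nth_equalityI)
      show "length as = length (single n j (as ! j))" using len by simp
      fix i assume "i < length as"
      then have i: "i < n" unfolding len .
      show "as ! i = single n j (as ! j) ! i" unfolding single_nth[OF i j(1)] using z[OF i] by (cases "i = j") simp_all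
    qed
    then show ?thesis using has_transv_single[OF j(1) labels_nth[OF less.prems j(1)] j(2)] by (rule ssubst)
  next
    case (3 j l)
    then have jl: "j < n" "l < n" "as ! j \<noteq> 0" "as ! l \<noteq> 0" by auto
    define b where "b = (if as ! l = 1 then 2 else 1 :: nat)"
    have b: "b < 4" "b \<noteq> 0" "b \<noteq> as ! l" by (auto simp: b_def)
    let ?A = "two_qubit n j (as ! j) l b"
    have lt: "as ! j < 4" "as ! l < 4" using labels_nth less.prems jl by auto
    have A: "?A \<in> labels n" using jl lt b by (intro two_qubit_labels)
    let ?B = "map2 pauli_xor as ?A"
    have B: "?B \<in> labels n" by (rule map2_pauli_xor_labels[OF less.prems A])
    have Bn: "?B ! i = (if i = l then pauli_xor (as ! l) b else if i = j then 0 else as ! i)" if "i < n" for i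
      using that len jl by (simp add: two_qubit_nth)
    have x: "comm_sign1 (pauli_xor (as ! l) b) b = - 1" "pauli_xor (as ! l) b \<noteq> 0" using comm_sign1_pauli_xor[of "as ! l" b] b jl lt by auto
    have "{i. i < n \<and> ?B ! i \<noteq> 0} \<subset> ?s"
    proof (rule psubsetI)
      show "{i. i < n \<and> ?B ! i \<noteq> 0} \<subseteq> ?s"
      proof (intro subsetI CollectI)
        fix i assume "i \<in> {i. i < n \<and> ?B ! i \<noteq> 0}"
        then have i: "i < n" "?B ! i \<noteq> 0" by blast+
        then show "i < n \<and> as ! i \<noteq> 0" using Bn[OF i(1)] jl(4) by (metis (full_types))
      qed
      have "?B ! j = 0" using Bn[OF jl(1)] 3(3) by (simp only: if_False refl if_True)
      then have "j \<notin> {i. i < n \<and> ?B ! i \<noteq> 0}" by blast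
      then show "{i. i < n \<and> ?B ! i \<noteq> 0} \<noteq> ?s" using 3(1) by blast
    qed
    then have "card {i. i < n \<and> ?B ! i \<noteq> 0} < card ?s" by (intro psubset_card_mono) auto
    then have hB: "has_transv n (pl ?B)" using less.hyps B by blast
    have hA: "has_transv n (pl ?A)" using has_transv_two_qubit[OF jl(1,2) 3(3) lt(1) jl(3) b(1,2)] .
    have lB: "length ?B = n" using labels_length[OF B] .
    have "comm_sign ?B ?A = (\<Prod>i<n. if i = l then - 1 else 1)"
      unfolding comm_sign_nth[OF lB two_qubit_length]
    proof (intro prod.cong refl)
      fix i assume "i \<in> {..<n}"
      then show "comm_sign1 (?B ! i) (?A ! i) = (if i = l then - 1 else 1)"
        unfolding Bn[of i, simplified] using jl x by (auto simp: two_qubit_nth Bn)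
    qed
    then have s: "comm_sign ?B ?A = - 1" using jl by simp
    have e: "map2 pauli_xor ?B ?A = as"
    proof (rule nth_equalityI)
      show "length (map2 pauli_xor ?B ?A) = length as" using len by simp
      fix i assume "i < length (map2 pauli_xor ?B ?A)"
      then have i: "i < n" using len by simp
      have "map2 pauli_xor ?B ?A ! i = pauli_xor (?B ! i) (?A ! i)" using i lB by simp
      then show "map2 pauli_xor ?B ?A ! i = as ! i"
        using i jl pauli_xor_self(2)[of "as ! l" b] lt b by (simp add: Bn two_qubit_nth)
    qed
    show ?thesis using has_transv_xor[OF B A s hB hA] unfolding e .
  qed
qed

interpretation cf: clifford_frame "2 ^ n" "pauli_set n" "clifford_group n" for n
proof
  show "finite (clifford_group n)" by (rule clifford_finite)
  show "C \<in> carrier_mat (2 ^ n) (2 ^ n)" if "C \<in> clifford_group n" for C by (rule clifford_carrier[OF that])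
  show "1\<^sub>m (2 ^ n) \<in> clifford_group n" by (rule clifford_group.id)
  show "C * C' \<in> clifford_group n" if "C \<in> clifford_group n" "C' \<in> clifford_group n" for C C'
    using that by (rule clifford_mult)
  show "adj C \<in> clifford_group n" if "C \<in> clifford_group n" for C using that by (rule clifford_adj)
  show "adj C * C = 1\<^sub>m (2 ^ n)" if "C \<in> clifford_group n" for C
    using clifford_normalizes[OF that] by (simp add: pf.normalizes_def)
  show "C * A * adj C \<in> pf.SS n" if "C \<in> clifford_group n" "A \<in> pf.SS n" for C A
    using clifford_normalizes[OF that(1)] that(2) by (simp add: pf.normalizes_def pf.act_def)
  show "\<exists>c. c * cnj c * 2 = 1 \<and> c \<cdot>\<^sub>m (1\<^sub>m (2 ^ n) + \<i> \<cdot>\<^sub>m P) \<in> clifford_group n" if P: "P \<in> pf.SS n" for P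
  proof -
    obtain as where as: "as \<in> labels n" "P = pl as \<or> P = - 1 \<cdot>\<^sub>m pl as"
      using P unfolding pf.SS_def[where n = n] by (auto simp: pauli_set_labels)
    then have "has_transv n P" using has_transv_labels[OF as(1)] has_transv_neg[OF pl_SS[OF as(1)]] by blast
    then show ?thesis by (simp add: has_transv_def)
  qed
qed

section \<open>The diagonal correlations of the magic layer\<close>

definition row_of :: "complex mat \<Rightarrow> nat \<Rightarrow> complex mat" where
  "row_of M b = mat 1 (dim_col M) (\<lambda>(_, j). M $$ (b, j))"

definition meas :: "complex mat \<Rightarrow> nat \<Rightarrow> complex mat" where
  "meas M b = adj (row_of M b) * row_of M b"

lemma mtrace_mult_1:
  assumes "A \<in> carrier_mat 1 1" "B \<in> carrier_mat 1 1"
  shows "mtrace (A * B) = mtrace A * mtrace B"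
  unfolding mtrace_mult[OF assms] using assms by (simp add: mtrace_def)

context sqmat
begin

lemma row_of_carrier [simp]: "M \<in> carrier_mat d d \<Longrightarrow> row_of M b \<in> carrier_mat 1 d"
  by (simp add: row_of_def)

lemma meas_carrier: "M \<in> carrier_mat d d \<Longrightarrow> meas M b \<in> carrier_mat d d"
  unfolding meas_def by (intro mult_carrier_mat[of _ d 1] adj_carrier row_of_carrier)

lemma meas_adj: "M \<in> carrier_mat d d \<Longrightarrow> adj (meas M b) = meas M b"
  unfolding meas_def using adj_mult[OF adj_carrier[OF row_of_carrier] row_of_carrier] by simp

lemma meas_trace:
  assumes M: "M \<in> carrier_mat d d" and X: "X \<in> carrier_mat d d"
  shows "mtrace (meas M b * X) = mtrace (row_of M b * X * adj (row_of M b))"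
proof -
  note R = row_of_carrier[OF M, of b]
  have "meas M b * X = adj (row_of M b) * (row_of M b * X)"
    unfolding meas_def using R X by (intro assoc_mult_mat[of _ d 1 _ d _ d]) auto
  then show ?thesis
    using mtrace_comm[OF adj_carrier[OF R] mult_carrier_mat[OF R X]] by (simp only:)
qed

lemma meas_diag:
  assumes M: "M \<in> carrier_mat d d" and X: "X \<in> carrier_mat d d" and b: "b < d"
  shows "mtrace (meas M b * X) = (M * X * adj M) $$ (b, b)"
proof -
  note R = row_of_carrier[OF M, of b]
  have MX: "M * X \<in> carrier_mat d d" "row_of M b * X \<in> carrier_mat 1 d" using M X R by auto
  have e: "(row_of M b * X) $$ (0, j) = (M * X) $$ (b, j)" if "j < d" for j
    using that b M X R by (subst (1 2) index_mult_mat_sum[of _ _ d _ d]) (auto simp: row_of_def)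
  have "mtrace (row_of M b * X * adj (row_of M b)) = (row_of M b * X * adj (row_of M b)) $$ (0, 0)"
    using R by (simp add: mtrace_def)
  also have "\<dots> = (\<Sum>j<d. (row_of M b * X) $$ (0, j) * adj (row_of M b) $$ (j, 0))"
    by (rule index_mult_mat_sum[OF MX(2) adj_carrier[OF R]]) simp_all
  also have "\<dots> = (\<Sum>j<d. (M * X) $$ (b, j) * adj M $$ (j, b))"
  proof (intro sum.cong refl)
    fix j assume "j \<in> {..<d}"
    then have j: "j < d" by simp
    have "adj (row_of M b) $$ (j, 0) = adj M $$ (j, b)" using j b M by (auto simp: adj_def row_of_def)
    then show "(row_of M b * X) $$ (0, j) * adj (row_of M b) $$ (j, 0) = (M * X) $$ (b, j) * adj M $$ (j, b)"
      using e[OF j] by simp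
  qed
  also have "\<dots> = (M * X * adj M) $$ (b, b)"
    by (rule index_mult_mat_sum[OF MX(1) adj_carrier[OF M] b b, symmetric])
  finally show ?thesis unfolding meas_trace[OF M X] .
qed

lemma meas_rank1:
  assumes M: "M \<in> carrier_mat d d" and X: "X \<in> carrier_mat d d" and Y: "Y \<in> carrier_mat d d"
  shows "mtrace ((meas M b * X) * (meas M b * Y)) = mtrace (meas M b * X) * mtrace (meas M b * Y)"
proof -
  define R where "R = row_of M b"
  have R: "R \<in> carrier_mat 1 d" "adj R \<in> carrier_mat d 1" 
    unfolding R_def by (rule row_of_carrier[OF M], rule adj_carrier[OF row_of_carrier[OF M]])
  have RX: "R * X \<in> carrier_mat 1 d" "R * Y \<in> carrier_mat 1 d" "R * X * adj R \<in> carrier_mat 1 1" "R * Y * adj R \<in> carrier_mat 1 1"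
    using mult_carrier_mat[OF R(1) X] mult_carrier_mat[OF R(1) Y] R(2) by (blast intro: mult_carrier_mat)+
  have AR: "adj R * (R * Y) \<in> carrier_mat d d" "R * X * (adj R * (R * Y)) \<in> carrier_mat 1 d"
    using mult_carrier_mat[OF R(2) RX(2)] RX(1) by (blast intro: mult_carrier_mat)+
  have m: "meas M b * Z = adj R * (R * Z)" if "Z \<in> carrier_mat d d" for Z
    unfolding meas_def R_def[symmetric] using R that by (intro assoc_mult_mat[of _ d 1 _ d _ d]) auto
  have "(meas M b * X) * (meas M b * Y) = adj R * ((R * X) * (adj R * (R * Y)))"
    unfolding m[OF X] m[OF Y] by (intro assoc_mult_mat[of _ d 1 _ d _ d]) (use R RX AR in auto)
  also have "mtrace \<dots> = mtrace (((R * X) * (adj R * (R * Y))) * adj R)"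
    by (rule mtrace_comm[of _ d 1]) (use R RX AR in auto)
  also have "((R * X) * (adj R * (R * Y))) * adj R = (R * X * adj R) * (R * Y * adj R)"
  proof -
    have "(R * X) * (adj R * (R * Y)) = (R * X * adj R) * (R * Y)"
      by (rule assoc_mult_mat[symmetric, of _ 1 d _ 1 _ d]) (use R RX AR in auto)
    then show ?thesis using assoc_mult_mat[OF RX(3) RX(2) R(2)] by simp
  qed
  also have "mtrace \<dots> = mtrace (R * X * adj R) * mtrace (R * Y * adj R)" by (rule mtrace_mult_1[OF RX(3,4)])
  finally show ?thesis unfolding meas_trace[OF M X] meas_trace[OF M Y] R_def .
qed

lemma meas_sum:
  assumes M: "M \<in> carrier_mat d d" "adj M * M = 1\<^sub>m d" and X: "X \<in> carrier_mat d d"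
  shows "(\<Sum>b<d. mtrace (meas M b * X)) = mtrace X"
proof -
  have "(\<Sum>b<d. mtrace (meas M b * X)) = (\<Sum>b<d. (M * X * adj M) $$ (b, b))"
    by (intro sum.cong refl) (simp add: meas_diag[OF M(1) X] del: index_mult_mat(1))
  also have "\<dots> = mtrace (M * X * adj M)" using M X by (simp add: mtrace_def del: index_mult_mat(1))
  also have "\<dots> = mtrace (adj M * (M * X))" using M X by (intro tr_comm) auto
  also have "adj M * (M * X) = X" using M X by (simp add: assoc[symmetric])
  finally show ?thesis .
qed

end

abbreviation HT :: "complex mat" where "HT \<equiv> hadamard * gate_T"

definition gate :: "bool \<Rightarrow> complex mat" where "gate t = (if t then HT else I2)"

abbreviation layer :: "bool list \<Rightarrow> complex mat" where "layer ts \<equiv> kl (map gate ts)"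

lemma magic_layer_gates: "magic_layer n k = layer (replicate (n - k) False @ replicate k True)"
proof -
  have c: "set (replicate (n - k) I2) \<subseteq> carrier_mat 2 2" "set (replicate k HT) \<subseteq> carrier_mat 2 2"
    by (auto simp: I2_def hadamard_def gate_T_def)
  show ?thesis unfolding magic_layer_def kpow_map kron_list_append[OF c] by (simp add: gate_def)
qed

lemma HT_carrier: "HT \<in> carrier_mat 2 2" by (auto simp: hadamard_def gate_T_def)

lemma HT_index:
  "i < 2 \<Longrightarrow> j < 2 \<Longrightarrow> HT $$ (i, j) = pf.inv_sqrt2 * (if j = 0 then 1 else (if i = 0 then 1 else - 1) * cis (pi / 4))"
  by (subst mult2_index) (auto simp: hadamard_def gate_T_def lt2 pf.inv_sqrt2_def)

lemma gate_carrier [simp]: "gate t \<in> carrier_mat 2 2"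
  using HT_carrier by (simp add: gate_def I2_def)

definition gate_corr :: "bool \<Rightarrow> nat \<Rightarrow> nat \<Rightarrow> real" where
  "gate_corr t a b = (if t then (if a = 0 \<and> b = 0 then 1 else if a \<in> {1, 2} \<and> b \<in> {1, 2} then (if a = b then 1 / 2 else - 1 / 2) else 0)
     else (if a = b \<and> (a = 0 \<or> a = 3) then 1 else 0))"

lemma gate_unitary: "adj (gate t) * gate t = 1\<^sub>m 2" "gate t * adj (gate t) = 1\<^sub>m 2"
proof -
  have c: "cis (pi / 4) * cnj (cis (pi / 4)) = 1" "cnj (cis (pi / 4)) * cis (pi / 4) = 1"
    by (simp_all add: cis_cnj cis_mult)
  note s = pf.inv_sqrt2 c HT_carrier gate_carrier
  have "adj HT * HT = 1\<^sub>m 2"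
    using HT_carrier mult_carrier_mat[OF HT_carrier adj_carrier[OF HT_carrier]] mult_carrier_mat[OF adj_carrier[OF HT_carrier] HT_carrier]
    by (intro eq_mat2I)
      (simp_all add: mult2_index[of _ HT] adj_index[of _ 2 2] HT_index c pf.inv_sqrt2 mult_ac del: index_mult_mat(1))
  moreover have "HT * adj HT = 1\<^sub>m 2"
    using HT_carrier mult_carrier_mat[OF HT_carrier adj_carrier[OF HT_carrier]] mult_carrier_mat[OF adj_carrier[OF HT_carrier] HT_carrier]
    by (intro eq_mat2I)
      (simp_all add: mult2_index[of HT] adj_index[of _ 2 2] HT_index c pf.inv_sqrt2 mult_ac del: index_mult_mat(1))
  ultimately show "adj (gate t) * gate t = 1\<^sub>m 2" "gate t * adj (gate t) = 1\<^sub>m 2"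
    by (simp_all add: gate_def I2_def)
qed

definition gdiag :: "bool \<Rightarrow> nat \<Rightarrow> nat \<Rightarrow> complex" where
  "gdiag t a b = (gate t * pauli1 a * adj (gate t)) $$ (b, b)"

lemma gdiag:
  assumes "b < 2" "a < 4"
  shows "gdiag t a b = (if a = 0 then 1 else if t then (if a = 3 then 0 else if a = 1 then (if b = 0 then pf.inv_sqrt2 else - pf.inv_sqrt2) else (if b = 0 then - pf.inv_sqrt2 else pf.inv_sqrt2))
     else if a = 3 then (if b = 0 then 1 else - 1) else 0)"
proof -
  have sq: "sqrt 2 / 2 = 1 / sqrt 2" by (simp add: field_simps)
  have c: "cis (pi / 4) = pf.inv_sqrt2 * (1 + \<i>)" "cnj (cis (pi / 4)) = pf.inv_sqrt2 * (1 - \<i>)"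
    by (simp_all add: complex_eq_iff cos_45 sin_45 pf.inv_sqrt2_def sq)
  have G: "gate t $$ (i, j) = (if t then pf.inv_sqrt2 * (if j = 0 then 1 else (if i = 0 then 1 else - 1) * (pf.inv_sqrt2 * (1 + \<i>))) else if i = j then 1 else 0)"
    if "i < 2" "j < 2" for i j t
    using that by (simp add: gate_def HT_index c I2_def)
  have e: "gdiag t a b = (gate t $$ (b, 0) * pauli1 a $$ (0, 0) + gate t $$ (b, 1) * pauli1 a $$ (1, 0)) * cnj (gate t $$ (b, 0))
    + (gate t $$ (b, 0) * pauli1 a $$ (0, 1) + gate t $$ (b, 1) * pauli1 a $$ (1, 1)) * cnj (gate t $$ (b, 1))"
    unfolding gdiag_def using assms
    by (simp add: mult2_index adj_index[of _ 2 2] mult_carrier_mat[of _ 2 2] del: index_mult_mat(1))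
  have "cnj pf.inv_sqrt2 = pf.inv_sqrt2" by (rule pf.inv_sqrt2)
  then show ?thesis unfolding e using assms(1,2)
    unfolding lt2 lt4 by (elim disjE; cases t) (simp_all add: G pauli1_index pf.inv_sqrt2 algebra_simps del: One_nat_def)
qed

lemma gdiag_corr:
  assumes "a < 4" "b < 4"
  shows "gdiag t a 0 * gdiag t b 0 + gdiag t a 1 * gdiag t b 1 = complex_of_real (2 * gate_corr t a b)"
  using assms by (cases t) (auto simp: gdiag gate_corr_def lt4 pf.inv_sqrt2)

fun layer_corr_prod :: "bool list \<Rightarrow> nat list \<Rightarrow> nat list \<Rightarrow> real" where
  "layer_corr_prod (t # ts) (a # as) (b # bs) = gate_corr t a b * layer_corr_prod ts as bs"
| "layer_corr_prod _ _ _ = 1"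

lemma layer_carrier [simp]: "layer ts \<in> carrier_mat (2 ^ length ts) (2 ^ length ts)"
  using kron_list_carrier[of "map gate ts"] by (simp add: image_subset_iff)

lemma layer_unitary: "adj (layer ts) * layer ts = 1\<^sub>m (2 ^ length ts)" "layer ts * adj (layer ts) = 1\<^sub>m (2 ^ length ts)"
proof (induction ts)
  case (Cons t ts)
  let ?m = "2 ^ length ts"
  note c = layer_carrier[of ts] adj_carrier[OF layer_carrier[of ts]] gate_carrier[of t] adj_carrier[OF gate_carrier[of t]]
  { case 1 then show ?case using Cons kron_mult[OF c(4,3) c(2,1)] by (simp add: kron_adj gate_unitary kron_one) }
  { case 2 then show ?case using Cons kron_mult[OF c(3,4) c(1,2)] by (simp add: kron_adj gate_unitary kron_one) }
qed auto

lemma layer_conj_Cons: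
  assumes as: "as \<in> labels (length ts)"
  shows "layer (t # ts) * pl (a # as) * adj (layer (t # ts)) =
    kron (gate t * pauli1 a * adj (gate t)) (layer ts * pl as * adj (layer ts))"
proof -
  note c = layer_carrier[of ts] pl_carrier[OF as] adj_carrier[OF layer_carrier[of ts]]
  note g = gate_carrier[of t] pauli1_carrier[of a] adj_carrier[OF gate_carrier[of t]]
  show ?thesis
    using kron_mult[OF g(1,2) c(1,2)] kron_mult[OF mult_carrier_mat[OF g(1,2)] g(3) mult_carrier_mat[OF c(1,2)] c(3)]
    by (simp add: kron_adj)
qed

lemma layer_corr:
  assumes "as \<in> labels (length ts)" "bs \<in> labels (length ts)"
  shows "(\<Sum>b<2 ^ length ts. (layer ts * pl as * adj (layer ts)) $$ (b, b) * (layer ts * pl bs * adj (layer ts)) $$ (b, b))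
    = complex_of_real (2 ^ length ts * layer_corr_prod ts as bs)"
  using assms
proof (induction ts arbitrary: as bs)
  case Nil
  then show ?case by (simp add: labels_0 index_mult_mat_sum[of _ 1 1 _ 1] adj_def)
next
  case (Cons t ts)
  let ?m = "2 ^ length ts :: nat"
  obtain a as' b bs' where e: "as = a # as'" "bs = b # bs'" "a < 4" "b < 4" "as' \<in> labels (length ts)" "bs' \<in> labels (length ts)"
    using Cons.prems by (auto simp: labels_Suc)
  define F where "F = (\<lambda>as x. (layer ts * pl as * adj (layer ts)) $$ (x, x))"
  have k: "(layer (t # ts) * pl (a # as) * adj (layer (t # ts))) $$ (x, x) = gdiag t a (x div ?m) * F as (x mod ?m)"
    if "as \<in> labels (length ts)" "x < 2 * ?m" for a as x
  proof -
    have d: "dim_row (layer ts) = ?m" "dim_row (gate t) = 2" "dim_col (adj (layer ts)) = ?m" "dim_col (adj (gate t)) = 2"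
      using carrier_matD[OF layer_carrier[of ts]] carrier_matD[OF gate_carrier[of t]] by (simp_all add: adj_def)
    show ?thesis unfolding layer_conj_Cons[OF that(1)] F_def gdiag_def using that(2)
      by (subst kron_index) (simp_all add: d del: index_mult_mat(1))
  qed
  have "(\<Sum>x<2 ^ length (t # ts). (layer (t # ts) * pl as * adj (layer (t # ts))) $$ (x, x) * (layer (t # ts) * pl bs * adj (layer (t # ts))) $$ (x, x))
    = (\<Sum>x<2 * ?m. (gdiag t a (x div ?m) * gdiag t b (x div ?m)) * (F as' (x mod ?m) * F bs' (x mod ?m)))"
    unfolding e(1,2)
  proof (intro sum.cong)
    fix x assume "x \<in> {..<2 * ?m}"
    then have "x < 2 * ?m" by simp
    from k[OF e(5) this, of a] k[OF e(6) this, of b]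
    show "(layer (t # ts) * pl (a # as') * adj (layer (t # ts))) $$ (x, x) * (layer (t # ts) * pl (b # bs') * adj (layer (t # ts))) $$ (x, x)
      = (gdiag t a (x div ?m) * gdiag t b (x div ?m)) * (F as' (x mod ?m) * F bs' (x mod ?m))"
      by (simp only: mult_ac)
  qed simp
  also have "\<dots> = (\<Sum>y<2. \<Sum>x<?m. (gdiag t a y * gdiag t b y) * (F as' x * F bs' x))"
    by (rule sum_div_mod[where f = "\<lambda>y x. (gdiag t a y * gdiag t b y) * (F as' x * F bs' x)"])
  also have "\<dots> = (\<Sum>y<2. gdiag t a y * gdiag t b y) * (\<Sum>x<?m. F as' x * F bs' x)"
    by (simp add: sum_product)
  also have "(\<Sum>y<2. gdiag t a y * gdiag t b y) = complex_of_real (2 * gate_corr t a b)"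
    using gdiag_corr[OF e(3,4)] by (simp add: numeral_2_eq_2)
  also have "(\<Sum>x<?m. F as' x * F bs' x) = complex_of_real (2 ^ length ts * layer_corr_prod ts as' bs')"
    unfolding F_def by (rule Cons.IH[OF e(5,6)])
  finally show ?case unfolding e(1,2) by simp
qed

lemma diag_corr_pl:
  assumes "as \<in> labels (length ts)" "bs \<in> labels (length ts)"
  shows "diag_corr (2 ^ length ts) (meas (layer ts)) (pl as) (pl bs) = layer_corr_prod ts as bs"
proof -
  let ?n = "length ts"
  have r: "complex_of_real (tau (meas (layer ts) x) (pl cs)) = (layer ts * pl cs * adj (layer ts)) $$ (x, x)"
    if "cs \<in> labels ?n" "x < 2 ^ ?n" for cs x
  proof -
    note c = layer_carrier[of ts] pl_carrier[OF that(1)]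
    have "complex_of_real (tau (meas (layer ts) x) (pl cs)) = mtrace (meas (layer ts) x * pl cs)"
      by (rule pf.herm_trace_real[symmetric, OF pf.meas_carrier[OF c(1)] c(2) pf.meas_adj[OF c(1)] pl_adj])
    then show ?thesis using pf.meas_diag[OF c that(2)] by simp
  qed
  have "complex_of_real (diag_corr (2 ^ ?n) (meas (layer ts)) (pl as) (pl bs)) =
    (\<Sum>x<2 ^ ?n. (layer ts * pl as * adj (layer ts)) $$ (x, x) * (layer ts * pl bs * adj (layer ts)) $$ (x, x)) / 2 ^ ?n"
    unfolding diag_corr_def using assms by (simp add: r del: index_mult_mat(1))
  also have "\<dots> = complex_of_real (layer_corr_prod ts as bs)" unfolding layer_corr[OF assms] by simp
  finally show ?thesis by (simp only: of_real_eq_iff)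
qed

lemma layer_corr_prod_parity:
  assumes "as \<in> labels (length ts)" "bs \<in> labels (length ts)" "layer_corr_prod ts as bs \<noteq> 0"
  shows "comm_sign as bs = comm_sign as (replicate (length ts) 1) * comm_sign bs (replicate (length ts) 1)"
  using assms
proof (induction ts arbitrary: as bs)
  case Nil then show ?case by (simp add: labels_0 comm_sign_def)
next
  case (Cons t ts)
  obtain a as' b bs' where e: "as = a # as'" "bs = b # bs'" "as' \<in> labels (length ts)" "bs' \<in> labels (length ts)"
    using Cons.prems by (auto simp: labels_Suc)
  have "comm_sign1 a b = comm_sign1 a 1 * comm_sign1 b 1"
    using Cons.prems(3) unfolding e by (auto simp: gate_corr_def comm_sign1_def split: if_splits)
  moreover have "comm_sign as' bs' = comm_sign as' (replicate (length ts) 1) * comm_sign bs' (replicate (length ts) 1)"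
    using Cons.IH[OF e(3,4)] Cons.prems(3) unfolding e by simp
  ultimately show ?case unfolding e by (simp add: comm_sign_def)
qed

lemma sum4: "(\<Sum>a<4. f a) = f 0 + f 1 + f 2 + f (3 :: nat)" for f :: "nat \<Rightarrow> real"
  by (simp add: numeral_eq_Suc)

lemma layer_corr_prod_sums:
  shows "(\<Sum>as\<in>labels (length ts). (layer_corr_prod ts as as)\<^sup>2) = (\<Prod>t\<leftarrow>ts. if t then 3 / 2 else 2)"
    and "(\<Sum>as\<in>labels (length ts). \<Sum>bs\<in>labels (length ts). (layer_corr_prod ts as bs)\<^sup>2) = 2 ^ length ts"
    and "(\<Sum>as\<in>labels (length ts). \<Sum>bs\<in>labels (length ts). comm_sign as bs * (layer_corr_prod ts as bs)\<^sup>2) = (\<Prod>t\<leftarrow>ts. if t then 1 else 2)"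
proof (induction ts)
  case (Cons t ts)
  let ?L = "labels (length ts)"
  have c: "(\<Sum>a<4. (gate_corr t a a)\<^sup>2) = (if t then 3 / 2 else 2)" "(\<Sum>a<4. \<Sum>b<4. (gate_corr t a b)\<^sup>2) = 2"
    "(\<Sum>a<4. \<Sum>b<4. comm_sign1 a b * (gate_corr t a b)\<^sup>2) = (if t then 1 else 2)"
    by (cases t; simp add: sum4 gate_corr_def comm_sign1_def power2_eq_square)+
  { case 1
    have "(\<Sum>as\<in>labels (length (t # ts)). (layer_corr_prod (t # ts) as as)\<^sup>2) = (\<Sum>a<4. (gate_corr t a a)\<^sup>2) * (\<Sum>as\<in>?L. (layer_corr_prod ts as as)\<^sup>2)"
      by (simp add: sum_labels_Suc power_mult_distrib sum_product)
    then show ?case unfolding Cons(1) c by simp }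
  have sw: "(\<Sum>a<4. \<Sum>as\<in>?L. \<Sum>b<4. \<Sum>bs\<in>?L. f a b * g as bs) = (\<Sum>a<4. \<Sum>b<4. f a b) * (\<Sum>as\<in>?L. \<Sum>bs\<in>?L. g as bs)"
    for f :: "nat \<Rightarrow> nat \<Rightarrow> real" and g
  proof -
    have "(\<Sum>a<4. \<Sum>as\<in>?L. \<Sum>b<4. \<Sum>bs\<in>?L. f a b * g as bs) = (\<Sum>a<4. \<Sum>as\<in>?L. (\<Sum>b<4. f a b) * (\<Sum>bs\<in>?L. g as bs))"
      by (simp only: sum_product)
    then show ?thesis by (simp only: sum_product)
  qed
  { case 2
    show ?case using sw[of "\<lambda>a b. (gate_corr t a b)\<^sup>2" "\<lambda>as bs. (layer_corr_prod ts as bs)\<^sup>2"]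
      unfolding c Cons(2) by (simp add: sum_labels_Suc power_mult_distrib) }
  { case 3
    show ?case using sw[of "\<lambda>a b. comm_sign1 a b * (gate_corr t a b)\<^sup>2" "\<lambda>as bs. comm_sign as bs * (layer_corr_prod ts as bs)\<^sup>2"]
      unfolding c Cons(3) by (simp add: sum_labels_Suc power_mult_distrib comm_sign_def mult_ac) }
qed (simp_all add: labels_0 comm_sign_def)

context shadow_frame
begin

lemma sum_chi_split:
  fixes F :: "complex mat \<times> complex mat \<Rightarrow> real"
  assumes "s = 1 \<or> s = - 1"
  shows "(\<Sum>p | p \<in> SS \<times> SS \<and> chi (fst p) (snd p) = s. F p) = (\<Sum>A\<in>SS. \<Sum>B\<in>SS. (1 + s * chi A B) / 2 * F (A, B))"
proof -
  have "(\<Sum>p | p \<in> SS \<times> SS \<and> chi (fst p) (snd p) = s. F p) = (\<Sum>p\<in>SS \<times> SS. if chi (fst p) (snd p) = s then F p else 0)"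
    by (rule sum.inter_filter) simp
  also have "\<dots> = (\<Sum>p\<in>SS \<times> SS. (1 + s * chi (fst p) (snd p)) / 2 * F p)"
  proof (rule sum.cong[OF refl])
    fix p
    show "(if chi (fst p) (snd p) = s then F p else 0) = (1 + s * chi (fst p) (snd p)) / 2 * F p"
      using assms chi_cases[of "fst p" "snd p"] by (elim disjE) simp_all
  qed
  finally show ?thesis by (simp add: sum.cartesian_product case_prod_unfold)
qed

lemma pair_weight_one_le:
  "pair_weight 1 \<le> (\<Sum>A\<in>SS. \<Sum>B\<in>SS. (1 + chi A B) / 2 * (D A B)\<^sup>2) - (\<Sum>A\<in>SS. (D A A)\<^sup>2)"
proof -
  define F where "F = (\<lambda>(A, B). (D A B)\<^sup>2)"
  let ?d = "(\<lambda>A. (A, A)) ` SS" and ?K = "{p. p \<in> SS \<times> SS \<and> chi (fst p) (snd p) = 1}"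
  have fK: "finite ?K" by simp
  have "sum F (pairs 1) + sum F ?d = sum F (pairs 1 \<union> ?d)"
    by (rule sum.union_disjoint[OF fin_pairs finite_imageI[OF fin_SS], symmetric]) (auto simp: pairs_def indep2_def)
  also have "\<dots> \<le> sum F ?K"
    by (rule sum_mono2[OF fK]) (auto simp: F_def pairs_def indep2_def)
  also have "sum F ?K = (\<Sum>A\<in>SS. \<Sum>B\<in>SS. (1 + chi A B) / 2 * (D A B)\<^sup>2)"
    using sum_chi_split[of 1 F] by (simp add: F_def)
  finally have "sum F (pairs 1) + sum F ?d \<le> \<dots>" .
  moreover have "sum F ?d = (\<Sum>A\<in>SS. (D A A)\<^sup>2)"
    by (subst sum.reindex) (auto simp: F_def inj_on_def)
  ultimately show ?thesis unfolding pair_weight_def F_def by linarith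
qed

lemma pair_weight_minus_le:
  "pair_weight (- 1) \<le> (\<Sum>A\<in>SS. \<Sum>B\<in>SS. (1 - chi A B) / 2 * (D A B)\<^sup>2)"
proof -
  define F where "F = (\<lambda>(A, B). (D A B)\<^sup>2)"
  let ?K = "{p. p \<in> SS \<times> SS \<and> chi (fst p) (snd p) = - 1}"
  have fK: "finite ?K" by simp
  have "sum F (pairs (- 1)) \<le> sum F ?K"
    by (rule sum_mono2[OF fK]) (auto simp: F_def pairs_def indep2_def)
  also have "sum F ?K = (\<Sum>A\<in>SS. \<Sum>B\<in>SS. (1 - chi A B) / 2 * (D A B)\<^sup>2)"
    using sum_chi_split[of "- 1" F] by (simp add: F_def)
  finally show ?thesis unfolding pair_weight_def F_def .
qed

lemma diag_weight_SS: "diag_weight = (\<Sum>A\<in>SS. (D A A)\<^sup>2) - 2"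
proof -
  have "(\<Sum>A | A \<in> SS \<and> True. (D A A)\<^sup>2) = 2 * (D (1\<^sub>m d) (1\<^sub>m d))\<^sup>2 + (\<Sum>A | A \<in> SS \<and> True \<and> \<not> eqv A (1\<^sub>m d). (D A A)\<^sup>2)"
    by (rule sum_remove_eqv) auto
  then show ?thesis by (simp add: diag_weight_def nonid_def D_one_one)
qed

end

lemma diag_corr_neg:
  assumes E: "\<And>b. b < 2 ^ n \<Longrightarrow> E b \<in> carrier_mat (2 ^ n) (2 ^ n)"
    and X: "X \<in> carrier_mat (2 ^ n) (2 ^ n)" "Y \<in> carrier_mat (2 ^ n) (2 ^ n)"
  shows "diag_corr (2 ^ n) E (- 1 \<cdot>\<^sub>m X) Y = - diag_corr (2 ^ n) E X Y"
    "diag_corr (2 ^ n) E X (- 1 \<cdot>\<^sub>m Y) = - diag_corr (2 ^ n) E X Y"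
  using X by (simp_all add: diag_corr_def E pf.tau_lin[where n = n] sum_negf)

lemma SS_labels:
  assumes "A \<in> pf.SS n"
  obtains as where "as \<in> labels n" "A = pl as \<or> A = - 1 \<cdot>\<^sub>m pl as"
proof -
  have "A \<in> pauli_set n \<or> (\<exists>P\<in>pauli_set n. A = - 1 \<cdot>\<^sub>m P)" using assms unfolding pf.SS_def[where n = n] by blast
  then show ?thesis unfolding pauli_set_labels using that by blast
qed

lemma layer_parity:
  assumes A: "A \<in> pf.SS n" and B: "B \<in> pf.SS n" and ts: "length ts = n"
    and nz: "diag_corr (2 ^ n) (meas (layer ts)) A B \<noteq> 0"
  shows "pf.chi A B = pf.chi A (pl (replicate n 1)) * pf.chi B (pl (replicate n 1))"
proof -
  obtain as where as: "as \<in> labels n" "A = pl as \<or> A = - 1 \<cdot>\<^sub>m pl as" by (rule SS_labels[OF A])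
  obtain bs where bs: "bs \<in> labels n" "B = pl bs \<or> B = - 1 \<cdot>\<^sub>m pl bs" by (rule SS_labels[OF B])
  have W: "replicate n 1 \<in> labels n" by (auto simp: labels_def)
  have E: "meas (layer ts) b \<in> carrier_mat (2 ^ n) (2 ^ n)" for b
    using pf.meas_carrier layer_carrier[of ts] ts by blast
  note neg = diag_corr_neg[of n "meas (layer ts)", OF E] pf.chi_neg[where n = n]
  note S = pl_SS[OF as(1)] pl_SS[OF bs(1)] pl_SS[OF W]
  note c = pl_carrier[OF as(1)] pl_carrier[OF bs(1)]
  have "layer_corr_prod ts as bs \<noteq> 0"
    using nz as(2) bs(2) diag_corr_pl[of as ts bs] as(1) bs(1) ts neg(1)[OF c] neg(2)[OF c] neg(1)[of "pl as" "- 1 \<cdot>\<^sub>m pl bs"] c by auto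
  then have p: "comm_sign as bs = comm_sign as (replicate n 1) * comm_sign bs (replicate n 1)"
    using layer_corr_prod_parity[of as ts bs] as(1) bs(1) ts by simp
  have "pf.chi A X = pf.chi (pl as) X" if "X \<in> pf.SS n" for X using as(2) S(1) that neg(3) by auto
  moreover have "pf.chi X B = pf.chi X (pl bs)" if "X \<in> pf.SS n" for X using bs(2) S(2) that neg(4) by auto
  moreover have "pf.chi B X = pf.chi (pl bs) X" if "X \<in> pf.SS n" for X using bs(2) S(2) that neg(3) by auto
  ultimately have "pf.chi A B = comm_sign as bs" "pf.chi A (pl (replicate n 1)) = comm_sign as (replicate n 1)"
    "pf.chi B (pl (replicate n 1)) = comm_sign bs (replicate n 1)"
    using S B chi_pl[OF as(1) bs(1)] chi_pl[OF as(1) W] chi_pl[OF bs(1) W] by metis+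
  then show ?thesis using p by (simp only:)
qed

lemma sum_SS_even:
  assumes "\<And>as. as \<in> labels n \<Longrightarrow> F (- 1 \<cdot>\<^sub>m pl as) = F (pl as)"
  shows "(\<Sum>A\<in>pf.SS n. F A) = 2 * (\<Sum>as\<in>labels n. F (pl as) :: real)"
  unfolding pf.sum_SS sum_pauli_set using assms by (simp add: sum_distrib_left)

lemma layer_sums:
  assumes k: "k \<le> n" and ts: "ts = replicate (n - k) False @ replicate k True"
  defines "Dm \<equiv> diag_corr (2 ^ n) (meas (layer ts))"
  shows "(\<Sum>A\<in>pf.SS n. (Dm A A)\<^sup>2) = 2 * (2 ^ n * (3 / 4) ^ k)"
    "(\<Sum>A\<in>pf.SS n. \<Sum>B\<in>pf.SS n. (Dm A B)\<^sup>2) = 4 * 2 ^ n"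
    "(\<Sum>A\<in>pf.SS n. \<Sum>B\<in>pf.SS n. pf.chi A B * (Dm A B)\<^sup>2) = 4 * 2 ^ (n - k)"
proof -
  have len: "length ts = n" using k ts by simp
  have E: "meas (layer ts) b \<in> carrier_mat (2 ^ n) (2 ^ n)" for b
    using pf.meas_carrier layer_carrier[of ts] len by blast
  note neg = diag_corr_neg[of n "meas (layer ts)", OF E, folded Dm_def]
  have D: "Dm (pl as) (pl bs) = layer_corr_prod ts as bs" if "as \<in> labels n" "bs \<in> labels n" for as bs
    using diag_corr_pl[of as ts bs] that len by (simp add: Dm_def)
  have c: "A \<in> carrier_mat (2 ^ n) (2 ^ n)" if "A \<in> pf.SS n" for A using that by (rule pf.SS_carrier)
  have pc: "pl as \<in> pf.SS n \<and> pl as \<in> carrier_mat (2 ^ n) (2 ^ n)" if "as \<in> labels n" for as using pl_SS[OF that] c by blast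
  have "(\<Sum>A\<in>pf.SS n. (Dm A A)\<^sup>2) = 2 * (\<Sum>as\<in>labels n. (Dm (pl as) (pl as))\<^sup>2)"
    by (rule sum_SS_even) (simp add: neg pc)
  also have "(\<Sum>as\<in>labels n. (Dm (pl as) (pl as))\<^sup>2) = 2 ^ (n - k) * (3 / 2) ^ k"
    using layer_corr_prod_sums(1)[of ts] len by (simp add: D) (simp add: ts prod_list_replicate)
  also have "\<dots> = 2 ^ n * (3 / 4 :: real) ^ k"
  proof -
    have "(2 :: real) ^ n = 2 ^ (n - k) * 2 ^ k" using k by (simp add: power_add[symmetric])
    then show ?thesis by (simp add: power_mult_distrib[symmetric])
  qed
  finally show "(\<Sum>A\<in>pf.SS n. (Dm A A)\<^sup>2) = 2 * (2 ^ n * (3 / 4) ^ k)" .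
  have dbl: "(\<Sum>A\<in>pf.SS n. \<Sum>B\<in>pf.SS n. f A B * (Dm A B)\<^sup>2) = 4 * (\<Sum>as\<in>labels n. \<Sum>bs\<in>labels n. f (pl as) (pl bs) * (layer_corr_prod ts as bs)\<^sup>2)"
    if f: "\<And>A B. A \<in> pf.SS n \<Longrightarrow> B \<in> pf.SS n \<Longrightarrow> f (- 1 \<cdot>\<^sub>m A) B = f A B \<and> f A (- 1 \<cdot>\<^sub>m B) = f A B"
    for f :: "complex mat \<Rightarrow> complex mat \<Rightarrow> real"
  proof -
    have "(\<Sum>A\<in>pf.SS n. \<Sum>B\<in>pf.SS n. f A B * (Dm A B)\<^sup>2) = (\<Sum>A\<in>pf.SS n. 2 * (\<Sum>bs\<in>labels n. f A (pl bs) * (Dm A (pl bs))\<^sup>2))"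
    proof (rule sum.cong[OF refl])
      fix A assume A: "A \<in> pf.SS n"
      show "(\<Sum>B\<in>pf.SS n. f A B * (Dm A B)\<^sup>2) = 2 * (\<Sum>bs\<in>labels n. f A (pl bs) * (Dm A (pl bs))\<^sup>2)"
        by (rule sum_SS_even) (simp add: f[OF A] neg c[OF A] pc)
    qed
    also have "\<dots> = 2 * (\<Sum>as\<in>labels n. 2 * (\<Sum>bs\<in>labels n. f (pl as) (pl bs) * (Dm (pl as) (pl bs))\<^sup>2))"
      by (rule sum_SS_even) (simp add: f neg pc)
    also have "\<dots> = 4 * (\<Sum>as\<in>labels n. \<Sum>bs\<in>labels n. f (pl as) (pl bs) * (layer_corr_prod ts as bs)\<^sup>2)"
      by (simp add: D sum_distrib_left mult_ac)
    finally show ?thesis .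
  qed
  show "(\<Sum>A\<in>pf.SS n. \<Sum>B\<in>pf.SS n. (Dm A B)\<^sup>2) = 4 * 2 ^ n"
    using dbl[of "\<lambda>_ _. 1"] layer_corr_prod_sums(2)[of ts] len by simp
  have "(\<Sum>as\<in>labels n. \<Sum>bs\<in>labels n. pf.chi (pl as) (pl bs) * (layer_corr_prod ts as bs)\<^sup>2) = (\<Prod>t\<leftarrow>ts. if t then 1 else 2)"
    using layer_corr_prod_sums(3)[of ts] len by (simp add: chi_pl)
  also have "\<dots> = 2 ^ (n - k)" by (simp add: ts prod_list_replicate)
  finally show "(\<Sum>A\<in>pf.SS n. \<Sum>B\<in>pf.SS n. pf.chi A B * (Dm A B)\<^sup>2) = 4 * 2 ^ (n - k)"
    using dbl[of pf.chi] pf.chi_neg[where n = n] by simp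
qed

section \<open>Density operators\<close>

lemma quadratic_form_minor:
  assumes p: "0 \<le> p" and q: "0 \<le> q" and w: "0 \<le> w"
    and h: "\<And>s t :: real. 0 \<le> s\<^sup>2 * w * p + t\<^sup>2 * q - 2 * s * t * w"
  shows "w \<le> p * q"
proof (cases "q = 0")
  case True
  have "0 \<le> w * p - 2 * (p + 1) * w" using h[of 1 "p + 1"] True by simp
  then have "w * (p + 2) \<le> 0" by (simp add: algebra_simps)
  then have "w = 0" using p w by (metis add_nonneg_pos mult_le_0_iff not_le order_antisym zero_less_numeral)
  then show ?thesis using p q by simp
next
  case False
  then have q': "0 < q" using q by simp
  show ?thesis
  proof (cases "w = 0")
    case False
    have "0 \<le> (q * w) * (p * q - w)" using h[of q w] by (simp add: algebra_simps power2_eq_square)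
    moreover have "0 < q * w" using q' w False by simp
    ultimately show ?thesis by (simp only: zero_le_mult_iff) linarith
  qed (use p q in simp)
qed

lemma density_form:
  assumes "density_op d \<rho>" and X: "X \<in> carrier_mat d d"
  shows "0 \<le> tau \<rho> (X * adj X)"
proof -
  have r: "\<rho> \<in> carrier_mat d d" "\<And>v :: nat \<Rightarrow> complex. 0 \<le> Re (\<Sum>i<d. \<Sum>j<d. cnj (v i) * \<rho> $$ (i,j) * v j)"
    using assms(1) by (auto simp: density_op_def hermitian_mat_def)
  have e: "(X * adj X) $$ (j, i) = (\<Sum>c<d. X $$ (j, c) * cnj (X $$ (i, c)))" if "i < d" "j < d" for i j
    using that X by (subst index_mult_mat_sum[OF X adj_carrier[OF X] that(2,1)]) (simp add: adj_index[OF X])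
  have "mtrace (\<rho> * (X * adj X)) = (\<Sum>i<d. \<Sum>j<d. \<rho> $$ (i, j) * (X * adj X) $$ (j, i))"
    using r X by (intro mtrace_mult) auto
  also have "\<dots> = (\<Sum>i<d. \<Sum>j<d. \<Sum>c<d. cnj (X $$ (i, c)) * \<rho> $$ (i, j) * X $$ (j, c))"
    by (intro sum.cong refl) (simp add: e sum_distrib_left mult_ac del: index_mult_mat(1))
  also have "\<dots> = (\<Sum>i<d. \<Sum>c<d. \<Sum>j<d. cnj (X $$ (i, c)) * \<rho> $$ (i, j) * X $$ (j, c))"
    by (intro sum.cong refl sum.swap)
  also have "\<dots> = (\<Sum>c<d. \<Sum>i<d. \<Sum>j<d. cnj (X $$ (i, c)) * \<rho> $$ (i, j) * X $$ (j, c))"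
    by (rule sum.swap)
  finally have "tau \<rho> (X * adj X) = (\<Sum>c<d. Re (\<Sum>i<d. \<Sum>j<d. cnj (X $$ (i, c)) * \<rho> $$ (i, j) * X $$ (j, c)))"
    by (simp add: tau_def)
  then show ?thesis using r(2) by (simp add: sum_nonneg)
qed

lemma hs_norm_tau:
  assumes "hermitian_mat d A"
  shows "hs_norm_sq A = tau A A"
proof -
  have A: "A \<in> carrier_mat d d" "adj A = A" using assms by (auto simp: hermitian_mat_def)
  have "A $$ (i, j) * A $$ (j, i) = complex_of_real ((cmod (A $$ (i, j)))\<^sup>2)" if "i < d" "j < d" for i j
  proof -
    have "A $$ (j, i) = cnj (A $$ (i, j))" using adj_index[OF A(1) that(2,1)] A(2) by simp
    then show ?thesis by (simp only: complex_norm_square)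
  qed
  then have "mtrace (A * A) = complex_of_real (hs_norm_sq A)"
    using A(1) unfolding mtrace_mult[OF A(1) A(1)] by (simp add: hs_norm_sq_def)
  then show ?thesis by (simp add: tau_def)
qed

lemma density_purity:
  assumes "density_op d \<rho>"
  shows "tau \<rho> \<rho> \<le> 1"
proof -
  have h: "hermitian_mat d \<rho>" and r: "\<rho> \<in> carrier_mat d d" "adj \<rho> = \<rho>" "mtrace \<rho> = 1"
    and psd: "\<And>v :: nat \<Rightarrow> complex. 0 \<le> Re (\<Sum>i<d. \<Sum>j<d. cnj (v i) * \<rho> $$ (i,j) * v j)"
    using assms by (auto simp: density_op_def hermitian_mat_def)
  have herm: "\<rho> $$ (j, i) = cnj (\<rho> $$ (i, j))" if "i < d" "j < d" for i j
    using adj_index[OF r(1) that(2,1)] r(2) by simp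
  have real: "\<rho> $$ (i, i) = complex_of_real (Re (\<rho> $$ (i, i)))" if "i < d" for i
    using herm[OF that that] by (simp add: complex_eq_iff)
  have delta: "(\<Sum>l<d. f l * (if l = i then x else 0)) = f i * x" "(\<Sum>l<d. (if l = i then x else 0) * f l) = x * f i"
    if "i < d" for f :: "nat \<Rightarrow> complex" and i x
  proof -
    have "(\<Sum>l<d. f l * (if l = i then x else 0)) = (\<Sum>l<d. if l = i then f i * x else 0)" by (intro sum.cong) auto
    then show "(\<Sum>l<d. f l * (if l = i then x else 0)) = f i * x" using that by simp
    then show "(\<Sum>l<d. (if l = i then x else 0) * f l) = x * f i" by (simp add: mult.commute)
  qed
  have form2: "0 \<le> Re (cnj x * (\<rho> $$ (i, i) * x + \<rho> $$ (i, j) * y) + cnj y * (\<rho> $$ (j, i) * x + \<rho> $$ (j, j) * y))"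
    if ij: "i < d" "j < d" for i j x y
  proof -
    let ?v = "\<lambda>l. (if l = i then x else 0) + (if l = j then y else 0)"
    have "(\<Sum>l<d. \<Sum>m<d. cnj (?v l) * \<rho> $$ (l, m) * ?v m) = (\<Sum>l<d. cnj (?v l) * (\<Sum>m<d. \<rho> $$ (l, m) * ?v m))"
      by (simp only: sum_distrib_left mult.assoc)
    also have "\<dots> = (\<Sum>l<d. cnj (?v l) * (\<rho> $$ (l, i) * x + \<rho> $$ (l, j) * y))"
      by (simp only: distrib_left sum.distrib delta[OF ij(1)] delta[OF ij(2)])
    also have "\<dots> = (\<Sum>l<d. (if l = i then cnj x else 0) * (\<rho> $$ (l, i) * x + \<rho> $$ (l, j) * y))
        + (\<Sum>l<d. (if l = j then cnj y else 0) * (\<rho> $$ (l, i) * x + \<rho> $$ (l, j) * y))"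
      unfolding sum.distrib[symmetric] by (intro sum.cong refl) (auto simp: algebra_simps)
    also have "\<dots> = cnj x * (\<rho> $$ (i, i) * x + \<rho> $$ (i, j) * y) + cnj y * (\<rho> $$ (j, i) * x + \<rho> $$ (j, j) * y)"
      by (simp only: delta[OF ij(1)] delta[OF ij(2)])
    finally show ?thesis using psd[of ?v] by simp
  qed
  have nn: "0 \<le> Re (\<rho> $$ (i, i))" if "i < d" for i using form2[OF that that, of 1 0] by simp
  have minor: "(cmod (\<rho> $$ (i, j)))\<^sup>2 \<le> Re (\<rho> $$ (i, i)) * Re (\<rho> $$ (j, j))" if ij: "i < d" "j < d" for i j
  proof (rule quadratic_form_minor)
    fix s t :: real
    let ?z = "\<rho> $$ (i, j)"
    have zz: "?z * cnj ?z = complex_of_real ((cmod ?z)\<^sup>2)" by (rule complex_norm_square[symmetric])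
    define w where "w = (cmod ?z)\<^sup>2"
    define p where "p = Re (\<rho> $$ (i, i))"
    define q where "q = Re (\<rho> $$ (j, j))"
    have "cnj (of_real s * ?z) * (of_real p * (of_real s * ?z) + ?z * (- of_real t)) + cnj (- of_real t) * (cnj ?z * (of_real s * ?z) + of_real q * (- of_real t))
      = of_real (s\<^sup>2 * p) * (?z * cnj ?z) - of_real (2 * s * t) * (?z * cnj ?z) + of_real (t\<^sup>2 * q)"
      by (simp add: algebra_simps power2_eq_square)
    also have "\<dots> = complex_of_real (s\<^sup>2 * w * p + t\<^sup>2 * q - 2 * s * t * w)"
      unfolding zz w_def by (simp add: algebra_simps)
    finally show "0 \<le> s\<^sup>2 * (cmod ?z)\<^sup>2 * Re (\<rho> $$ (i, i)) + t\<^sup>2 * Re (\<rho> $$ (j, j)) - 2 * s * t * (cmod ?z)\<^sup>2"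
      using form2[OF ij, of "of_real s * ?z" "- of_real t"] herm[OF ij] real[OF ij(1)] real[OF ij(2)]
      unfolding w_def p_def q_def by (metis Re_complex_of_real)
  qed (use nn ij in auto)
  have "tau \<rho> \<rho> = (\<Sum>i<d. \<Sum>j<d. (cmod (\<rho> $$ (i, j)))\<^sup>2)"
    using hs_norm_tau[OF h] r(1) by (simp add: hs_norm_sq_def)
  also have "\<dots> \<le> (\<Sum>i<d. \<Sum>j<d. Re (\<rho> $$ (i, i)) * Re (\<rho> $$ (j, j)))"
    using minor by (intro sum_mono) auto
  also have "\<dots> = (\<Sum>i<d. Re (\<rho> $$ (i, i))) * (\<Sum>j<d. Re (\<rho> $$ (j, j)))"
    by (simp add: sum_product)
  also have "(\<Sum>i<d. Re (\<rho> $$ (i, i))) = 1"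
  proof -
    have "(\<Sum>i<d. Re (\<rho> $$ (i, i))) = Re (mtrace \<rho>)" using r(1) by (simp add: mtrace_def)
    then show ?thesis using r(3) by simp
  qed
  finally show ?thesis by simp
qed

theorem theorem7:
  fixes n k :: nat and \<rho> Ob :: "complex mat"
  assumes "n \<ge> 1" and "k \<le> n"
    and "density_op (2 ^ n) \<rho>"
    and "hermitian_mat (2 ^ n) Ob" and "mtrace Ob = 0"
  shows "\<bar>V_star n k Ob \<rho> - (3 / 4) ^ k * V_tri n Ob \<rho>\<bar> \<le> 6 / real (2 ^ n) * hs_norm_sq Ob"
proof -
  define M where "M = magic_layer n k"
  define ts where "ts = replicate (n - k) False @ replicate k True"
  define W0 where "W0 = pl (replicate n 1)"
  define c where "c = - 1 / real (2 ^ n)"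
  define \<sigma> where "\<sigma> = \<rho> + complex_of_real c \<cdot>\<^sub>m 1\<^sub>m (2 ^ n)"
  have len: "length ts = n" using assms(2) by (simp add: ts_def)
  have M: "M = layer ts" unfolding M_def ts_def by (rule magic_layer_gates)
  have Mc: "M \<in> carrier_mat (2 ^ n) (2 ^ n)" and Mu: "adj M * M = 1\<^sub>m (2 ^ n)" "M * adj M = 1\<^sub>m (2 ^ n)"
    using layer_carrier[of ts] layer_unitary[of ts] unfolding M len by simp_all
  have \<rho>: "\<rho> \<in> carrier_mat (2 ^ n) (2 ^ n)" "adj \<rho> = \<rho>" "mtrace \<rho> = 1"
    using assms(3) by (auto simp: density_op_def hermitian_mat_def)
  have Ob: "Ob \<in> carrier_mat (2 ^ n) (2 ^ n)" "adj Ob = Ob" using assms(4) by (auto simp: hermitian_mat_def)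
  have one: "1\<^sub>m (2 ^ n) \<in> carrier_mat (2 ^ n) (2 ^ n)" by simp
  have cn: "complex_of_real c * 2 ^ n = - 1" by (simp add: c_def)
  have \<sigma>: "\<sigma> \<in> carrier_mat (2 ^ n) (2 ^ n)" "adj \<sigma> = \<sigma>" "mtrace \<sigma> = 0"
    unfolding \<sigma>_def using \<rho> cn by (simp_all add: pf.adj_simps[where n = n] pf.tr_simps[where n = n])
  have E1: "mtrace (meas M b) = 1" if "b < 2 ^ n" for b
    using pf.meas_diag[OF Mc one that] Mc Mu that pf.meas_carrier[OF Mc, of b] by (simp del: index_mult_mat(1))
  interpret sf: shadow_frame "2 ^ n" "pauli_set n" "clifford_group n" \<sigma> Ob W0 "meas M"
  proof
    show "W0 \<in> pf.SS n" unfolding W0_def by (rule pl_SS) (auto simp: labels_def)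
    show "pf.chi A B = pf.chi A W0 * pf.chi B W0" if "A \<in> pf.SS n" "B \<in> pf.SS n" "diag_corr (2 ^ n) (meas M) A B \<noteq> 0" for A B
      using layer_parity[OF that(1,2) len] that(3) unfolding M W0_def by simp
    show "(\<Sum>b<2 ^ n. mtrace (meas M b * X)) = mtrace X" if "X \<in> carrier_mat (2 ^ n) (2 ^ n)" for X
      by (rule pf.meas_sum[OF Mc Mu(1) that])
    show "mtrace (meas M b * X * (meas M b * Y)) = mtrace (meas M b * X) * mtrace (meas M b * Y)"
      if "X \<in> carrier_mat (2 ^ n) (2 ^ n)" "Y \<in> carrier_mat (2 ^ n) (2 ^ n)" for b X Y
      by (rule pf.meas_rank1[OF Mc that])
  qed (use \<sigma> Ob assms(5) E1 pf.meas_carrier[OF Mc] pf.meas_adj[OF Mc] in auto)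
  have tau_\<sigma>: "tau \<sigma> X = tau \<rho> X + c * Re (mtrace X)" if "X \<in> carrier_mat (2 ^ n) (2 ^ n)" for X
    unfolding \<sigma>_def using that \<rho>(1) by (simp add: pf.tau_lin[where n = n]) (simp add: tau_def)
  have tau_Ob: "tau \<sigma> Ob = Re (mtrace (Ob * \<rho>))"
    using tau_\<sigma>[OF Ob(1)] assms(5) pf.tau_comm[OF \<rho>(1) Ob(1)] by (simp add: tau_def)
  have V1: "V_star n k Ob \<rho> = (real (2 ^ n) + 1)\<^sup>2 * cf.avg n (\<lambda>C. (sf.est C)\<^sup>2) - (tau \<sigma> Ob)\<^sup>2"
  proof -
    have est: "(\<Sum>b<2 ^ n. Re ((M * C * \<rho> * adj (M * C)) $$ (b, b)) * Re ((M * C * Minv n Ob * adj (M * C)) $$ (b, b)))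
      = (real (2 ^ n) + 1) * sf.est C" if C: "C \<in> clifford_group n" for C
    proof -
      have Cc: "C \<in> carrier_mat (2 ^ n) (2 ^ n)" "adj C * C = 1\<^sub>m (2 ^ n)" "C * adj C = 1\<^sub>m (2 ^ n)"
        using clifford_normalizes[OF C] by (auto simp: pf.normalizes_def)
      have cc: "C * X * adj C \<in> carrier_mat (2 ^ n) (2 ^ n)" if "X \<in> carrier_mat (2 ^ n) (2 ^ n)" for X
        using Cc(1) that by auto
      have dg: "Re ((M * C * X * adj (M * C)) $$ (b, b)) = tau (meas M b) (C * X * adj C)"
        if X: "X \<in> carrier_mat (2 ^ n) (2 ^ n)" and b: "b < 2 ^ n" for X b
      proof -
        have "M * C * X * adj (M * C) = M * (C * X * adj C) * adj M"
          using Mc Cc(1) X by (simp add: pf.adj_simps[where n = n] pf.assoc[where n = n])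
        then show ?thesis using pf.meas_diag[OF Mc cc[OF X] b] by (simp only: tau_def)
      qed
      have "Minv n Ob = complex_of_real (real (2 ^ n) + 1) \<cdot>\<^sub>m Ob"
      proof (rule eq_matI)
        note dim = carrier_matD[OF Ob(1)]
        show "dim_row (Minv n Ob) = dim_row (complex_of_real (real (2 ^ n) + 1) \<cdot>\<^sub>m Ob)"
          "dim_col (Minv n Ob) = dim_col (complex_of_real (real (2 ^ n) + 1) \<cdot>\<^sub>m Ob)"
          by (simp_all add: Minv_def dim)
        fix i j
        assume "i < dim_row (complex_of_real (real (2 ^ n) + 1) \<cdot>\<^sub>m Ob)" "j < dim_col (complex_of_real (real (2 ^ n) + 1) \<cdot>\<^sub>m Ob)"
        then show "Minv n Ob $$ (i, j) = (complex_of_real (real (2 ^ n) + 1) \<cdot>\<^sub>m Ob) $$ (i, j)"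
          by (simp add: Minv_def dim assms(5) add.commute)
      qed
      then have y: "Re ((M * C * Minv n Ob * adj (M * C)) $$ (b, b)) = (real (2 ^ n) + 1) * tau (meas M b) (C * Ob * adj C)"
        if "b < 2 ^ n" for b
      proof -
        have mb: "meas M b \<in> carrier_mat (2 ^ n) (2 ^ n)" by (rule pf.meas_carrier[OF Mc])
        have "C * (complex_of_real (real (2 ^ n) + 1) \<cdot>\<^sub>m Ob) * adj C = complex_of_real (real (2 ^ n) + 1) \<cdot>\<^sub>m (C * Ob * adj C)"
          using Cc(1) Ob(1) by (simp add: pf.smult_simps(1,2,5,6)[where n = n] smult_smult_mat)
        then show ?thesis
          using dg[of "complex_of_real (real (2 ^ n) + 1) \<cdot>\<^sub>m Ob" b] that Ob(1) pf.tau_lin(3)[OF mb cc[OF Ob(1)], of "real (2 ^ n) + 1"]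
          unfolding \<open>Minv n Ob = _\<close> by simp
      qed
      have x: "Re ((M * C * \<rho> * adj (M * C)) $$ (b, b)) = tau (meas M b) (C * \<sigma> * adj C) - c" if b: "b < 2 ^ n" for b
      proof -
        have mb: "meas M b \<in> carrier_mat (2 ^ n) (2 ^ n)" by (rule pf.meas_carrier[OF Mc])
        have "C * \<sigma> * adj C = C * \<rho> * adj C + complex_of_real c \<cdot>\<^sub>m 1\<^sub>m (2 ^ n)"
          unfolding \<sigma>_def using Cc \<rho>(1) by (simp add: pf.distrib_mat[where n = n] pf.smult_simps(1,2,5,6)[where n = n] smult_smult_mat)
        then have "tau (meas M b) (C * \<sigma> * adj C) = tau (meas M b) (C * \<rho> * adj C) + c * tau (meas M b) (1\<^sub>m (2 ^ n))"
          using mb cc[OF \<rho>(1)] by (simp add: pf.tau_lin[where n = n])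
        moreover have "tau (meas M b) (1\<^sub>m (2 ^ n)) = 1" using mb E1[OF b] by (simp add: tau_def)
        ultimately show ?thesis using dg[OF \<rho>(1) b] by simp
      qed
      have z: "(\<Sum>b<2 ^ n. tau (meas M b) (C * Ob * adj C)) = 0"
      proof -
        have "mtrace (C * Ob * adj C) = mtrace (adj C * (C * Ob))" by (rule pf.tr_comm[where n = n]) (use Cc Ob in auto)
        also have "adj C * (C * Ob) = Ob" using Cc Ob by (simp add: pf.assoc[symmetric, where n = n])
        finally show ?thesis using sf.E_sum_tau[OF cc[OF Ob(1)]] assms(5) by simp
      qed
      have "(\<Sum>b<2 ^ n. Re ((M * C * \<rho> * adj (M * C)) $$ (b, b)) * Re ((M * C * Minv n Ob * adj (M * C)) $$ (b, b)))
        = (\<Sum>b<2 ^ n. (tau (meas M b) (C * \<sigma> * adj C) - c) * ((real (2 ^ n) + 1) * tau (meas M b) (C * Ob * adj C)))"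
        by (intro sum.cong refl) (simp only: x y lessThan_iff)
      also have "\<dots> = (real (2 ^ n) + 1) * sf.est C - c * (real (2 ^ n) + 1) * (\<Sum>b<2 ^ n. tau (meas M b) (C * Ob * adj C))"
        unfolding sf.est_def sum_distrib_left sum_subtractf[symmetric] by (intro sum.cong refl) (simp add: algebra_simps)
      finally show ?thesis unfolding z by simp
    qed
    have "V_star n k Ob \<rho> = (\<Sum>C\<in>clifford_group n. ((real (2 ^ n) + 1) * sf.est C)\<^sup>2) / real (card (clifford_group n)) - (tau \<sigma> Ob)\<^sup>2"
      unfolding V_star_def expect_Uk_def tau_Ob M_def[symmetric] using est by simp
    then show ?thesis by (simp add: cf.avg_def power_mult_distrib sum_distrib_left)
  qed
  have V2: "V_tri n Ob \<rho> = (real (2 ^ n) + 1) / (real (2 ^ n) * (real (2 ^ n) + 2)) * ((sf.XX + sf.BB) / 2)"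
  proof -
    have P: "Xi \<rho> Ob (pl as) = tau \<sigma> (pl as) * tau Ob (pl as)" "Xi_tilde \<rho> Ob (pl as) = tau \<sigma> (pl as * Ob * pl as)"
      if as: "as \<in> labels n" for as
    proof -
      note p = pl_carrier[OF as]
      have "mtrace (\<rho> * pl as) = complex_of_real (tau \<rho> (pl as))" "mtrace (Ob * pl as) = complex_of_real (tau Ob (pl as))"
        using pf.herm_trace_real[OF \<rho>(1) p \<rho>(2) pl_adj] pf.herm_trace_real[OF Ob(1) p Ob(2) pl_adj] by simp_all
      then have "Xi \<rho> Ob (pl as) = tau \<rho> (pl as) * tau Ob (pl as)" by (simp add: Xi_def)
      moreover have "Re (mtrace (pl as)) * tau Ob (pl as) = 0"
        using pl_trace[OF as] assms(5) Ob(1) by (cases "as = replicate n 0") (simp_all add: pl_zero tau_def del: map_replicate)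
      ultimately show "Xi \<rho> Ob (pl as) = tau \<sigma> (pl as) * tau Ob (pl as)" by (simp add: tau_\<sigma>[OF p] algebra_simps)
      have "mtrace (pl as * Ob * pl as) = mtrace (pl as * (pl as * Ob))" by (rule pf.tr_comm[where n = n]) (use p Ob in auto)
      also have "pl as * (pl as * Ob) = Ob" using p Ob by (simp add: pf.assoc[symmetric, where n = n] pl_sq[OF as])
      finally have "tau \<sigma> (pl as * Ob * pl as) = tau \<rho> (pl as * Ob * pl as)"
        unfolding tau_\<sigma>[OF mult_carrier_mat[OF mult_carrier_mat[OF p Ob(1)] p]]
        by (simp only: assms(5) zero_complex.simps mult_zero_right add_0_right)
      moreover have "\<rho> * pl as * Ob * pl as = \<rho> * (pl as * Ob * pl as)" using p Ob \<rho>(1) by (simp add: pf.assoc[where n = n])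
      ultimately show "Xi_tilde \<rho> Ob (pl as) = tau \<sigma> (pl as * Ob * pl as)" by (simp add: Xi_tilde_def tau_def)
    qed
    have "sf.XX = 2 * (\<Sum>as\<in>labels n. (tau \<sigma> (pl as) * tau Ob (pl as))\<^sup>2)"
      unfolding sf.XX_def by (rule sum_SS_even) (use \<sigma> Ob in \<open>simp add: pf.tau_lin[where n = n]\<close>)
    moreover have "sf.BB = 2 * (\<Sum>as\<in>labels n. tau \<sigma> (pl as) * tau Ob (pl as) * tau \<sigma> (pl as * Ob * pl as))"
      unfolding sf.BB_def
    proof (rule sum_SS_even)
      fix as assume as: "as \<in> labels n"
      note p = pl_carrier[OF as]
      have "(- 1 \<cdot>\<^sub>m pl as) * Ob * (- 1 \<cdot>\<^sub>m pl as) = pl as * Ob * pl as"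
        using p Ob by (simp add: pf.smult_simps(1,2,5,6)[where n = n] smult_smult_mat)
      then show "tau \<sigma> (- 1 \<cdot>\<^sub>m pl as) * tau Ob (- 1 \<cdot>\<^sub>m pl as) * tau \<sigma> (- 1 \<cdot>\<^sub>m pl as * Ob * (- 1 \<cdot>\<^sub>m pl as)) =
        tau \<sigma> (pl as) * tau Ob (pl as) * tau \<sigma> (pl as * Ob * pl as)"
        using pf.tau_lin(5)[OF \<sigma>(1) p] pf.tau_lin(5)[OF Ob(1) p] by (simp only: minus_mult_minus)
    qed
    ultimately have "(sf.XX + sf.BB) / 2 = (\<Sum>P\<in>pauli_set n. (Xi \<rho> Ob P)\<^sup>2) + (\<Sum>P\<in>pauli_set n. Xi_tilde \<rho> Ob P * Xi \<rho> Ob P)"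
      unfolding sum_pauli_set by (simp add: P mult_ac)
    then show ?thesis unfolding V_tri_def Let_def by (simp only:)
  qed
  note sums = layer_sums[OF assms(2) ts_def, folded M]
  have dk: "2 ^ (n - k) \<le> 2 ^ n * (3 / 4 :: real) ^ k"
  proof -
    have "(2 :: real) ^ n = 2 ^ (n - k) * 2 ^ k" using assms(2) by (simp add: power_add[symmetric])
    then have "2 ^ n * (3 / 4 :: real) ^ k = 2 ^ (n - k) * (3 / 2) ^ k" by (simp add: power_mult_distrib[symmetric])
    then show ?thesis by (simp add: one_le_power)
  qed
  have split: "(\<Sum>A\<in>pf.SS n. \<Sum>B\<in>pf.SS n. (1 + s * pf.chi A B) / 2 * (diag_corr (2 ^ n) (meas M) A B)\<^sup>2)
    = 2 * 2 ^ n + s * (2 * 2 ^ (n - k))" for s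
  proof -
    have "(\<Sum>A\<in>pf.SS n. \<Sum>B\<in>pf.SS n. (1 + s * pf.chi A B) / 2 * (diag_corr (2 ^ n) (meas M) A B)\<^sup>2)
      = (\<Sum>A\<in>pf.SS n. \<Sum>B\<in>pf.SS n. (diag_corr (2 ^ n) (meas M) A B)\<^sup>2) / 2
      + s / 2 * (\<Sum>A\<in>pf.SS n. \<Sum>B\<in>pf.SS n. pf.chi A B * (diag_corr (2 ^ n) (meas M) A B)\<^sup>2)"
      unfolding sum_distrib_left sum_divide_distrib sum.distrib[symmetric]
      by (intro sum.cong refl) (simp add: field_simps)
    then show ?thesis unfolding sums by simp
  qed
  have om1: "sf.pair_weight 1 \<le> 2 * real (2 ^ n)"
    using sf.pair_weight_one_le split[of 1] dk unfolding sums by simp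
  have om2: "sf.pair_weight (- 1) \<le> 2 * real (2 ^ n)"
  proof -
    have "sf.pair_weight (- 1) \<le> 2 * real (2 ^ n) - 2 * 2 ^ (n - k)" using sf.pair_weight_minus_le split[of "- 1"] by simp
    moreover have "0 \<le> (2 :: real) ^ (n - k)" by simp
    ultimately show ?thesis by linarith
  qed
  have diag_weight: "sf.diag_weight = 2 * (real (2 ^ n) * (3 / 4) ^ k - 1)"
    using sf.diag_weight_SS unfolding sums by simp
  have r1: "\<bar>tau \<sigma> A\<bar> \<le> 1" if A: "A \<in> pf.SS n" "\<not> pf.eqv A (1\<^sub>m (2 ^ n))" for A
  proof -
    have Ac: "A \<in> carrier_mat (2 ^ n) (2 ^ n)" "adj A = A" "A * A = 1\<^sub>m (2 ^ n)"
      using pf.SS_carrier[OF A(1)] pf.SS_adj[OF A(1)] pf.SS_sq[OF A(1)] by auto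
    have r\<rho>: "tau \<rho> (1\<^sub>m (2 ^ n)) = 1" using \<rho> by (simp add: tau_def)
    have "0 \<le> 2 * (1 + s * tau \<rho> A)" if s: "s * s = 1" for s :: real
    proof -
      let ?X = "1\<^sub>m (2 ^ n) + complex_of_real s \<cdot>\<^sub>m A"
      have ss: "complex_of_real s * complex_of_real s = 1" using s by (simp only: of_real_mult[symmetric] of_real_1)
      have X: "?X \<in> carrier_mat (2 ^ n) (2 ^ n)" "adj ?X = ?X" using Ac by (simp_all add: pf.adj_simps[where n = n])
      have "?X * ?X = complex_of_real 2 \<cdot>\<^sub>m ?X"
      proof -
        have "?X * ?X = ?X + (complex_of_real s \<cdot>\<^sub>m A + 1\<^sub>m (2 ^ n))"
          using Ac by (simp add: pf.distrib_mat[where n = n] pf.smult_simps(1,2,5,6)[where n = n] smult_smult_mat ss one_smult_mat add_smult_distrib_left_mat[of _ "2 ^ n" "2 ^ n"])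
        also have "\<dots> = complex_of_real 2 \<cdot>\<^sub>m ?X" using Ac by (intro eq_matI) auto
        finally show ?thesis .
      qed
      then have "0 \<le> tau \<rho> (complex_of_real 2 \<cdot>\<^sub>m ?X)" using density_form[OF assms(3) X(1)] X(2) by simp
      then show ?thesis using \<rho>(1) Ac(1) X(1) r\<rho>
        by (simp only: pf.tau_lin[where n = n] one smult_carrier_mat)
    qed
    from this[of 1] this[of "- 1"] have "\<bar>tau \<rho> A\<bar> \<le> 1" by simp
    then show ?thesis using tau_\<sigma>[OF Ac(1)] pf.SS_trace[OF A] by simp
  qed
  have r2: "tau \<sigma> \<sigma> \<le> 1 - 1 / real (2 ^ n)"
  proof -
    have "tau \<sigma> \<sigma> = tau \<rho> \<sigma>" using tau_\<sigma>[OF \<sigma>(1)] \<sigma>(3) by simp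
    also have "\<dots> = tau \<sigma> \<rho>" by (rule pf.tau_comm[OF \<rho>(1) \<sigma>(1)])
    also have "\<dots> = tau \<rho> \<rho> + c" using tau_\<sigma>[OF \<rho>(1)] \<rho>(3) by simp
    finally show ?thesis using density_purity[OF assms(3)] by (simp add: c_def)
  qed
  have d: "(2 ^ n :: nat) = 2 \<or> 4 \<le> (2 ^ n :: nat)"
  proof (cases "n = 1")
    case False
    then have "2 \<le> n" using assms(1) by simp
    then have "2 ^ 2 \<le> (2 ^ n :: nat)" by (rule power_increasing) simp
    then show ?thesis by simp
  qed simp
  have g: "0 \<le> (3 / 4 :: real) ^ k" "(3 / 4 :: real) ^ k \<le> 1" by (simp_all add: power_le_one)
  have "\<bar>(real (2 ^ n) + 1)\<^sup>2 * cf.avg n (\<lambda>C. (sf.est C)\<^sup>2) - (tau \<sigma> Ob)\<^sup>2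
    - (3 / 4) ^ k * ((real (2 ^ n) + 1) / (real (2 ^ n) * (real (2 ^ n) + 2)) * ((sf.XX + sf.BB) / 2))\<bar> \<le> 6 / real (2 ^ n) * tau Ob Ob"
    by (rule sf.variance_bound[OF d _ _ diag_weight g r1 r2]) (use om1 om2 in simp_all)
  then show ?thesis unfolding V1 V2 hs_norm_tau[OF assms(4)] .
qed

end
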